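(* Let $d\geq 2$, $N\geq 1$, let $A,B\in\mathbb{C}^{N,N}$ be simultaneously diagonalizable (over $\mathbb{C}$) with transformation matrix $Y\in\mathbb{C}^{N,N}$, let every eigenvalue of $A$ have positive real part, and let $S\in\mathbb{R}^{d,d}$ be skew-symmetric. Let $1\leq p<\infty$ and let $\theta_1\in C(\mathbb{R}^d,\mathbb{R})$ be a radial weight function of exponential growth rate $\eta_1\geq0$ satisfying $$\lim_{|\psi|\to0}\sup_{x\in\mathbb{R}^d}\left|\frac{\theta_1(x+\psi)-\theta_1(x)}{\theta_1(x)}\right|=0.$$ Let $0<\vartheta<1$, $\varepsilon>0$, $\omega_{p,\theta_1}=-b_0+(1+\varepsilon)\frac{a_{\max}^2\eta_1^2p}{a_0}$, and $\lambda\in\mathbb{C}$ with $\mathrm{Re}\,\lambda>\omega_{p,\theta_1}$. Let $\theta_2\in C(\mathbb{R}^d,\mathbb{R})$ be a radial weight function of exponential growth rate $\eta_2\geq0$ (with constant $C_{\theta_2}$) such that $$0\leq\eta_2^2\leq\vartheta\,\frac{a_0(\mathrm{Re}\,\lambda-\omega_{p,\theta_1})}{a_{\max}^2p^2}$$ and such that there is $C>0$ with $\theta_1(x)\leq C\theta_2(x)$ for all $x\in\mathbb{R}^d$. Let $g\in L^p_{\theta_1}(\mathbb{R}^d,\mathbb{C}^N)$ and let $v_\star\in\mathcal{D}(A_{p,\theta_1})$ be the unique solution of $(\lambda I-A_{p,\theta_1})v=g$ in $L^p_{\theta_1}(\mathbb{R}^d,\mathbb{C}^N)$, where $A_{p,\theta_1}$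 is the generator of the semigroup $(T(t))_{t\geq0}$ on $L^p_{\theta_1}(\mathbb{R}^d,\mathbb{C}^N)$ defined in the context. If in addition $g\in L^p_{\theta_2}(\mathbb{R}^d,\mathbb{C}^N)$, then $v_\star\in W^{1,p}_{\theta_2}(\mathbb{R}^d,\mathbb{C}^N)$ and $$\|v_\star\|_{L^p_{\theta_2}}\leq\frac{C_7}{\mathrm{Re}\,\lambda-\omega_{p,\theta_1}}\|g\|_{L^p_{\theta_2}},\qquad \|D_iv_\star\|_{L^p_{\theta_2}}\leq\frac{C_8}{(\mathrm{Re}\,\lambda-\omega_{p,\theta_1})^{1/2}}\|g\|_{L^p_{\theta_2}},\quad i=1,\dots,d,$$ where, with ${}_2F_1$ the hypergeometric function, the $\lambda$-independent constants are $$C_7=C_{\theta_2}\kappa a_1^{\frac d2}\left(\tfrac1{1-\vartheta}\right)^{\frac1p}\left({}_2F_1\left(-\tfrac{d-1}2,1;\tfrac12;-\tfrac\vartheta{1-\vartheta}\right)+\pi^{\frac12}\tfrac{\Gamma(\frac{d+1}2)}{\Gamma(\frac d2)}\left(\tfrac\vartheta{1-\vartheta}\right)^{\frac12}{}_2F_1\left(-\tfrac{d-2}2,\tfrac32;\tfrac32;-\tfrac\vartheta{1-\vartheta}\right)\right)^{\frac1p},$$ $$C_8=C_{\theta_2}\kappa a_1^{\frac{d+1}2}\tfrac{\Gamma(\frac12)}{a_{\min}^{1/2}}\left(\tfrac1{1-\vartheta}\right)^{\frac1{2p}}\left(\tfrac{\Gamma(\frac{d+1}2)}{\Gamma(\frac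 d2)}\,{}_2F_1\left(-\tfrac d2,\tfrac12;\tfrac12;-\tfrac\vartheta{1-\vartheta}\right)+2\tfrac{\Gamma(\frac{d+2}2)}{\Gamma(\frac12)\Gamma(\frac d2)}\left(\tfrac\vartheta{1-\vartheta}\right)^{\frac12}{}_2F_1\left(-\tfrac{d-1}2,1;\tfrac32;-\tfrac\vartheta{1-\vartheta}\right)\right)^{\frac1p}.$$
   Context: Weight functions: $\theta\in C(\mathbb{R}^d,\mathbb{R})$ is a weight function of exponential growth rate $\eta\geq0$ if $\theta>0$ and there is $C_\theta>0$ with $\theta(x+y)\leq C_\theta\theta(x)e^{\eta|y|}$ for all $x,y$; it is radial if $\theta(x)=\phi(|x|)$ for some $\phi:[0,\infty)\to\mathbb{R}$. $L^p_\theta(\mathbb{R}^d,\mathbb{C}^N)=\{v\in L^1_{\mathrm{loc}}:\|\theta v\|_{L^p}<\infty\}$, $\|v\|_{L^p_\theta}=\|\theta v\|_{L^p}$; $W^{1,p}_\theta(\mathbb{R}^d,\mathbb{C}^N)=\{v\in L^p_\theta: D_iv\in L^p_\theta,\ i=1,\dots,d\}$ (weak derivatives). Semigroup: $T(0)=I$ and $[T(t)v](x)=\int_{\mathbb{R}^d}H(x,\xi,t)v(\xi)\,d\xi$ for $t>0$, where $H(x,\xi,t)=(4\pi tA)^{-d/2}\exp(-Bt-(4tA)^{-1}|e^{tS}x-\xi|^2)$. Matrix powers: if $A=Y\,\mathrm{diag}(\lambda_k)\,Y^{-1}$ then $(4\pi tA)^{-d/2}=Y\,\mathrm{diag}((4\pi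 t\lambda_k)^{-d/2})\,Y^{-1}$, with $z^{-d/2}=\exp(-\frac d2\mathrm{Log}\,z)$, $\mathrm{Log}$ the principal logarithm. Under the hypotheses on $\theta_1$, $(T(t))_{t\ge0}$ is a $C_0$-semigroup on $L^p_{\theta_1}(\mathbb{R}^d,\mathbb{C}^N)$ with generator $A_{p,\theta_1}v=\lim_{t\downarrow0}\frac{T(t)v-v}{t}$, whose domain $\mathcal{D}(A_{p,\theta_1})$ consists of all $v\in L^p_{\theta_1}$ for which the limit exists in $L^p_{\theta_1}$. For $\mathrm{Re}\,\lambda>\omega_{p,\theta_1}$ the equation $(\lambda I-A_{p,\theta_1})v=g$ has, for each $g\in L^p_{\theta_1}$, a unique solution $v_\star=\int_0^\infty e^{-\lambda t}T(t)g\,dt\in\mathcal{D}(A_{p,\theta_1})$. Constants: $a_{\min}=\min_{\lambda\in\sigma(A)}|\lambda|$, $a_{\max}=\max_{\lambda\in\sigma(A)}|\lambda|$, $a_0=\min_{\lambda\in\sigma(A)}\mathrm{Re}\,\lambda$, $b_0=\min_{\mu\in\sigma(B)}\mathrm{Re}\,\mu$, $a_1=\frac{a_{\max}^2}{a_{\min}a_0}$, $\kappa=|Y||Y^{-1}|$ (spectral norm), where $Y^{-1}AY$ and $Y^{-1}BY$ are diagonal. *)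

theory Defs
  imports "HOL-Complex_Analysis.Complex_Analysis"
begin

definition weight_function :: "real \<Rightarrow> real \<Rightarrow> ('a::real_normed_vector \<Rightarrow> real) \<Rightarrow> bool" where
  "weight_function \<eta> C \<theta> \<longleftrightarrow>
     continuous_on UNIV \<theta> \<and> (\<forall>x. \<theta> x > 0) \<and> \<eta> \<ge> 0 \<and> C > 0 \<and>
     (\<forall>x y. \<theta> (x + y) \<le> C * \<theta> x * exp (\<eta> * norm y))"

definition radial :: "('a::real_normed_vector \<Rightarrow> real) \<Rightarrow> bool" where
  "radial \<theta> \<longleftrightarrow> (\<exists>\<phi>. \<forall>x. \<theta> x = \<phi> (norm x))"

text \<open>
  Elements of the spaces are represented by Lebesgue measurable functions;
  all notions are invariant under changes on null sets.  Measurability in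
  \<open>loc_integrable\<close> is implied by the second conjunct.
\<close>

definition loc_integrable ::
    "('a::euclidean_space \<Rightarrow> 'b::euclidean_space) \<Rightarrow> bool" where
  "loc_integrable v \<longleftrightarrow>
     v \<in> borel_measurable lebesgue \<and> (\<forall>K. compact K \<longrightarrow> set_integrable lebesgue K v)"

definition Lp :: "real \<Rightarrow> ('a::euclidean_space \<Rightarrow> real) \<Rightarrow> ('a \<Rightarrow> 'b::euclidean_space) set" where
  "Lp p \<theta> = {v. loc_integrable v \<and>
     integrable lebesgue (\<lambda>x. norm (\<theta> x *\<^sub>R v x) powr p)}"

definition Lp_norm :: "real \<Rightarrow> ('a::euclidean_space \<Rightarrow> real) \<Rightarrow> ('a \<Rightarrow> 'b::euclidean_space) \<Rightarrow> real" where
  "Lp_norm p \<theta> v = (LINT x|lebesgue. norm (\<theta> x *\<^sub>R v x) powr p) powr (1 / p)"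

text \<open>
  The Bochner integral of a non-integrable function is 0, hence convergence in
  the weighted space has to demand membership explicitly.
\<close>

definition Lp_tendsto ::
    "real \<Rightarrow> ('a::euclidean_space \<Rightarrow> real) \<Rightarrow> ('t \<Rightarrow> 'a \<Rightarrow> 'b::euclidean_space) \<Rightarrow>
     ('a \<Rightarrow> 'b) \<Rightarrow> 't filter \<Rightarrow> bool" where
  "Lp_tendsto p \<theta> f w F \<longleftrightarrow>
     w \<in> Lp p \<theta> \<and> (\<forall>\<^sub>F t in F. f t \<in> Lp p \<theta>) \<and>
     ((\<lambda>t. Lp_norm p \<theta> (\<lambda>x. f t x - w x)) \<longlongrightarrow> 0) F"

definition partial :: "'d \<Rightarrow> (real^'d \<Rightarrow> real) \<Rightarrow> real^'d \<Rightarrow> real" where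
  "partial i \<phi> x = frechet_derivative \<phi> (at x) (axis i 1)"

definition smooth :: "(real^'d \<Rightarrow> real) \<Rightarrow> bool" where
  "smooth \<phi> \<longleftrightarrow> (\<forall>is. foldr partial is \<phi> differentiable_on UNIV)"

definition test_function :: "(real^'d \<Rightarrow> real) \<Rightarrow> bool" where
  "test_function \<phi> \<longleftrightarrow> smooth \<phi> \<and> compact (closure {x. \<phi> x \<noteq> 0})"

definition weak_partial ::
    "'d \<Rightarrow> (real^'d \<Rightarrow> 'b::euclidean_space) \<Rightarrow> (real^'d \<Rightarrow> 'b) \<Rightarrow> bool" where
  "weak_partial i v w \<longleftrightarrow> loc_integrable v \<and> loc_integrable w \<and>
     (\<forall>\<phi>. test_function \<phi> \<longrightarrow>
        (LINT x|lebesgue. partial i \<phi> x *\<^sub>R v x) = - (LINT x|lebesgue. \<phi> x *\<^sub>R w x))"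

definition W1p :: "real \<Rightarrow> (real^'d \<Rightarrow> real) \<Rightarrow> (real^'d \<Rightarrow> 'b::euclidean_space) set" where
  "W1p p \<theta> = {v \<in> Lp p \<theta>. \<forall>i. \<exists>w\<in>Lp p \<theta>. weak_partial i v w}"

primrec mat_power :: "'a::semiring_1^'n^'n \<Rightarrow> nat \<Rightarrow> 'a^'n^'n" where
  "mat_power M 0 = mat 1"
| "mat_power M (Suc k) = M ** mat_power M k"

definition mat_exp :: "'a::real_normed_field^'n^'n \<Rightarrow> 'a^'n^'n" where
  "mat_exp M = (\<Sum>k. (1 / fact k) *\<^sub>R mat_power M k)"

definition is_diag :: "'a::zero^'n^'n \<Rightarrow> bool" where
  "is_diag M \<longleftrightarrow> (\<forall>i j. i \<noteq> j \<longrightarrow> M $ i $ j = 0)"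

definition diag :: "('n \<Rightarrow> 'a::zero) \<Rightarrow> 'a^'n^'n" where
  "diag l = (\<chi> i j. if i = j then l i else 0)"

text \<open>\<open>f(M)\<close> for a diagonalizable matrix \<open>M\<close>; see \<open>mat_fun_eq\<close> for well-definedness.\<close>

definition mat_fun :: "(complex \<Rightarrow> complex) \<Rightarrow> complex^'n^'n \<Rightarrow> complex^'n^'n" where
  "mat_fun f M = (THE R. \<exists>(Y :: complex^'n^'n) l. invertible Y \<and>
     M = Y ** diag l ** matrix_inv Y \<and> R = Y ** diag (f \<circ> l) ** matrix_inv Y)"

lemma matrix_inv_mult:
  assumes "invertible M"
  shows "M ** matrix_inv M = mat 1" "matrix_inv M ** M = mat 1"
  using someI_ex[OF assms[unfolded invertible_def]] by (simp_all add: matrix_inv_def)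

lemma diag_mult: "(W ** diag l) $ i $ j = W $ i $ j * l j"
  "(diag l ** W) $ i $ j = l i * W $ i $ j" for W :: "complex^'n^'n"
  by (simp_all add: matrix_matrix_mult_def diag_def if_distrib if_distribR
      cong: if_cong)

lemma mat_fun_eq:
  fixes Y :: "complex^'n^'n"
  assumes Y: "invertible Y"
  shows "mat_fun f (Y ** diag l ** matrix_inv Y) = Y ** diag (f \<circ> l) ** matrix_inv Y"
  unfolding mat_fun_def
proof (rule the_equality)
  fix R assume "\<exists>(Z :: complex^'n^'n) k. invertible Z \<and> Y ** diag l ** matrix_inv Y = Z ** diag k ** matrix_inv Z
    \<and> R = Z ** diag (f \<circ> k) ** matrix_inv Z"
  then obtain Z :: "complex^'n^'n" and k where Z: "invertible Z"
    and eq: "Y ** diag l ** matrix_inv Y = Z ** diag k ** matrix_inv Z"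
    and R: "R = Z ** diag (f \<circ> k) ** matrix_inv Z" by blast
  define W where "W = matrix_inv Z ** Y"
  have Yi: "Y ** matrix_inv Y = mat 1" "matrix_inv Y ** Y = mat 1"
    using Y by (auto simp: matrix_inv_mult)
  have Zi: "Z ** matrix_inv Z = mat 1" "matrix_inv Z ** Z = mat 1"
    using Z by (auto simp: matrix_inv_mult)
  have "W ** diag l = matrix_inv Z ** (Y ** diag l ** matrix_inv Y) ** Y"
    by (simp add: W_def matrix_mul_assoc[symmetric] Yi)
  also have "\<dots> = (matrix_inv Z ** Z) ** diag k ** W"
    unfolding eq by (simp add: W_def matrix_mul_assoc)
  finally have "W ** diag l = diag k ** W" by (simp add: Zi)
  then have "W $ i $ j * l j = k i * W $ i $ j" for i j by (metis diag_mult)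
  then have "W $ i $ j * f (l j) = f (k i) * W $ i $ j" for i j
    by (metis mult.commute mult_cancel_left)
  then have comm: "W ** diag (f \<circ> l) = diag (f \<circ> k) ** W"
    by (simp add: vec_eq_iff diag_mult)
  have "Y ** diag (f \<circ> l) ** matrix_inv Y = (Z ** matrix_inv Z) ** Y ** diag (f \<circ> l) ** matrix_inv Y"
    by (simp add: Zi)
  also have "\<dots> = Z ** (W ** diag (f \<circ> l)) ** matrix_inv Y"
    by (simp add: W_def matrix_mul_assoc)
  also have "\<dots> = Z ** diag (f \<circ> k) ** matrix_inv Z ** (Y ** matrix_inv Y)"
    unfolding comm by (simp add: W_def matrix_mul_assoc)
  finally show "R = Y ** diag (f \<circ> l) ** matrix_inv Y" by (simp add: R Yi)
qed (use Y in blast)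

definition eigenvalues :: "complex^'n^'n \<Rightarrow> complex set" where
  "eigenvalues M = {\<mu>. \<exists>v. v \<noteq> 0 \<and> M *v v = \<mu> *s v}"

definition a_min :: "complex^'n^'n \<Rightarrow> real" where
  "a_min A = Min (cmod ` eigenvalues A)"

definition a_max :: "complex^'n^'n \<Rightarrow> real" where
  "a_max A = Max (cmod ` eigenvalues A)"

text \<open>The constants \<open>a\<^sub>0\<close> (for \<open>A\<close>) and \<open>b\<^sub>0\<close> (for \<open>B\<close>).\<close>

definition min_Re_eigenvalue :: "complex^'n^'n \<Rightarrow> real" where
  "min_Re_eigenvalue M = Min (Re ` eigenvalues M)"

definition a_1 :: "complex^'n^'n \<Rightarrow> real" where
  "a_1 A = (a_max A)\<^sup>2 / (a_min A * min_Re_eigenvalue A)"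

definition spectral_norm :: "complex^'n^'n \<Rightarrow> real" where
  "spectral_norm M = onorm ((*v) M)"

definition condition_number :: "complex^'n^'n \<Rightarrow> real" where
  "condition_number Y = spectral_norm Y * spectral_norm (matrix_inv Y)"

definition growth_rate :: "complex^'n^'n \<Rightarrow> complex^'n^'n \<Rightarrow> real \<Rightarrow> real \<Rightarrow> real \<Rightarrow> real" where
  "growth_rate A B p \<eta> \<epsilon> = - min_Re_eigenvalue B + (1 + \<epsilon>) * ((a_max A)\<^sup>2 * \<eta>\<^sup>2 * p / min_Re_eigenvalue A)"

definition heat_kernel ::
    "complex^'n^'n \<Rightarrow> complex^'n^'n \<Rightarrow> real^'d^'d \<Rightarrow> real^'d \<Rightarrow> real^'d \<Rightarrow> real \<Rightarrow> complex^'n^'n" where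
  "heat_kernel A B S x \<xi> t =
     mat_fun (\<lambda>z. exp (- (of_nat CARD('d) / 2) * Ln z)) ((4 * pi * t) *\<^sub>R A) **
     mat_exp (- (t *\<^sub>R B)
       - (norm (mat_exp (t *\<^sub>R S) *v x - \<xi>))\<^sup>2 *\<^sub>R matrix_inv ((4 * t) *\<^sub>R A))"

definition ou_semigroup ::
    "complex^'n^'n \<Rightarrow> complex^'n^'n \<Rightarrow> real^'d^'d \<Rightarrow> real \<Rightarrow>
     (real^'d \<Rightarrow> complex^'n) \<Rightarrow> real^'d \<Rightarrow> complex^'n" where
  "ou_semigroup A B S t v x =
     (if t = 0 then v x else (LINT \<xi>|lebesgue. heat_kernel A B S x \<xi> t *v v \<xi>))"

text \<open>
  The generator in the weighted space, as a graph: the value at \<open>v\<close> is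
  determined up to null sets only.
\<close>

definition ou_generator ::
    "real \<Rightarrow> (real^'d \<Rightarrow> real) \<Rightarrow> complex^'n^'n \<Rightarrow> complex^'n^'n \<Rightarrow> real^'d^'d \<Rightarrow>
     ((real^'d \<Rightarrow> complex^'n) \<times> (real^'d \<Rightarrow> complex^'n)) set" where
  "ou_generator p \<theta> A B S = {(v, w). v \<in> Lp p \<theta> \<and>
     Lp_tendsto p \<theta> (\<lambda>t x. (1 / t) *\<^sub>R (ou_semigroup A B S t v x - v x)) w (at_right 0)}"

definition resolvent_solution ::
    "real \<Rightarrow> (real^'d \<Rightarrow> real) \<Rightarrow> complex^'n^'n \<Rightarrow> complex^'n^'n \<Rightarrow> real^'d^'d \<Rightarrow> complex \<Rightarrow>
     (real^'d \<Rightarrow> complex^'n) \<Rightarrow> (real^'d \<Rightarrow> complex^'n) \<Rightarrow> bool" where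
  "resolvent_solution p \<theta> A B S z g v \<longleftrightarrow>
     (\<exists>w. (v, w) \<in> ou_generator p \<theta> A B S \<and> (AE x in lebesgue. z *s v x - w x = g x))"

text \<open>
  The constants involve arguments of modulus possibly \<open>\<ge> 1\<close>, so the hypergeometric
  function is the principal branch: the analytic continuation of the hypergeometric
  series from the origin along rays, i.e. on open sets that are star-shaped about 0.
  The lemma \<open>hyp2f1_eq\<close> shows that the value does not depend on the chosen domain.
\<close>

definition hyp2f1_continuation ::
    "complex \<Rightarrow> complex \<Rightarrow> complex \<Rightarrow> complex set \<Rightarrow> (complex \<Rightarrow> complex) \<Rightarrow> bool" where
  "hyp2f1_continuation a b c S f \<longleftrightarrow>
     open S \<and> (\<forall>z\<in>S. closed_segment 0 z \<subseteq> S) \<and> f holomorphic_on S \<and>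
     f has_fps_expansion fps_hypergeo [a, b] [c] 1"

definition hyp2f1 :: "complex \<Rightarrow> complex \<Rightarrow> complex \<Rightarrow> complex \<Rightarrow> complex" where
  "hyp2f1 a b c z = (THE w. \<exists>S f. hyp2f1_continuation a b c S f \<and> z \<in> S \<and> w = f z)"

lemma hyp2f1_eq:
  assumes f: "hyp2f1_continuation a b c S f" and z: "z \<in> S"
  shows "hyp2f1 a b c z = f z"
  unfolding hyp2f1_def
proof (rule the_equality)
  fix w assume "\<exists>T g. hyp2f1_continuation a b c T g \<and> z \<in> T \<and> w = g z"
  then obtain T g where g: "hyp2f1_continuation a b c T g" and zT: "z \<in> T" and w: "w = g z"
    by blast
  have 0: "0 \<in> S" "0 \<in> T" using f g z zT by (auto simp: hyp2f1_continuation_def)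
  have "eventually (\<lambda>x. f x = g x) (nhds 0)"
    using f g unfolding hyp2f1_continuation_def has_fps_expansion_def
    by (auto elim: eventually_elim2)
  then obtain U where U: "open U" "0 \<in> U" "\<And>x. x \<in> U \<Longrightarrow> f x = g x"
    by (auto simp: eventually_nhds)
  have opn: "open (S \<inter> T)" "open (U \<inter> (S \<inter> T))"
    using f g U by (auto simp: hyp2f1_continuation_def)
  have "starlike (S \<inter> T)"
    unfolding starlike_def using f g 0 unfolding hyp2f1_continuation_def
    by (intro bexI[of _ 0]) auto
  then have con: "connected (S \<inter> T)" by (rule starlike_imp_connected)
  have "f z = g z"
    by (rule analytic_continuation_open[of "U \<inter> (S \<inter> T)" "S \<inter> T" f g])
      (use opn con f g 0 U z zT in
        \<open>auto simp: hyp2f1_continuation_def intro: holomorphic_on_subset\<close>)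
  then show "w = f z" using w by simp
qed (use assms in blast)

abbreviation hyp2f1_real :: "real \<Rightarrow> real \<Rightarrow> real \<Rightarrow> real \<Rightarrow> real" where
  "hyp2f1_real a b c x \<equiv> Re (hyp2f1 (of_real a) (of_real b) (of_real c) (of_real x))"

text \<open>\<open>d\<close> is the space dimension, \<open>C\<close> the constant of the weight function.\<close>

definition C\<^sub>7 ::
    "nat \<Rightarrow> complex^'n^'n \<Rightarrow> complex^'n^'n \<Rightarrow> real \<Rightarrow> real \<Rightarrow> real \<Rightarrow> real" where
  "C\<^sub>7 d A Y p C vt =
     (let d = real d; r = vt / (1 - vt) in
      C * condition_number Y * a_1 A powr (d / 2) * (1 / (1 - vt)) powr (1 / p) *
      (hyp2f1_real (- (d - 1) / 2) 1 (1 / 2) (- r)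
       + pi powr (1 / 2) * (Gamma ((d + 1) / 2) / Gamma (d / 2)) * r powr (1 / 2) *
         hyp2f1_real (- (d - 2) / 2) (3 / 2) (3 / 2) (- r)) powr (1 / p))"

definition C\<^sub>8 ::
    "nat \<Rightarrow> complex^'n^'n \<Rightarrow> complex^'n^'n \<Rightarrow> real \<Rightarrow> real \<Rightarrow> real \<Rightarrow> real" where
  "C\<^sub>8 d A Y p C vt =
     (let d = real d; r = vt / (1 - vt) in
      C * condition_number Y * a_1 A powr ((d + 1) / 2) * (Gamma (1 / 2) / a_min A powr (1 / 2)) *
      (1 / (1 - vt)) powr (1 / (2 * p)) *
      (Gamma ((d + 1) / 2) / Gamma (d / 2) * hyp2f1_real (- d / 2) (1 / 2) (1 / 2) (- r)
       + 2 * (Gamma ((d + 2) / 2) / (Gamma (1 / 2) * Gamma (d / 2))) * r powr (1 / 2) *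
         hyp2f1_real (- (d - 1) / 2) 1 (3 / 2) (- r)) powr (1 / p))"

end

theory Submission
  imports Defs
begin

text \<open>
  Write \<open>R t = exp (t S)\<close>, a flow of isometries that leaves radial weights invariant.  In the basis \<open>Y\<close> the
  semigroup splits into scalar ones, and the substitution \<open>\<xi> = R t y\<close> turns each of them into convolution with
  a complex Gaussian \<open>k t\<close> followed by the rotation of the argument, \<open>T t u x = \<integral>k t (x - y) u (R t y) dy\<close>.
  From the definition of the generator and the semigroup law alone, a solution of \<open>(\<lambda> - A) v = g\<close> in the space
  weighted by \<open>\<theta>\<^sub>1\<close> is almost everywhere the Laplace transform \<open>\<integral>exp (- \<lambda>t) T t g dt\<close>; this formula no
  longer involves the weight and can be estimated with \<open>\<theta>\<^sub>2\<close>.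

  An operator with kernel \<open>\<kappa> t (x - y)\<close> of this form is bounded on the weighted space with norm at most
  \<open>C\<close> times the mass of \<open>exp (\<eta>|x|) |\<kappa> t x|\<close>, and by Hoelder this is at most \<open>M\<^sub>0 powr (1 - 1/p)\<close> times
  \<open>M\<^sub>p powr (1/p)\<close>, where \<open>M\<^sub>0\<close> and \<open>M\<^sub>p\<close> are the masses of \<open>|\<kappa> t x|\<close> and \<open>exp (p\<eta>|x|) |\<kappa> t x|\<close>.  Expanding
  the exponential and integrating term by term gives two power series in \<open>\<vartheta>\<close>, from even and odd moments, and
  Pfaff's transformation identifies them with the hypergeometric functions at \<open>- \<vartheta>/(1 - \<vartheta>)\<close>.  The weak
  derivatives of \<open>v\<close> have the differentiated kernel and are treated in the same way.
\<close>


section \<open>Flows of skew-symmetric matrices\<close>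

text \<open>The constants have a common source. For an eigenvalue \<lambda> of \<open>A\<close>, Re
  (1/\<lambda>) = Re \<lambda> / |\<lambda>|^2 is at least a_0 / a_max^2. With
  \<open>c = a0 / (4 * (a_max A)\<^sup>2)\<close> every scalar kernel is therefore dominated by a
  real Gaussian density of decay rate c/t, up to the factor (1/(4 c a_min))^(d/2), and 1/(4 c a_min)
  is \<open>a_1 A\<close>. The decay rate in time is taken as \<delta> = Re z minus the growth rate.
  The hypothesis on the second growth rate then reads (p \<eta>)^2 <= 4 \<vartheta> c \<delta>,
  which bounds the argument of the moment series by 2 sqrt \<vartheta>. The interpolation between
  \<open>M\<^sub>0\<close> and \<open>M\<^sub>p\<close> is what places the hypergeometric sums under
  a p-th root. For the gradient, \<open>M\<^sub>0\<close> is computed with one component of x, whose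
  first absolute moment does not grow with the dimension; |x| enters only in
  \<open>M\<^sub>p\<close>. Membership of \<open>v\<close> in the second space is part of the
  conclusion, so the equation can be exploited in the first space only; this forces the detour
  through an explicit formula.\<close>

lemma sums_matrixI:
  fixes f :: "nat \<Rightarrow> 'a::real_normed_field^'n^'n"
  assumes "\<And>i j. (\<lambda>k. f k $ i $ j) sums (s $ i $ j)"
  shows "f sums s"
  unfolding sums_def
  by (intro vec_tendstoI) (use assms in \<open>simp add: sums_def\<close>)

lemma mat_power_scaleR:
  fixes M :: "real^'n^'n"
  shows "mat_power (t *\<^sub>R M) k = t ^ k *\<^sub>R mat_power M k"
  by (induction k)
    (simp_all add: vec_eq_iff matrix_matrix_mult_def sum_distrib_left algebra_simps)

lemma mat_power_conj_diag:
  fixes Y :: "complex^'n^'n"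
  assumes "invertible Y"
  shows "mat_power (Y ** diag l ** matrix_inv Y) k = Y ** diag (\<lambda>i. l i ^ k) ** matrix_inv Y"
proof (induction k)
  case 0
  have "diag (\<lambda>i. 1) = (mat 1 :: complex^'n^'n)"
    by (simp add: diag_def mat_def vec_eq_iff)
  then show ?case by (simp add: matrix_inv_mult[OF assms])
next
  case (Suc k)
  have "diag l ** diag (\<lambda>i. l i ^ k) = (diag (\<lambda>i. l i ^ Suc k) :: complex^'n^'n)"
    unfolding vec_eq_iff diag_mult by (simp add: diag_def)
  moreover have "(Y ** diag l ** matrix_inv Y) ** (Y ** diag (\<lambda>i. l i ^ k) ** matrix_inv Y)
      = Y ** (diag l ** (matrix_inv Y ** Y) ** diag (\<lambda>i. l i ^ k)) ** matrix_inv Y"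
    by (simp add: matrix_mul_assoc)
  ultimately show ?case using Suc by (simp add: matrix_inv_mult[OF assms])
qed

lemma conj_diag_component:
  fixes Y Z :: "complex^'n^'n"
  shows "(Y ** diag l ** Z) $ i $ j = (\<Sum>a\<in>UNIV. Y $ i $ a * l a * Z $ a $ j)"
  by (simp add: matrix_matrix_mult_def[of "Y ** diag l"] diag_mult)

lemma mat_exp_conj_diag:
  fixes Y :: "complex^'n^'n"
  assumes "invertible Y"
  shows "mat_exp (Y ** diag l ** matrix_inv Y) = Y ** diag (\<lambda>i. exp (l i)) ** matrix_inv Y"
proof -
  have "(\<lambda>k. (1 / fact k) *\<^sub>R mat_power (Y ** diag l ** matrix_inv Y) k)
      sums (Y ** diag (\<lambda>i. exp (l i)) ** matrix_inv Y)"
  proof (rule sums_matrixI)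
    fix i j
    have "(\<lambda>k. \<Sum>a\<in>UNIV. Y $ i $ a * (l a ^ k /\<^sub>R fact k) * matrix_inv Y $ a $ j) sums
        (\<Sum>a\<in>UNIV. Y $ i $ a * exp (l a) * matrix_inv Y $ a $ j)"
      by (intro sums_sum sums_mult sums_mult2 exp_converges)
    then show "(\<lambda>k. ((1 / fact k) *\<^sub>R mat_power (Y ** diag l ** matrix_inv Y) k) $ i $ j)
        sums ((Y ** diag (\<lambda>i. exp (l i)) ** matrix_inv Y) $ i $ j)"
      unfolding mat_power_conj_diag[OF assms] vector_scaleR_component conj_diag_component
      by (simp add: scaleR_sum_right divide_inverse)
  qed
  then show ?thesis by (simp add: mat_exp_def sums_iff)
qed

text \<open>The witness is the sum of the moduli of all entries: it dominates every row sum, so each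
  induction step multiplies the entrywise bound by it. The geometric bound makes the exponential
  series converge entrywise.\<close>

lemma mat_power_bound:
  fixes M :: "real^'n^'n"
  obtains c where "\<And>k i j. \<bar>mat_power M k $ i $ j\<bar> \<le> c ^ k"
proof
  define m where "m = (\<Sum>i\<in>UNIV. \<Sum>j\<in>UNIV. \<bar>M $ i $ j\<bar>)"
  have m: "(\<Sum>j\<in>UNIV. \<bar>M $ i $ j\<bar>) \<le> m" for i
    unfolding m_def by (rule member_le_sum) (auto intro: sum_nonneg)
  have m0: "m \<ge> 0" by (simp add: m_def sum_nonneg)
  show "\<bar>mat_power M k $ i $ j\<bar> \<le> m ^ k" for k i j
  proof (induction k arbitrary: i j)
    case 0
    then show ?case by (simp add: mat_def)
  next
    case (Suc k)
    have "\<bar>mat_power M (Suc k) $ i $ j\<bar> \<le> (\<Sum>a\<in>UNIV. \<bar>M $ i $ a\<bar> * \<bar>mat_power M k $ a $ j\<bar>)"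
      by (auto simp: matrix_matrix_mult_def abs_mult intro: sum_abs order_trans[OF sum_abs])
    also have "\<dots> \<le> (\<Sum>a\<in>UNIV. \<bar>M $ i $ a\<bar> * m ^ k)"
      by (intro sum_mono mult_left_mono Suc) auto
    also have "\<dots> \<le> m * m ^ k"
      unfolding sum_distrib_right[symmetric] using m m0 by (intro mult_right_mono) auto
    finally show ?case by simp
  qed
qed

text \<open>Entrywise the exponential is an everywhere convergent power series in \<open>t\<close>;
  shifting its coefficients with \<open>diffs\<close> amounts to left multiplication by
  \<open>S\<close>.\<close>

lemma mat_exp_has_derivative:
  fixes S :: "real^'n^'n"
  shows "((\<lambda>t. mat_exp (t *\<^sub>R S) $ i $ j) has_real_derivative (S ** mat_exp (t *\<^sub>R S)) $ i $ j) (at t)"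
proof -
  define c where "c i j k = mat_power S k $ i $ j / fact k" for i j k
  obtain b where b: "\<And>k i j. \<bar>mat_power S k $ i $ j\<bar> \<le> b ^ k" using mat_power_bound[of S] by blast
  have b0: "b \<ge> 0" using b[of 1] by (metis abs_ge_zero order_trans power_one_right)
  have summ: "summable (\<lambda>k. c i j k * t ^ k)" for i j t
  proof (rule summable_comparison_test')
    show "summable (\<lambda>k. (b * \<bar>t\<bar>) ^ k /\<^sub>R fact k)" by (rule summable_exp_generic)
    show "norm (c i j k * t ^ k) \<le> (b * \<bar>t\<bar>) ^ k /\<^sub>R fact k" for k
      using mult_right_mono[OF b[of k i j], of "\<bar>t\<bar> ^ k / fact k"]
      by (simp add: c_def abs_mult power_abs power_mult_distrib field_simps)
  qed
  have sumsE: "(\<lambda>k. (1 / fact k) *\<^sub>R mat_power (t *\<^sub>R S) k) sums (\<chi> i j. \<Sum>k. c i j k * t ^ k)" for t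
  proof (rule sums_matrixI)
    fix i j
    show "(\<lambda>k. ((1 / fact k) *\<^sub>R mat_power (t *\<^sub>R S) k) $ i $ j) sums ((\<chi> i j. \<Sum>k. c i j k * t ^ k) $ i $ j)"
      using summable_sums[OF summ[of i j t]] by (simp add: mat_power_scaleR c_def mult.commute)
  qed
  have E: "mat_exp (t *\<^sub>R S) $ i $ j = (\<Sum>k. c i j k * t ^ k)" for t i j
    using sumsE[of t] by (simp add: mat_exp_def sums_iff)
  have d: "diffs (c i j) k = (\<Sum>m\<in>UNIV. S $ i $ m * c m j k)" for i j k
  proof -
    have "diffs (c i j) k = mat_power S (Suc k) $ i $ j / fact k"
      by (simp add: diffs_def c_def del: mat_power.simps)
    also have "\<dots> = (\<Sum>m\<in>UNIV. S $ i $ m * c m j k)"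
      by (simp add: matrix_matrix_mult_def c_def sum_divide_distrib)
    finally show ?thesis .
  qed
  have "((\<lambda>t. \<Sum>k. c i j k * t ^ k) has_real_derivative (\<Sum>k. diffs (c i j) k * t ^ k)) (at t)"
    by (rule termdiffs_strong_converges_everywhere) (rule summ)
  also have "(\<Sum>k. diffs (c i j) k * t ^ k) = (\<Sum>k. \<Sum>m\<in>UNIV. S $ i $ m * (c m j k * t ^ k))"
    by (simp add: d sum_distrib_right mult.assoc)
  also have "\<dots> = (\<Sum>m\<in>UNIV. S $ i $ m * (\<Sum>k. c m j k * t ^ k))"
    by (subst suminf_sum) (use summ in \<open>auto intro: summable_mult simp: suminf_mult\<close>)
  finally show ?thesis by (simp add: E matrix_matrix_mult_def)
qed

text \<open>The properties of the flow exp (tS) on which the convolution estimates rest. Continuity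
  is required jointly because time is an integration variable as well.\<close>

locale isometric_flow =
  fixes R :: "real \<Rightarrow> 'a::euclidean_space \<Rightarrow> 'a"
  assumes lin: "linear (R t)"
    and norm_R [simp]: "norm (R t x) = norm x"
    and cont: "continuous_on UNIV (\<lambda>(t, x). R t x)"
    and R_add: "R (s + t) x = R s (R t x)"
    and R_0 [simp]: "R 0 x = x"
begin

lemma R_minus [simp]: "R t (R (- t) x) = x" "R (- t) (R t x) = x"
  using R_add[of t "- t" x] R_add[of "- t" t x] by auto

lemma R_diff: "R t (x - y) = R t x - R t y"
  using lin by (simp add: linear_diff)

lemma measurable_R [measurable (raw)]:
  assumes [measurable]: "f \<in> borel_measurable M" "g \<in> borel_measurable M"
  shows "(\<lambda>x. R (f x) (g x)) \<in> borel_measurable M"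
proof -
  have "(\<lambda>z. R (fst z) (snd z)) \<in> borel_measurable (borel \<Otimes>\<^sub>M borel)"
    using borel_measurable_continuous_onI[OF cont] by (simp add: borel_prod case_prod_unfold)
  from measurable_compose[OF _ this, of "\<lambda>x. (f x, g x)" M] show ?thesis by simp
qed

end

text \<open>The derivative of |w|^2 is 2 w . (S w), which vanishes for skew-symmetric
  \<open>S\<close>. Applied to the difference of two solutions this is also the uniqueness behind
  the group law.\<close>

lemma skew_ode_norm:
  fixes S :: "real^'n^'n" and w :: "real \<Rightarrow> real^'n"
  assumes "transpose S = - S"
    and w: "\<And>t i. ((\<lambda>t. w t $ i) has_real_derivative (S *v w t) $ i) (at t)"
  shows "norm (w t) = norm (w 0)"
proof -
  have skew: "x \<bullet> (S *v x) = 0" for x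
  proof -
    have "x \<bullet> (S *v x) = (transpose S *v x) \<bullet> x"
      by (metis dot_lmul_matrix transpose_matrix_vector)
    also have "\<dots> = - (x \<bullet> (S *v x))"
      by (simp add: assms(1) inner_commute matrix_vector_mult_def inner_vec_def sum_negf)
    finally show ?thesis by simp
  qed
  have "((\<lambda>t. \<Sum>i\<in>UNIV. (w t $ i)\<^sup>2) has_real_derivative 0) (at t)" for t
  proof -
    have "((\<lambda>t. \<Sum>i\<in>UNIV. (w t $ i)\<^sup>2) has_real_derivative (\<Sum>i\<in>UNIV. 2 * (w t $ i * (S *v w t) $ i))) (at t)"
      by (rule DERIV_sum) (auto intro!: derivative_eq_intros w)
    also have "(\<Sum>i\<in>UNIV. 2 * (w t $ i * (S *v w t) $ i)) = 0"
      using skew[of "w t"] unfolding inner_vec_def by (simp flip: sum_distrib_left)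
    finally show ?thesis .
  qed
  then have "(\<Sum>i\<in>UNIV. (w t $ i)\<^sup>2) = (\<Sum>i\<in>UNIV. (w 0 $ i)\<^sup>2)"
    using DERIV_isconst_all[of "\<lambda>t. \<Sum>i\<in>UNIV. (w t $ i)\<^sup>2" t 0] by blast
  then show ?thesis by (simp add: norm_vec_def L2_set_def)
qed

lemma isometric_flow_mat_exp:
  fixes S :: "real^'n^'n"
  assumes "transpose S = - S"
  shows "isometric_flow (\<lambda>t x. mat_exp (t *\<^sub>R S) *v x)"
proof -
  let ?R = "\<lambda>t x. mat_exp (t *\<^sub>R S) *v x"
  have zero: "?R 0 x = x" for x
  proof -
    have "(\<lambda>k. (1 / fact k) *\<^sub>R mat_power (0 *\<^sub>R S) k) sums (mat_power (0 *\<^sub>R S) 0)"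
      using sums_single[of 0 "\<lambda>k. (1 / fact k) *\<^sub>R mat_power (0 *\<^sub>R S) k"]
      by (subst sums_cong[where g = "\<lambda>k. if k = 0 then (1 / fact k) *\<^sub>R mat_power (0 *\<^sub>R S) k else 0"])
        (auto simp: mat_power_scaleR power_0_left simp del: scaleR_zero_left)
    then show ?thesis by (simp add: mat_exp_def sums_iff)
  qed
  have deriv: "((\<lambda>t. ?R t x $ i) has_real_derivative (S *v ?R t x) $ i) (at t)" for t x i
    unfolding matrix_vector_mul_assoc
    unfolding matrix_vector_mult_def vec_lambda_beta
    by (intro DERIV_sum DERIV_cmult_right mat_exp_has_derivative)
  have norm: "norm (?R t x) = norm x" for t x
    using skew_ode_norm[OF assms, of "\<lambda>t. ?R t x" t] deriv by (simp only: zero)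
  have add: "?R (s + t) x = ?R s (?R t x)" for s t x
  proof -
    \<comment> \<open>Both terms solve the same linear equation in \<open>s\<close> and agree at
      \<open>s = 0\<close>.\<close>
    define w where "w s = ?R (s + t) x - ?R s (?R t x)" for s
    have "((\<lambda>s. ?R (s + t) x $ i) has_real_derivative (S *v ?R (s + t) x) $ i) (at s)" for s i
      using deriv[of x i "s + t"] by (simp add: DERIV_shift)
    then have "((\<lambda>s. w s $ i) has_real_derivative (S *v w s) $ i) (at s)" for s i
      unfolding w_def matrix_vector_mult_diff_distrib vector_minus_component
      by (intro DERIV_diff deriv)
    then have "norm (w s) = norm (w 0)" by (rule skew_ode_norm[OF assms])
    moreover have "w 0 = 0" unfolding w_def zero by simp
    ultimately show ?thesis by (simp add: w_def)
  qed
  show ?thesis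
  proof (rule isometric_flow.intro)
    show "continuous_on UNIV (\<lambda>(t, x). ?R t x)"
    proof -
      have "continuous_on UNIV (\<lambda>t. mat_exp (t *\<^sub>R S) $ i $ j)" for i j
        using mat_exp_has_derivative[where S = S and i = i and j = j] by (meson DERIV_isCont continuous_at_imp_continuous_on)
      from continuous_on_compose2[OF this continuous_on_fst[OF continuous_on_id]]
      have c: "continuous_on UNIV (\<lambda>z. mat_exp (fst z *\<^sub>R S) $ i $ j)" for i j by auto
      have "continuous_on UNIV (\<lambda>z. \<chi> i. \<Sum>j\<in>UNIV. mat_exp (fst z *\<^sub>R S) $ i $ j * snd z $ j)"
        by (intro continuous_on_vec_lambda continuous_intros c)
      then show ?thesis by (simp add: matrix_vector_mult_def case_prod_unfold)
    qed
  qed (simp_all add: norm add zero matrix_vector_mul_linear del: scaleR_zero_left)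
qed

text \<open>An argument without determinants: multiply by the volume of the unit ball, written as a
  double integral. Two translations and Fubini move the rotation from \<open>E\<close> to the ball,
  whose image is again a ball of the same volume; this volume is then cancelled. The result
  justifies the substitution \<xi> = R t y.\<close>

lemma (in isometric_flow) emeasure_R:
  assumes [measurable]: "E \<in> sets borel"
  shows "emeasure lborel (R t -` E) = emeasure lborel (E :: 'a set)"
proof -
  let ?B = "ball (0::'a) 1"
  define b e :: "'a \<Rightarrow> ennreal" where "b = indicator ?B" and "e = indicator E"
  have [measurable]: "b \<in> borel_measurable borel" "e \<in> borel_measurable borel"
    unfolding b_def e_def by (rule borel_measurable_indicator; simp)+
  have eb: "(\<integral>\<^sup>+x. b x \<partial>lborel) = emeasure lborel ?B" and ee: "(\<integral>\<^sup>+x. e x \<partial>lborel) = emeasure lborel E"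
    by (simp_all add: b_def e_def)
  have tr: "(\<integral>\<^sup>+y. f y \<partial>lborel) = (\<integral>\<^sup>+y. f (c + y) \<partial>lborel)" if [measurable]: "f \<in> borel_measurable borel"
    for f :: "'a \<Rightarrow> ennreal" and c
    by (subst (1) lborel_distr_plus[of c, symmetric]) (simp add: nn_integral_distr)
  have [measurable]: "R t -` E \<in> sets borel"
    using measurable_sets[of "R t" borel borel E] by simp
  have "emeasure lborel (R t -` E) * emeasure lborel ?B
      = (\<integral>\<^sup>+x. \<integral>\<^sup>+y. b x * e (R t y) \<partial>lborel \<partial>lborel)"
  proof -
    have "(\<integral>\<^sup>+y. e (R t y) \<partial>lborel) = (\<integral>\<^sup>+y. indicator (R t -` E) y \<partial>lborel)"
      by (intro nn_integral_cong) (auto simp: e_def split: split_indicator)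
    then have "(\<integral>\<^sup>+x. \<integral>\<^sup>+y. b x * e (R t y) \<partial>lborel \<partial>lborel)
        = (\<integral>\<^sup>+x. b x * emeasure lborel (R t -` E) \<partial>lborel)"
      by (simp add: nn_integral_cmult)
    also have "\<dots> = emeasure lborel ?B * emeasure lborel (R t -` E)"
      by (subst nn_integral_multc) (simp_all add: eb)
    finally show ?thesis by (simp add: mult.commute)
  qed
  also have "\<dots> = (\<integral>\<^sup>+x. \<integral>\<^sup>+y. b x * e (R t y + x) \<partial>lborel \<partial>lborel)"
  proof (rule nn_integral_cong)
    fix x
    have "R t (R (- t) x + y) = R t y + x" for y
      using lin[of t] by (simp add: linear_add)
    then show "(\<integral>\<^sup>+y. b x * e (R t y) \<partial>lborel) = (\<integral>\<^sup>+y. b x * e (R t y + x) \<partial>lborel)"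
      by (subst tr[of _ "R (- t) x"]) simp_all
  qed
  also have "\<dots> = (\<integral>\<^sup>+y. \<integral>\<^sup>+x. b x * e (R t y + x) \<partial>lborel \<partial>lborel)"
    by (rule lborel_pair.Fubini') measurable
  also have "\<dots> = (\<integral>\<^sup>+y. \<integral>\<^sup>+x. b (x - R t y) * e x \<partial>lborel \<partial>lborel)"
  proof (rule nn_integral_cong)
    fix y
    show "(\<integral>\<^sup>+x. b x * e (R t y + x) \<partial>lborel) = (\<integral>\<^sup>+x. b (x - R t y) * e x \<partial>lborel)"
      by (subst (2) tr[of _ "R t y"]) (simp_all add: add.commute)
  qed
  also have "\<dots> = (\<integral>\<^sup>+x. \<integral>\<^sup>+y. b (x - R t y) * e x \<partial>lborel \<partial>lborel)"
    by (rule lborel_pair.Fubini') measurable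
  also have "\<dots> = (\<integral>\<^sup>+x. emeasure lborel ?B * e x \<partial>lborel)"
  proof (rule nn_integral_cong)
    fix x
    have "b (x - R t y) = indicator (ball (R (- t) x) 1) y" for y
    proof -
      have "norm (x - R t y) = norm (R t (R (- t) x - y))" by (simp add: R_diff)
      then show ?thesis by (simp add: b_def indicator_def dist_norm norm_minus_commute del: norm_R) (simp add: norm_minus_commute)
    qed
    then have "(\<integral>\<^sup>+y. b (x - R t y) \<partial>lborel) = emeasure lborel (ball (R (- t) x) 1)" by simp
    also have "\<dots> = emeasure lborel ?B" by (simp add: emeasure_ball)
    finally show "(\<integral>\<^sup>+y. b (x - R t y) * e x \<partial>lborel) = emeasure lborel ?B * e x"
      by (simp add: nn_integral_multc)
  qed
  also have "\<dots> = emeasure lborel E * emeasure lborel ?B" by (subst nn_integral_cmult) (simp_all add: mult.commute ee)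
  finally have "emeasure lborel (R t -` E) * emeasure lborel ?B = emeasure lborel E * emeasure lborel ?B" .
  moreover have "emeasure lborel ?B \<noteq> 0" "emeasure lborel ?B \<noteq> \<infinity>"
    using unit_ball_vol_pos[of "real DIM('a)"] by (simp_all add: emeasure_ball order.strict_implies_not_eq[symmetric] del: unit_ball_vol_pos)
  ultimately show ?thesis
    by (metis (no_types) infinity_ennreal_def mult.commute ennreal_mult_cancel_left)
qed

context isometric_flow begin

lemma distr_R: "distr lborel borel (R t) = lborel"
  by (rule measure_eqI) (simp_all add: emeasure_distr emeasure_R)

lemma nn_integral_R:
  assumes [measurable]: "f \<in> borel_measurable borel"
  shows "(\<integral>\<^sup>+x. f (R t x) \<partial>lborel) = (\<integral>\<^sup>+x. f x \<partial>lborel)"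
  by (subst (2) distr_R[of t, symmetric]) (simp add: nn_integral_distr)

lemma integral_R:
  fixes f :: "'a \<Rightarrow> 'b::{banach, second_countable_topology}"
  assumes [measurable]: "f \<in> borel_measurable borel"
  shows "(LINT x|lborel. f (R t x)) = (LINT x|lborel. f x)"
  by (subst (2) distr_R[of t, symmetric]) (simp add: integral_distr)

end

section \<open>Gaussian integrals and the heat kernel\<close>

lemma powr_half_power2:
  fixes r :: real
  assumes "r > 0"
  shows "(r\<^sup>2) powr (real k / 2) = r ^ k"
proof -
  have "r\<^sup>2 = r powr 2" "r ^ k = r powr real k" using assms by (simp_all add: powr_realpow)
  then show ?thesis by (simp add: powr_powr)
qed

lemma nn_integral_Gamma:
  fixes s c :: real
  assumes "s > 0" "c > 0"
  shows "(\<integral>\<^sup>+a. indicator {0<..} a * ennreal (a powr (s - 1) * exp (- c * a)) \<partial>lborel)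
    = ennreal (Gamma s * c powr (- s))"
proof -
  have eq: "indicator {0<..} (0 + (1 / c) * a) * ennreal ((0 + (1 / c) * a) powr (s - 1) * exp (- c * (0 + (1 / c) * a)))
      = ennreal (c powr (1 - s)) * ennreal (indicator {0..} a * (a powr (s - 1) / exp a))" for a
    using assms by (auto simp: indicator_def zero_less_divide_iff powr_mult powr_divide exp_minus
        powr_diff field_simps simp flip: ennreal_mult' )
  have "(\<integral>\<^sup>+a. indicator {0<..} a * ennreal (a powr (s - 1) * exp (- c * a)) \<partial>lborel)
     = ennreal (1 / c) * (\<integral>\<^sup>+a. ennreal (c powr (1 - s)) * ennreal (indicator {0..} a * (a powr (s - 1) / exp a)) \<partial>lborel)"
    using assms by (subst nn_integral_real_affine[where t = 0 and c = "1 / c"]) (simp_all only: eq, simp_all)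
  also have "(\<integral>\<^sup>+a. ennreal (c powr (1 - s)) * ennreal (indicator {0..} a * (a powr (s - 1) / exp a)) \<partial>lborel)
     = ennreal (c powr (1 - s)) * (\<integral>\<^sup>+a. ennreal (indicator {0..} a * (a powr (s - 1) / exp a)) \<partial>lborel)"
    by (rule nn_integral_cmult) simp
  also have "(\<integral>\<^sup>+a. ennreal (indicator {0..} a * (a powr (s - 1) / exp a)) \<partial>lborel) = ennreal (Gamma s)"
    using nn_integral_has_integral_lebesgue[OF _ Gamma_integral_real[OF \<open>s > 0\<close>]] by simp
  also have "ennreal (1 / c) * (ennreal (c powr (1 - s)) * ennreal (Gamma s)) = ennreal (Gamma s * c powr (- s))"
    using assms by (simp add: powr_diff powr_minus field_simps Gamma_real_pos less_imp_le flip: ennreal_mult)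
  finally show ?thesis .
qed

text \<open>The push-forward of Lebesgue measure under |x|^2 is determined by its values on
  half-lines, which are ball volumes; the density is the derivative of
  \<open>unit_ball_vol d * a powr (d / 2)\<close>. With the squared norm as variable, Gaussian
  moments become Gamma integrals.\<close>

lemma nn_integral_radial:
  fixes f :: "real \<Rightarrow> ennreal"
  assumes [measurable]: "f \<in> borel_measurable borel"
  shows "(\<integral>\<^sup>+x. f ((norm (x::'a::euclidean_space))\<^sup>2) \<partial>lborel)
    = (\<integral>\<^sup>+a. ennreal (real DIM('a) / 2 * unit_ball_vol DIM('a)) *
         (indicator {0<..} a * ennreal (a powr (real DIM('a) / 2 - 1)) * f a) \<partial>lborel)"
proof -
  define d where "d = real DIM('a)"
  have d: "d > 0" by (simp add: d_def)
  define w where "w a = ennreal (d / 2 * unit_ball_vol d) * (indicator {0<..} a * ennreal (a powr (d / 2 - 1)))" for a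
  have [measurable]: "w \<in> borel_measurable borel" unfolding w_def by measurable
  have "distr lborel borel (\<lambda>x::'a. (norm x)\<^sup>2) = density lborel w"
  proof (rule measure_eqI_generator_eq[where E = "range atMost" and \<Omega> = UNIV and A = "\<lambda>i. {..real i}"])
    show "Int_stable (range (atMost :: real \<Rightarrow> _))" by (auto simp: Int_stable_def)
    show *: "emeasure (distr lborel borel (\<lambda>x::'a. (norm x)\<^sup>2)) X = emeasure (density lborel w) X"
      if X: "X \<in> range atMost" for X
    proof -
      obtain a where a: "X = {..a}" using X by auto
      have l: "emeasure (distr lborel borel (\<lambda>x::'a. (norm x)\<^sup>2)) {..a} = emeasure lborel {x::'a. (norm x)\<^sup>2 \<le> a}"
        by (subst emeasure_distr) (auto simp: vimage_def)
      show ?thesis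
      proof (cases "a < 0")
        case True
        then have "{x::'a. (norm x)\<^sup>2 \<le> a} = {}"
          by (auto simp: not_le intro: less_le_trans)
        moreover have "w x * indicator {..a} x = 0" for x
          using True by (auto simp: w_def indicator_def)
        ultimately show ?thesis using l by (simp only: a, subst emeasure_density) (simp_all only: nn_integral_0_iff_AE[symmetric], simp_all)
      next
        case False
        then have "{x::'a. (norm x)\<^sup>2 \<le> a} = cball 0 (sqrt a)"
          by auto (metis real_sqrt_le_iff real_sqrt_abs abs_norm_cancel)+
        then have "emeasure (distr lborel borel (\<lambda>x::'a. (norm x)\<^sup>2)) {..a} = ennreal (unit_ball_vol d * a powr (d / 2))"
          using l False powr_half_power2[of "sqrt a" "DIM('a)"]
            by (cases "a = 0") (simp_all add: emeasure_cball d_def)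
        moreover have "emeasure (density lborel w) {..a} = ennreal (unit_ball_vol d * a powr (d / 2))"
        proof -
          have "emeasure (density lborel w) {..a} = (\<integral>\<^sup>+x. w x * indicator {..a} x \<partial>lborel)"
            by (simp add: emeasure_density)
          also have "\<dots> = (\<integral>\<^sup>+x. ennreal (d / 2 * unit_ball_vol d) * ennreal (indicator {0..a} x * x powr (d / 2 - 1)) \<partial>lborel)"
            by (intro nn_integral_cong) (auto simp: w_def indicator_def)
          also have "\<dots> = ennreal (d / 2 * unit_ball_vol d) * (\<integral>\<^sup>+x. ennreal (indicator {0..a} x * x powr (d / 2 - 1)) \<partial>lborel)"
            by (rule nn_integral_cmult) simp
          also have "(\<integral>\<^sup>+x. ennreal (indicator {0..a} x * x powr (d / 2 - 1)) \<partial>lborel) = ennreal (a powr (d / 2) / (d / 2))"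
            using nn_integral_has_integral_lebesgue[OF _ has_integral_powr_from_0[of "d / 2 - 1" a]] False d by simp
          finally show ?thesis using d by (simp flip: ennreal_mult)
        qed
        ultimately show ?thesis by (simp add: a)
      qed
    qed
    show "sets (distr lborel borel (\<lambda>x::'a. (norm x)\<^sup>2)) = sigma_sets UNIV (range atMost)"
      by (simp add: borel_eq_atMost)
    show "sets (density lborel w) = sigma_sets UNIV (range atMost)"
      by (simp add: borel_eq_atMost)
    show "(\<Union>i. {..real i}) = UNIV" by (auto intro: real_arch_simple)
    show "emeasure (distr lborel borel (\<lambda>x::'a. (norm x)\<^sup>2)) {..real i} \<noteq> \<infinity>" for i
    proof -
      have "{x::'a. (norm x)\<^sup>2 \<le> real i} = cball 0 (sqrt i)"
        by auto (metis real_sqrt_le_iff real_sqrt_abs abs_norm_cancel)+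
      then show ?thesis by (subst emeasure_distr) (auto simp: vimage_def emeasure_cball)
    qed
  qed auto
  then have "(\<integral>\<^sup>+x. f ((norm (x::'a))\<^sup>2) \<partial>lborel) = (\<integral>\<^sup>+a. f a \<partial>density lborel w)"
    by (simp add: nn_integral_distr flip: \<open>distr _ _ _ = _\<close>)
  also have "\<dots> = (\<integral>\<^sup>+a. w a * f a \<partial>lborel)" by (rule nn_integral_density) simp_all
  finally show ?thesis by (simp add: w_def d_def mult.assoc)
qed

lemma nn_integral_norm_gaussian:
  fixes c :: real
  assumes "c > 0"
  shows "(\<integral>\<^sup>+x. ennreal (norm (x::'a::euclidean_space) ^ k * exp (- c * (norm x)\<^sup>2)) \<partial>lborel)
    = ennreal (pi powr (real DIM('a) / 2) * Gamma ((real DIM('a) + real k) / 2) / Gamma (real DIM('a) / 2)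
        * c powr (- ((real DIM('a) + real k) / 2)))"
proof -
  define d where "d = real DIM('a)"
  have d: "d > 0" by (simp add: d_def)
  define f where "f a = ennreal (a powr (real k / 2) * exp (- c * a))" for a
  have [measurable]: "f \<in> borel_measurable borel" unfolding f_def by measurable
  have "(\<integral>\<^sup>+x. ennreal (norm (x::'a) ^ k * exp (- c * (norm x)\<^sup>2)) \<partial>lborel)
      = (\<integral>\<^sup>+x. f ((norm (x::'a))\<^sup>2) \<partial>lborel)"
  proof (rule nn_integral_cong_AE)
    \<comment> \<open>At the origin the two integrands differ for \<open>k = 0\<close>:
      \<open>0 ^ 0 = 1\<close>, but \<open>0 powr 0 = 0\<close>.\<close>
    have "AE x in lborel. x \<noteq> (0::'a)" by (rule AE_lborel_singleton)
    then show "AE x in lborel. ennreal (norm (x::'a) ^ k * exp (- c * (norm x)\<^sup>2)) = f ((norm x)\<^sup>2)"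
      by eventually_elim (simp add: f_def powr_half_power2)
  qed
  also have "\<dots> = (\<integral>\<^sup>+a. ennreal (d / 2 * unit_ball_vol d) *
      (indicator {0<..} a * ennreal (a powr (d / 2 - 1)) * f a) \<partial>lborel)"
    unfolding d_def by (rule nn_integral_radial) measurable
  also have "\<dots> = (\<integral>\<^sup>+a. ennreal (d / 2 * unit_ball_vol d) *
      (indicator {0<..} a * ennreal (a powr ((d + k) / 2 - 1) * exp (- c * a))) \<partial>lborel)"
    by (intro nn_integral_cong)
      (auto simp: f_def indicator_def add_divide_distrib powr_add powr_diff mult_ac simp flip: ennreal_mult)
  also have "\<dots> = ennreal (d / 2 * unit_ball_vol d) * ennreal (Gamma ((d + k) / 2) * c powr (- ((d + k) / 2)))"
    using assms d by (subst nn_integral_cmult) (measurable, subst nn_integral_Gamma, simp_all)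
  also have "\<dots> = ennreal (pi powr (d / 2) * Gamma ((d + k) / 2) / Gamma (d / 2) * c powr (- ((d + k) / 2)))"
  proof -
    have "Gamma (d / 2 + 1) = d / 2 * Gamma (d / 2)"
      by (rule Gamma_plus1) (use d in \<open>auto elim!: nonpos_Ints_cases\<close>)
    moreover have "Gamma (d / 2) > 0" using d by (simp add: Gamma_real_pos)
    ultimately have "d / 2 * unit_ball_vol d = pi powr (d / 2) / Gamma (d / 2)"
      using d by (simp only: unit_ball_vol_def) (simp add: field_simps)
    then show ?thesis using d by (simp add: Gamma_real_pos less_imp_le flip: ennreal_mult)
  qed
  finally show ?thesis by (simp add: d_def)
qed

lemma integrable_norm_gaussian:
  fixes c :: real
  assumes "c > 0"
  shows "integrable lborel (\<lambda>x::'a::euclidean_space. norm x ^ k * exp (- c * (norm x)\<^sup>2))"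
  by (rule integrableI_nonneg) (use nn_integral_norm_gaussian[OF assms, of k, where 'a = 'a] in auto)

section \<open>Complex Gaussians by analytic continuation\<close>

lemma integrable_complex_gaussian:
  fixes \<gamma> :: complex
  assumes "Re \<gamma> > 0"
  shows "integrable lborel (\<lambda>x::'a::euclidean_space. exp (- (\<gamma> * of_real ((norm x)\<^sup>2))))"
  by (rule Bochner_Integration.integrable_bound[OF integrable_norm_gaussian[OF assms, of 0]])
    (simp_all add: norm_exp_eq_Re)

text \<open>Differentiation under the integral. On the disc of radius Re \<gamma> / 2 the real part
  stays above Re \<gamma> / 2, so the mean value inequality gives all difference quotients the
  integrable majorant |x|^2 exp (- (Re \<gamma> / 2) |x|^2).\<close>

lemma complex_gaussian_holomorphic:
  "(\<lambda>\<gamma>. LINT x|lborel. exp (- (\<gamma> * of_real ((norm (x::'a::euclidean_space))\<^sup>2)))) holomorphic_on {\<gamma>. Re \<gamma> > 0}"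
  (is "?G holomorphic_on _")
  unfolding holomorphic_on_open[OF open_halfspace_Re_gt]
proof (intro ballI, clarify)
  fix \<gamma> :: complex assume \<gamma>: "Re \<gamma> > 0"
  define S where "S = ball \<gamma> (Re \<gamma> / 2)"
  have S: "w \<in> S \<Longrightarrow> Re w > Re \<gamma> / 2" for w
    using abs_Re_le_cmod[of "\<gamma> - w"] by (auto simp: S_def dist_norm)
  have \<gamma>S: "\<gamma> \<in> S" using \<gamma> by (simp add: S_def)
  let ?e = "\<lambda>x w. exp (- (w * of_real ((norm (x::'a))\<^sup>2)))"
  let ?D = "\<lambda>x. - of_real ((norm (x::'a))\<^sup>2) * ?e x \<gamma>"
  have der: "((\<lambda>w. ?e x w) has_field_derivative - of_real ((norm x)\<^sup>2) * ?e x w) (at w)" for x w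
    by (auto intro!: derivative_eq_intros)
  have "((\<lambda>w. (?G w - ?G \<gamma>) / (w - \<gamma>)) \<longlongrightarrow> (LINT x|lborel. ?D x)) (at \<gamma> within S)"
    unfolding tendsto_at_iff_sequentially comp_def
  proof safe
    fix X assume X: "\<forall>i. X i \<in> S - {\<gamma>}" "X \<longlonglongrightarrow> \<gamma>"
    have lim: "(\<lambda>i. LINT x|lborel. (?e x (X i) - ?e x \<gamma>) / (X i - \<gamma>)) \<longlonglongrightarrow> (LINT x|lborel. ?D x)"
    proof (rule integral_dominated_convergence)
      show "integrable lborel (\<lambda>x::'a. norm x ^ 2 * exp (- (Re \<gamma> / 2) * (norm x)\<^sup>2))"
        using \<gamma> by (intro integrable_norm_gaussian) auto
      show "AE x in lborel. (\<lambda>i. (?e x (X i) - ?e x \<gamma>) / (X i - \<gamma>)) \<longlonglongrightarrow> ?D x"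
      proof (rule AE_I2)
        fix x :: 'a
        have "((\<lambda>w. (?e x w - ?e x \<gamma>) / (w - \<gamma>)) \<longlongrightarrow> ?D x) (at \<gamma>)"
          using der[of x \<gamma>] by (simp add: has_field_derivative_iff)
        then show "(\<lambda>i. (?e x (X i) - ?e x \<gamma>) / (X i - \<gamma>)) \<longlonglongrightarrow> ?D x"
          unfolding tendsto_at_iff_sequentially comp_def using X by auto
      qed
      show "AE x in lborel. norm ((?e x (X i) - ?e x \<gamma>) / (X i - \<gamma>)) \<le> norm x ^ 2 * exp (- (Re \<gamma> / 2) * (norm x)\<^sup>2)" for i
      proof (rule AE_I2)
        fix x :: 'a
        have "norm (?e x (X i) - ?e x \<gamma>) \<le> (norm x ^ 2 * exp (- (Re \<gamma> / 2) * (norm x)\<^sup>2)) * norm (X i - \<gamma>)"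
        proof (rule field_differentiable_bound[of S _ "\<lambda>w. - of_real ((norm x)\<^sup>2) * ?e x w"])
          show "norm (- of_real ((norm x)\<^sup>2) * ?e x w) \<le> norm x ^ 2 * exp (- (Re \<gamma> / 2) * (norm x)\<^sup>2)" if "w \<in> S" for w
          proof -
            have "Re \<gamma> / 2 * (norm x)\<^sup>2 \<le> Re w * (norm x)\<^sup>2"
              using S[OF that] by (intro mult_right_mono) auto
            then show ?thesis by (simp add: norm_mult norm_exp_eq_Re norm_power mult_left_mono)
          qed
        qed (use X \<gamma>S der in \<open>auto simp: S_def intro: has_field_derivative_at_within\<close>)
        moreover have "norm (X i - \<gamma>) > 0" using X(1) by auto
        ultimately show "norm ((?e x (X i) - ?e x \<gamma>) / (X i - \<gamma>)) \<le> norm x ^ 2 * exp (- (Re \<gamma> / 2) * (norm x)\<^sup>2)"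
          by (simp add: norm_divide divide_le_eq)
      qed
    qed auto
    have "(?G (X i) - ?G \<gamma>) / (X i - \<gamma>) = (LINT x|lborel. (?e x (X i) - ?e x \<gamma>) / (X i - \<gamma>))" for i
    proof -
      have "Re (X i) > 0" using S[of "X i"] X(1) \<gamma> by auto
      then have "?G (X i) - ?G \<gamma> = (LINT x|lborel. ?e x (X i) - ?e x \<gamma>)"
        by (intro Bochner_Integration.integral_diff[symmetric] integrable_complex_gaussian \<gamma>)
      then show ?thesis by (simp only: integral_divide_zero)
    qed
    with lim show "(\<lambda>i. (?G (X i) - ?G \<gamma>) / (X i - \<gamma>)) \<longlonglongrightarrow> (LINT x|lborel. ?D x)" by (simp only:)
  qed
  moreover have "at \<gamma> within S = at \<gamma>" using \<gamma>S by (intro at_within_open) (auto simp: S_def)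
  ultimately show "\<exists>f'. (?G has_field_derivative f') (at \<gamma>)"
    by (auto simp: has_field_derivative_iff)
qed

text \<open>Both sides are holomorphic on the right half-plane and coincide on the positive reals,
  where the moment of order 0 is known; the identity theorem then also settles the branch of the
  logarithm.\<close>

lemma complex_gaussian_integral:
  fixes \<gamma> :: complex
  assumes "Re \<gamma> > 0"
  shows "(LINT x|lborel. exp (- (\<gamma> * of_real ((norm (x::'a::euclidean_space))\<^sup>2))))
    = exp (- (of_nat DIM('a) / 2) * Ln (\<gamma> / of_real pi))" (is "?G \<gamma> = ?H \<gamma>")
proof -
  define d where "d = real DIM('a)"
  have d: "d > 0" by (simp add: d_def)
  have "?G \<gamma> - ?H \<gamma> = 0"
  proof (rule analytic_continuation[of "\<lambda>\<gamma>. ?G \<gamma> - ?H \<gamma>" "{\<gamma>. Re \<gamma> > 0}" "complex_of_real ` {0<..}" 1 \<gamma>])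
    show "(\<lambda>\<gamma>. ?G \<gamma> - ?H \<gamma>) holomorphic_on {\<gamma>. Re \<gamma> > 0}"
      by (intro holomorphic_intros complex_gaussian_holomorphic)
        (auto simp: complex_nonpos_Reals_iff Re_divide_of_real divide_le_0_iff not_le)
    show "open {\<gamma>. Re \<gamma> > 0}" by (rule open_halfspace_Re_gt)
    show "connected {\<gamma>. Re \<gamma> > 0}" by (intro convex_connected convex_halfspace_Re_gt)
    show "1 islimpt complex_of_real ` {0<..}"
      unfolding islimpt_approachable
    proof safe
      fix e :: real assume "e > 0"
      then show "\<exists>x'\<in>complex_of_real ` {0<..}. x' \<noteq> 1 \<and> dist x' 1 < e"
        by (intro bexI[of _ "complex_of_real (1 + e / 2)"] image_eqI[OF refl]) (auto simp: dist_norm)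
    qed
    fix z assume "z \<in> complex_of_real ` {0<..}"
    then obtain c where c: "c > 0" "z = of_real c" by auto
    have "(LINT x|lborel. norm (x::'a) ^ 0 * exp (- c * (norm x)\<^sup>2)) = pi powr (d / 2) * c powr (- (d / 2))"
      using nn_integral_norm_gaussian[OF c(1), where k = 0 and 'a = 'a] d c(1) Gamma_real_pos[of "d / 2"]
      by (subst integral_eq_nn_integral) (simp_all add: less_imp_neq[THEN not_sym] flip: d_def)
    moreover have "?G z = of_real (LINT x|lborel. norm (x::'a) ^ 0 * exp (- c * (norm x)\<^sup>2))"
      unfolding c(2) by (subst integral_complex_of_real[symmetric]) (simp add: exp_of_real[symmetric])
    moreover have "?H z = of_real (pi powr (d / 2) * c powr (- (d / 2)))"
    proof -
      have "Ln (z / of_real pi) = of_real (ln (c / pi))"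
        using c by (simp add: Ln_of_real flip: of_real_divide)
      then have "?H z = of_real (exp (- (d / 2) * ln (c / pi)))"
        by (simp add: d_def exp_of_real[symmetric])
      also have "exp (- (d / 2) * ln (c / pi)) = pi powr (d / 2) * c powr (- (d / 2))"
        using c by (simp add: powr_def ln_div right_diff_distrib flip: exp_add)
      finally show ?thesis .
    qed
    ultimately show "?G z - ?H z = 0" by simp
  qed (use assms in auto)
  then show ?thesis by simp
qed

section \<open>The scalar heat kernel and its semigroup law\<close>

text \<open>The heat kernel for one eigenvalue \<alpha> of \<open>A\<close> and the matching
  eigenvalue \<beta> of \<open>B\<close>. The rotation is kept out of it, so that it depends on
  \<open>x\<close> through the norm only; the prefactor copies the principal logarithm in
  \<open>heat_kernel\<close>.\<close>

definition ou_kernel :: "complex \<Rightarrow> complex \<Rightarrow> real \<Rightarrow> 'a::euclidean_space \<Rightarrow> complex" where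
  "ou_kernel \<alpha> \<beta> t x = exp (- (of_nat DIM('a) / 2) * Ln (of_real (4 * pi * t) * \<alpha>)) *
     exp (- (of_real t * \<beta>) - of_real ((norm x)\<^sup>2) / (of_real (4 * t) * \<alpha>))"

lemma Re_inverse_pos: "Re \<alpha> > 0 \<Longrightarrow> Re (inverse \<alpha>) > 0"
  by (auto simp: zero_less_divide_iff sum_power2_gt_zero_iff)

text \<open>Completing the square in \<open>y\<close>. The second summand is free of
  \<open>y\<close> and carries the added time parameter, which is the source of the semigroup
  law.\<close>

lemma gaussian_square:
  fixes x y :: "'a::euclidean_space" and s t :: real
  assumes "s > 0" "t > 0"
  shows "(norm (x - y))\<^sup>2 / s + (norm y)\<^sup>2 / t
    = (s + t) / (s * t) * (norm (y - (t / (s + t)) *\<^sub>R x))\<^sup>2 + (norm x)\<^sup>2 / (s + t)"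
proof -
  have "(norm (x - y))\<^sup>2 = x \<bullet> x - 2 * (x \<bullet> y) + y \<bullet> y"
    by (simp add: power2_norm_eq_inner inner_diff inner_commute)
  moreover have "(norm (y - (t / (s + t)) *\<^sub>R x))\<^sup>2
      = y \<bullet> y - 2 * (t / (s + t)) * (x \<bullet> y) + (t / (s + t))\<^sup>2 * (x \<bullet> x)"
    unfolding power2_norm_eq_inner by (simp add: inner_diff inner_commute power2_eq_square)
  moreover have "s + t \<noteq> 0" using assms by simp
  ultimately show ?thesis
    using assms
  proof -
    assume e1: "(norm (x - y))\<^sup>2 = x \<bullet> x - 2 * (x \<bullet> y) + y \<bullet> y"
      and e2: "(norm (y - (t / (s + t)) *\<^sub>R x))\<^sup>2
        = y \<bullet> y - 2 * (t / (s + t)) * (x \<bullet> y) + (t / (s + t))\<^sup>2 * (x \<bullet> x)" and st: "s + t \<noteq> 0" "0 < s" "0 < t"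
    show ?thesis unfolding e1 e2 power2_norm_eq_inner[of x] power2_norm_eq_inner[of y]
      using st by (simp add: divide_simps) algebra
  qed
qed

lemma integrable_translate:
  fixes f :: "'a::euclidean_space \<Rightarrow> 'b::{banach, second_countable_topology}"
  assumes "f \<in> borel_measurable borel"
  shows "integrable lborel (\<lambda>x. f (x - c)) \<longleftrightarrow> integrable lborel f"
  using integrable_distr_eq[of "(+) (- c)" lborel borel f] assms by (simp add: lborel_distr_plus)

lemma integral_translate:
  fixes f :: "'a::euclidean_space \<Rightarrow> 'b::{banach, second_countable_topology}"
  assumes "f \<in> borel_measurable borel"
  shows "(LINT x|lborel. f (x - c)) = (LINT x|lborel. f x)"
  using integral_distr[of "(+) (- c)" lborel borel f] assms by (simp add: lborel_distr_plus)

lemma ou_kernel_measurable [measurable (raw)]: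
  assumes [measurable]: "f \<in> borel_measurable M" "g \<in> borel_measurable M"
  shows "(\<lambda>z. ou_kernel \<alpha> \<beta> (f z) (g z)) \<in> borel_measurable M"
proof -
  have "(\<lambda>z. Ln (of_real (4 * pi * f z) * \<alpha>)) \<in> borel_measurable M"
    by (rule measurable_compose[OF _ Ln_measurable]) simp
  note [measurable] = this
  show ?thesis unfolding ou_kernel_def by simp
qed

text \<open>The Chapman-Kolmogorov equation. Completing the square leaves a Gaussian integral in
  \<open>y\<close> with complex coefficient \<open>\<gamma>\<close>. Its value merges with the two
  prefactors because the three principal logarithms add up without a multiple of 2 pi i: as Re
  \<alpha> > 0, each of them is a real logarithm plus or minus \<open>Ln \<alpha>\<close>.\<close>

lemma ou_kernel_semigroup:
  fixes x w :: "'a::euclidean_space"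
  assumes "Re \<alpha> > 0" "s > 0" "t > 0"
  shows "(LINT y|lborel. ou_kernel \<alpha> \<beta> s (x - y) * ou_kernel \<alpha> \<beta> t (y - w)) = ou_kernel \<alpha> \<beta> (s + t) (x - w)"
proof -
  define d where "d = complex_of_real (real DIM('a))"
  define \<gamma> where "\<gamma> = of_real ((s + t) / (4 * s * t)) * inverse \<alpha>"
  have \<alpha>0: "\<alpha> \<noteq> 0" using assms by auto
  have \<gamma>: "Re \<gamma> > 0" unfolding \<gamma>_def using assms Re_inverse_pos[of \<alpha>] by (simp del: inverse_complex.simps)
  have Ln1: "Ln (of_real r * \<alpha>) = of_real (ln r) + Ln \<alpha>" if "r > 0" for r
    using that \<alpha>0 by (simp add: Ln_times_of_real Ln_of_real)
  have Ln2: "Ln (of_real r * inverse \<alpha>) = of_real (ln r) - Ln \<alpha>" if "r > 0" for r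
    using that \<alpha>0 assms by (simp add: Ln_times_of_real Ln_inverse complex_nonpos_Reals_iff Ln_of_real)
  have exps: "exp p * exp (a - u) * (exp q * exp (b - w)) = exp p * exp q * exp (a + b) * exp (- (u + w))"
    for p q a b u w :: complex
    by (simp only: exp_add diff_conv_add_uminus minus_add_distrib mult_ac)
  define K where "K = exp (- (d / 2) * Ln (of_real (4 * pi * s) * \<alpha>)) * exp (- (d / 2) * Ln (of_real (4 * pi * t) * \<alpha>))
    * exp (- (of_real (s + t) * \<beta>))"
  have one: "(LINT y|lborel. ou_kernel \<alpha> \<beta> s (x - y) * ou_kernel \<alpha> \<beta> t y) = ou_kernel \<alpha> \<beta> (s + t) x" for x :: 'a
  proof -
    define c where "c = (t / (s + t)) *\<^sub>R x"
    have ex: "of_real ((norm (x - y))\<^sup>2) / (of_real (4 * s) * \<alpha>) + of_real ((norm y)\<^sup>2) / (of_real (4 * t) * \<alpha>)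
      = \<gamma> * of_real ((norm (y - c))\<^sup>2) + of_real ((norm x)\<^sup>2) / (of_real (4 * (s + t)) * \<alpha>)" for y
    proof -
      have lhs: "of_real u / (of_real (4 * s) * \<alpha>) + of_real v / (of_real (4 * t) * \<alpha>) = of_real (u / s + v / t) * (inverse \<alpha> / 4)"
        for u v :: real using assms \<alpha>0 by (simp add: field_simps)
      have rhs: "of_real (p * u + v / q) * (inverse \<alpha> / 4) = (of_real (p / 4) * inverse \<alpha>) * of_real u + of_real v / (of_real (4 * q) * \<alpha>)"
        if "q > 0" for p q u v :: real using that \<alpha>0 by (simp add: field_simps)
      have g: "\<gamma> = of_real ((s + t) / (s * t) / 4) * inverse \<alpha>" by (simp add: \<gamma>_def mult_ac)
      show ?thesis unfolding lhs gaussian_square[OF assms(2,3)] c_def[symmetric] g by (rule rhs) (use assms in simp)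
    qed
    have "ou_kernel \<alpha> \<beta> s (x - y) * ou_kernel \<alpha> \<beta> t y
      = (K * exp (- (of_real ((norm x)\<^sup>2) / (of_real (4 * (s + t)) * \<alpha>)))) * exp (- (\<gamma> * of_real ((norm (y - c))\<^sup>2)))" for y
    proof -
      have "ou_kernel \<alpha> \<beta> s (x - y) * ou_kernel \<alpha> \<beta> t y
        = K * exp (- (of_real ((norm (x - y))\<^sup>2) / (of_real (4 * s) * \<alpha>) + of_real ((norm y)\<^sup>2) / (of_real (4 * t) * \<alpha>)))"
        unfolding ou_kernel_def K_def d_def of_real_of_nat_eq exps of_real_add distrib_right by (simp only: minus_add_distrib)
      also have "\<dots> = (K * exp (- (of_real ((norm x)\<^sup>2) / (of_real (4 * (s + t)) * \<alpha>)))) * exp (- (\<gamma> * of_real ((norm (y - c))\<^sup>2)))"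
        unfolding ex minus_add_distrib exp_add by (simp only: mult_ac)
      finally show ?thesis .
    qed
    then have "(LINT y|lborel. ou_kernel \<alpha> \<beta> s (x - y) * ou_kernel \<alpha> \<beta> t y)
      = (K * exp (- (of_real ((norm x)\<^sup>2) / (of_real (4 * (s + t)) * \<alpha>)))) * (LINT y|lborel. exp (- (\<gamma> * of_real ((norm (y - c))\<^sup>2))))"
      by simp
    also have "(LINT y|lborel. exp (- (\<gamma> * of_real ((norm (y - c))\<^sup>2)))) = exp (- (d / 2) * Ln (\<gamma> / of_real pi))"
      using integral_translate[of "\<lambda>y. exp (- (\<gamma> * of_real ((norm (y::'a))\<^sup>2)))" c]
        complex_gaussian_integral[OF \<gamma>, where 'a = 'a]
      by (simp add: d_def)
    also have "(K * exp (- (of_real ((norm x)\<^sup>2) / (of_real (4 * (s + t)) * \<alpha>)))) * exp (- (d / 2) * Ln (\<gamma> / of_real pi))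
      = (K * exp (- (d / 2) * Ln (\<gamma> / of_real pi))) * exp (- (of_real ((norm x)\<^sup>2) / (of_real (4 * (s + t)) * \<alpha>)))" by simp
    also have "K * exp (- (d / 2) * Ln (\<gamma> / of_real pi))
      = exp (- (d / 2) * Ln (of_real (4 * pi * (s + t)) * \<alpha>)) * exp (- (of_real (s + t) * \<beta>))"
    proof -
      have "\<gamma> / of_real pi = of_real ((s + t) / (4 * s * t * pi)) * inverse \<alpha>" by (simp add: \<gamma>_def)
      then have "Ln (of_real (4 * pi * s) * \<alpha>) + Ln (of_real (4 * pi * t) * \<alpha>) + Ln (\<gamma> / of_real pi)
        = of_real (ln (4 * pi * s) + ln (4 * pi * t) + ln ((s + t) / (4 * s * t * pi))) + Ln \<alpha>"
        using assms by (simp add: Ln1 Ln2 del: of_real_mult of_real_divide)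
      also have "ln (4 * pi * s) + ln (4 * pi * t) + ln ((s + t) / (4 * s * t * pi)) = ln (4 * pi * (s + t))"
        using assms by (simp add: ln_mult ln_div)
      finally have L: "Ln (of_real (4 * pi * s) * \<alpha>) + Ln (of_real (4 * pi * t) * \<alpha>) + Ln (\<gamma> / of_real pi)
        = Ln (of_real (4 * pi * (s + t)) * \<alpha>)" using assms by (simp add: Ln1 del: of_real_mult)
      have "exp (k * u) * exp (k * v) * e * exp (k * w) = exp (k * (u + v + w)) * e" for k u v w e :: complex
        by (simp only: distrib_left exp_add mult_ac)
      then show ?thesis unfolding K_def L[symmetric] .
    qed
    finally show ?thesis
      by (simp only: ou_kernel_def d_def of_real_of_nat_eq diff_conv_add_uminus exp_add mult_ac)
  qed
  have "(LINT y|lborel. ou_kernel \<alpha> \<beta> s (x - y) * ou_kernel \<alpha> \<beta> t (y - w))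
     = (LINT y|lborel. (\<lambda>y. ou_kernel \<alpha> \<beta> s ((x - w) - y) * ou_kernel \<alpha> \<beta> t y) (y - w))"
    by (simp add: algebra_simps)
  also have "\<dots> = ou_kernel \<alpha> \<beta> (s + t) (x - w)"
    by (subst integral_translate) (simp_all add: one)
  finally show ?thesis .
qed

section \<open>Positive kernel operators on weighted spaces\<close>

text \<open>Jensen's inequality for a kernel of total mass at most \<open>m\<close>, obtained by
  integrating Young's inequality. It is stated for reals \<open>F\<close> below the integral because
  the integral itself may be infinite.\<close>

lemma Jensen_powr_nn_integral:
  fixes h :: "'w \<Rightarrow> real" and \<kappa> :: "'w \<Rightarrow> ennreal" and p m F :: real
  assumes [measurable]: "\<kappa> \<in> borel_measurable M" "h \<in> borel_measurable M"
    and h: "\<And>w. h w \<ge> 0" and p: "p \<ge> 1" and m: "m > 0" and mass: "(\<integral>\<^sup>+w. \<kappa> w \<partial>M) \<le> ennreal m"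
    and F: "F \<ge> 0" "ennreal F \<le> (\<integral>\<^sup>+w. \<kappa> w * ennreal (h w) \<partial>M)"
  shows "ennreal (F powr p) \<le> ennreal (m powr (p - 1)) * (\<integral>\<^sup>+w. \<kappa> w * ennreal (h w powr p) \<partial>M)"
    (is "_ \<le> _ * ?P")
proof (cases "?P = \<infinity> \<or> F = 0")
  case True
  then show ?thesis using m p by (auto simp: ennreal_mult_eq_top_iff ennreal_top_mult ennreal_mult_top)
next
  case False
  then have F0: "F > 0" and "?P \<noteq> \<infinity>" using F by auto
  then obtain P where P: "?P = ennreal P" "P \<ge> 0" by (metis ennreal_cases infinity_ennreal_def)
  \<comment> \<open>Young's inequality h <= s^(1 - p) h^p / p + (1 - 1/p) s is an equality at h = s.
    With \<open>s\<close> the mean value F/m, its last term integrates to at most F - F/p, which is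
    absorbed on the left.\<close>
  define s where "s = F / m"
  have s: "s > 0" using F0 m by (simp add: s_def)
  have Y: "h w \<le> (1 / p) * s powr (1 - p) * h w powr p + (1 - 1 / p) * s" for w
  proof (cases "p = 1 \<or> h w = 0")
    case False
    then have p1: "p > 1" using p by simp
    have "(h w powr p * s powr (1 - p)) powr (1 / p) * s powr (1 - 1 / p)
        \<le> (1 / p) * (h w powr p * s powr (1 - p)) + (1 - 1 / p) * s"
      by (rule Youngs_inequality_0) (use p1 s False in auto)
    moreover have "(h w powr p * s powr (1 - p)) powr (1 / p) * s powr (1 - 1 / p) = h w"
      using p1 s h[of w] by (simp add: powr_mult powr_powr powr_add[symmetric] mult.assoc diff_divide_distrib)
    ultimately show ?thesis by (simp add: mult_ac)
  qed (use s h p in auto)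
  have "ennreal F \<le> (\<integral>\<^sup>+w. \<kappa> w * ennreal (h w) \<partial>M)" by (rule F)
  also have "\<dots> \<le> (\<integral>\<^sup>+w. ennreal ((1 / p) * s powr (1 - p)) * (\<kappa> w * ennreal (h w powr p)) + ennreal ((1 - 1 / p) * s) * \<kappa> w \<partial>M)"
  proof (rule nn_integral_mono)
    fix w
    have "\<kappa> w * ennreal (h w) \<le> \<kappa> w * ennreal ((1 / p) * s powr (1 - p) * h w powr p + (1 - 1 / p) * s)"
      by (intro mult_left_mono ennreal_leI Y) simp
    also have "\<dots> = ennreal ((1 / p) * s powr (1 - p)) * (\<kappa> w * ennreal (h w powr p)) + ennreal ((1 - 1 / p) * s) * \<kappa> w"
    proof -
      have "(1 / p) * s powr (1 - p) \<ge> 0" "(1 - 1 / p) * s \<ge> 0" using p s by simp_all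
      then have "ennreal ((1 / p) * s powr (1 - p) * h w powr p + (1 - 1 / p) * s)
          = ennreal ((1 / p) * s powr (1 - p)) * ennreal (h w powr p) + ennreal ((1 - 1 / p) * s)"
        by (simp only: ennreal_plus mult_nonneg_nonneg powr_ge_zero ennreal_mult)
      then show ?thesis by (simp only: distrib_left mult_ac)
    qed
    finally show "\<kappa> w * ennreal (h w) \<le> \<dots>" .
  qed
  also have "\<dots> = ennreal ((1 / p) * s powr (1 - p)) * ?P + ennreal ((1 - 1 / p) * s) * (\<integral>\<^sup>+w. \<kappa> w \<partial>M)"
    by (subst nn_integral_add) (simp_all add: nn_integral_cmult)
  also have "\<dots> \<le> ennreal ((1 / p) * s powr (1 - p)) * ?P + ennreal ((1 - 1 / p) * s) * ennreal m"
    by (intro add_left_mono mult_left_mono mass) simp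
  also have "\<dots> = ennreal ((1 / p) * s powr (1 - p) * P + (1 - 1 / p) * s * m)"
    using P p s m by (simp add: ennreal_mult[symmetric] ennreal_plus[symmetric] del: ennreal_plus)
  finally have "F \<le> (1 / p) * s powr (1 - p) * P + (1 - 1 / p) * s * m"
    using P p s m by (subst (asm) ennreal_le_iff) auto
  also have "(1 - 1 / p) * s * m = F - F / p" using m by (simp add: s_def field_simps)
  finally have "F / p \<le> (1 / p) * (s powr (1 - p) * P)" by simp
  then have "F \<le> s powr (1 - p) * P" using p by (simp add: field_simps)
  also have "s powr (1 - p) = F powr (1 - p) * m powr (p - 1)"
    using F0 m by (simp add: s_def powr_divide powr_diff field_simps)
  finally have "F * F powr (p - 1) \<le> (F powr (1 - p) * m powr (p - 1) * P) * F powr (p - 1)"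
    by (rule mult_right_mono) simp
  also have "F * F powr (p - 1) = F powr p" using F0 by (simp add: powr_diff)
  also have "(F powr (1 - p) * m powr (p - 1) * P) * F powr (p - 1) = m powr (p - 1) * P"
    using F0 by (simp add: powr_diff)
  finally show ?thesis using P by (simp add: ennreal_mult[symmetric])
qed

locale weighted_flow = isometric_flow R for R :: "real \<Rightarrow> 'a::euclidean_space \<Rightarrow> 'a" +
  fixes \<theta> :: "'a \<Rightarrow> real" and C \<eta> :: real
  assumes \<theta>_pos: "\<theta> x > 0"
    and \<theta>_cont: "continuous_on UNIV \<theta>"
    and C_pos: "C > 0" and \<eta>_nonneg: "\<eta> \<ge> 0"
    and \<theta>_growth: "\<theta> (x + y) \<le> C * \<theta> x * exp (\<eta> * norm y)"
    and \<theta>_R: "\<theta> (R t x) = \<theta> x"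
begin

lemma \<theta>_measurable [measurable]: "\<theta> \<in> borel_measurable borel"
  using \<theta>_cont by (rule borel_measurable_continuous_onI)

lemma \<theta>_le: "\<theta> x \<le> C * exp (\<eta> * norm (x - y)) * \<theta> (R t y)"
  using \<theta>_growth[of y "x - y"] by (simp add: \<theta>_R mult_ac)

text \<open>
  The substitution \<open>\<xi> = R t y\<close> turns \<open>\<integral>\<kappa> t (R t x - \<xi>) f \<xi> d\<xi>\<close> into the formula below if \<open>\<kappa> t\<close> is invariant
  under rotations.  The measure \<open>N\<close> is a point mass for the semigroup and Lebesgue measure for its
  resolvent.
\<close>

definition kop :: "real measure \<Rightarrow> (real \<Rightarrow> 'a \<Rightarrow> ennreal) \<Rightarrow> ('a \<Rightarrow> ennreal) \<Rightarrow> 'a \<Rightarrow> ennreal" where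
  "kop N \<kappa> f x = (\<integral>\<^sup>+z. \<kappa> (fst z) (x - snd z) * f (R (fst z) (snd z)) \<partial>(N \<Otimes>\<^sub>M lborel))"

definition exp_mass :: "real measure \<Rightarrow> (real \<Rightarrow> 'a \<Rightarrow> ennreal) \<Rightarrow> real \<Rightarrow> ennreal" where
  "exp_mass N \<kappa> e = (\<integral>\<^sup>+t. \<integral>\<^sup>+x. \<kappa> t x * ennreal (exp (e * norm x)) \<partial>lborel \<partial>N)"

definition kernel_on :: "real measure \<Rightarrow> (real \<Rightarrow> 'a \<Rightarrow> ennreal) \<Rightarrow> bool" where
  "kernel_on N \<kappa> \<longleftrightarrow> sigma_finite_measure N \<and> sets N = sets borel \<and>
     (\<lambda>z. \<kappa> (fst z) (snd z)) \<in> borel_measurable (borel \<Otimes>\<^sub>M borel)"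

lemma kernel_measurable:
  assumes "kernel_on N \<kappa>" "f \<in> borel_measurable M" "g \<in> borel_measurable M"
  shows "(\<lambda>z. \<kappa> (f z) (g z)) \<in> borel_measurable M"
  using measurable_compose[OF measurable_Pair[OF assms(2,3)], of "\<lambda>z. \<kappa> (fst z) (snd z)" borel] assms(1)
  by (simp add: kernel_on_def)

lemma nn_integral_diff:
  fixes f :: "'a \<Rightarrow> ennreal"
  assumes [measurable]: "f \<in> borel_measurable borel"
  shows "(\<integral>\<^sup>+x. f (x - c) \<partial>lborel) = (\<integral>\<^sup>+x. f x \<partial>lborel)"
  using nn_integral_distr[of "(+) (- c)" lborel borel f] by (simp add: lborel_distr_plus)

lemma nn_integral_diff':
  fixes f :: "'a \<Rightarrow> ennreal"
  assumes [measurable]: "f \<in> borel_measurable borel"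
  shows "(\<integral>\<^sup>+x. f (c - x) \<partial>lborel) = (\<integral>\<^sup>+x. f x \<partial>lborel)"
proof -
  have "(\<integral>\<^sup>+x. f x \<partial>lborel) = (\<integral>\<^sup>+x. f (- x) \<partial>lborel)"
    by (subst lborel_affine[of "-1" 0]) (simp_all add: nn_integral_density nn_integral_distr)
  with nn_integral_diff[of "\<lambda>x. f (- x)" c] show ?thesis by simp
qed

context
  fixes N \<kappa>
  assumes N: "kernel_on N \<kappa>"
begin

interpretation N: sigma_finite_measure N using N by (simp add: kernel_on_def)
interpretation NL: pair_sigma_finite N "lborel :: 'a measure" ..
interpretation NL_L: pair_sigma_finite "N \<Otimes>\<^sub>M (lborel :: 'a measure)" "lborel :: 'a measure" ..

private lemma setsN: "sets N = sets borel" using N by (simp add: kernel_on_def)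

lemma kop_measurable [measurable]:
  assumes [measurable]: "f \<in> borel_measurable borel"
  shows "kop N \<kappa> f \<in> borel_measurable borel"
proof -
  note [measurable_cong] = setsN and [measurable (raw)] = kernel_measurable[OF N]
  show ?thesis unfolding kop_def by measurable
qed

lemma exp_mass_pair:
  "exp_mass N \<kappa> e = (\<integral>\<^sup>+z. \<kappa> (fst z) (x - snd z) * ennreal (exp (e * norm (x - snd z))) \<partial>(N \<Otimes>\<^sub>M lborel))"
proof -
  note [measurable_cong] = setsN and [measurable (raw)] = kernel_measurable[OF N]
  have "(\<integral>\<^sup>+z. \<kappa> (fst z) (x - snd z) * ennreal (exp (e * norm (x - snd z))) \<partial>(N \<Otimes>\<^sub>M lborel))
      = (\<integral>\<^sup>+t. \<integral>\<^sup>+y. \<kappa> t (x - y) * ennreal (exp (e * norm (x - y))) \<partial>lborel \<partial>N)"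
    by (subst lborel.nn_integral_fst[symmetric]) simp_all
  also have "\<dots> = exp_mass N \<kappa> e"
    unfolding exp_mass_def
    by (intro nn_integral_cong nn_integral_diff'[where f = "\<lambda>y. \<kappa> _ y * ennreal (exp (e * norm y))"]) measurable
  finally show ?thesis by simp
qed

text \<open>Tonelli: the inner integral over \<open>x\<close> is translation invariant, and at each
  fixed time the rotation in the argument of \<open>f\<close> preserves the remaining
  integral.\<close>

lemma kop_nn_integral:
  assumes [measurable]: "f \<in> borel_measurable borel"
  shows "(\<integral>\<^sup>+x. kop N \<kappa> f x \<partial>lborel) = exp_mass N \<kappa> 0 * (\<integral>\<^sup>+x. f x \<partial>lborel)"
proof -
  note [measurable_cong] = setsN and [measurable (raw)] = kernel_measurable[OF N]
  have "(\<integral>\<^sup>+x. kop N \<kappa> f x \<partial>lborel)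
      = (\<integral>\<^sup>+z. \<integral>\<^sup>+x. \<kappa> (fst z) (x - snd z) * f (R (fst z) (snd z)) \<partial>lborel \<partial>(N \<Otimes>\<^sub>M lborel))"
    unfolding kop_def by (rule NL_L.Fubini') measurable
  also have "\<dots> = (\<integral>\<^sup>+t. \<integral>\<^sup>+y. \<integral>\<^sup>+x. \<kappa> t (x - y) * f (R t y) \<partial>lborel \<partial>lborel \<partial>N)"
    by (subst lborel.nn_integral_fst[symmetric]) simp_all
  also have "\<dots> = (\<integral>\<^sup>+t. (\<integral>\<^sup>+x. \<kappa> t x \<partial>lborel) * (\<integral>\<^sup>+x. f x \<partial>lborel) \<partial>N)"
  proof (rule nn_integral_cong)
    fix t
    have "(\<integral>\<^sup>+y. \<integral>\<^sup>+x. \<kappa> t (x - y) * f (R t y) \<partial>lborel \<partial>lborel)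
        = (\<integral>\<^sup>+y. (\<integral>\<^sup>+x. \<kappa> t x \<partial>lborel) * f (R t y) \<partial>lborel)"
      by (intro nn_integral_cong) (subst nn_integral_multc, simp_all add: nn_integral_diff[where f = "\<kappa> t"])
    also have "\<dots> = (\<integral>\<^sup>+x. \<kappa> t x \<partial>lborel) * (\<integral>\<^sup>+x. f x \<partial>lborel)"
      by (subst nn_integral_cmult) (simp_all add: nn_integral_R)
    finally show "(\<integral>\<^sup>+y. \<integral>\<^sup>+x. \<kappa> t (x - y) * f (R t y) \<partial>lborel \<partial>lborel) = \<dots>" .
  qed
  also have "\<dots> = exp_mass N \<kappa> 0 * (\<integral>\<^sup>+x. f x \<partial>lborel)"
    by (subst nn_integral_multc) (simp_all add: exp_mass_def)
  finally show ?thesis .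
qed

end

lemma kernel_on_weighted:
  assumes "kernel_on N \<kappa>"
  shows "kernel_on N (\<lambda>t x. \<kappa> t x * ennreal (exp (\<eta> * norm x)))"
  using assms by (auto simp: kernel_on_def)

lemma exp_mass_weighted: "exp_mass N (\<lambda>t x. \<kappa> t x * ennreal (exp (\<eta> * norm x))) 0 = exp_mass N \<kappa> \<eta>"
  by (simp add: exp_mass_def)

text \<open>The growth condition moves the weight from x to y at the price of exp (\<eta> |x - y|),
  which joins the kernel; by rotation invariance the weight at y is the one at R t y, where
  \<open>f\<close> is evaluated.\<close>

lemma weight_kop_le:
  assumes [measurable]: "f \<in> borel_measurable borel" and N: "kernel_on N \<kappa>"
  shows "ennreal (\<theta> x) * kop N \<kappa> f x
    \<le> ennreal C * kop N (\<lambda>t x. \<kappa> t x * ennreal (exp (\<eta> * norm x))) (\<lambda>y. ennreal (\<theta> y) * f y) x"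
proof -
  have [measurable_cong]: "sets N = sets borel" using N unfolding kernel_on_def by blast
  note [measurable (raw)] = kernel_measurable[OF N]
  have "ennreal (\<theta> x) * kop N \<kappa> f x
      = (\<integral>\<^sup>+z. ennreal (\<theta> x) * (\<kappa> (fst z) (x - snd z) * f (R (fst z) (snd z))) \<partial>(N \<Otimes>\<^sub>M lborel))"
    unfolding kop_def by (rule nn_integral_cmult[symmetric]) measurable
  also have "\<dots> \<le> (\<integral>\<^sup>+z. ennreal C * (\<kappa> (fst z) (x - snd z) * ennreal (exp (\<eta> * norm (x - snd z)))
        * (ennreal (\<theta> (R (fst z) (snd z))) * f (R (fst z) (snd z)))) \<partial>(N \<Otimes>\<^sub>M lborel))"
  proof (rule nn_integral_mono)
    fix z :: "real \<times> 'a"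
    have "ennreal (\<theta> x) \<le> ennreal C * ennreal (exp (\<eta> * norm (x - snd z))) * ennreal (\<theta> (R (fst z) (snd z)))"
      using \<theta>_le[of x "snd z" "fst z"] C_pos \<theta>_pos[of "R (fst z) (snd z)"]
      by (simp add: ennreal_mult[symmetric] less_imp_le ennreal_leI)
    then have "ennreal (\<theta> x) * (\<kappa> (fst z) (x - snd z) * f (R (fst z) (snd z)))
        \<le> ennreal C * ennreal (exp (\<eta> * norm (x - snd z))) * ennreal (\<theta> (R (fst z) (snd z))) * (\<kappa> (fst z) (x - snd z) * f (R (fst z) (snd z)))"
      by (rule mult_right_mono) simp
    then show "ennreal (\<theta> x) * (\<kappa> (fst z) (x - snd z) * f (R (fst z) (snd z)))
      \<le> ennreal C * (\<kappa> (fst z) (x - snd z) * ennreal (exp (\<eta> * norm (x - snd z)))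
        * (ennreal (\<theta> (R (fst z) (snd z))) * f (R (fst z) (snd z))))"
      by (simp add: mult_ac)
  qed
  also have "\<dots> = ennreal C * kop N (\<lambda>t x. \<kappa> t x * ennreal (exp (\<eta> * norm x))) (\<lambda>y. ennreal (\<theta> y) * f y) x"
    unfolding kop_def by (rule nn_integral_cmult) measurable
  finally show ?thesis .
qed

text \<open>Young's convolution inequality with weights: once the weight is absorbed, Jensen's
  inequality contributes m^(p - 1) pointwise and Tonelli one more factor \<open>m\<close>. Stating
  it for any \<open>F\<close> below the operator makes it applicable to complex and to matrix
  kernels.\<close>

lemma kop_Lp_bound:
  fixes F h :: "'a \<Rightarrow> real" and p m :: real
  assumes N: "kernel_on N \<kappa>" and [measurable]: "h \<in> borel_measurable borel"
    and h: "\<And>x. h x \<ge> 0" and p: "p \<ge> 1" and m: "m > 0" and mass: "exp_mass N \<kappa> \<eta> \<le> ennreal m"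
    and F: "\<And>x. F x \<ge> 0" "AE x in lborel. ennreal (F x) \<le> kop N \<kappa> (\<lambda>x. ennreal (h x)) x"
  shows "(\<integral>\<^sup>+x. ennreal ((\<theta> x * F x) powr p) \<partial>lborel)
    \<le> ennreal ((C * m) powr p) * (\<integral>\<^sup>+x. ennreal ((\<theta> x * h x) powr p) \<partial>lborel)"
proof -
  let ?\<kappa> = "\<lambda>t x. \<kappa> t x * ennreal (exp (\<eta> * norm x))"
  note N' = kernel_on_weighted[OF N]
  have [measurable_cong]: "sets N = sets borel" using N unfolding kernel_on_def by blast
  note [measurable (raw)] = kernel_measurable[OF N]
  have pt: "ennreal ((\<theta> x * F x) powr p)
      \<le> ennreal (C powr p * m powr (p - 1)) * kop N ?\<kappa> (\<lambda>y. ennreal ((\<theta> y * h y) powr p)) x"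
    if x: "ennreal (F x) \<le> kop N \<kappa> (\<lambda>x. ennreal (h x)) x" for x
  proof -
    \<comment> \<open>Division by \<open>C\<close> leaves exactly the weighted kernel on the right,
      to which Jensen's inequality applies with the mass bound \<open>m\<close>; the constant
      returns as \<open>C powr p\<close>.\<close>
    have "ennreal C * ennreal (\<theta> x * F x / C) = ennreal (\<theta> x) * ennreal (F x)"
      using C_pos \<theta>_pos[of x] F(1)[of x] by (simp add: less_imp_le ennreal_mult[symmetric])
    also have "\<dots> \<le> ennreal (\<theta> x) * kop N \<kappa> (\<lambda>x. ennreal (h x)) x" by (intro mult_left_mono x) simp
    also have "\<dots> \<le> ennreal C * kop N ?\<kappa> (\<lambda>y. ennreal (\<theta> y) * ennreal (h y)) x"
      by (rule weight_kop_le[OF _ N]) simp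
    finally have "ennreal (\<theta> x * F x / C) \<le> kop N ?\<kappa> (\<lambda>y. ennreal (\<theta> y) * ennreal (h y)) x"
      using C_pos by (subst (asm) ennreal_mult_le_mult_iff) auto
    also have "(\<lambda>y. ennreal (\<theta> y) * ennreal (h y)) = (\<lambda>y. ennreal (\<theta> y * h y))"
      using \<theta>_pos h by (simp add: ennreal_mult less_imp_le)
    finally have "ennreal ((\<theta> x * F x / C) powr p) \<le> ennreal (m powr (p - 1)) * kop N ?\<kappa> (\<lambda>y. ennreal ((\<theta> y * h y) powr p)) x"
      unfolding kop_def
      using C_pos \<theta>_pos h F(1)[of x] mass
      by (intro Jensen_powr_nn_integral p m)
        (auto simp: less_imp_le exp_mass_pair[OF N, symmetric])
    then have "ennreal (C powr p) * ennreal ((\<theta> x * F x / C) powr p)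
       \<le> ennreal (C powr p) * (ennreal (m powr (p - 1)) * kop N ?\<kappa> (\<lambda>y. ennreal ((\<theta> y * h y) powr p)) x)"
      by (rule mult_left_mono) simp
    moreover have "ennreal (C powr p) * ennreal ((\<theta> x * F x / C) powr p) = ennreal ((\<theta> x * F x) powr p)"
      using C_pos \<theta>_pos[of x] F(1)[of x] by (simp add: ennreal_mult[symmetric] powr_divide)
    ultimately show ?thesis by (simp add: ennreal_mult mult.assoc)
  qed
  have "(\<integral>\<^sup>+x. ennreal ((\<theta> x * F x) powr p) \<partial>lborel)
      \<le> (\<integral>\<^sup>+x. ennreal (C powr p * m powr (p - 1)) * kop N ?\<kappa> (\<lambda>y. ennreal ((\<theta> y * h y) powr p)) x \<partial>lborel)"
    using F(2) by (intro nn_integral_mono_AE) (auto elim!: eventually_mono intro: pt)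
  also have "\<dots> = ennreal (C powr p * m powr (p - 1)) * (exp_mass N \<kappa> \<eta> * (\<integral>\<^sup>+x. ennreal ((\<theta> x * h x) powr p) \<partial>lborel))"
    by (subst nn_integral_cmult) (simp_all add: kop_measurable[OF N'] kop_nn_integral[OF N'] exp_mass_weighted)
  also have "\<dots> \<le> ennreal (C powr p * m powr (p - 1)) * (ennreal m * (\<integral>\<^sup>+x. ennreal ((\<theta> x * h x) powr p) \<partial>lborel))"
    by (intro mult_left_mono mult_right_mono mass) simp_all
  also have "\<dots> = ennreal ((C * m) powr p) * (\<integral>\<^sup>+x. ennreal ((\<theta> x * h x) powr p) \<partial>lborel)"
    using m C_pos by (simp add: ennreal_mult[symmetric] mult.assoc[symmetric] powr_mult powr_diff)
  finally show ?thesis .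
qed

text \<open>
  This class contains the weighted Lebesgue spaces and is stable under \<open>kop\<close>, so that compositions of the
  operators are finite almost everywhere and Fubini's theorem applies to them pointwise.
\<close>

definition tame :: "('a \<Rightarrow> ennreal) \<Rightarrow> bool" where
  "tame U \<longleftrightarrow> U \<in> borel_measurable borel \<and> (\<exists>M b. M < \<infinity> \<and> b \<in> borel_measurable borel \<and>
     (\<integral>\<^sup>+x. b x \<partial>lborel) < \<infinity> \<and> (\<forall>x. ennreal (\<theta> x) * U x \<le> M + b x))"

text \<open>The bounded part is multiplied by the exponential mass of the kernel, and the integrable
  part stays integrable by Tonelli.\<close>

lemma tame_kop:
  assumes "tame U" "kernel_on N \<kappa>" "exp_mass N \<kappa> \<eta> < \<infinity>"
  shows "tame (kop N \<kappa> U)"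
proof -
  obtain M b where U[measurable]: "U \<in> borel_measurable borel" and M: "M < \<infinity>" and b[measurable]: "b \<in> borel_measurable borel"
    and bi: "(\<integral>\<^sup>+x. b x \<partial>lborel) < \<infinity>" and le: "\<And>x. ennreal (\<theta> x) * U x \<le> M + b x"
    using assms(1) by (auto simp: tame_def)
  let ?\<kappa> = "\<lambda>t x. \<kappa> t x * ennreal (exp (\<eta> * norm x))"
  note N = assms(2) and N' = kernel_on_weighted[OF assms(2)]
  have [measurable_cong]: "sets N = sets borel" using N unfolding kernel_on_def by blast
  note [measurable (raw)] = kernel_measurable[OF N]
  have "ennreal (\<theta> x) * kop N \<kappa> U x \<le> ennreal C * exp_mass N \<kappa> \<eta> * M + ennreal C * kop N ?\<kappa> b x" for x
  proof -
    have "kop N ?\<kappa> (\<lambda>y. ennreal (\<theta> y) * U y) x \<le> kop N ?\<kappa> (\<lambda>y. M + b y) x"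
      unfolding kop_def by (intro nn_integral_mono mult_left_mono le) simp
    also have "\<dots> = (\<integral>\<^sup>+z. ?\<kappa> (fst z) (x - snd z) * M + ?\<kappa> (fst z) (x - snd z) * b (R (fst z) (snd z)) \<partial>(N \<Otimes>\<^sub>M lborel))"
      by (simp add: kop_def distrib_left)
    also have "\<dots> = exp_mass N \<kappa> \<eta> * M + kop N ?\<kappa> b x"
      by (subst nn_integral_add) (simp_all add: nn_integral_multc exp_mass_pair[OF N, of \<eta> x] kop_def)
    finally have "kop N ?\<kappa> (\<lambda>y. ennreal (\<theta> y) * U y) x \<le> exp_mass N \<kappa> \<eta> * M + kop N ?\<kappa> b x" .
    then have "ennreal C * kop N ?\<kappa> (\<lambda>y. ennreal (\<theta> y) * U y) x \<le> ennreal C * (exp_mass N \<kappa> \<eta> * M + kop N ?\<kappa> b x)"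
      by (rule mult_left_mono) simp
    with weight_kop_le[OF U N, of x] show ?thesis by (simp add: distrib_left mult.assoc)
  qed
  moreover have "ennreal C * exp_mass N \<kappa> \<eta> * M < \<infinity>"
    using assms(3) M by (simp add: ennreal_mult_less_top)
  moreover have "(\<integral>\<^sup>+x. ennreal C * kop N ?\<kappa> b x \<partial>lborel) < \<infinity>"
    using assms(3) bi
    by (subst nn_integral_cmult)
      (simp_all add: kop_measurable[OF N'] kop_nn_integral[OF N'] exp_mass_weighted ennreal_mult_less_top)
  moreover have "(\<lambda>x. ennreal C * kop N ?\<kappa> b x) \<in> borel_measurable borel"
    using kop_measurable[OF N' b] by simp
  ultimately show ?thesis unfolding tame_def using kop_measurable[OF N U] by blast
qed

lemma tame_AE_finite:
  assumes "tame U"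
  shows "AE x in lborel. U x < \<infinity>"
proof -
  obtain M b where M: "M < \<infinity>" and [measurable]: "b \<in> borel_measurable borel"
    and bi: "(\<integral>\<^sup>+x. b x \<partial>lborel) < \<infinity>" and le: "\<And>x. ennreal (\<theta> x) * U x \<le> M + b x"
    using assms by (auto simp: tame_def)
  have "AE x in lborel. b x \<noteq> \<infinity>" using bi by (intro nn_integral_noteq_infinite) auto
  then show ?thesis
  proof eventually_elim
    fix x assume "b x \<noteq> \<infinity>"
    then have "ennreal (\<theta> x) * U x < \<infinity>" using le[of x] M by (metis ennreal_add_less_top infinity_ennreal_def less_top order_le_less_trans)
    then show "U x < \<infinity>" using \<theta>_pos[of x] by (auto simp: ennreal_mult_less_top)
  qed
qed

text \<open>On a compact set the continuous weight has a positive minimum, by which one may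
  divide.\<close>

lemma tame_compact_finite:
  assumes "tame U" "compact K"
  shows "(\<integral>\<^sup>+x. U x * indicator K x \<partial>lborel) < \<infinity>"
proof (cases "K = {}")
  case False
  obtain M b where M: "M < \<infinity>" and [measurable]: "b \<in> borel_measurable borel" "U \<in> borel_measurable borel"
    and bi: "(\<integral>\<^sup>+x. b x \<partial>lborel) < \<infinity>" and le: "\<And>x. ennreal (\<theta> x) * U x \<le> M + b x"
    using assms by (auto simp: tame_def)
  have [measurable]: "K \<in> sets borel" using assms by (simp add: borel_compact)
  obtain x0 where x0: "\<And>x. x \<in> K \<Longrightarrow> \<theta> x0 \<le> \<theta> x"
    using continuous_attains_inf[OF assms(2) False continuous_on_subset[OF \<theta>_cont]] by auto
  have "ennreal (\<theta> x0) * (\<integral>\<^sup>+x. U x * indicator K x \<partial>lborel) = (\<integral>\<^sup>+x. ennreal (\<theta> x0) * (U x * indicator K x) \<partial>lborel)"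
    by (rule nn_integral_cmult[symmetric]) measurable
  also have "\<dots> \<le> (\<integral>\<^sup>+x. M * indicator K x + b x \<partial>lborel)"
  proof (rule nn_integral_mono)
    fix x
    show "ennreal (\<theta> x0) * (U x * indicator K x) \<le> M * indicator K x + b x"
    proof (cases "x \<in> K")
      case True
      then have "ennreal (\<theta> x0) * U x \<le> ennreal (\<theta> x) * U x" by (intro mult_right_mono ennreal_leI x0) simp_all
      with le[of x] True show ?thesis by simp
    qed simp
  qed
  also have "\<dots> = M * emeasure lborel K + (\<integral>\<^sup>+x. b x \<partial>lborel)"
    by (subst nn_integral_add) (simp_all add: nn_integral_cmult_indicator)
  also have "\<dots> < \<infinity>" using M bi emeasure_compact_finite[OF assms(2)] by (simp add: ennreal_mult_less_top)
  finally show ?thesis using \<theta>_pos[of x0] by (auto simp: ennreal_mult_less_top)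
qed simp

text \<open>By a <= 1 + a^p the product of weight and function splits into the bounded part 1 and an
  integrable part.\<close>

lemma tame_of_Lp:
  fixes h :: "'a \<Rightarrow> real"
  assumes [measurable]: "h \<in> borel_measurable borel" and h: "\<And>x. h x \<ge> 0" and p: "p \<ge> 1"
    and fin: "(\<integral>\<^sup>+x. ennreal ((\<theta> x * h x) powr p) \<partial>lborel) < \<infinity>"
  shows "tame (\<lambda>x. ennreal (h x))"
  unfolding tame_def
proof (intro conjI exI[of _ 1] exI[of _ "\<lambda>x. ennreal ((\<theta> x * h x) powr p)"] allI fin)
  fix x
  have a: "a \<le> 1 + a powr p" if "a \<ge> 0" for a :: real
  proof (cases "a \<le> 1")
    case False
    then have "a powr 1 \<le> a powr p" using p by (intro powr_mono) auto
    then show ?thesis using False by simp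
  qed (use powr_ge_zero[of a p] in linarith)
  have "ennreal (\<theta> x) * ennreal (h x) \<le> ennreal (1 + (\<theta> x * h x) powr p)"
    using a[of "\<theta> x * h x"] \<theta>_pos[of x] h[of x] by (simp add: ennreal_mult[symmetric] less_imp_le ennreal_leI del: ennreal_plus)
  then show "ennreal (\<theta> x) * ennreal (h x) \<le> 1 + ennreal ((\<theta> x * h x) powr p)"
    by (simp add: ennreal_1[symmetric] del: ennreal_1)
qed auto

end

section \<open>Generator and resolvent of a kernel semigroup\<close>

definition dirac :: "real \<Rightarrow> real measure" where
  "dirac h = distr (count_space (UNIV :: unit set)) borel (\<lambda>_. h)"

lemma nn_integral_dirac: "f \<in> borel_measurable borel \<Longrightarrow> (\<integral>\<^sup>+t. f t \<partial>dirac h) = f h"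
  unfolding dirac_def by (subst nn_integral_distr) (simp_all add: nn_integral_count_space_finite UNIV_unit)

lemma sigma_finite_dirac: "sigma_finite_measure (dirac h)"
  unfolding dirac_def
  using finite_measure.finite_measure_distr[OF finite_measure_count_space[of "UNIV :: unit set"], of "\<lambda>_. h" borel]
  by (auto simp: finite_measure_def)

lemma powr_add_le:
  fixes a b p :: real
  assumes "a \<ge> 0" "b \<ge> 0" "p \<ge> 0"
  shows "(a + b) powr p \<le> 2 powr p * (a powr p + b powr p)"
proof -
  have "(a + b) powr p \<le> (2 * max a b) powr p" using assms by (intro powr_mono2) auto
  also have "\<dots> = 2 powr p * max a b powr p" using assms by (simp add: powr_mult)
  also have "\<dots> \<le> 2 powr p * (a powr p + b powr p)" by (intro mult_left_mono) (auto simp: max_def)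
  finally show ?thesis .
qed

lemma tendsto_ennreal_mult_const:
  assumes "(c \<longlongrightarrow> 0) F" "g < (\<infinity> :: ennreal)"
  shows "((\<lambda>h. ennreal (c h) * g) \<longlongrightarrow> 0) F"
proof -
  obtain r where r: "g = ennreal r" "r \<ge> 0" using assms(2) by (cases g) auto
  have "((\<lambda>h. ennreal (c h * r)) \<longlongrightarrow> ennreal (0 * r)) F" by (intro tendsto_ennrealI tendsto_mult_right assms)
  then show ?thesis using r by (simp add: ennreal_mult'')
qed

lemma tendsto_ennreal_const_mult:
  assumes "(f \<longlongrightarrow> (0 :: ennreal)) F"
  shows "((\<lambda>h. ennreal K * f h) \<longlongrightarrow> 0) F"
  using ennreal_tendsto_cmult[of "ennreal K" f 0 F] assms by simp

text \<open>Without integrability the left side is 0 by the convention for the Bochner integral.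
  Pointwise majorants can thus be written down before finiteness is known.\<close>

lemma cmod_integral_le_nn:
  fixes f :: "'w \<Rightarrow> complex"
  shows "ennreal (cmod (LINT w|M. f w)) \<le> (\<integral>\<^sup>+w. ennreal (cmod (f w)) \<partial>M)"
  by (cases "integrable M f") (auto simp: integral_norm_bound_ennreal not_integrable_integral_eq)

context weighted_flow begin

lemma kernel_on_dirac: "(\<lambda>z. \<kappa> (fst z) (snd z)) \<in> borel_measurable (borel \<Otimes>\<^sub>M borel) \<Longrightarrow> kernel_on (dirac h) \<kappa>"
  by (auto simp: kernel_on_def sigma_finite_dirac) (auto simp: dirac_def)

lemma kernel_on_lborel: "(\<lambda>z. \<kappa> (fst z) (snd z)) \<in> borel_measurable (borel \<Otimes>\<^sub>M borel) \<Longrightarrow> kernel_on lborel \<kappa>"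
  by (auto simp: kernel_on_def intro: sigma_finite_lborel)

lemma kop_iterated:
  assumes N: "kernel_on N \<kappa>" and [measurable]: "f \<in> borel_measurable borel"
  shows "kop N \<kappa> f x = (\<integral>\<^sup>+t. \<integral>\<^sup>+y. \<kappa> t (x - y) * f (R t y) \<partial>lborel \<partial>N)"
proof -
  have [measurable_cong]: "sets N = sets borel" using N unfolding kernel_on_def by blast
  note [measurable (raw)] = kernel_measurable[OF N]
  show ?thesis unfolding kop_def by (subst lborel.nn_integral_fst[symmetric]) simp_all
qed

lemma kop_dirac:
  assumes N: "kernel_on (dirac h) \<kappa>" and [measurable]: "f \<in> borel_measurable borel"
  shows "kop (dirac h) \<kappa> f x = (\<integral>\<^sup>+y. \<kappa> h (x - y) * f (R h y) \<partial>lborel)"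
proof -
  note [measurable (raw)] = kernel_measurable[OF N]
  show ?thesis by (subst kop_iterated[OF N]) (simp_all add: nn_integral_dirac)
qed

text \<open>The p-th power of the weighted norm, extended-valued and without the root.
  \<open>Lpn_add\<close> is then a triangle inequality up to the constant 2^p, which is enough for
  limits equal to 0.\<close>

definition Lpn :: "real \<Rightarrow> ('a \<Rightarrow> complex) \<Rightarrow> ennreal" where
  "Lpn p f = (\<integral>\<^sup>+x. ennreal ((\<theta> x * cmod (f x)) powr p) \<partial>lborel)"

lemma Lpn_cong_AE: "AE x in lborel. f x = g x \<Longrightarrow> Lpn p f = Lpn p g"
  unfolding Lpn_def by (intro nn_integral_cong_AE) auto

lemma Lpn_cmult:
  assumes [measurable]: "f \<in> borel_measurable borel"
  shows "Lpn p (\<lambda>x. c * f x) = ennreal (cmod c powr p) * Lpn p f"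
  unfolding Lpn_def using \<theta>_pos
  by (subst nn_integral_cmult[symmetric]) (auto simp: norm_mult powr_mult less_imp_le mult_ac ennreal_mult[symmetric] intro!: nn_integral_cong)

lemma Lpn_add:
  assumes [measurable]: "f \<in> borel_measurable borel" "g \<in> borel_measurable borel" and p: "p \<ge> 1"
  shows "Lpn p (\<lambda>x. f x + g x) \<le> ennreal (2 powr p) * (Lpn p f + Lpn p g)"
proof -
  have "Lpn p (\<lambda>x. f x + g x) \<le> (\<integral>\<^sup>+x. ennreal (2 powr p) * (ennreal ((\<theta> x * cmod (f x)) powr p) + ennreal ((\<theta> x * cmod (g x)) powr p)) \<partial>lborel)"
    unfolding Lpn_def
  proof (rule nn_integral_mono)
    fix x
    have "(\<theta> x * cmod (f x + g x)) powr p \<le> (\<theta> x * cmod (f x) + \<theta> x * cmod (g x)) powr p"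
      using \<theta>_pos[of x] p by (intro powr_mono2) (auto simp: distrib_left[symmetric] less_imp_le norm_triangle_ineq intro!: mult_left_mono)
    also have "\<dots> \<le> 2 powr p * ((\<theta> x * cmod (f x)) powr p + (\<theta> x * cmod (g x)) powr p)"
      using \<theta>_pos[of x] p by (intro powr_add_le) (auto simp: less_imp_le)
    finally show "ennreal ((\<theta> x * cmod (f x + g x)) powr p)
        \<le> ennreal (2 powr p) * (ennreal ((\<theta> x * cmod (f x)) powr p) + ennreal ((\<theta> x * cmod (g x)) powr p))"
      by (simp add: ennreal_plus[symmetric] ennreal_mult[symmetric] ennreal_leI del: ennreal_plus)
  qed
  also have "\<dots> = ennreal (2 powr p) * (Lpn p f + Lpn p g)"
    unfolding Lpn_def by (subst nn_integral_cmult) (simp_all add: nn_integral_add)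
  finally show ?thesis .
qed

lemma Lpn_zero_AE:
  assumes [measurable]: "f \<in> borel_measurable borel" and p: "p \<ge> 1" and "Lpn p f = 0"
  shows "AE x in lborel. f x = 0"
proof -
  have "AE x in lborel. ennreal ((\<theta> x * cmod (f x)) powr p) = 0"
    using assms(3) unfolding Lpn_def by (subst (asm) nn_integral_0_iff_AE) simp_all
  then show ?thesis
  proof eventually_elim
    fix x assume "ennreal ((\<theta> x * cmod (f x)) powr p) = 0"
    then show "f x = 0" using \<theta>_pos[of x] by (auto simp: ennreal_eq_0_iff)
  qed
qed

lemma tame_of_Lpn:
  assumes [measurable]: "f \<in> borel_measurable borel" and p: "p \<ge> 1" and "Lpn p f < \<infinity>"
  shows "tame (\<lambda>x. ennreal (cmod (f x)))"
  using assms(3) by (intro tame_of_Lp[OF _ _ p]) (simp_all add: Lpn_def)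

end

text \<open>\<open>k_mass\<close> bounds each single operator and \<open>res_mass\<close> the
  Laplace transform on the weighted space; together they keep all compositions in the class
  \<open>tame\<close>. The invariance \<open>k_R\<close> lets rotations commute with the
  convolutions, so that \<open>k_semigroup\<close> becomes a semigroup law for operators.\<close>

locale kernel_semigroup = weighted_flow R \<theta> C \<eta>
  for R :: "real \<Rightarrow> 'a::euclidean_space \<Rightarrow> 'a" and \<theta> C \<eta> +
  fixes k :: "real \<Rightarrow> 'a \<Rightarrow> complex" and z :: complex
  assumes k_borel: "(\<lambda>w. k (fst w) (snd w)) \<in> borel_measurable (borel \<Otimes>\<^sub>M borel)"
    and k_R: "k t (R s x) = k t x"
    and k_semigroup: "s > 0 \<Longrightarrow> t > 0 \<Longrightarrow> (LINT y|lborel. k s (x - y) * k t (y - w)) = k (s + t) (x - w)"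
    and k_mass: "t > 0 \<Longrightarrow> (\<integral>\<^sup>+x. ennreal (cmod (k t x)) * ennreal (exp (\<eta> * norm x)) \<partial>lborel) < \<infinity>"
    and res_mass: "(\<integral>\<^sup>+t. \<integral>\<^sup>+x. ennreal (cmod (if t > 0 then exp (- z * of_real t) * k t x else 0)) *
       ennreal (exp (\<eta> * norm x)) \<partial>lborel \<partial>lborel) < \<infinity>"
begin

lemma k_measurable [measurable (raw)]:
  assumes [measurable]: "f \<in> borel_measurable M" "g \<in> borel_measurable M"
  shows "(\<lambda>w. k (f w) (g w)) \<in> borel_measurable M"
  using measurable_compose[OF measurable_Pair[OF assms] k_borel] by simp

definition rk :: "real \<Rightarrow> 'a \<Rightarrow> complex" where
  "rk t x = (if t > 0 then exp (- z * of_real t) * k t x else 0)"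

lemma rk_measurable [measurable (raw)]:
  assumes [measurable]: "f \<in> borel_measurable M" "g \<in> borel_measurable M"
  shows "(\<lambda>w. rk (f w) (g w)) \<in> borel_measurable M"
  unfolding rk_def by measurable

definition T :: "real \<Rightarrow> ('a \<Rightarrow> complex) \<Rightarrow> 'a \<Rightarrow> complex" where
  "T t u x = (LINT y|lborel. k t (x - y) * u (R t y))"

text \<open>The Laplace transform of the semigroup as a single integral over space-time. Its
  absolute convergence at \<open>x\<close> is the one condition
  \<open>absr u x < \<infinity>\<close>, from which the iterated form in \<open>res_iterated\<close>
  follows.\<close>

definition res :: "('a \<Rightarrow> complex) \<Rightarrow> 'a \<Rightarrow> complex" where
  "res u x = (LINT w|(lborel \<Otimes>\<^sub>M lborel). rk (fst w) (x - snd w) * u (R (fst w) (snd w)))"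

lemma T_measurable [measurable (raw)]:
  assumes [measurable]: "u \<in> borel_measurable borel" "f \<in> borel_measurable M" "g \<in> borel_measurable M"
  shows "(\<lambda>w. T (f w) u (g w)) \<in> borel_measurable M"
  unfolding T_def by measurable

lemma res_measurable [measurable]:
  assumes [measurable]: "u \<in> borel_measurable borel"
  shows "res u \<in> borel_measurable borel"
  unfolding res_def by measurable

abbreviation \<kappa>k :: "real \<Rightarrow> 'a \<Rightarrow> ennreal" where "\<kappa>k \<equiv> \<lambda>t x. ennreal (cmod (k t x))"
abbreviation \<kappa>r :: "real \<Rightarrow> 'a \<Rightarrow> ennreal" where "\<kappa>r \<equiv> \<lambda>t x. ennreal (cmod (rk t x))"

lemma kernel_k: "kernel_on (dirac h) \<kappa>k" by (rule kernel_on_dirac) measurable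
lemma kernel_r: "kernel_on lborel \<kappa>r" by (rule kernel_on_lborel) measurable

lemma exp_mass_k: "t > 0 \<Longrightarrow> exp_mass (dirac t) \<kappa>k \<eta> < \<infinity>"
  unfolding exp_mass_def using k_mass[of t] by (subst nn_integral_dirac) simp_all

lemma exp_mass_r: "exp_mass lborel \<kappa>r \<eta> < \<infinity>"
  unfolding exp_mass_def rk_def by (rule res_mass)

abbreviation absk :: "real \<Rightarrow> ('a \<Rightarrow> complex) \<Rightarrow> 'a \<Rightarrow> ennreal" where "absk h u \<equiv> kop (dirac h) \<kappa>k (\<lambda>x. ennreal (cmod (u x)))"
abbreviation absr :: "('a \<Rightarrow> complex) \<Rightarrow> 'a \<Rightarrow> ennreal" where "absr u \<equiv> kop lborel \<kappa>r (\<lambda>x. ennreal (cmod (u x)))"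

lemma absk_eq:
  assumes [measurable]: "u \<in> borel_measurable borel"
  shows "absk h u x = (\<integral>\<^sup>+y. ennreal (cmod (k h (x - y) * u (R h y))) \<partial>lborel)"
  by (subst kop_dirac[OF kernel_k]) (simp_all add: norm_mult ennreal_mult)

lemma absr_eq: "absr u x = (\<integral>\<^sup>+w. ennreal (cmod (rk (fst w) (x - snd w) * u (R (fst w) (snd w)))) \<partial>(lborel \<Otimes>\<^sub>M lborel))"
  by (simp add: kop_def norm_mult ennreal_mult)

lemma T_integrable:
  assumes [measurable]: "u \<in> borel_measurable borel" and "absk h u x < \<infinity>"
  shows "integrable lborel (\<lambda>y. k h (x - y) * u (R h y))"
  using assms(2) by (intro integrableI_bounded) (simp_all add: absk_eq)

lemma res_integrable:
  assumes [measurable]: "u \<in> borel_measurable borel" and "absr u x < \<infinity>"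
  shows "integrable (lborel \<Otimes>\<^sub>M lborel) (\<lambda>w. rk (fst w) (x - snd w) * u (R (fst w) (snd w)))"
  using assms(2) by (intro integrableI_bounded) (simp_all add: absr_eq)

lemma cmod_T_le:
  assumes "u \<in> borel_measurable borel"
  shows "ennreal (cmod (T h u x)) \<le> absk h u x"
  unfolding T_def absk_eq[OF assms] by (rule cmod_integral_le_nn)

lemma cmod_res_le: "ennreal (cmod (res u x)) \<le> absr u x"
  unfolding res_def absr_eq by (rule cmod_integral_le_nn)

lemma k_R_diff: "k h (R t y - R t w) = k h (y - w)"
  by (simp add: R_diff[symmetric] k_R)

text \<open>The semigroup law at a point where the moduli converge. Replacing the inner variable by
  R t w and using the rotation invariance of \<open>k\<close> turns the composition into a
  convolution with the argument R (t + h) w, to which \<open>k_semigroup\<close> applies.\<close>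

lemma T_T:
  assumes [measurable]: "u \<in> borel_measurable borel" and t: "t > 0" and h: "h > 0"
    and fin: "(\<integral>\<^sup>+y. \<kappa>k t (x - y) * absk h u (R t y) \<partial>lborel) < \<infinity>"
  shows "(LINT y|lborel. k t (x - y) * T h u (R t y)) = T (t + h) u x"
proof -
  have inner: "k t (x - y) * T h u (R t y) = (LINT w|lborel. k t (x - y) * (k h (y - w) * u (R (t + h) w)))" for y
  proof -
    have "T h u (R t y) = (LINT w|lborel. k h (R t y - R t w) * u (R h (R t w)))"
      unfolding T_def by (rule integral_R[symmetric]) measurable
    then show ?thesis by (simp add: k_R_diff R_add[symmetric] add.commute)
  qed
  have innerA: "absk h u (R t y) = (\<integral>\<^sup>+w. ennreal (cmod (k h (y - w) * u (R (t + h) w))) \<partial>lborel)" for y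
  proof -
    have "absk h u (R t y) = (\<integral>\<^sup>+w. ennreal (cmod (k h (R t y - R t w) * u (R h (R t w)))) \<partial>lborel)"
      unfolding absk_eq[OF assms(1)] by (rule nn_integral_R[symmetric]) measurable
    then show ?thesis by (simp add: k_R_diff R_add[symmetric] add.commute)
  qed
  let ?G = "\<lambda>y w. k t (x - y) * (k h (y - w) * u (R (t + h) w))"
  have int: "integrable (lborel \<Otimes>\<^sub>M lborel) (\<lambda>(y, w). ?G y w)"
  proof (rule integrableI_bounded)
    have "(\<integral>\<^sup>+v. ennreal (cmod (case v of (y, w) \<Rightarrow> ?G y w)) \<partial>(lborel \<Otimes>\<^sub>M lborel))
        = (\<integral>\<^sup>+y. \<integral>\<^sup>+w. \<kappa>k t (x - y) * ennreal (cmod (k h (y - w) * u (R (t + h) w))) \<partial>lborel \<partial>lborel)"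
      by (subst lborel.nn_integral_fst[symmetric]) (simp_all add: norm_mult ennreal_mult)
    also have "\<dots> = (\<integral>\<^sup>+y. \<kappa>k t (x - y) * absk h u (R t y) \<partial>lborel)"
      by (intro nn_integral_cong) (subst nn_integral_cmult, simp_all add: innerA)
    finally show "(\<integral>\<^sup>+v. ennreal (cmod (case v of (y, w) \<Rightarrow> ?G y w)) \<partial>(lborel \<Otimes>\<^sub>M lborel)) < \<infinity>"
      using fin by simp
  qed measurable
  have "(LINT y|lborel. k t (x - y) * T h u (R t y)) = (LINT y|lborel. LINT w|lborel. ?G y w)"
    by (simp only: inner)
  also have "\<dots> = (LINT w|lborel. LINT y|lborel. ?G y w)"
    by (rule lborel_pair.Fubini_integral[symmetric]) (rule int)
  also have "\<dots> = (LINT w|lborel. k (t + h) (x - w) * u (R (t + h) w))"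
  proof (rule Bochner_Integration.integral_cong)
    fix w
    have "(LINT y|lborel. ?G y w) = (LINT y|lborel. (k t (x - y) * k h (y - w)) * u (R (t + h) w))"
      by (simp add: mult.assoc)
    then show "(LINT y|lborel. ?G y w) = k (t + h) (x - w) * u (R (t + h) w)"
      by (simp add: k_semigroup[OF t h])
  qed simp
  finally show ?thesis by (simp add: T_def)
qed

definition resI :: "real \<Rightarrow> ('a \<Rightarrow> complex) \<Rightarrow> 'a \<Rightarrow> complex" where
  "resI h u x = (LINT t|lborel. (if 0 < t \<and> t \<le> h then exp (- z * of_real t) * T t u x else 0))"

lemma resI_measurable [measurable]:
  assumes [measurable]: "u \<in> borel_measurable borel"
  shows "resI h u \<in> borel_measurable borel"
  unfolding resI_def by measurable

lemma
  assumes [measurable]: "u \<in> borel_measurable borel" and fin: "absr u x < \<infinity>"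
  shows res_iterated: "res u x = (LINT t|lborel. (if 0 < t then exp (- z * of_real t) * T t u x else 0))"
    and res_iterated_integrable: "integrable lborel (\<lambda>t. if 0 < t then exp (- z * of_real t) * T t u x else 0)"
proof -
  have eq: "(LINT y|lborel. rk t (x - y) * u (R t y)) = (if 0 < t then exp (- z * of_real t) * T t u x else 0)" for t
    by (simp add: rk_def T_def mult.assoc)
  note int = res_integrable[OF assms]
  show "res u x = (LINT t|lborel. (if 0 < t then exp (- z * of_real t) * T t u x else 0))"
    unfolding res_def using lborel_pair.integral_fst'[OF int] by (simp add: eq)
  show "integrable lborel (\<lambda>t. if 0 < t then exp (- z * of_real t) * T t u x else 0)"
    using lborel_pair.integrable_fst'[OF int] by (simp add: eq)
qed

text \<open>One has exp (- zt) T t (T h u) = exp (zh) exp (- z(t + h)) T (t + h) u, and the shift of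
  time removes the part over (0, h], which is \<open>resI\<close>. The second finiteness assumption
  provides the semigroup law at \<open>x\<close> for almost every \<open>t\<close>.\<close>

lemma res_T:
  assumes [measurable]: "u \<in> borel_measurable borel" and h: "h > 0"
    and fin: "absr u x < \<infinity>" "kop lborel \<kappa>r (absk h u) x < \<infinity>"
  shows "res (T h u) x = exp (z * of_real h) * (res u x - resI h u x)"
proof -
  have [measurable]: "absk h u \<in> borel_measurable borel" by (rule kop_measurable[OF kernel_k]) simp
  have "absr (T h u) x \<le> kop lborel \<kappa>r (absk h u) x"
    unfolding kop_def by (intro nn_integral_mono mult_left_mono) (use cmod_T_le[OF assms(1)] in \<open>auto simp: kop_def\<close>)
  then have finT: "absr (T h u) x < \<infinity>" using fin(2) by (rule order_le_less_trans)
  have "(\<integral>\<^sup>+t. \<integral>\<^sup>+y. \<kappa>r t (x - y) * absk h u (R t y) \<partial>lborel \<partial>lborel) < \<infinity>"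
    using fin(2) by (subst (asm) kop_iterated[OF kernel_r]) simp_all
  then have "AE t in lborel. (\<integral>\<^sup>+y. \<kappa>r t (x - y) * absk h u (R t y) \<partial>lborel) \<noteq> \<infinity>"
    by (intro nn_integral_noteq_infinite) auto
  then have AE: "AE t in lborel. (if 0 < t then exp (- z * of_real t) * T t (T h u) x else 0)
      = (if 0 < t then exp (- z * of_real t) * T (t + h) u x else 0)"
  proof eventually_elim
    fix t assume t: "(\<integral>\<^sup>+y. \<kappa>r t (x - y) * absk h u (R t y) \<partial>lborel) \<noteq> \<infinity>"
    show "(if 0 < t then exp (- z * of_real t) * T t (T h u) x else 0)
      = (if 0 < t then exp (- z * of_real t) * T (t + h) u x else 0)"
    proof (cases "0 < t")
      case True
      have "(\<integral>\<^sup>+y. \<kappa>r t (x - y) * absk h u (R t y) \<partial>lborel)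
         = ennreal (cmod (exp (- z * of_real t))) * (\<integral>\<^sup>+y. \<kappa>k t (x - y) * absk h u (R t y) \<partial>lborel)"
        using True by (subst nn_integral_cmult[symmetric]) (simp_all add: rk_def norm_mult ennreal_mult mult.assoc)
      with t have "(\<integral>\<^sup>+y. \<kappa>k t (x - y) * absk h u (R t y) \<partial>lborel) < \<infinity>"
        by (auto simp: ennreal_mult_eq_top_iff less_top)
      from T_T[OF assms(1) True h this] True show ?thesis by (simp add: T_def)
    qed simp
  qed
  have "res (T h u) x = (LINT t|lborel. (if 0 < t then exp (- z * of_real t) * T (t + h) u x else 0))"
    unfolding res_iterated[OF _ finT, simplified] by (rule integral_cong_AE) (simp_all add: AE)
  also have "\<dots> = (LINT t|lborel. (\<lambda>s. if h < s then exp (- z * of_real (s - h)) * T s u x else 0) (t - (- h)))"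
    by (intro Bochner_Integration.integral_cong) auto
  also have "\<dots> = (LINT s|lborel. (if h < s then exp (- z * of_real (s - h)) * T s u x else 0))"
    by (rule integral_translate) measurable
  also have "\<dots> = (LINT s|lborel. exp (z * of_real h) * (if h < s then exp (- z * of_real s) * T s u x else 0))"
    by (intro Bochner_Integration.integral_cong) (auto simp: algebra_simps simp flip: exp_add)
  also have "\<dots> = exp (z * of_real h) * (LINT s|lborel. (if h < s then exp (- z * of_real s) * T s u x else 0))"
    by (rule integral_mult_right_zero)
  also have "(LINT s|lborel. (if h < s then exp (- z * of_real s) * T s u x else 0)) = res u x - resI h u x"
  proof -
    let ?f = "\<lambda>t. if 0 < t then exp (- z * of_real t) * T t u x else 0"
    note int = res_iterated_integrable[OF assms(1) fin(1)]
    have "integrable lborel (\<lambda>t. indicator {..h} t *\<^sub>R ?f t)" "integrable lborel (\<lambda>t. indicator {h<..} t *\<^sub>R ?f t)"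
      by (intro int integrable_mult_indicator; simp)+
    then have "(LINT t|lborel. indicator {..h} t *\<^sub>R ?f t + indicator {h<..} t *\<^sub>R ?f t)
      = (LINT t|lborel. indicator {..h} t *\<^sub>R ?f t) + (LINT t|lborel. indicator {h<..} t *\<^sub>R ?f t)"
      by (rule Bochner_Integration.integral_add)
    moreover have "indicator {..h} t *\<^sub>R ?f t + indicator {h<..} t *\<^sub>R ?f t = ?f t" for t
      by (auto simp: indicator_def)
    moreover have "(LINT t|lborel. indicator {..h} t *\<^sub>R ?f t) = resI h u x"
      unfolding resI_def by (intro Bochner_Integration.integral_cong) (auto simp: indicator_def)
    moreover have "(LINT t|lborel. indicator {h<..} t *\<^sub>R ?f t) = (LINT s|lborel. (if h < s then exp (- z * of_real s) * T s u x else 0))"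
      using h by (intro Bochner_Integration.integral_cong) (auto simp: indicator_def)
    ultimately show ?thesis by (simp add: res_iterated[OF assms(1) fin(1)])
  qed
  finally show ?thesis .
qed

text \<open>Boundedness of \<open>res\<close> on the weighted space; it allows \<open>res\<close> to
  be applied to a convergent family of difference quotients.\<close>

lemma res_Lpn_le:
  assumes p: "p \<ge> 1"
  obtains K where "K \<ge> 0" "\<And>u. u \<in> borel_measurable borel \<Longrightarrow> Lpn p (res u) \<le> ennreal K * Lpn p u"
proof -
  obtain m where m: "m > 0" "exp_mass lborel \<kappa>r \<eta> \<le> ennreal m"
  proof -
    obtain r where "exp_mass lborel \<kappa>r \<eta> = ennreal r" "r \<ge> 0" using exp_mass_r by (cases "exp_mass lborel \<kappa>r \<eta>") auto
    then show thesis by (intro that[of "r + 1"]) (auto intro!: ennreal_leI)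
  qed
  show thesis
  proof (rule that[of "(C * m) powr p"])
    fix u :: "'a \<Rightarrow> complex" assume [measurable]: "u \<in> borel_measurable borel"
    show "Lpn p (res u) \<le> ennreal ((C * m) powr p) * Lpn p u"
      unfolding Lpn_def by (rule kop_Lp_bound[OF kernel_r _ _ p m]) (simp_all add: cmod_res_le)
  qed simp
qed

text \<open>\<open>resI h u / h\<close> is the average of exp (- zt) T t u over (0, h]. Jensen's
  inequality for the uniform distribution on this interval, followed by Tonelli, bounds its distance
  to \<open>u\<close> by the worst time.\<close>

lemma resI_average_Lpn:
  assumes [measurable]: "u \<in> borel_measurable borel" and p: "p \<ge> 1" and h: "h > 0"
    and fin: "AE x in lborel. absr u x < \<infinity>"
    and e: "\<And>t. 0 < t \<Longrightarrow> t \<le> h \<Longrightarrow> Lpn p (\<lambda>x. exp (- z * of_real t) * T t u x - u x) \<le> e"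
  shows "Lpn p (\<lambda>x. resI h u x / of_real h - u x) \<le> e"
proof -
  let ?f = "\<lambda>t x. exp (- z * of_real t) * T t u x - u x"
  let ?w = "\<lambda>t. ennreal (1 / h) * indicator {0<..h} t"
  have mass: "(\<integral>\<^sup>+t. ?w t \<partial>lborel) = 1"
    using h by (simp add: nn_integral_cmult ennreal_mult[symmetric])
  have pt: "AE x in lborel. ennreal ((\<theta> x * cmod (resI h u x / of_real h - u x)) powr p)
      \<le> (\<integral>\<^sup>+t. ?w t * ennreal ((\<theta> x * cmod (?f t x)) powr p) \<partial>lborel)"
    using fin
  proof eventually_elim
    fix x assume fin: "absr u x < \<infinity>"
    let ?g = "\<lambda>t. (if 0 < t \<and> t \<le> h then exp (- z * of_real t) * T t u x else 0)"
    have "integrable lborel (\<lambda>t. indicator {..h} t *\<^sub>R (if 0 < t then exp (- z * of_real t) * T t u x else 0))"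
      by (intro integrable_mult_indicator res_iterated_integrable assms(1) fin) simp
    also have "(\<lambda>t. indicator {..h} t *\<^sub>R (if 0 < t then exp (- z * of_real t) * T t u x else 0)) = ?g"
      by (auto simp: indicator_def)
    finally have int: "integrable lborel ?g" .
    have int2: "integrable lborel (\<lambda>t. indicator {0<..h} t *\<^sub>R u x)"
      using h by simp
    have "resI h u x - of_real h * u x = (LINT t|lborel. ?g t) - (LINT t|lborel. indicator {0<..h} t *\<^sub>R u x)"
      using h by (simp add: resI_def scaleR_conv_of_real)
    also have "\<dots> = (LINT t|lborel. ?g t - indicator {0<..h} t *\<^sub>R u x)"
      by (rule Bochner_Integration.integral_diff[symmetric, OF int int2])
    also have "\<dots> = (LINT t|lborel. indicator {0<..h} t *\<^sub>R ?f t x)"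
      by (intro Bochner_Integration.integral_cong) (auto simp: indicator_def)
    finally have eq: "resI h u x / of_real h - u x = (LINT t|lborel. indicator {0<..h} t *\<^sub>R ?f t x) / of_real h"
      using h by (simp add: field_simps)
    have "ennreal (\<theta> x * cmod (resI h u x / of_real h - u x))
        = ennreal (\<theta> x / h) * ennreal (cmod (LINT t|lborel. indicator {0<..h} t *\<^sub>R ?f t x))"
      unfolding eq using h \<theta>_pos[of x] by (simp add: norm_divide ennreal_mult[symmetric] less_imp_le)
    also have "\<dots> \<le> ennreal (\<theta> x / h) * (\<integral>\<^sup>+t. ennreal (cmod (indicator {0<..h} t *\<^sub>R ?f t x)) \<partial>lborel)"
      by (intro mult_left_mono cmod_integral_le_nn) simp
    also have "\<dots> = (\<integral>\<^sup>+t. ennreal (\<theta> x / h) * ennreal (cmod (indicator {0<..h} t *\<^sub>R ?f t x)) \<partial>lborel)"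
      by (rule nn_integral_cmult[symmetric]) measurable
    also have "\<dots> = (\<integral>\<^sup>+t. ?w t * ennreal (\<theta> x * cmod (?f t x)) \<partial>lborel)"
      using h \<theta>_pos[of x] by (intro nn_integral_cong) (auto simp: indicator_def ennreal_mult[symmetric] less_imp_le)
    finally have "ennreal (\<theta> x * cmod (resI h u x / of_real h - u x)) \<le> (\<integral>\<^sup>+t. ?w t * ennreal (\<theta> x * cmod (?f t x)) \<partial>lborel)" .
    then have "ennreal ((\<theta> x * cmod (resI h u x / of_real h - u x)) powr p)
      \<le> ennreal (1 powr (p - 1)) * (\<integral>\<^sup>+t. ?w t * ennreal ((\<theta> x * cmod (?f t x)) powr p) \<partial>lborel)"
      by (intro Jensen_powr_nn_integral p) (use \<theta>_pos[of x] mass in \<open>auto simp: less_imp_le\<close>)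
    then show "ennreal ((\<theta> x * cmod (resI h u x / of_real h - u x)) powr p)
      \<le> (\<integral>\<^sup>+t. ?w t * ennreal ((\<theta> x * cmod (?f t x)) powr p) \<partial>lborel)" by simp
  qed
  have "Lpn p (\<lambda>x. resI h u x / of_real h - u x) \<le> (\<integral>\<^sup>+x. \<integral>\<^sup>+t. ?w t * ennreal ((\<theta> x * cmod (?f t x)) powr p) \<partial>lborel \<partial>lborel)"
    unfolding Lpn_def by (rule nn_integral_mono_AE) (rule pt)
  also have "\<dots> = (\<integral>\<^sup>+t. \<integral>\<^sup>+x. ?w t * ennreal ((\<theta> x * cmod (?f t x)) powr p) \<partial>lborel \<partial>lborel)"
    by (rule lborel_pair.Fubini') measurable
  also have "\<dots> = (\<integral>\<^sup>+t. ?w t * Lpn p (?f t) \<partial>lborel)"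
    unfolding Lpn_def by (intro nn_integral_cong nn_integral_cmult) measurable
  also have "\<dots> \<le> (\<integral>\<^sup>+t. e * ?w t \<partial>lborel)"
    by (intro nn_integral_mono) (auto simp: indicator_def mult.commute[of e] intro!: mult_left_mono e[simplified])
  also have "\<dots> = e" by (subst nn_integral_cmult) (simp_all add: mass)
  finally show ?thesis .
qed

text \<open>
  The limit hypothesis forces \<open>T h u \<rightarrow> u\<close>, hence \<open>resI h u / h \<rightarrow> u\<close>; apply \<open>res\<close> to the
  difference quotient, use \<open>res_T\<close> and let \<open>h\<close> tend to \<open>0\<close>.  Strong continuity of the semigroup is not
  needed.
\<close>

lemma generator_imp_res:
  assumes [measurable]: "u \<in> borel_measurable borel" "w \<in> borel_measurable borel" and p: "p \<ge> 1"
    and u: "Lpn p u < \<infinity>" and w: "Lpn p w < \<infinity>"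
    and lim: "((\<lambda>h. Lpn p (\<lambda>x. (T h u x - u x) / of_real h - w x)) \<longlongrightarrow> 0) (at_right 0)"
  shows "AE x in lborel. u x = res (\<lambda>x. z * u x - w x) x"
proof -
  define D where "D h x = (T h u x - u x) / of_real h" for h x
  have [measurable]: "D h \<in> borel_measurable borel" for h unfolding D_def by measurable
  \<comment> \<open>The defect that has to vanish. It does not depend on \<open>h\<close>, so a
    bound that tends to 0 with \<open>h\<close> suffices.\<close>
  define X where "X x = z * res u x - res w x - u x" for x
  have [measurable]: "X \<in> borel_measurable borel" unfolding X_def by measurable
  define E where "E h = exp (z * of_real h)" for h :: real
  have tu: "tame (\<lambda>x. ennreal (cmod (u x)))" and tw: "tame (\<lambda>x. ennreal (cmod (w x)))"
    using u w by (simp_all add: tame_of_Lpn[OF _ p])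
  have fu: "AE x in lborel. absr u x < \<infinity>" and fw: "AE x in lborel. absr w x < \<infinity>"
    by (intro tame_AE_finite tame_kop tu tw kernel_r exp_mass_r)+
  obtain K where K: "K \<ge> 0" "\<And>u. u \<in> borel_measurable borel \<Longrightarrow> Lpn p (res u) \<le> ennreal K * Lpn p u"
    using res_Lpn_le[OF p] by blast
  have ru: "Lpn p (res u) < \<infinity>" using K(2)[of u] u by (simp add: ennreal_mult_less_top order_le_less_trans[of _ "ennreal K * Lpn p u"])
  have L0: "((\<lambda>h. Lpn p (\<lambda>x. D h x - w x)) \<longlongrightarrow> 0) (at_right 0)" using lim by (simp add: D_def)
  have pos: "eventually (\<lambda>h::real. h > 0) (at_right 0)" by (simp add: eventually_at_right_less)

  \<comment> \<open>Inserting \<open>res_T\<close> into \<open>res (D h - w)\<close> splits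
    \<open>X\<close> into four errors: \<open>A\<close> for the difference quotient of the
    semigroup, \<open>B\<close> for (exp (zh) - 1)/h against z, \<open>G\<close> for the average
    \<open>resI h u / h\<close> against \<open>u\<close>, and \<open>H\<close> for the factor exp
    (zh) against 1.\<close>
  define A where "A h = Lpn p (\<lambda>x. res (\<lambda>x. D h x - w x) x)" for h
  define B where "B h = Lpn p (\<lambda>x. (z - (E h - 1) / of_real h) * res u x)" for h
  define G where "G h = Lpn p (\<lambda>x. E h * (resI h u x / of_real h - u x))" for h
  define H where "H h = Lpn p (\<lambda>x. (E h - 1) * u x)" for h
  have Eder: "((\<lambda>h. (E h - 1) / of_real h) \<longlongrightarrow> z) (at_right 0)"
  proof -
    have "((\<lambda>w. exp (z * w)) has_field_derivative z) (at 0)"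
      by (auto intro!: derivative_eq_intros)
    then have "((\<lambda>w. (exp (z * w) - 1) / w) \<longlongrightarrow> z) (at 0)"
      by (simp add: has_field_derivative_iff)
    moreover have "filterlim complex_of_real (at 0) (at_right 0)"
      using pos by (intro filterlim_atI) (auto intro!: tendsto_eq_intros elim!: eventually_mono)
    ultimately show ?thesis unfolding E_def by (rule filterlim_compose)
  qed
  have E0: "((\<lambda>h. E h) \<longlongrightarrow> 1) (at_right 0)"
    unfolding E_def by (rule tendsto_eq_intros refl | simp)+
  have A0: "(A \<longlongrightarrow> 0) (at_right 0)"
    by (rule tendsto_sandwich[OF _ _ tendsto_const tendsto_ennreal_const_mult[OF L0, of K]])
      (auto simp: A_def intro!: always_eventually K(2))
  have B0: "(B \<longlongrightarrow> 0) (at_right 0)"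
  proof -
    have "((\<lambda>h. cmod (z - (E h - 1) / of_real h) powr p) \<longlongrightarrow> cmod (z - z) powr p) (at_right 0)"
      using p by (intro tendsto_powr' tendsto_norm tendsto_diff tendsto_const Eder) auto
    then show ?thesis unfolding B_def using ru p
      by (subst Lpn_cmult) (auto intro!: tendsto_ennreal_mult_const)
  qed
  have H0: "(H \<longlongrightarrow> 0) (at_right 0)"
  proof -
    have "((\<lambda>h. cmod (E h - 1) powr p) \<longlongrightarrow> cmod (1 - 1) powr p) (at_right 0)"
      using p by (intro tendsto_powr' tendsto_norm tendsto_diff tendsto_const E0) auto
    then show ?thesis unfolding H_def using u p
      by (subst Lpn_cmult) (auto intro!: tendsto_ennreal_mult_const)
  qed
  \<comment> \<open>From T t u - u = t (D t - w) + t w, convergence of the difference quotients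
    forces T t u to tend to \<open>u\<close>; the factor exp (- zt) adds a multiple of
    \<open>u\<close>.\<close>
  have V0: "((\<lambda>t. Lpn p (\<lambda>x. exp (- z * of_real t) * T t u x - u x)) \<longlongrightarrow> 0) (at_right 0)"
  proof -
    define e where "e t = exp (- z * of_real t)" for t :: real
    have e0: "(e \<longlongrightarrow> 1) (at_right 0)" unfolding e_def by (rule tendsto_eq_intros refl | simp)+
    define b1 where "b1 t = ennreal (cmod (e t * of_real t) powr p) * Lpn p (\<lambda>x. D t x - w x)" for t
    define b2 where "b2 t = ennreal (cmod (e t * of_real t) powr p) * Lpn p w" for t
    define b3 where "b3 t = ennreal (cmod (e t - 1) powr p) * Lpn p u" for t
    let ?q = "ennreal (2 powr p)"
    have bd: "Lpn p (\<lambda>x. e t * T t u x - u x) \<le> ?q * (?q * (b1 t + b2 t) + b3 t)" if "t > 0" for t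
    proof -
      have "(\<lambda>x. e t * T t u x - u x) = (\<lambda>x. (e t * of_real t * (D t x - w x) + e t * of_real t * w x) + (e t - 1) * u x)"
        using that by (auto simp: D_def field_simps)
      then have "Lpn p (\<lambda>x. e t * T t u x - u x) = Lpn p (\<lambda>x. (e t * of_real t * (D t x - w x) + e t * of_real t * w x) + (e t - 1) * u x)"
        by (rule arg_cong)
      also have "Lpn p (\<lambda>x. (e t * of_real t * (D t x - w x) + e t * of_real t * w x) + (e t - 1) * u x)
         \<le> ?q * (Lpn p (\<lambda>x. e t * of_real t * (D t x - w x) + e t * of_real t * w x) + Lpn p (\<lambda>x. (e t - 1) * u x))"
        by (rule Lpn_add[OF _ _ p]) measurable
      also have "\<dots> \<le> ?q * (?q * (Lpn p (\<lambda>x. e t * of_real t * (D t x - w x)) + Lpn p (\<lambda>x. e t * of_real t * w x)) + Lpn p (\<lambda>x. (e t - 1) * u x))"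
        by (intro mult_left_mono add_right_mono Lpn_add[OF _ _ p]) simp_all
      also have "\<dots> = ?q * (?q * (b1 t + b2 t) + b3 t)"
        unfolding b1_def b2_def b3_def
        using Lpn_cmult[of "\<lambda>x. D t x - w x" p "e t * of_real t"] Lpn_cmult[of w p "e t * of_real t"]
          Lpn_cmult[of u p "e t - 1"] by simp
      finally show ?thesis .
    qed
    have et: "((\<lambda>t. cmod (e t * of_real t) powr p) \<longlongrightarrow> cmod (1 * of_real 0) powr p) (at_right 0)"
      using p by (intro tendsto_powr' tendsto_norm tendsto_mult e0 tendsto_of_real tendsto_ident_at tendsto_const) auto
    have b2: "(b2 \<longlongrightarrow> 0) (at_right 0)" unfolding b2_def using et p w by (intro tendsto_ennreal_mult_const) auto
    have "((\<lambda>t. cmod (e t - 1) powr p) \<longlongrightarrow> cmod (1 - 1) powr p) (at_right 0)"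
      using p by (intro tendsto_powr' tendsto_norm tendsto_diff tendsto_const e0) auto
    then have b3: "(b3 \<longlongrightarrow> 0) (at_right 0)" unfolding b3_def using p u by (intro tendsto_ennreal_mult_const) auto
    have b1: "(b1 \<longlongrightarrow> 0) (at_right 0)"
    proof (rule tendsto_sandwich[OF _ _ tendsto_const L0])
      have "eventually (\<lambda>t. cmod (e t * of_real t) powr p < 1) (at_right 0)"
        using order_tendstoD(2)[OF et, of 1] p by simp
      then show "eventually (\<lambda>t. b1 t \<le> Lpn p (\<lambda>x. D t x - w x)) (at_right 0)"
      proof eventually_elim
        fix t assume "cmod (e t * of_real t) powr p < 1"
        then have "ennreal (cmod (e t * of_real t) powr p) \<le> 1" by (simp add: ennreal_le_1 less_imp_le)
        then have "b1 t \<le> 1 * Lpn p (\<lambda>x. D t x - w x)" unfolding b1_def by (rule mult_right_mono) simp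
        then show "b1 t \<le> Lpn p (\<lambda>x. D t x - w x)" by simp
      qed
    qed simp
    have "((\<lambda>t. ?q * (?q * (b1 t + b2 t) + b3 t)) \<longlongrightarrow> 0) (at_right 0)"
      by (intro tendsto_ennreal_const_mult tendsto_add_zero b1 b2 b3)
    then show ?thesis
      by (rule tendsto_sandwich[OF _ _ tendsto_const, rotated 2])
        (use pos bd in \<open>auto simp: e_def elim!: eventually_mono\<close>)
  qed
  have G1: "((\<lambda>h. Lpn p (\<lambda>x. resI h u x / of_real h - u x)) \<longlongrightarrow> 0) (at_right 0)"
  proof (rule order_tendstoI)
    fix e :: ennreal assume "0 < e"
    \<comment> \<open>\<open>resI_average_Lpn\<close> yields a non-strict bound, hence the room
      between \<open>e'\<close> and \<open>e\<close>.\<close>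
    then obtain e' where e': "0 < e'" "e' < e" using dense by blast
    have "eventually (\<lambda>t. Lpn p (\<lambda>x. exp (- z * of_real t) * T t u x - u x) < e') (at_right 0)"
      by (rule order_tendstoD(2)[OF V0 e'(1)])
    then obtain b where b: "b > 0" "\<And>t. 0 < t \<Longrightarrow> t < b \<Longrightarrow> Lpn p (\<lambda>x. exp (- z * of_real t) * T t u x - u x) < e'"
      by (auto simp: eventually_at_right_field)
    have "Lpn p (\<lambda>x. resI h u x / of_real h - u x) < e" if "0 < h" "h < b" for h
    proof -
      have "Lpn p (\<lambda>x. resI h u x / of_real h - u x) \<le> e'"
        using that by (intro resI_average_Lpn p fu) (auto intro!: less_imp_le b(2)[simplified])
      then show ?thesis using e'(2) by simp
    qed
    then show "eventually (\<lambda>h. Lpn p (\<lambda>x. resI h u x / of_real h - u x) < e) (at_right 0)"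
      unfolding eventually_at_right_field using b(1) by blast
  qed simp
  have G0: "(G \<longlongrightarrow> 0) (at_right 0)"
  proof (rule tendsto_sandwich[OF _ _ tendsto_const tendsto_ennreal_const_mult[OF G1, of "2 powr p"]])
    have "((\<lambda>h. cmod (E h)) \<longlongrightarrow> cmod 1) (at_right 0)" by (intro tendsto_norm E0)
    then have "eventually (\<lambda>h. cmod (E h) < 2) (at_right 0)" by (rule order_tendstoD(2)) simp
    then show "eventually (\<lambda>h. G h \<le> ennreal (2 powr p) * Lpn p (\<lambda>x. resI h u x / of_real h - u x)) (at_right 0)"
    proof eventually_elim
      fix h assume "cmod (E h) < 2"
      then have "cmod (E h) powr p \<le> 2 powr p" using p by (intro powr_mono2) auto
      then show "G h \<le> ennreal (2 powr p) * Lpn p (\<lambda>x. resI h u x / of_real h - u x)"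
        unfolding G_def by (subst Lpn_cmult) (auto intro!: mult_right_mono ennreal_leI)
    qed
  qed simp
  let ?q = "ennreal (2 powr p)"
  have bound: "Lpn p X \<le> ?q * (?q * (A h + B h) + ?q * (G h + H h))" if h: "h > 0" for h
  proof -
    have tk: "tame (absk h u)" by (intro tame_kop tu kernel_k exp_mass_k h)
    have fk: "AE x in lborel. kop lborel \<kappa>r (absk h u) x < \<infinity>" by (intro tame_AE_finite tame_kop tk kernel_r exp_mass_r)
    have "AE x in lborel. X x = (res (\<lambda>x. D h x - w x) x + (z - (E h - 1) / of_real h) * res u x)
      + (E h * (resI h u x / of_real h - u x) + (E h - 1) * u x)"
      using fu fw fk
    proof eventually_elim
      fix x assume fu: "absr u x < \<infinity>" and fw: "absr w x < \<infinity>" and fk: "kop lborel \<kappa>r (absk h u) x < \<infinity>"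
      have [measurable]: "absk h u \<in> borel_measurable borel" by (rule kop_measurable[OF kernel_k]) simp
      have "absr (T h u) x \<le> kop lborel \<kappa>r (absk h u) x"
        unfolding kop_def by (intro nn_integral_mono mult_left_mono) (use cmod_T_le[OF assms(1)] in \<open>auto simp: kop_def\<close>)
      then have finT: "absr (T h u) x < \<infinity>" using fk by (rule order_le_less_trans)
      have [measurable]: "T h u \<in> borel_measurable borel" by measurable
      note i = res_integrable[OF assms(1) fu] res_integrable[OF assms(2) fw] res_integrable[OF _ finT, simplified]
      have "res (\<lambda>x. D h x - w x) x = (LINT v|(lborel \<Otimes>\<^sub>M lborel).
          (rk (fst v) (x - snd v) * T h u (R (fst v) (snd v)) - rk (fst v) (x - snd v) * u (R (fst v) (snd v))) / of_real h
          - rk (fst v) (x - snd v) * w (R (fst v) (snd v)))"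
        unfolding res_def D_def by (intro Bochner_Integration.integral_cong) (auto simp: algebra_simps diff_divide_distrib)
      also have "\<dots> = (res (T h u) x - res u x) / of_real h - res w x"
        unfolding res_def
        by (subst Bochner_Integration.integral_diff, intro integrable_divide_zero Bochner_Integration.integrable_diff i, rule i)
          (simp add: Bochner_Integration.integral_diff i)
      also have "res (T h u) x = E h * (res u x - resI h u x)"
        unfolding E_def by (rule res_T[OF assms(1) h fu fk])
      finally have eq: "res (\<lambda>x. D h x - w x) x = (E h * (res u x - resI h u x) - res u x) / of_real h - res w x" .
      show "X x = (res (\<lambda>x. D h x - w x) x + (z - (E h - 1) / of_real h) * res u x)
        + (E h * (resI h u x / of_real h - u x) + (E h - 1) * u x)"
        unfolding X_def eq using h by (simp add: field_simps)
    qed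
    then have "Lpn p X = Lpn p (\<lambda>x. (res (\<lambda>x. D h x - w x) x + (z - (E h - 1) / of_real h) * res u x)
      + (E h * (resI h u x / of_real h - u x) + (E h - 1) * u x))" by (rule Lpn_cong_AE)
    also have "\<dots> \<le> ?q * (Lpn p (\<lambda>x. res (\<lambda>x. D h x - w x) x + (z - (E h - 1) / of_real h) * res u x)
      + Lpn p (\<lambda>x. E h * (resI h u x / of_real h - u x) + (E h - 1) * u x))"
      by (rule Lpn_add[OF _ _ p]) measurable
    also have "\<dots> \<le> ?q * (?q * (A h + B h) + ?q * (G h + H h))"
      unfolding A_def B_def G_def H_def
      by (intro mult_left_mono add_mono Lpn_add[OF _ _ p]) simp_all
    finally show ?thesis .
  qed
  have "((\<lambda>h. ?q * (?q * (A h + B h) + ?q * (G h + H h))) \<longlongrightarrow> 0) (at_right 0)"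
    by (intro tendsto_ennreal_const_mult tendsto_add_zero A0 B0 G0 H0)
  then have "Lpn p X \<le> 0"
    by (rule tendsto_lowerbound) (use pos bound in \<open>auto elim!: eventually_mono\<close>)
  then have "AE x in lborel. X x = 0" by (intro Lpn_zero_AE[OF _ p]) auto
  with fu fw show ?thesis
  proof eventually_elim
    fix x assume fu: "absr u x < \<infinity>" and fw: "absr w x < \<infinity>" and X: "X x = 0"
    note i = res_integrable[OF assms(1) fu] res_integrable[OF assms(2) fw]
    have "res (\<lambda>x. z * u x - w x) x = (LINT v|(lborel \<Otimes>\<^sub>M lborel).
       z * (rk (fst v) (x - snd v) * u (R (fst v) (snd v))) - rk (fst v) (x - snd v) * w (R (fst v) (snd v)))"
      unfolding res_def by (intro Bochner_Integration.integral_cong) (auto simp: algebra_simps)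
    also have "\<dots> = z * res u x - res w x"
      unfolding res_def by (subst Bochner_Integration.integral_diff) (simp_all add: i)
    finally show "u x = res (\<lambda>x. z * u x - w x) x" using X by (simp add: X_def)
  qed
qed

end

section \<open>Hypergeometric values\<close>

text \<open>Pfaff's transformation as an identity of formal power series in \<open>z\<close>, with inner argument \<open>z / (z - 1)\<close>.\<close>

lemma pfaff_fps:
  fixes a c :: complex
  assumes c: "\<And>i. c \<noteq> - of_nat i"
  shows "inverse (1 - fps_X) * (Abs_fps (\<lambda>m. pochhammer (c - a) m / pochhammer c m) oo (- fps_X * inverse (1 - fps_X)))
    = fps_hypergeo [a, 1] [c] 1"
proof (rule fps_ext)
  fix n
  let ?P = "\<lambda>m. pochhammer (c - a) m / pochhammer c m"
  let ?u = "inverse (1 - fps_X) :: complex fps"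
  let ?w = "- fps_X * ?u"
  have u: "(?u ^ Suc i) $ k = of_nat ((i + k) choose k)" for i k
    using one_minus_const_fps_X_neg_power'[of "Suc i" "1 :: complex"] by (simp add: fps_inverse_power del: power_Suc)
  have w: "?w ^ i = fps_X ^ i * (fps_const ((- 1) ^ i) * ?u ^ i)" for i
    by (simp add: power_mult_distrib[symmetric] fps_const_power[symmetric] flip: fps_const_neg)
  have w0: "(?w ^ i) $ j = 0" if "j < i" for i j
    unfolding w using that by (simp add: fps_X_power_mult_nth)
  \<comment> \<open>The power X^i shifts the index by i, and the coefficient of (1 - X)^(- i - 1) at
    n - i is \<open>n choose i\<close>.\<close>
  have uw: "(?u * ?w ^ i) $ n = (- 1) ^ i * of_nat (n choose i)" if "i \<le> n" for i
  proof -
    have "?u * ?w ^ i = fps_X ^ i * (fps_const ((- 1) ^ i) * ?u ^ Suc i)" unfolding w by (simp add: mult_ac)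
    then have "(?u * ?w ^ i) $ n = (- 1) ^ i * (?u ^ Suc i) $ (n - i)"
      using that by (simp add: fps_X_power_mult_nth del: power_Suc)
    then show ?thesis using that binomial_symmetric[OF that] by (simp add: u del: power_Suc)
  qed
  have "(?u * (Abs_fps ?P oo ?w)) $ n = (\<Sum>j=0..n. ?u $ j * (\<Sum>i=0..n. ?P i * (?w ^ i) $ (n - j)))"
    unfolding fps_mult_nth
  proof (intro sum.cong refl arg_cong2[of _ _ _ _ "(*)"])
    fix j assume "j \<in> {0..n}"
    have "(Abs_fps ?P oo ?w) $ (n - j) = (\<Sum>i=0..n - j. ?P i * (?w ^ i) $ (n - j))"
      by (simp add: fps_compose_nth)
    also have "\<dots> = (\<Sum>i=0..n. ?P i * (?w ^ i) $ (n - j))"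
      by (rule sum.mono_neutral_left) (auto simp del: mult_minus_left intro!: w0)
    finally show "(Abs_fps ?P oo ?w) $ (n - j) = \<dots>" .
  qed
  also have "\<dots> = (\<Sum>i=0..n. ?P i * (\<Sum>j=0..n. ?u $ j * (?w ^ i) $ (n - j)))"
    unfolding sum_distrib_left by (subst sum.swap) (simp add: mult_ac)
  also have "\<dots> = (\<Sum>i=0..n. ?P i * (?u * ?w ^ i) $ n)" by (simp only: fps_mult_nth)
  also have "\<dots> = (\<Sum>i=0..n. pochhammer (c - a) i * pochhammer (- of_nat n) i / (of_nat (fact i) * pochhammer c i))"
  proof (rule sum.cong)
    fix i assume "i \<in> {0..n}"
    then have "i \<le> n" by simp
    have "of_nat (n choose i) = ((- 1) ^ i * pochhammer (- of_nat n) i / fact i :: complex)"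
      by (simp add: binomial_gbinomial gbinomial_pochhammer)
    then have "(- 1) ^ i * of_nat (n choose i) = (pochhammer (- of_nat n) i / fact i :: complex)"
      by (simp add: power_mult_distrib[symmetric] mult.assoc[symmetric])
    then show "?P i * (?u * ?w ^ i) $ n = pochhammer (c - a) i * pochhammer (- of_nat n) i / (of_nat (fact i) * pochhammer c i)"
      unfolding uw[OF \<open>i \<le> n\<close>] by (simp only:) (simp add: field_simps)
  qed simp
  \<comment> \<open>Chu-Vandermonde evaluates the terminating series 2F1(c - a, - n; c; 1).\<close>
  also have "\<dots> = pochhammer (c - (c - a)) n / pochhammer c n"
    by (rule Vandermonde_pochhammer) (use c in auto)
  also have "\<dots> = fps_hypergeo [a, 1] [c] 1 $ n"
    by (simp add: pochhammer_fact[symmetric])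
  finally show "(?u * (Abs_fps ?P oo ?w)) $ n = fps_hypergeo [a, 1] [c] 1 $ n" .
qed

lemma pochhammer_quotient_conv_radius:
  fixes b c :: real
  assumes "b > 0" "c > 0"
  shows "fps_conv_radius (Abs_fps (\<lambda>m. complex_of_real (pochhammer b m / pochhammer c m))) = 1"
proof -
  have pos: "pochhammer b m > 0" "pochhammer c m > 0" for m using assms by (auto intro: pochhammer_pos)
  let ?f = "\<lambda>m. complex_of_real (pochhammer b m / pochhammer c m)"
  have "conv_radius ?f = 1"
  proof (rule conv_radius_ratio_limit_ereal_nonzero)
    have "norm (?f n) / norm (?f (Suc n)) = (c + real n) / (b + real n)" for n
    proof -
      have n: "norm (?f n) = pochhammer b n / pochhammer c n" for n
        unfolding norm_of_real using pos[of n] by simp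
      show ?thesis unfolding n unfolding pochhammer_Suc using pos[of n] assms by simp
    qed
    moreover have "(\<lambda>n. (c + real n) / (b + real n)) \<longlonglongrightarrow> 1"
    proof -
      have "(\<lambda>n. 1 + (c - b) * inverse (b + real n)) \<longlonglongrightarrow> 1 + (c - b) * 0"
        by (intro tendsto_intros tendsto_inverse_0_at_top filterlim_tendsto_add_at_top[OF tendsto_const filterlim_real_sequentially])
      moreover have "1 + (c - b) * inverse (b + real n) = (c + real n) / (b + real n)" for n
        using assms by (simp add: field_simps)
      ultimately show ?thesis by simp
    qed
    ultimately show "(\<lambda>n. ereal (norm (?f n) / norm (?f (Suc n)))) \<longlonglongrightarrow> 1"
      by (simp only: one_ereal_def tendsto_ereal)
  qed simp
  then show ?thesis by (simp add: fps_conv_radius_def)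
qed

lemma pochhammer_quotient_summable:
  fixes b c q :: real
  assumes "b > 0" "c > 0" "0 \<le> q" "q < 1"
  shows "summable (\<lambda>m. pochhammer b m / pochhammer c m * q ^ m)"
proof -
  have "summable (\<lambda>m. complex_of_real (pochhammer b m / pochhammer c m) * of_real q ^ m)"
    by (rule summable_in_conv_radius)
      (use pochhammer_quotient_conv_radius[OF assms(1,2)] assms in \<open>simp add: fps_conv_radius_def one_ereal_def\<close>)
  then have "summable (\<lambda>m. complex_of_real (pochhammer b m / pochhammer c m * q ^ m))" by simp
  then show ?thesis by (simp only: summable_complex_of_real)
qed

text \<open>Pfaff's formula 2F1(a, 1; c; z) = (1 - z)^(-1) 2F1(c - a, 1; c; z/(z - 1)) continues the
  series beyond the unit disc: |z/(z - 1)| < 1 holds exactly for Re z < 1/2, a convex set containing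
  0. The point - vt/(1 - vt) lies in it and is mapped to vt.\<close>

lemma hyp2f1_Pfaff:
  fixes a c vt :: real
  assumes "c > 0" "c - a > 0" "0 \<le> vt" "vt < 1"
  shows "hyp2f1_real a 1 c (- (vt / (1 - vt))) = (1 - vt) * (\<Sum>m. pochhammer (c - a) m / pochhammer c m * vt ^ m)"
proof -
  define P where "P = Abs_fps (\<lambda>m. complex_of_real (pochhammer (c - a) m / pochhammer c m))"
  have P': "P = Abs_fps (\<lambda>m. pochhammer (of_real c - of_real a) m / pochhammer (of_real c) m)"
    by (simp add: P_def pochhammer_of_real flip: of_real_diff)
  have rad: "fps_conv_radius P = 1" unfolding P_def by (rule pochhammer_quotient_conv_radius) (use assms in auto)
  define f where "f z = inverse (1 - z) * eval_fps P (- z * inverse (1 - z))" for z :: complex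
  let ?S = "{z. Re z < 1 / 2}"
  have S: "1 - z \<noteq> 0" "- z * inverse (1 - z) \<in> eball 0 1" if "z \<in> ?S" for z :: complex
  proof -
    show 1: "1 - z \<noteq> 0" using that by auto
    have "(cmod z)\<^sup>2 < (cmod (1 - z))\<^sup>2"
      using that unfolding cmod_power2 by (simp add: power2_eq_square algebra_simps)
    then have "cmod z < cmod (1 - z)" by (rule power_less_imp_less_base) simp
    then show "- z * inverse (1 - z) \<in> eball 0 1"
      using 1 by (simp add: in_eball_iff norm_mult norm_inverse norm_divide divide_inverse[symmetric] one_ereal_def)
  qed
  have "hyp2f1_continuation (of_real a) 1 (of_real c) ?S f"
    unfolding hyp2f1_continuation_def
  proof (intro conjI ballI)
    show "open ?S" by (rule open_halfspace_Re_lt)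
    have "convex ?S" by (rule convex_halfspace_Re_lt)
    then show "closed_segment 0 z \<subseteq> ?S" if "z \<in> ?S" for z
      using that by (intro closed_segment_subset) auto
    have "(\<lambda>z. eval_fps P (- z * inverse (1 - z))) holomorphic_on ?S"
      using S rad
      by (intro holomorphic_on_compose_gen[OF _ holomorphic_on_eval_fps[of "eball 0 1" P], unfolded comp_def] holomorphic_intros) auto
    then show "f holomorphic_on ?S" unfolding f_def using S by (intro holomorphic_intros) auto
    have "f has_fps_expansion inverse (1 - fps_X) * (P oo (- fps_X * inverse (1 - fps_X)))"
    proof -
      have e: "eval_fps P has_fps_expansion P" by (rule eval_fps_has_fps_expansion) (simp add: rad)
      have i: "(\<lambda>z. inverse (1 - z)) has_fps_expansion (inverse (1 - fps_X) :: complex fps)"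
        by (intro fps_expansion_intros) simp
      have "(eval_fps P \<circ> (\<lambda>z. - z * inverse (1 - z))) has_fps_expansion (P oo (- fps_X * inverse (1 - fps_X)))"
        by (intro has_fps_expansion_compose e fps_expansion_intros i) simp
      from has_fps_expansion_mult[OF i this] show ?thesis by (simp add: f_def[abs_def] comp_def)
    qed
    also have "inverse (1 - fps_X) * (P oo (- fps_X * inverse (1 - fps_X))) = fps_hypergeo [of_real a, 1] [of_real c] 1"
      unfolding P'
    proof (rule pfaff_fps)
      show "complex_of_real c \<noteq> - of_nat i" for i
      proof
        assume "complex_of_real c = - of_nat i"
        then have "c = - real i" by (metis of_real_eq_iff of_real_minus of_real_of_nat_eq)
        then show False using assms(1) by simp
      qed
    qed
    finally show "f has_fps_expansion fps_hypergeo [of_real a, 1] [of_real c] 1" .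
  qed
  moreover have "complex_of_real (- (vt / (1 - vt))) \<in> ?S" using assms by (simp add: divide_nonneg_pos less_le_trans[of _ 0])
  ultimately have "hyp2f1 (of_real a) 1 (of_real c) (of_real (- (vt / (1 - vt)))) = f (of_real (- (vt / (1 - vt))))"
    by (rule hyp2f1_eq)
  also have "\<dots> = of_real (1 - vt) * eval_fps P (of_real vt)"
  proof -
    define r where "r = vt / (1 - vt)"
    have "1 + r = 1 / (1 - vt)" and r: "r * (1 - vt) = vt" using assms by (simp_all add: r_def field_simps)
    then have "1 - complex_of_real (- r) = of_real (1 / (1 - vt))" by (metis diff_minus_eq_add of_real_1 of_real_diff)
    then have i: "inverse (1 - complex_of_real (- r)) = of_real (1 - vt)"
      by (simp only: of_real_inverse[symmetric] inverse_divide div_by_1)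
    have "- complex_of_real (- r) * of_real (1 - vt) = of_real (r * (1 - vt))" by simp
    then show ?thesis unfolding f_def r_def[symmetric] i by (simp only: r)
  qed
  also have "eval_fps P (of_real vt) = of_real (\<Sum>m. pochhammer (c - a) m / pochhammer c m * vt ^ m)"
    unfolding eval_fps_def P_def fps_nth_Abs_fps
    using suminf_of_real[OF pochhammer_quotient_summable[of "c - a" c vt], where 'a = complex] assms by simp
  finally show ?thesis by simp
qed

text \<open>The equal parameters cancel and leave the binomial function (1 - z)^(-a), holomorphic
  for Re z < 1; at the point in question 1 - z is 1/(1 - vt).\<close>

lemma hyp2f1_binomial:
  fixes a b vt :: real
  assumes "b > 0" "0 \<le> vt" "vt < 1"
  shows "hyp2f1_real a b b (- (vt / (1 - vt))) = (1 - vt) powr a"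
proof -
  define f where "f z = (1 + - z) powr (- of_real a)" for z :: complex
  let ?S = "{z. Re z < 1}"
  have "hyp2f1_continuation (of_real a) (of_real b) (of_real b) ?S f"
    unfolding hyp2f1_continuation_def
  proof (intro conjI ballI)
    show "open ?S" by (rule open_halfspace_Re_lt)
    have "convex ?S" by (rule convex_halfspace_Re_lt)
    then show "closed_segment 0 z \<subseteq> ?S" if "z \<in> ?S" for z
      using that by (intro closed_segment_subset) auto
    show "f holomorphic_on ?S" unfolding f_def
      by (intro holomorphic_intros) (auto simp: complex_nonpos_Reals_iff)
    have "((\<lambda>z. (1 + z) powr (- complex_of_real a)) \<circ> (\<lambda>z. - z)) has_fps_expansion (fps_binomial (- complex_of_real a) oo (- fps_X))"
      by (intro has_fps_expansion_compose has_fps_expansion_binomial_complex fps_expansion_intros) simp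
    also have "fps_binomial (- complex_of_real a) oo (- fps_X) = fps_hypergeo [of_real a, of_real b] [of_real b] 1"
    proof (rule fps_ext)
      fix n
      have "pochhammer (complex_of_real b) n \<noteq> 0"
        using pochhammer_pos[OF assms(1), of n] by (simp add: pochhammer_of_real)
      moreover have "(fps_binomial (- complex_of_real a) oo (fps_const (- 1) * fps_X)) $ n = (- 1) ^ n * fps_binomial (- complex_of_real a) $ n"
        by (simp only: fps_compose_linear) simp
      moreover have "fps_const (- 1) * fps_X = (- fps_X :: complex fps)" by (simp flip: fps_const_neg)
      ultimately show "(fps_binomial (- complex_of_real a) oo (- fps_X)) $ n = fps_hypergeo [of_real a, of_real b] [of_real b] 1 $ n"
        by (simp add: gbinomial_pochhammer mult.assoc[symmetric] flip: power_mult_distrib)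
    qed
    finally show "f has_fps_expansion fps_hypergeo [of_real a, of_real b] [of_real b] 1"
      by (simp add: f_def[abs_def] comp_def)
  qed
  moreover have "complex_of_real (- (vt / (1 - vt))) \<in> ?S" using assms by (simp add: divide_nonneg_pos less_le_trans[of _ 0])
  ultimately have "hyp2f1 (of_real a) (of_real b) (of_real b) (of_real (- (vt / (1 - vt)))) = f (of_real (- (vt / (1 - vt))))"
    by (rule hyp2f1_eq)
  also have "\<dots> = of_real ((1 / (1 - vt)) powr (- a))"
  proof -
    have "1 + - (- (vt / (1 - vt))) = 1 / (1 - vt)" using assms by (simp add: field_simps)
    then have "1 + - complex_of_real (- (vt / (1 - vt))) = of_real (1 / (1 - vt))"
      by (metis of_real_1 of_real_add of_real_minus)
    then show ?thesis unfolding f_def using assms by (simp only:) (subst powr_of_real[symmetric], auto)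
  qed
  also have "(1 / (1 - vt)) powr (- a) = (1 - vt) powr a"
    using assms by (simp add: powr_minus powr_divide)
  finally show ?thesis by simp
qed

section \<open>Moment series and their sums\<close>

lemma binomial_series_sums:
  fixes b q :: real
  assumes "0 \<le> q" "q < 1"
  shows "(\<lambda>m. pochhammer b m / fact m * q ^ m) sums ((1 - q) powr (- b))"
proof -
  have "(\<lambda>n. (- b gchoose n) * (- q) ^ n) sums (1 + - q) powr (- b)"
    by (rule gen_binomial_real) (use assms in auto)
  moreover have "(- b gchoose n) * (- q) ^ n = pochhammer b n / fact n * q ^ n" for n
    by (cases "even n") (simp_all add: gbinomial_pochhammer)
  ultimately show ?thesis by simp
qed

lemma Gamma_add_nat:
  fixes x :: real
  assumes "x > 0"
  shows "Gamma (x + real m) = Gamma x * pochhammer x m"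
proof -
  have "x \<notin> \<int>\<^sub>\<le>\<^sub>0" using assms nonpos_Ints_nonpos[of x] by auto
  then show ?thesis using pochhammer_Gamma[of x m] Gamma_real_pos[OF assms] by (simp add: field_simps)
qed

text \<open>Even and odd factorials are split into Pochhammer symbols, so that \<open>4 ^ m\<close>
  cancels against the power of 2 sqrt q and hypergeometric coefficients remain.\<close>

lemma fact_even: "fact (2 * m) = (4 ^ m * fact m * pochhammer (1 / 2) m :: real)"
  by (subst fact_double) (simp add: power_mult)

lemma fact_odd: "fact (2 * m + 1) = (4 ^ m * fact m * pochhammer (3 / 2) m :: real)"
proof -
  have "pochhammer (1 / 2) (Suc m) = 1 / 2 * pochhammer (3 / 2 :: real) m"
    using pochhammer_rec[of "1 / 2 :: real" m] by simp
  then have "(1 / 2 + real m) * pochhammer (1 / 2) m = 1 / 2 * pochhammer (3 / 2 :: real) m"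
    by (simp only: pochhammer_Suc mult_ac)
  then have "pochhammer (3 / 2 :: real) m = (2 * real m + 1) * pochhammer (1 / 2) m" by (simp add: algebra_simps)
  moreover have "fact (2 * m + 1) = (2 * real m + 1) * (fact (2 * m) :: real)" by (simp add: algebra_simps)
  ultimately show ?thesis unfolding fact_even by (simp only: mult_ac)
qed

text \<open>
  The normalized moments of order \<open>j + k\<close> of a Gaussian density integrated in time against a Gamma density
  (\<open>tgauss_moment\<close>).  In the series below the even \<open>k\<close> produce the first and the odd \<open>k\<close> the second
  hypergeometric function in the constants.
\<close>

definition moment_coeff :: "real \<Rightarrow> real \<Rightarrow> real \<Rightarrow> nat \<Rightarrow> real" where
  "moment_coeff d s j k = Gamma ((d + j + real k) / 2) * Gamma (s + real k / 2) / (Gamma (d / 2) * fact k)"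

lemma moment_coeff_nonneg:
  assumes "d > 0" "s > 0" "j \<ge> 0"
  shows "moment_coeff d s j k \<ge> 0"
  unfolding moment_coeff_def using assms
  by (intro divide_nonneg_nonneg mult_nonneg_nonneg less_imp_le[OF Gamma_real_pos]) (auto intro: add_pos_nonneg)

lemma Gamma_three_halves: "2 * Gamma (3 / 2 :: real) = sqrt pi"
  using Gamma_add_nat[of "1 / 2" 1] by (simp add: Gamma_one_half_real)

lemma sums_even_odd:
  fixes f :: "nat \<Rightarrow> real"
  assumes "(\<lambda>m. f (2 * m)) sums x" "(\<lambda>m. f (2 * m + 1)) sums y"
  shows "f sums (x + y)"
proof -
  have "(\<lambda>n. if even n then f (2 * (n div 2)) else f (2 * ((n - 1) div 2) + 1)) sums (y + x)"
    by (rule sums_if[OF assms(2,1)])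
  moreover have "(if even n then f (2 * (n div 2)) else f (2 * ((n - 1) div 2) + 1)) = f n" for n
    by (auto elim!: oddE)
  ultimately show ?thesis by (simp add: add.commute)
qed

text \<open>For k = 2m the factor Gamma (1 + m) cancels m! and leaves (d/2)_m / (1/2)_m; for k = 2m
  + 1 the factor Gamma (3/2 + m) cancels (3/2)_m and leaves a binomial series. This is why one of
  the hypergeometric functions in \<open>C\<^sub>7\<close> is elementary.\<close>

lemma moment_series_value:
  fixes d q :: real
  assumes "d > 0" "0 \<le> q" "q < 1"
  shows "(\<lambda>k. moment_coeff d 1 0 k * (2 * sqrt q) ^ k) sums
      ((\<Sum>m. pochhammer (d / 2) m / pochhammer (1 / 2) m * q ^ m)
       + sqrt pi * (Gamma ((d + 1) / 2) / Gamma (d / 2)) * sqrt q * (1 - q) powr (- ((d + 1) / 2)))"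
proof (rule sums_even_odd)
  have G: "Gamma (d / 2) > 0" using assms by (simp add: Gamma_real_pos)
  have p: "pochhammer (1 / 2 :: real) m > 0" "pochhammer (3 / 2 :: real) m > 0" for m by (auto intro: pochhammer_pos)
  have "moment_coeff d 1 0 (2 * m) * (2 * sqrt q) ^ (2 * m) = pochhammer (d / 2) m / pochhammer (1 / 2) m * q ^ m" for m
  proof -
    have "Gamma ((d + 0 + real (2 * m)) / 2) = Gamma (d / 2) * pochhammer (d / 2) m"
      using Gamma_add_nat[of "d / 2" m] assms by (simp add: add_divide_distrib)
    moreover have "Gamma (1 + real (2 * m) / 2) = fact m" by (simp add: Gamma_fact)
    moreover have "(2 * sqrt q) ^ (2 * m) = 4 ^ m * q ^ m" using assms by (simp add: power_mult power_mult_distrib)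
    ultimately show ?thesis unfolding moment_coeff_def fact_even using G p[of m] by (simp only:) (simp add: field_simps)
  qed
  then show "(\<lambda>m. moment_coeff d 1 0 (2 * m) * (2 * sqrt q) ^ (2 * m)) sums (\<Sum>m. pochhammer (d / 2) m / pochhammer (1 / 2) m * q ^ m)"
    using summable_sums[OF pochhammer_quotient_summable[of "d / 2" "1 / 2" q]] assms by simp
  have "moment_coeff d 1 0 (2 * m + 1) * (2 * sqrt q) ^ (2 * m + 1)
      = sqrt pi * (Gamma ((d + 1) / 2) / Gamma (d / 2)) * sqrt q * (pochhammer ((d + 1) / 2) m / fact m * q ^ m)" for m
  proof -
    have "Gamma ((d + 0 + real (2 * m + 1)) / 2) = Gamma ((d + 1) / 2) * pochhammer ((d + 1) / 2) m"
      using Gamma_add_nat[of "(d + 1) / 2" m] assms by (simp add: add_divide_distrib add_ac)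
    moreover have "Gamma (1 + real (2 * m + 1) / 2) = Gamma (3 / 2) * pochhammer (3 / 2) m"
      using Gamma_add_nat[of "3 / 2" m] by (simp add: add_divide_distrib add_ac)
    moreover have "(2 * sqrt q) ^ (2 * m + 1) = 2 * sqrt q * 4 ^ m * q ^ m" using assms by (simp add: power_mult power_mult_distrib)
    ultimately show ?thesis unfolding moment_coeff_def fact_odd Gamma_three_halves[symmetric]
      using G p[of m] Gamma_real_pos[of "3 / 2"] by (simp only:) (simp add: field_simps)
  qed
  then show "(\<lambda>m. moment_coeff d 1 0 (2 * m + 1) * (2 * sqrt q) ^ (2 * m + 1)) sums
      (sqrt pi * (Gamma ((d + 1) / 2) / Gamma (d / 2)) * sqrt q * (1 - q) powr (- ((d + 1) / 2)))"
    using sums_mult[OF binomial_series_sums[of q "(d + 1) / 2"]] assms by (simp only:)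
qed

text \<open>The half power of time exchanges the roles: Gamma (1/2 + m) cancels (1/2)_m, so the even
  terms form the binomial series, and the odd terms keep the quotient with (3/2)_m.\<close>

lemma moment_series_value_gradient:
  fixes d q :: real
  assumes "d > 0" "0 \<le> q" "q < 1"
  shows "(\<lambda>k. moment_coeff d (1 / 2) 1 k * (2 * sqrt q) ^ k) sums
      (Gamma (1 / 2) * (Gamma ((d + 1) / 2) / Gamma (d / 2)) * (1 - q) powr (- ((d + 1) / 2))
       + 2 * (Gamma ((d + 2) / 2) / Gamma (d / 2)) * sqrt q * (\<Sum>m. pochhammer ((d + 2) / 2) m / pochhammer (3 / 2) m * q ^ m))"
proof (rule sums_even_odd)
  have G: "Gamma (d / 2) > 0" using assms by (simp add: Gamma_real_pos)
  have p: "pochhammer (1 / 2 :: real) m > 0" "pochhammer (3 / 2 :: real) m > 0" for m by (auto intro: pochhammer_pos)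
  have "moment_coeff d (1 / 2) 1 (2 * m) * (2 * sqrt q) ^ (2 * m)
      = Gamma (1 / 2) * (Gamma ((d + 1) / 2) / Gamma (d / 2)) * (pochhammer ((d + 1) / 2) m / fact m * q ^ m)" for m
  proof -
    have "Gamma ((d + 1 + real (2 * m)) / 2) = Gamma ((d + 1) / 2) * pochhammer ((d + 1) / 2) m"
      using Gamma_add_nat[of "(d + 1) / 2" m] assms by (simp add: add_divide_distrib)
    moreover have "Gamma (1 / 2 + real (2 * m) / 2) = Gamma (1 / 2) * pochhammer (1 / 2) m"
      using Gamma_add_nat[of "1 / 2" m] by simp
    moreover have "(2 * sqrt q) ^ (2 * m) = 4 ^ m * q ^ m" using assms by (simp add: power_mult power_mult_distrib)
    ultimately show ?thesis unfolding moment_coeff_def fact_even using G p[of m] by (simp only:) (simp add: field_simps)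
  qed
  then show "(\<lambda>m. moment_coeff d (1 / 2) 1 (2 * m) * (2 * sqrt q) ^ (2 * m)) sums
      (Gamma (1 / 2) * (Gamma ((d + 1) / 2) / Gamma (d / 2)) * (1 - q) powr (- ((d + 1) / 2)))"
    using sums_mult[OF binomial_series_sums[of q "(d + 1) / 2"]] assms by (simp only:)
  have eq: "moment_coeff d (1 / 2) 1 (2 * m + 1) * (2 * sqrt q) ^ (2 * m + 1)
      = 2 * (Gamma ((d + 2) / 2) / Gamma (d / 2)) * sqrt q * (pochhammer ((d + 2) / 2) m / pochhammer (3 / 2) m * q ^ m)" for m
  proof -
    have "Gamma ((d + 1 + real (2 * m + 1)) / 2) = Gamma ((d + 2) / 2) * pochhammer ((d + 2) / 2) m"
      using Gamma_add_nat[of "(d + 2) / 2" m] assms by (simp add: add_divide_distrib add_ac)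
    moreover have "Gamma (1 / 2 + real (2 * m + 1) / 2) = fact m"
      using Gamma_fact[of m, where 'a = real] by (simp add: add_divide_distrib add_ac)
    moreover have "(2 * sqrt q) ^ (2 * m + 1) = 2 * sqrt q * 4 ^ m * q ^ m" using assms by (simp add: power_mult power_mult_distrib)
    ultimately show ?thesis unfolding moment_coeff_def fact_odd using G p[of m] by (simp only:) (simp add: field_simps)
  qed
  show "(\<lambda>m. moment_coeff d (1 / 2) 1 (2 * m + 1) * (2 * sqrt q) ^ (2 * m + 1)) sums
      (2 * (Gamma ((d + 2) / 2) / Gamma (d / 2)) * sqrt q * (\<Sum>m. pochhammer ((d + 2) / 2) m / pochhammer (3 / 2) m * q ^ m))"
    unfolding eq by (intro sums_mult summable_sums pochhammer_quotient_summable) (use assms in auto)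
qed

section \<open>Exponential moments of Gaussian densities\<close>

text \<open>A probability density with decay rate c/t; up to a factor it is the real Gaussian that
  dominates \<open>ou_kernel\<close>.\<close>

definition gauss :: "real \<Rightarrow> real \<Rightarrow> 'a::euclidean_space \<Rightarrow> real" where
  "gauss c t x = (c / (pi * t)) powr (real DIM('a) / 2) * exp (- (c / t) * (norm x)\<^sup>2)"

lemma gauss_nonneg [simp]: "gauss c t x \<ge> 0"
  by (simp add: gauss_def)

lemma gauss_measurable [measurable (raw)]:
  assumes [measurable]: "f \<in> borel_measurable M" "g \<in> borel_measurable M"
  shows "(\<lambda>w. gauss c (f w) (g w)) \<in> borel_measurable M"
  unfolding gauss_def by measurable

lemma sqrt_power_powr: "x > 0 \<Longrightarrow> sqrt x ^ k = x powr (real k / 2)"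
  using powr_half_power2[of "sqrt x" k] by simp

lemma gauss_moment:
  assumes "c > 0" "t > 0"
  shows "(\<integral>\<^sup>+x. ennreal (gauss c t (x::'a::euclidean_space) * norm x ^ k) \<partial>lborel)
    = ennreal ((t / c) powr (real k / 2) * Gamma ((real DIM('a) + real k) / 2) / Gamma (real DIM('a) / 2))"
proof -
  define d where "d = real DIM('a)"
  have d: "d > 0" by (simp add: d_def)
  have ct: "c / t > 0" using assms by simp
  have "(\<integral>\<^sup>+x. ennreal (gauss c t (x::'a) * norm x ^ k) \<partial>lborel)
      = (\<integral>\<^sup>+x. ennreal ((c / (pi * t)) powr (d / 2)) * ennreal (norm x ^ k * exp (- (c / t) * (norm (x::'a))\<^sup>2)) \<partial>lborel)"
    by (intro nn_integral_cong) (simp add: gauss_def d_def ennreal_mult[symmetric] mult_ac)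
  also have "\<dots> = ennreal ((c / (pi * t)) powr (d / 2)) * ennreal (pi powr (d / 2) * Gamma ((d + k) / 2) / Gamma (d / 2) * (c / t) powr (- ((d + k) / 2)))"
    unfolding d_def by (subst nn_integral_cmult, simp, subst nn_integral_norm_gaussian[OF ct]) (rule refl)
  also have "\<dots> = ennreal ((c / (pi * t)) powr (d / 2) * (pi powr (d / 2) * Gamma ((d + k) / 2) / Gamma (d / 2) * (c / t) powr (- ((d + k) / 2))))"
    by (rule ennreal_mult[symmetric]) (use d Gamma_real_pos[of "d / 2"] Gamma_real_pos[of "(d + k) / 2"] in \<open>auto intro!: mult_nonneg_nonneg divide_nonneg_nonneg simp: less_imp_le\<close>)
  also have "(c / (pi * t)) powr (d / 2) * (pi powr (d / 2) * Gamma ((d + k) / 2) / Gamma (d / 2) * (c / t) powr (- ((d + k) / 2)))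
     = (t / c) powr (real k / 2) * Gamma ((d + k) / 2) / Gamma (d / 2)"
  proof -
    have "(c / (pi * t)) powr (d / 2) = ((c / t) / pi) powr (d / 2)" by (simp add: mult.commute)
    also have "\<dots> = (c / t) powr (d / 2) * pi powr (- (d / 2))"
      using assms by (simp add: powr_divide[of "c / t"] powr_minus_divide del: divide_divide_eq_left)
    finally have "(c / (pi * t)) powr (d / 2) = (c / t) powr (d / 2) * pi powr (- (d / 2))" .
    moreover have "(c / t) powr (- ((d + k) / 2)) = (c / t) powr (- (d / 2)) * (t / c) powr (real k / 2)"
    proof -
      have "(t / c) powr (real k / 2) = (c / t) powr (- (real k / 2))"
        using assms by (simp add: powr_minus_divide powr_divide)
      then show ?thesis by (simp add: powr_add[symmetric] add_divide_distrib)
    qed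
    moreover have "(c / t) powr (d / 2) * (c / t) powr (- (d / 2)) = 1" "pi powr (- (d / 2)) * pi powr (d / 2) = 1"
      using assms by (simp_all add: powr_minus)
    ultimately show ?thesis by (simp add: mult_ac)
  qed
  finally show ?thesis by (simp add: d_def)
qed

text \<open>The density factorizes over the coordinates, so a one-dimensional first moment remains,
  with the value sqrt (t/(pi c)) in every dimension; the last step gives up the factor sqrt pi. With
  |x| in place of a component a factor growing with the dimension would appear.\<close>

lemma gauss_abs_component:
  fixes b :: "'a::euclidean_space"
  assumes "c > 0" "t > 0" "b \<in> Basis"
  shows "(\<integral>\<^sup>+x. ennreal (gauss c t x * \<bar>x \<bullet> b\<bar>) \<partial>lborel) \<le> ennreal (sqrt (t / c))"
proof -
  define d where "d = real DIM('a)"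
  have d: "d \<ge> 1" using DIM_positive[where 'a = 'a] by (simp add: d_def)
  define u where "u = c / t"
  have u: "u > 0" using assms by (simp add: u_def)
  define f where "f b' s = (if b' = b then norm s ^ 1 else norm s ^ 0) * exp (- u * (norm s)\<^sup>2)" for b' :: 'a and s :: real
  have f1: "(\<integral>\<^sup>+s. ennreal (f b' s) \<partial>lborel) = (if b' = b then ennreal (1 / u) else ennreal (sqrt (pi / u)))" for b'
    using nn_integral_norm_gaussian[OF u, where 'a = real, of 1] nn_integral_norm_gaussian[OF u, where 'a = real, of 0] u
    by (auto simp: f_def Gamma_one_half_real powr_minus powr_half_sqrt real_sqrt_divide field_simps simp flip: powr_half_sqrt)
  have pf: "(\<Prod>b'\<in>Basis. f b' (x \<bullet> b')) = \<bar>x \<bullet> b\<bar> * exp (- u * (norm x)\<^sup>2)" for x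
  proof -
    have "(\<Prod>b'\<in>Basis. f b' (x \<bullet> b')) = (\<Prod>b'\<in>Basis. if b' = b then \<bar>x \<bullet> b'\<bar> else 1) * (\<Prod>b'\<in>Basis. exp (- u * (x \<bullet> b')\<^sup>2))"
      unfolding prod.distrib[symmetric] by (intro prod.cong) (auto simp: f_def)
    also have "(\<Prod>b'\<in>Basis. if b' = b then \<bar>x \<bullet> b'\<bar> else 1) = \<bar>x \<bullet> b\<bar>"
      using assms(3) by (simp add: prod.delta)
    also have "(\<Prod>b'\<in>Basis. exp (- u * (x \<bullet> b')\<^sup>2)) = exp (- u * (norm x)\<^sup>2)"
      by (simp add: exp_sum[symmetric] sum_distrib_left[symmetric] sum_negf power2_norm_eq_inner euclidean_inner[of x x] power2_eq_square[of "x \<bullet> _"])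
    finally show ?thesis .
  qed
  have "(\<integral>\<^sup>+x. ennreal (gauss c t x * \<bar>x \<bullet> b\<bar>) \<partial>lborel)
      = (\<integral>\<^sup>+x. ennreal ((u / pi) powr (d / 2)) * (\<Prod>b'\<in>Basis. ennreal (f b' (x \<bullet> b'))) \<partial>lborel)"
  proof (rule nn_integral_cong)
    fix x
    have "(\<Prod>b'\<in>Basis. ennreal (f b' (x \<bullet> b'))) = ennreal (\<bar>x \<bullet> b\<bar> * exp (- u * (norm x)\<^sup>2))"
      unfolding pf[symmetric] by (rule prod_ennreal) (simp add: f_def)
    then show "ennreal (gauss c t x * \<bar>x \<bullet> b\<bar>) = ennreal ((u / pi) powr (d / 2)) * (\<Prod>b'\<in>Basis. ennreal (f b' (x \<bullet> b')))"
      by (simp add: gauss_def d_def u_def ennreal_mult[symmetric] mult_ac)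
  qed
  also have "\<dots> = ennreal ((u / pi) powr (d / 2)) * (\<integral>\<^sup>+x. (\<Prod>b'\<in>Basis. ennreal (f b' (x \<bullet> b'))) \<partial>lborel)"
    by (rule nn_integral_cmult) (simp add: f_def)
  also have "(\<integral>\<^sup>+x. (\<Prod>b'\<in>Basis. ennreal (f b' (x \<bullet> b'))) \<partial>lborel) = (\<Prod>b'\<in>Basis. \<integral>\<^sup>+s. ennreal (f b' s) \<partial>lborel)"
    by (rule nn_integral_lborel_prod) (auto simp: f_def)
  also have "\<dots> = ennreal (1 / u) * (\<Prod>b'\<in>Basis - {b}. ennreal (sqrt (pi / u)))"
    by (subst prod.remove[OF _ assms(3)]) (simp_all add: f1)
  also have "\<dots> = ennreal (1 / u * sqrt (pi / u) ^ (DIM('a) - 1))"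
    using u assms(3) by (simp add: ennreal_power ennreal_mult[symmetric])
  also have "ennreal ((u / pi) powr (d / 2)) * \<dots> = ennreal ((u / pi) powr (d / 2) * (1 / u * sqrt (pi / u) ^ (DIM('a) - 1)))"
    using u by (intro ennreal_mult[symmetric]) auto
  also have "(u / pi) powr (d / 2) * (1 / u * sqrt (pi / u) ^ (DIM('a) - 1)) = 1 / sqrt (pi * u)"
  proof -
    have "sqrt (pi / u) ^ (DIM('a) - 1) = (pi / u) powr ((d - 1) / 2)"
      using u d by (simp add: sqrt_power_powr d_def of_nat_diff)
    also have "\<dots> = (u / pi) powr (- ((d - 1) / 2))" using u by (simp add: powr_minus powr_divide)
    finally have "(u / pi) powr (d / 2) * sqrt (pi / u) ^ (DIM('a) - 1) = (u / pi) powr (1 / 2)"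
      using u by (simp add: powr_add[symmetric] diff_divide_distrib)
    then have "(u / pi) powr (d / 2) * (1 / u * sqrt (pi / u) ^ (DIM('a) - 1)) = sqrt (u / pi) / u"
      using u by (simp add: powr_half_sqrt)
    also have "\<dots> = 1 / sqrt (pi * u)" using u by (simp add: real_sqrt_divide real_sqrt_mult field_simps)
    finally show ?thesis .
  qed
  also have "1 / sqrt (pi * u) \<le> sqrt (t / c)"
  proof -
    have "1 / sqrt (pi * u) \<le> 1 / sqrt u" using u pi_ge_two by (intro divide_left_mono) auto
    then show ?thesis using assms by (simp add: u_def real_sqrt_divide)
  qed
  finally show ?thesis by (simp add: ennreal_leI)
qed

text \<open>The exponents make one family of both majorants: s = 1, j = 0 for the resolvent kernel,
  and s = 1/2, j = 1, multiplied by |x_i|, for its derivative. The value 0 for t <= 0 permits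
  integration over the whole line.\<close>

definition tgauss :: "real \<Rightarrow> real \<Rightarrow> real \<Rightarrow> nat \<Rightarrow> real \<Rightarrow> 'a::euclidean_space \<Rightarrow> real" where
  "tgauss \<delta> s c j t x = (if t > 0 then exp (- \<delta> * t) * t powr (s - 1) * (c / t) powr (real j / 2) * gauss c t x else 0)"

lemma tgauss_nonneg [simp]: "tgauss \<delta> s c j t x \<ge> 0"
  by (simp add: tgauss_def)

lemma tgauss_measurable [measurable (raw)]:
  assumes [measurable]: "f \<in> borel_measurable M" "g \<in> borel_measurable M"
  shows "(\<lambda>w. tgauss \<delta> s c j (f w) (g w)) \<in> borel_measurable M"
  unfolding tgauss_def by measurable

text \<open>The spatial moment contributes (t/c)^((j + k)/2), whose j-part cancels (c/t)^(j/2). A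
  Gamma integral in time with parameter s + k/2 remains, and each order k costs a factor 1/sqrt (c
  \<delta>).\<close>

lemma tgauss_moment:
  fixes \<delta> s c :: real
  assumes "\<delta> > 0" "s > 0" "c > 0"
  shows "(\<integral>\<^sup>+t. \<integral>\<^sup>+x. ennreal (tgauss \<delta> s c j t (x::'a::euclidean_space) * norm x ^ (j + k)) \<partial>lborel \<partial>lborel)
    = ennreal (\<delta> powr (- s) * moment_coeff (real DIM('a)) s (real j) k * fact k * (1 / sqrt (c * \<delta>)) ^ k)"
proof -
  define d where "d = real DIM('a)"
  have d: "d > 0" by (simp add: d_def)
  define \<Gamma> where "\<Gamma> = Gamma ((d + (real j + real k)) / 2) / Gamma (d / 2)"
  have \<Gamma>: "\<Gamma> \<ge> 0" unfolding \<Gamma>_def using d by (intro divide_nonneg_nonneg less_imp_le[OF Gamma_real_pos]) (auto intro: add_pos_nonneg)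
  have inner: "(\<integral>\<^sup>+x. ennreal (tgauss \<delta> s c j t (x::'a) * norm x ^ (j + k)) \<partial>lborel)
      = ennreal (\<Gamma> * c powr (- (real k / 2))) * (indicator {0<..} t * ennreal (t powr ((s + real k / 2) - 1) * exp (- \<delta> * t)))" for t
  proof (cases "t > 0")
    case True
    have "(\<integral>\<^sup>+x. ennreal (tgauss \<delta> s c j t (x::'a) * norm x ^ (j + k)) \<partial>lborel)
       = (\<integral>\<^sup>+x. ennreal (exp (- \<delta> * t) * t powr (s - 1) * (c / t) powr (real j / 2)) * ennreal (gauss c t (x::'a) * norm x ^ (j + k)) \<partial>lborel)"
      using True by (intro nn_integral_cong) (simp add: tgauss_def ennreal_mult[symmetric] mult.assoc)
    also have "\<dots> = ennreal (exp (- \<delta> * t) * t powr (s - 1) * (c / t) powr (real j / 2)) * ennreal ((t / c) powr (real (j + k) / 2) * Gamma ((d + real (j + k)) / 2) / Gamma (d / 2))"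
      by (subst nn_integral_cmult) (simp_all add: gauss_moment[OF \<open>c > 0\<close> True] d_def)
    also have "\<dots> = ennreal (exp (- \<delta> * t) * t powr (s - 1) * (c / t) powr (real j / 2) * ((t / c) powr (real (j + k) / 2) * \<Gamma>))"
      using \<Gamma> by (subst ennreal_mult[symmetric]) (simp_all add: \<Gamma>_def[symmetric] add.assoc flip: times_divide_eq_right)
    also have "exp (- \<delta> * t) * t powr (s - 1) * (c / t) powr (real j / 2) * ((t / c) powr (real (j + k) / 2) * \<Gamma>)
       = \<Gamma> * c powr (- (real k / 2)) * (t powr ((s + real k / 2) - 1) * exp (- \<delta> * t))"
    proof -
      have "(t / c) powr (real (j + k) / 2) = (t / c) powr (real j / 2) * (t powr (real k / 2) * c powr (- (real k / 2)))"
        using True assms by (simp add: add_divide_distrib powr_add powr_divide powr_minus_divide)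
      moreover have "(c / t) powr (real j / 2) * (t / c) powr (real j / 2) = 1"
        using True assms by (simp flip: powr_mult)
      moreover have "t powr ((s + real k / 2) - 1) = t powr (s - 1) * t powr (real k / 2)"
        by (simp add: powr_add[symmetric] algebra_simps)
      ultimately have "exp (- \<delta> * t) * t powr (s - 1) * (c / t) powr (real j / 2) * ((t / c) powr (real (j + k) / 2) * \<Gamma>)
         = ((c / t) powr (real j / 2) * (t / c) powr (real j / 2)) * (\<Gamma> * c powr (- (real k / 2)) * (t powr ((s + real k / 2) - 1) * exp (- \<delta> * t)))"
        by (simp only: mult_ac)
      then show ?thesis by (simp only: \<open>(c / t) powr _ * _ = 1\<close> mult_1)
    qed
    also have "ennreal \<dots> = ennreal (\<Gamma> * c powr (- (real k / 2))) * ennreal (t powr ((s + real k / 2) - 1) * exp (- \<delta> * t))"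
      using \<Gamma> by (intro ennreal_mult) auto
    finally show ?thesis using True by simp
  qed (simp add: tgauss_def)
  have "(\<integral>\<^sup>+t. \<integral>\<^sup>+x. ennreal (tgauss \<delta> s c j t (x::'a) * norm x ^ (j + k)) \<partial>lborel \<partial>lborel)
     = ennreal (\<Gamma> * c powr (- (real k / 2))) * ennreal (Gamma (s + real k / 2) * \<delta> powr (- (s + real k / 2)))"
    unfolding inner using assms by (subst nn_integral_cmult, simp, subst nn_integral_Gamma) (auto intro: add_pos_nonneg)
  also have "\<dots> = ennreal (\<Gamma> * c powr (- (real k / 2)) * (Gamma (s + real k / 2) * \<delta> powr (- (s + real k / 2))))"
    by (rule ennreal_mult[symmetric]) (use \<Gamma> assms Gamma_real_pos[of "s + real k / 2"] in \<open>auto simp: add_pos_nonneg less_imp_le\<close>)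
  also have "\<Gamma> * c powr (- (real k / 2)) * (Gamma (s + real k / 2) * \<delta> powr (- (s + real k / 2)))
     = \<delta> powr (- s) * moment_coeff d s (real j) k * fact k * (1 / sqrt (c * \<delta>)) ^ k"
  proof -
    have "(1 / sqrt (c * \<delta>)) ^ k = c powr (- (real k / 2)) * \<delta> powr (- (real k / 2))"
      using assms by (simp add: power_divide sqrt_power_powr powr_mult powr_minus_divide)
    moreover have "\<delta> powr (- (s + real k / 2)) = \<delta> powr (- s) * \<delta> powr (- (real k / 2))"
      by (simp add: powr_add[symmetric])
    moreover have "moment_coeff d s (real j) k * fact k = \<Gamma> * Gamma (s + real k / 2)"
      by (simp add: moment_coeff_def \<Gamma>_def add.assoc)
    ultimately have "\<Gamma> * c powr (- (real k / 2)) * (Gamma (s + real k / 2) * \<delta> powr (- (s + real k / 2)))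
      = \<delta> powr (- s) * (moment_coeff d s (real j) k * fact k) * (1 / sqrt (c * \<delta>)) ^ k" by (simp only: mult_ac)
    then show ?thesis by (simp only: mult.assoc)
  qed
  finally show ?thesis by (simp add: d_def)
qed

text \<open>Up to a common factor the term of order k is \<open>moment_coeff\<close> times (e / sqrt
  (c \<delta>))^k, so the assumption on \<open>e\<close> is a termwise comparison with a series
  whose sum is known.\<close>

lemma tgauss_exp_moment:
  fixes \<delta> s c e q :: real
  assumes "\<delta> > 0" "s > 0" "c > 0" "e \<ge> 0" "q \<ge> 0" and e: "e / sqrt (c * \<delta>) \<le> 2 * sqrt q"
    and summ: "summable (\<lambda>k. moment_coeff (real DIM('a)) s (real j) k * (2 * sqrt q) ^ k)"
  shows "(\<integral>\<^sup>+t. \<integral>\<^sup>+x. ennreal (tgauss \<delta> s c j t (x::'a::euclidean_space) * norm x ^ j) * ennreal (exp (e * norm x)) \<partial>lborel \<partial>lborel)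
    \<le> ennreal (\<delta> powr (- s) * (\<Sum>k. moment_coeff (real DIM('a)) s (real j) k * (2 * sqrt q) ^ k))"
proof -
  have E: "ennreal (exp (e * norm x)) = (\<Sum>k. ennreal (e ^ k / fact k * norm x ^ k))" for x :: 'a
  proof -
    have "(\<lambda>k. (e * norm x) ^ k /\<^sub>R fact k) sums exp (e * norm x)" by (rule exp_converges)
    then have "(\<lambda>k. e ^ k / fact k * norm x ^ k) sums exp (e * norm x)"
      by (simp add: power_mult_distrib divide_inverse mult_ac)
    then show ?thesis using assms by (subst suminf_ennreal2) (auto simp: sums_iff)
  qed
  have coeff: "(\<integral>\<^sup>+t. \<integral>\<^sup>+x. ennreal (tgauss \<delta> s c j t (x::'a) * norm x ^ j) * ennreal (e ^ k / fact k * norm x ^ k) \<partial>lborel \<partial>lborel)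
      \<le> ennreal (\<delta> powr (- s) * (moment_coeff (real DIM('a)) s (real j) k * (2 * sqrt q) ^ k))" (is "?l \<le> _") for k
  proof -
    have "?l = (\<integral>\<^sup>+t. \<integral>\<^sup>+x. ennreal (e ^ k / fact k) * ennreal (tgauss \<delta> s c j t (x::'a) * norm x ^ (j + k)) \<partial>lborel \<partial>lborel)"
      using assms by (intro nn_integral_cong) (simp add: ennreal_mult[symmetric] power_add mult_ac)
    also have "\<dots> = ennreal (e ^ k / fact k) * ennreal (\<delta> powr (- s) * moment_coeff (real DIM('a)) s (real j) k * fact k * (1 / sqrt (c * \<delta>)) ^ k)"
      using assms by (simp add: nn_integral_cmult tgauss_moment)
    also have "\<dots> = ennreal (e ^ k / fact k * (\<delta> powr (- s) * moment_coeff (real DIM('a)) s (real j) k * fact k * (1 / sqrt (c * \<delta>)) ^ k))"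
      using assms by (intro ennreal_mult[symmetric] mult_nonneg_nonneg) (auto simp: moment_coeff_nonneg)
    also have "e ^ k / fact k * (\<delta> powr (- s) * moment_coeff (real DIM('a)) s (real j) k * fact k * (1 / sqrt (c * \<delta>)) ^ k)
       = \<delta> powr (- s) * (moment_coeff (real DIM('a)) s (real j) k * (e / sqrt (c * \<delta>)) ^ k)"
      by (simp add: power_divide)
    also have "ennreal \<dots> \<le> ennreal (\<delta> powr (- s) * (moment_coeff (real DIM('a)) s (real j) k * (2 * sqrt q) ^ k))"
      using assms by (intro ennreal_leI mult_left_mono power_mono e) (auto simp: moment_coeff_nonneg)
    finally show ?thesis .
  qed
  have "(\<integral>\<^sup>+t. \<integral>\<^sup>+x. ennreal (tgauss \<delta> s c j t (x::'a) * norm x ^ j) * ennreal (exp (e * norm x)) \<partial>lborel \<partial>lborel)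
      = (\<integral>\<^sup>+t. \<integral>\<^sup>+x. (\<Sum>k. ennreal (tgauss \<delta> s c j t (x::'a) * norm x ^ j) * ennreal (e ^ k / fact k * norm x ^ k)) \<partial>lborel \<partial>lborel)"
    unfolding E ennreal_suminf_cmult ..
  also have "\<dots> = (\<Sum>k. \<integral>\<^sup>+t. \<integral>\<^sup>+x. ennreal (tgauss \<delta> s c j t (x::'a) * norm x ^ j) * ennreal (e ^ k / fact k * norm x ^ k) \<partial>lborel \<partial>lborel)"
    by (subst nn_integral_suminf, measurable, subst nn_integral_suminf) auto
  also have "\<dots> \<le> (\<Sum>k. ennreal (\<delta> powr (- s) * (moment_coeff (real DIM('a)) s (real j) k * (2 * sqrt q) ^ k)))"
    by (intro suminf_le coeff) auto
  also have "\<dots> = ennreal (\<Sum>k. \<delta> powr (- s) * (moment_coeff (real DIM('a)) s (real j) k * (2 * sqrt q) ^ k))"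
    using assms by (intro suminf_ennreal2 summable_mult summ) (auto intro!: mult_nonneg_nonneg simp: moment_coeff_nonneg)
  also have "(\<Sum>k. \<delta> powr (- s) * (moment_coeff (real DIM('a)) s (real j) k * (2 * sqrt q) ^ k))
     = \<delta> powr (- s) * (\<Sum>k. moment_coeff (real DIM('a)) s (real j) k * (2 * sqrt q) ^ k)"
    by (rule suminf_mult[OF summ])
  finally show ?thesis .
qed

lemma tgauss_mass:
  fixes \<delta> c :: real
  assumes "\<delta> > 0" "c > 0"
  shows "(\<integral>\<^sup>+t. \<integral>\<^sup>+x. ennreal (tgauss \<delta> 1 c 0 t (x::'a::euclidean_space)) \<partial>lborel \<partial>lborel) = ennreal (1 / \<delta>)"
proof -
  have "Gamma (real DIM('a) / 2) > 0" by (intro Gamma_real_pos) simp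
  then show ?thesis
    using tgauss_moment[of \<delta> 1 c 0 0, where 'a = 'a] assms by (simp add: moment_coeff_def powr_minus_divide less_imp_neq[THEN not_sym])
qed

text \<open>The mass without exponential weight, the endpoint of the interpolation that produces the
  power of Gamma (1/2).\<close>

lemma tgauss_gradient_mass:
  fixes \<delta> c :: real and b :: "'a::euclidean_space"
  assumes "\<delta> > 0" "c > 0" "b \<in> Basis"
  shows "(\<integral>\<^sup>+t. \<integral>\<^sup>+x. ennreal (tgauss \<delta> (1 / 2) c 1 t x * \<bar>x \<bullet> b\<bar>) \<partial>lborel \<partial>lborel) \<le> ennreal (Gamma (1 / 2) * \<delta> powr (- (1 / 2)))"
proof -
  have "(\<integral>\<^sup>+x. ennreal (tgauss \<delta> (1 / 2) c 1 t x * \<bar>x \<bullet> b\<bar>) \<partial>lborel) \<le> indicator {0<..} t * ennreal (t powr (1 / 2 - 1) * exp (- \<delta> * t))" for t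
  proof (cases "t > 0")
    case True
    let ?K = "exp (- \<delta> * t) * t powr (1 / 2 - 1) * (c / t) powr (1 / 2)"
    have "(\<integral>\<^sup>+x. ennreal (tgauss \<delta> (1 / 2) c 1 t x * \<bar>x \<bullet> b\<bar>) \<partial>lborel)
        = (\<integral>\<^sup>+x. ennreal ?K * ennreal (gauss c t x * \<bar>x \<bullet> b\<bar>) \<partial>lborel)"
      using True by (intro nn_integral_cong) (simp add: tgauss_def ennreal_mult[symmetric] mult.assoc)
    also have "\<dots> = ennreal ?K * (\<integral>\<^sup>+x. ennreal (gauss c t x * \<bar>x \<bullet> b\<bar>) \<partial>lborel)"
      by (rule nn_integral_cmult) measurable
    also have "\<dots> \<le> ennreal ?K * ennreal (sqrt (t / c))"
      by (intro mult_left_mono gauss_abs_component True assms) simp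
    also have "\<dots> = ennreal (exp (- \<delta> * t) * t powr (1 / 2 - 1) * (sqrt (c / t) * sqrt (t / c)))"
      using True assms by (simp add: ennreal_mult[symmetric] powr_half_sqrt mult.assoc)
    also have "sqrt (c / t) * sqrt (t / c) = 1" using True assms by (simp flip: real_sqrt_mult)
    finally show ?thesis using True by (simp add: mult_ac)
  qed (simp add: tgauss_def)
  then have "(\<integral>\<^sup>+t. \<integral>\<^sup>+x. ennreal (tgauss \<delta> (1 / 2) c 1 t x * \<bar>x \<bullet> b\<bar>) \<partial>lborel \<partial>lborel)
     \<le> (\<integral>\<^sup>+t. indicator {0<..} t * ennreal (t powr (1 / 2 - 1) * exp (- \<delta> * t)) \<partial>lborel)"
    by (rule nn_integral_mono)
  also have "\<dots> = ennreal (Gamma (1 / 2) * \<delta> powr (- (1 / 2)))"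
    by (rule nn_integral_Gamma) (use assms in auto)
  finally show ?thesis .
qed

section \<open>Test functions\<close>

text \<open>The powers of \<open>1 / r\<close> close the family under differentiation, which yields smoothness by induction.\<close>

definition flat :: "nat \<Rightarrow> real \<Rightarrow> real \<Rightarrow> real" where
  "flat k s r = (if r > 0 then exp (- s / r) / r ^ k else 0)"

lemma power_le_exp: "x \<ge> 0 \<Longrightarrow> x ^ m / fact m \<le> exp (x :: real)"
  using sum_le_suminf[OF summable_exp_generic[of x], of "{m}"] by (simp add: exp_def divide_inverse mult.commute)

text \<open>exp (s/r) is at least its Taylor term of order k + 2. Order k would bound
  \<open>flat k s r\<close>; the two further powers of r give the derivative 0 at the
  origin.\<close>

lemma flat_le:
  assumes "s > 0" "r > 0"
  shows "flat k s r \<le> fact (k + 2) / s ^ (k + 2) * r\<^sup>2"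
proof -
  have "(s / r) ^ (k + 2) / fact (k + 2) \<le> exp (s / r)" using assms by (intro power_le_exp) auto
  moreover have "inverse E \<le> F * rm / sm" if "sm / rm / F \<le> E" "E > 0" "F > 0" "rm > 0" "sm > 0" for sm rm F E :: real
    using that by (simp add: field_simps)
  ultimately have "inverse (exp (s / r)) \<le> fact (k + 2) * r ^ (k + 2) / s ^ (k + 2)"
    using assms unfolding power_divide by (meson exp_gt_zero fact_gt_zero zero_less_power)
  then have "exp (- s / r) \<le> fact (k + 2) * r ^ (k + 2) / s ^ (k + 2)"
    by (simp only: minus_divide_left[symmetric] exp_minus)
  then have "exp (- s / r) / r ^ k \<le> fact (k + 2) * r ^ (k + 2) / s ^ (k + 2) / r ^ k"
    using assms by (intro divide_right_mono) auto
  also have "\<dots> = fact (k + 2) / s ^ (k + 2) * r\<^sup>2" using assms by (simp add: power_add power2_eq_square)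
  finally show ?thesis using assms by (simp add: flat_def)
qed

lemma flat_has_derivative:
  assumes "s > 0"
  shows "(flat k s has_real_derivative (- real k * flat (k + 1) s r + s * flat (k + 2) s r)) (at r)"
proof -
  consider "r > 0" | "r < 0" | "r = 0" by linarith
  then show ?thesis
  proof cases
    case 1
    have "((\<lambda>r. exp (- s / r) / r ^ k) has_real_derivative
        ((exp (- s / r) * (s / r\<^sup>2)) * r ^ k - exp (- s / r) * (real k * r ^ (k - 1))) / (r ^ k * r ^ k)) (at r)"
      using 1 by (auto intro!: derivative_eq_intros simp: power2_eq_square)
    also have "((exp (- s / r) * (s / r\<^sup>2)) * r ^ k - exp (- s / r) * (real k * r ^ (k - 1))) / (r ^ k * r ^ k)
        = - real k * flat (k + 1) s r + s * flat (k + 2) s r"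
    proof (cases k)
      case (Suc n)
      then show ?thesis using 1 by (simp add: flat_def power2_eq_square field_simps)
    qed (use 1 in \<open>simp add: flat_def power2_eq_square field_simps\<close>)
    finally show ?thesis
      by (rule has_field_derivative_transform_within_open[of _ _ _ "{0<..}"]) (use 1 in \<open>auto simp: flat_def\<close>)
  next
    case 2
    have "((\<lambda>_. 0) has_real_derivative 0) (at r)" by simp
    then have "(flat k s has_real_derivative 0) (at r)"
      by (rule has_field_derivative_transform_within_open[of _ _ _ "{..<0}"]) (use 2 in \<open>auto simp: flat_def\<close>)
    then show ?thesis using 2 by (simp add: flat_def)
  next
    case 3
    define M where "M = fact (k + 2) / s ^ (k + 2)"
    have M0: "M \<ge> 0" using assms unfolding M_def by (intro divide_nonneg_nonneg) auto
    have "((\<lambda>y. flat k s y / y) \<longlongrightarrow> 0) (at 0)"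
    proof (rule Lim_null_comparison)
      have "norm (flat k s y / y) \<le> M * \<bar>y\<bar>" for y
      proof (cases "y > 0")
        case True
        then have "flat k s y / y \<le> M * y\<^sup>2 / y"
          using flat_le[OF assms True, of k] by (intro divide_right_mono) (auto simp: M_def)
        moreover have "flat k s y \<ge> 0" by (simp add: flat_def)
        ultimately show ?thesis using True by (simp add: power2_eq_square)
      qed (simp add: flat_def M0 mult_nonneg_nonpos)
      then show "eventually (\<lambda>y. norm (flat k s y / y) \<le> M * \<bar>y\<bar>) (at 0)" by simp
      show "((\<lambda>y. M * \<bar>y\<bar>) \<longlongrightarrow> 0) (at 0)" by (auto intro!: tendsto_eq_intros)
    qed
    then have "(flat k s has_real_derivative 0) (at 0)"
      by (simp add: has_field_derivative_iff flat_def)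
    then show ?thesis using 3 by (simp add: flat_def)
  qed
qed

text \<open>The algebra generated by flat functions of single coordinates. It is closed under
  \<open>partial i\<close>, so smoothness reduces to the differentiability of its members; the signs
  \<sigma> = 1 and \<sigma> = - 1 give opposite faces of a box.\<close>

inductive_set bumps :: "(real^'d \<Rightarrow> real) set" where
  gen: "s > 0 \<Longrightarrow> (\<lambda>x. flat k s (\<sigma> * (x $ j - c))) \<in> bumps"
| const: "(\<lambda>x. c) \<in> bumps"
| add: "f \<in> bumps \<Longrightarrow> g \<in> bumps \<Longrightarrow> (\<lambda>x. f x + g x) \<in> bumps"
| mult: "f \<in> bumps \<Longrightarrow> g \<in> bumps \<Longrightarrow> (\<lambda>x. f x * g x) \<in> bumps"

lemma partial_eq:
  assumes "\<And>x. (f has_derivative f' x) (at x)"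
  shows "partial i f = (\<lambda>x. f' x (axis i 1))"
  using frechet_derivative_at[OF assms] by (auto simp: partial_def fun_eq_iff)

lemma bumps_partial:
  fixes f :: "real^'d \<Rightarrow> real"
  assumes "f \<in> bumps"
  shows "f differentiable_on UNIV \<and> (\<forall>i. partial i f \<in> bumps)"
  using assms
proof induction
  case (gen s k \<sigma> j c)
  let ?D = "\<lambda>x. - real k * flat (k + 1) s (\<sigma> * (x $ j - c)) + s * flat (k + 2) s (\<sigma> * (x $ j - c))"
  have d: "((\<lambda>x. flat k s (\<sigma> * (x $ j - c))) has_derivative (\<lambda>h. ?D x * (\<sigma> * h $ j))) (at x)" for x
  proof -
    have "((\<lambda>x. \<sigma> * (x $ j - c)) has_derivative (\<lambda>h. \<sigma> * h $ j)) (at x)"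
      by (auto intro!: derivative_eq_intros bounded_linear.has_derivative[OF bounded_linear_vec_nth])
    from has_derivative_compose[OF this flat_has_derivative[OF gen, unfolded has_field_derivative_def]]
    show ?thesis .
  qed
  have "partial i (\<lambda>x. flat k s (\<sigma> * (x $ j - c))) = (\<lambda>x. ?D x * (\<sigma> * axis i 1 $ j))" for i
    by (rule partial_eq) (rule d)
  moreover have "(\<lambda>x. ?D x * (\<sigma> * axis i 1 $ j)) \<in> bumps" for i
    by (intro bumps.intros gen)
  ultimately show ?case using d by (auto simp: differentiable_on_def differentiable_def)
next
  case (const c)
  have "partial i (\<lambda>x::real^'d. c) = (\<lambda>x. 0)" for i by (rule partial_eq) simp
  then show ?case by (auto intro: bumps.const)
next
  case (add f g)
  then have d: "(f has_derivative frechet_derivative f (at x)) (at x)" "(g has_derivative frechet_derivative g (at x)) (at x)" for x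
    by (auto simp: differentiable_on_def frechet_derivative_works)
  note s = has_derivative_add[OF d]
  have "partial i (\<lambda>x. f x + g x) = (\<lambda>x. partial i f x + partial i g x)" for i
    unfolding partial_eq[OF s] by (simp add: partial_def)
  then show ?case using add s by (auto simp: differentiable_on_def differentiable_def intro: bumps.add)
next
  case (mult f g)
  then have d: "(f has_derivative frechet_derivative f (at x)) (at x)" "(g has_derivative frechet_derivative g (at x)) (at x)" for x
    by (auto simp: differentiable_on_def frechet_derivative_works)
  note s = has_derivative_mult[OF d]
  have "partial i (\<lambda>x. f x * g x) = (\<lambda>x. f x * partial i g x + partial i f x * g x)" for i
    unfolding partial_eq[OF s] by (simp add: partial_def)
  then show ?case using mult s by (auto simp: differentiable_on_def differentiable_def intro!: bumps.intros)
qed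

lemma bumps_smooth:
  assumes "f \<in> bumps"
  shows "smooth f"
proof -
  have "foldr partial is f \<in> bumps" for "is"
    using assms bumps_partial by (induction "is") auto
  then show ?thesis using bumps_partial by (auto simp: smooth_def)
qed

text \<open>Positive exactly on the open box. For r > 0 each factor exp (- 1/((n + 1) r)) tends to 1
  as n grows, so these test functions approximate the indicator of the box from below.\<close>

definition box_bump :: "nat \<Rightarrow> real^'d \<Rightarrow> real^'d \<Rightarrow> real^'d \<Rightarrow> real" where
  "box_bump n a b x = (\<Prod>j\<in>UNIV. flat 0 (inverse (Suc n)) (1 * (x $ j - a $ j)) * flat 0 (inverse (Suc n)) (- 1 * (x $ j - b $ j)))"

lemma box_bump_zero: "x \<notin> box a b \<Longrightarrow> box_bump n a b x = 0"
  by (auto simp: box_bump_def mem_box_cart flat_def prod_zero_iff)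

lemma box_bump_test:
  fixes a b :: "real^'d"
  shows "test_function (box_bump n a b)"
proof -
  have p: "(\<lambda>x. \<Prod>j\<in>J. f j x) \<in> bumps" if "finite J" "\<And>j. f j \<in> bumps" for J :: "'d set" and f
    using that(1) by induction (auto intro: that bumps.intros)
  have "box_bump n a b \<in> bumps"
    unfolding box_bump_def[abs_def] by (intro p bumps.mult bumps.gen) auto
  moreover have "compact (closure {x. box_bump n a b x \<noteq> 0})"
  proof -
    have "{x. box_bump n a b x \<noteq> 0} \<subseteq> box a b" using box_bump_zero by blast
    then have "bounded {x. box_bump n a b x \<noteq> 0}" using bounded_box bounded_subset by blast
    then show ?thesis by (simp add: compact_closure)
  qed
  ultimately show ?thesis by (simp add: test_function_def bumps_smooth)
qed

lemma box_bump_bounds: "0 \<le> box_bump n a b x" "box_bump n a b x \<le> 1"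
proof -
  have "0 \<le> flat 0 (inverse (Suc n)) r" "flat 0 (inverse (Suc n)) r \<le> 1" for r
    by (auto simp: flat_def)
  then show "0 \<le> box_bump n a b x" "box_bump n a b x \<le> 1"
    unfolding box_bump_def by (auto intro!: prod_nonneg prod_le_1 mult_le_one)
qed

lemma box_bump_tendsto:
  fixes a b x :: "real^'d"
  shows "(\<lambda>n. box_bump n a b x) \<longlonglongrightarrow> indicator (box a b) x"
proof (cases "x \<in> box a b")
  case True
  have f: "(\<lambda>n. flat 0 (inverse (Suc n)) r) \<longlonglongrightarrow> 1" if "r > 0" for r
  proof -
    have "(\<lambda>n. exp (- inverse (real (Suc n)) / r)) \<longlonglongrightarrow> exp (- 0 / r)"
      using that by (intro tendsto_intros LIMSEQ_inverse_real_of_nat) auto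
    then show ?thesis using that by (simp add: flat_def)
  qed
  have "(\<lambda>n. box_bump n a b x) \<longlonglongrightarrow> (\<Prod>j\<in>(UNIV :: 'd set). 1 * 1)"
    unfolding box_bump_def by (intro tendsto_prod tendsto_mult f) (use True in \<open>auto simp: mem_box_cart\<close>)
  then show ?thesis using True by simp
qed (simp add: box_bump_zero)

text \<open>\<open>ennreal\<close> cuts off negative values, so the two densities are the positive
  and the negative part of \<open>u\<close>. Their integrals over boxes are finite and equal; boxes
  are closed under intersection and generate the Borel sets, hence the two measures agree, and
  densities are unique almost everywhere.\<close>

lemma AE_zero_of_box_integrals:
  fixes u :: "'a::euclidean_space \<Rightarrow> real"
  assumes [measurable]: "u \<in> borel_measurable borel"
    and int: "\<And>a b. integrable lborel (\<lambda>x. indicator (box a b) x * u x)"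
    and zero: "\<And>a b. (LINT x|lborel. indicator (box a b) x * u x) = 0"
  shows "AE x in lborel. u x = 0"
proof -
  have box: "emeasure (density lborel (\<lambda>x. ennreal (s * u x))) (box a b) = (\<integral>\<^sup>+x. ennreal (s * (indicator (box a b) x * u x)) \<partial>lborel)" for a b s
    by (subst emeasure_density) (auto intro!: nn_integral_cong simp: indicator_def)
  have fin: "(\<integral>\<^sup>+x. ennreal (s * (indicator (box a b) x * u x)) \<partial>lborel) < \<infinity>" for a b s
  proof -
    have "(\<integral>\<^sup>+x. ennreal (s * (indicator (box a b) x * u x)) \<partial>lborel) \<le> (\<integral>\<^sup>+x. ennreal (norm (s * (indicator (box a b) x * u x))) \<partial>lborel)"
      by (intro nn_integral_mono ennreal_leI) auto
    also have "\<dots> < \<infinity>" using integrable_mult_right[OF int, of s a b] unfolding integrable_iff_bounded by (rule conjunct2)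
    finally show ?thesis .
  qed
  have "density lborel (\<lambda>x. ennreal (1 * u x)) = density lborel (\<lambda>x. ennreal (- 1 * u x))"
  proof (rule measure_eqI_generator_eq[where E = "range (\<lambda>(a, b). box a b)" and \<Omega> = UNIV
        and A = "\<lambda>n::nat. box (- (real n *\<^sub>R One)) (real n *\<^sub>R One)"])
    show "Int_stable (range (\<lambda>(a, b). box a b :: 'a set))"
      by (auto simp: Int_stable_def box_Int_box)
    fix X :: "'a set" assume "X \<in> range (\<lambda>(a, b). box a b)"
    then obtain a b where X: "X = box a b" by auto
    let ?g = "\<lambda>x. indicator (box a b) x * u x"
    obtain p where p: "(\<integral>\<^sup>+x. ennreal (?g x) \<partial>lborel) = ennreal p" "p \<ge> 0" using fin[of 1 a b] by (cases "\<integral>\<^sup>+x. ennreal (?g x) \<partial>lborel") auto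
    obtain m where m: "(\<integral>\<^sup>+x. ennreal (- ?g x) \<partial>lborel) = ennreal m" "m \<ge> 0" using fin[of "- 1" a b] by (cases "\<integral>\<^sup>+x. ennreal (- ?g x) \<partial>lborel") auto
    have "0 = p - m" using real_lebesgue_integral_def[OF int, of a b] zero[of a b] p m by simp
    then show "emeasure (density lborel (\<lambda>x. ennreal (1 * u x))) X = emeasure (density lborel (\<lambda>x. ennreal (- 1 * u x))) X"
      unfolding X box using p m by simp
  next
    show "(\<Union>n::nat. box (- (real n *\<^sub>R One)) (real n *\<^sub>R One)) = (UNIV :: 'a set)" by (rule UN_box_eq_UNIV)
    show "emeasure (density lborel (\<lambda>x. ennreal (1 * u x))) (box (- (real n *\<^sub>R One)) (real n *\<^sub>R One)) \<noteq> \<infinity>" for n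
      unfolding box using fin[of 1] by (simp add: less_top)
  qed (auto simp: borel_eq_box)
  then have "AE x in lborel. ennreal (1 * u x) = ennreal (- 1 * u x)"
    by (subst (asm) sigma_finite_measure.density_unique_iff[OF sigma_finite_lborel]) auto
  then show ?thesis
  proof eventually_elim
    fix x assume "ennreal (1 * u x) = ennreal (- 1 * u x)"
    then show "u x = 0"
      by (cases "u x \<ge> 0") (auto simp: ennreal_neg dest: sym)
  qed
qed

text \<open>The fundamental lemma of the calculus of variations, by dominated convergence along
  \<open>box_bump\<close>. It serves the uniqueness of weak derivatives.\<close>

lemma AE_zero_of_test_functions:
  fixes u :: "real^'d \<Rightarrow> real"
  assumes [measurable]: "u \<in> borel_measurable borel"
    and loc: "\<And>K. compact K \<Longrightarrow> integrable lborel (\<lambda>x. indicator K x * u x)"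
    and zero: "\<And>\<phi>. test_function \<phi> \<Longrightarrow> (LINT x|lborel. \<phi> x * u x) = 0"
  shows "AE x in lborel. u x = 0"
proof (rule AE_zero_of_box_integrals)
  fix a b :: "real^'d"
  have c: "integrable lborel (\<lambda>x. indicator (cbox a b) x * u x)" by (rule loc) simp
  show i: "integrable lborel (\<lambda>x. indicator (box a b) x * u x)"
    by (rule Bochner_Integration.integrable_bound[OF c]) (use box_subset_cbox[of a b] in \<open>auto simp: indicator_def\<close>)
  have [measurable]: "box_bump n a b \<in> borel_measurable borel" for n
    using box_bump_test[of n a b]
    by (intro borel_measurable_continuous_onI differentiable_imp_continuous_on)
      (auto simp: test_function_def smooth_def dest: spec[of _ "[]"])
  have "(\<lambda>n. LINT x|lborel. box_bump n a b x * u x) \<longlonglongrightarrow> (LINT x|lborel. indicator (box a b) x * u x)"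
  proof (rule integral_dominated_convergence[where w = "\<lambda>x. norm (indicator (box a b) x * u x)"])
    show "integrable lborel (\<lambda>x. norm (indicator (box a b) x * u x))" by (intro integrable_norm i)
    show "AE x in lborel. (\<lambda>n. box_bump n a b x * u x) \<longlonglongrightarrow> indicator (box a b) x * u x"
      by (intro AE_I2 tendsto_mult_right box_bump_tendsto)
    show "AE x in lborel. norm (box_bump n a b x * u x) \<le> norm (indicator (box a b) x * u x)" for n
    proof (rule AE_I2)
      fix x
      show "norm (box_bump n a b x * u x) \<le> norm (indicator (box a b) x * u x)"
        using box_bump_bounds[of n a b x] box_bump_zero[of x a b n]
        by (cases "x \<in> box a b") (auto simp: abs_mult mult_left_le_one_le)
    qed
  qed auto
  moreover have "(LINT x|lborel. box_bump n a b x * u x) = 0" for n by (intro zero box_bump_test)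
  ultimately show "(LINT x|lborel. indicator (box a b) x * u x) = 0" by (simp add: LIMSEQ_const_iff)
qed measurable

section \<open>Integration by parts against test functions\<close>

lemma test_function_facts:
  fixes \<phi> :: "real^'d \<Rightarrow> real"
  assumes "test_function \<phi>"
  shows test_continuous: "continuous_on UNIV \<phi>" and test_partial_continuous: "continuous_on UNIV (partial i \<phi>)"
    and test_partial_derivative: "((\<lambda>s. \<phi> (x + s *\<^sub>R axis i 1)) has_real_derivative partial i \<phi> (x + t *\<^sub>R axis i 1)) (at t)"
    and test_support: "x \<notin> closure {x. \<phi> x \<noteq> 0} \<Longrightarrow> \<phi> x = 0" "x \<notin> closure {x. \<phi> x \<noteq> 0} \<Longrightarrow> partial i \<phi> x = 0"
    and test_compact: "compact (closure {x. \<phi> x \<noteq> 0})"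
proof -
  have d: "foldr partial is \<phi> differentiable_on UNIV" for "is" using assms by (auto simp: test_function_def smooth_def)
  have d0: "(\<phi> has_derivative frechet_derivative \<phi> (at x)) (at x)" for x
    using d[of "[]"] by (auto simp: differentiable_on_def frechet_derivative_works)
  show "continuous_on UNIV \<phi>" using d[of "[]"] by (simp add: differentiable_imp_continuous_on)
  show "continuous_on UNIV (partial i \<phi>)" using d[of "[i]"] by (simp add: differentiable_imp_continuous_on)
  have "((\<lambda>s. x + s *\<^sub>R axis i 1) has_derivative (\<lambda>h. h *\<^sub>R axis i 1)) (at t)"
    by (auto intro!: derivative_eq_intros)
  from has_derivative_compose[OF this d0]
  show "((\<lambda>s. \<phi> (x + s *\<^sub>R axis i 1)) has_real_derivative partial i \<phi> (x + t *\<^sub>R axis i 1)) (at t)"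
  proof -
    assume "((\<lambda>s. \<phi> (x + s *\<^sub>R axis i 1)) has_derivative (\<lambda>h. frechet_derivative \<phi> (at (x + t *\<^sub>R axis i 1)) (h *\<^sub>R axis i 1))) (at t)"
    moreover have "(\<lambda>h. frechet_derivative \<phi> (at (x + t *\<^sub>R axis i 1)) (h *\<^sub>R axis i 1)) = (*) (partial i \<phi> (x + t *\<^sub>R axis i 1))"
      using linear_scale[OF has_derivative_linear[OF d0]] by (auto simp: partial_def fun_eq_iff)
    ultimately show ?thesis by (simp add: has_field_derivative_def)
  qed
  show s: "\<phi> x = 0" if "x \<notin> closure {x. \<phi> x \<noteq> 0}" for x
  proof (rule ccontr)
    assume "\<phi> x \<noteq> 0"
    then have "x \<in> {x. \<phi> x \<noteq> 0}" by simp
    then have "x \<in> closure {x. \<phi> x \<noteq> 0}" by (rule subsetD[OF closure_subset])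
    with that show False ..
  qed
  show "compact (closure {x. \<phi> x \<noteq> 0})" using assms by (simp add: test_function_def)
  assume x: "x \<notin> closure {x. \<phi> x \<noteq> 0}"
  have "((\<lambda>_. 0) has_derivative (\<lambda>_. 0)) (at x)" by simp
  then have "(\<phi> has_derivative (\<lambda>_. 0)) (at x)"
  proof (rule has_derivative_transform_within_open)
    show "open (- closure {x. \<phi> x \<noteq> 0})" by (rule open_Compl) (rule closed_closure)
    show "x \<in> - closure {x. \<phi> x \<noteq> 0}" using x by (simp only: Compl_iff) simp
    show "0 = \<phi> y" if "y \<in> - closure {x. \<phi> x \<noteq> 0}" for y
      by (rule sym, rule s, rule ComplD, rule that)
  qed
  then have "(\<lambda>_. 0) = frechet_derivative \<phi> (at x)" by (rule frechet_derivative_at)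
  then show "partial i \<phi> x = 0" unfolding partial_def by metis
qed

lemma integrable_continuous_compact_support:
  fixes f :: "'a::euclidean_space \<Rightarrow> 'b::euclidean_space"
  assumes "continuous_on UNIV f" "compact K" "\<And>x. x \<notin> K \<Longrightarrow> f x = 0"
  shows "integrable lborel f"
proof -
  have "integrable lborel (\<lambda>x. indicator K x *\<^sub>R f x)"
    by (intro borel_integrable_compact assms continuous_on_subset[OF assms(1)]) auto
  moreover have "(\<lambda>x. indicator K x *\<^sub>R f x) = f" using assms(3) by (auto simp: indicator_def)
  ultimately show ?thesis by simp
qed

text \<open>Difference quotients of \<open>P\<close> along \<open>e\<close> integrate to 0 by
  translation invariance. The mean value inequality bounds them by a bound for \<open>Q\<close>, and
  since the steps \<open>h n\<close> are at most 1 they vanish outside the ball of radius r + |e|;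
  dominated convergence passes to \<open>Q\<close>.\<close>

lemma integral_directional_derivative_zero:
  fixes P Q :: "'a::euclidean_space \<Rightarrow> 'b::euclidean_space"
  assumes P: "continuous_on UNIV P" and Q: "continuous_on UNIV Q" and K: "compact K"
    and supp: "\<And>x. x \<notin> K \<Longrightarrow> P x = 0" "\<And>x. x \<notin> K \<Longrightarrow> Q x = 0"
    and der: "\<And>x t. ((\<lambda>s. P (x + s *\<^sub>R e)) has_vector_derivative Q (x + t *\<^sub>R e)) (at t)"
  shows "(LINT x|lborel. Q x) = 0"
proof -
  have [measurable]: "P \<in> borel_measurable borel" "Q \<in> borel_measurable borel"
    using P Q by (auto intro: borel_measurable_continuous_onI)
  obtain M where M: "\<And>x. norm (Q x) \<le> M" "M \<ge> 0"
  proof -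
    have "bounded (Q ` K)" by (intro compact_imp_bounded compact_continuous_image K continuous_on_subset[OF Q]) auto
    then obtain M where "\<And>x. x \<in> K \<Longrightarrow> norm (Q x) \<le> M" by (auto simp: bounded_iff)
    then show thesis by (intro that[of "max M 0"]) (metis max.coboundedI1 max.coboundedI2 norm_zero order_refl supp(2), simp)
  qed
  obtain r where r: "\<And>x. x \<in> K \<Longrightarrow> norm x \<le> r" using compact_imp_bounded[OF K] by (auto simp: bounded_iff)
  define h where "h n = inverse (real (Suc n))" for n
  have h: "h n > 0" "h n \<le> 1" for n by (auto simp: h_def field_simps)
  have h0: "h \<longlonglongrightarrow> 0" unfolding h_def[abs_def] by (rule LIMSEQ_inverse_real_of_nat)
  define D where "D n x = (P (x + h n *\<^sub>R e) - P x) /\<^sub>R h n" for n x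
  have lip: "norm (P (x + h n *\<^sub>R e) - P x) \<le> M * h n" for n x
  proof -
    have "norm (P (x + h n *\<^sub>R e) - P (x + 0 *\<^sub>R e)) \<le> M * norm (h n - 0)"
    proof (rule differentiable_bound[of "{0..h n}" "\<lambda>s. P (x + s *\<^sub>R e)" "\<lambda>t u. u *\<^sub>R Q (x + t *\<^sub>R e)"])
      show "((\<lambda>s. P (x + s *\<^sub>R e)) has_derivative (\<lambda>u. u *\<^sub>R Q (x + t *\<^sub>R e))) (at t within {0..h n})" for t
        using der[of x t] by (auto simp: has_vector_derivative_def intro: has_derivative_at_withinI)
      show "onorm (\<lambda>u. u *\<^sub>R Q (x + t *\<^sub>R e)) \<le> M" for t
        by (rule onorm_le) (simp add: mult.commute[of M] mult_left_mono M)
    qed (use h[of n] in auto)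
    then show ?thesis using h[of n] by simp
  qed
  have "(\<lambda>n. LINT x|lborel. D n x) \<longlonglongrightarrow> (LINT x|lborel. Q x)"
  proof (rule integral_dominated_convergence[where w = "\<lambda>x. M * indicator (cball 0 (r + norm e)) x"])
    show "integrable lborel (\<lambda>x::'a. M * indicator (cball 0 (r + norm e)) x)"
      using emeasure_lborel_cball_finite[of 0 "r + norm e"] by (auto intro!: integrable_mult_right)
    show "AE x in lborel. (\<lambda>n. D n x) \<longlonglongrightarrow> Q x"
    proof (rule AE_I2)
      fix x
      have l: "((\<lambda>y. norm (P (x + y *\<^sub>R e) - P x - y *\<^sub>R Q x) / norm y) \<longlongrightarrow> 0) (at 0)"
        using der[of x 0] by (simp add: has_vector_derivative_def has_derivative_at)
      have n: "norm (P (x + y *\<^sub>R e) - P x - y *\<^sub>R Q x) / norm y = norm ((P (x + y *\<^sub>R e) - P x) /\<^sub>R y - Q x)"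
        if "y \<noteq> 0" for y
      proof -
        have "(P (x + y *\<^sub>R e) - P x) /\<^sub>R y - Q x = inverse y *\<^sub>R (P (x + y *\<^sub>R e) - P x - y *\<^sub>R Q x)"
          using that by (simp add: scaleR_diff_right)
        then show ?thesis by (simp add: divide_inverse mult.commute)
      qed
      have "((\<lambda>y. norm ((P (x + y *\<^sub>R e) - P x) /\<^sub>R y - Q x)) \<longlongrightarrow> 0) (at 0)"
        by (rule Lim_transform_eventually[OF l]) (use n in \<open>auto simp: eventually_at_filter intro!: always_eventually\<close>)
      then have "((\<lambda>y. (P (x + y *\<^sub>R e) - P x) /\<^sub>R y) \<longlongrightarrow> Q x) (at 0)"
        by (simp add: tendsto_norm_zero_iff LIM_zero_iff)
      moreover have "filterlim h (at 0) sequentially"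
        by (rule filterlim_atI[OF h0]) (simp add: h_def)
      ultimately show "(\<lambda>n. D n x) \<longlonglongrightarrow> Q x"
        unfolding D_def by (rule filterlim_compose)
    qed
    show "AE x in lborel. norm (D n x) \<le> M * indicator (cball 0 (r + norm e)) x" for n
    proof (rule AE_I2)
      fix x
      show "norm (D n x) \<le> M * indicator (cball 0 (r + norm e)) x"
      proof (cases "norm x \<le> r + norm e")
        case True
        have "norm (D n x) = norm (P (x + h n *\<^sub>R e) - P x) / h n"
          using h(1)[of n] by (simp add: D_def divide_inverse mult.commute)
        also have "\<dots> \<le> M" using lip[of x n] h(1)[of n] by (simp add: divide_le_eq)
        finally show ?thesis using True by simp
      next
        case False
        have "x \<notin> K" using r[of x] False norm_ge_zero[of e] by linarith
        moreover have "x + h n *\<^sub>R e \<notin> K"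
        proof
          assume "x + h n *\<^sub>R e \<in> K"
          then have "norm (x + h n *\<^sub>R e) \<le> r" by (rule r)
          moreover have "norm x \<le> norm (x + h n *\<^sub>R e) + norm (h n *\<^sub>R e)" using norm_triangle_ineq4[of "x + h n *\<^sub>R e" "h n *\<^sub>R e"] by simp
          moreover have "norm (h n *\<^sub>R e) \<le> norm e" using h[of n] by (simp add: mult_left_le_one_le)
          ultimately show False using False by linarith
        qed
        ultimately show ?thesis using False by (simp add: D_def supp)
      qed
    qed
  qed (auto simp: D_def)
  moreover have "(LINT x|lborel. D n x) = 0" for n
  proof -
    have i: "integrable lborel P" by (rule integrable_continuous_compact_support[OF P K supp(1)])
    have i2: "integrable lborel (\<lambda>x. P (x + h n *\<^sub>R e))"
      using integrable_translate[of P "- (h n *\<^sub>R e)"] i by simp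
    have "(LINT x|lborel. P (x + h n *\<^sub>R e)) = (LINT x|lborel. P x)"
      using integral_translate[of P "- (h n *\<^sub>R e)"] by simp
    then show ?thesis unfolding D_def using i i2 by simp
  qed
  ultimately show ?thesis by (simp add: LIMSEQ_const_iff)
qed

text \<open>The product of \<phi> and \<open>F\<close> has compact support, so its derivative in
  direction i integrates to 0.\<close>

lemma test_function_by_parts:
  fixes F G :: "real^'d \<Rightarrow> complex"
  assumes \<phi>: "test_function \<phi>" and F: "continuous_on UNIV F" and G: "continuous_on UNIV G"
    and der: "\<And>x t. ((\<lambda>s. F (x + s *\<^sub>R axis i 1)) has_vector_derivative G (x + t *\<^sub>R axis i 1)) (at t)"
  shows "(LINT x|lborel. partial i \<phi> x *\<^sub>R F x) = - (LINT x|lborel. \<phi> x *\<^sub>R G x)"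
proof -
  let ?K = "closure {x. \<phi> x \<noteq> 0}"
  have c: "continuous_on UNIV (\<lambda>x. partial i \<phi> x *\<^sub>R F x)" "continuous_on UNIV (\<lambda>x. \<phi> x *\<^sub>R G x)"
    "continuous_on UNIV (\<lambda>x. \<phi> x *\<^sub>R F x)"
    by (intro continuous_intros test_continuous[OF \<phi>] test_partial_continuous[OF \<phi>] F G)+
  have i: "integrable lborel (\<lambda>x. partial i \<phi> x *\<^sub>R F x)" "integrable lborel (\<lambda>x. \<phi> x *\<^sub>R G x)"
  proof -
    show "integrable lborel (\<lambda>x. partial i \<phi> x *\<^sub>R F x)"
      by (rule integrable_continuous_compact_support[OF c(1) test_compact[OF \<phi>]])
        (subst test_support(2)[OF \<phi>], assumption, rule scaleR_zero_left)
    show "integrable lborel (\<lambda>x. \<phi> x *\<^sub>R G x)"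
      by (rule integrable_continuous_compact_support[OF c(2) test_compact[OF \<phi>]], subst test_support(1)[OF \<phi>], assumption)
        (rule scaleR_zero_left)
  qed
  have "(LINT x|lborel. \<phi> x *\<^sub>R G x + partial i \<phi> x *\<^sub>R F x) = 0"
  proof (rule integral_directional_derivative_zero[of "\<lambda>x. \<phi> x *\<^sub>R F x" _ ?K "axis i 1"])
    show "continuous_on UNIV (\<lambda>x. \<phi> x *\<^sub>R F x)" by (fact c(3))
    show "continuous_on UNIV (\<lambda>x. \<phi> x *\<^sub>R G x + partial i \<phi> x *\<^sub>R F x)" by (rule continuous_on_add[OF c(2,1)])
    show "compact ?K" by (fact test_compact[OF \<phi>])
    show "((\<lambda>s. \<phi> (x + s *\<^sub>R axis i 1) *\<^sub>R F (x + s *\<^sub>R axis i 1)) has_vector_derivative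
        \<phi> (x + t *\<^sub>R axis i 1) *\<^sub>R G (x + t *\<^sub>R axis i 1) + partial i \<phi> (x + t *\<^sub>R axis i 1) *\<^sub>R F (x + t *\<^sub>R axis i 1)) (at t)" for x t
      by (rule has_vector_derivative_scaleR[OF test_partial_derivative[OF \<phi>] der])
    fix x assume x: "x \<notin> ?K"
    have "\<phi> x = 0" "partial i \<phi> x = 0" by (rule test_support[OF \<phi> x])+
    then show "\<phi> x *\<^sub>R F x = 0" "\<phi> x *\<^sub>R G x + partial i \<phi> x *\<^sub>R F x = 0" by (simp_all only: scaleR_zero_left add_0)
  qed
  then show ?thesis using i by (simp add: add_eq_0_iff)
qed

section \<open>The resolvent kernel and its gradient\<close>

context weighted_flow begin

text \<open>Fubini for a test function against the operator; the absolute integral is finite because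
  tame functions are integrable on compact sets. In this form a derivative can be passed from the
  test function to the kernel.\<close>

lemma integral_test_swap:
  fixes \<kappa> :: "real \<Rightarrow> 'a \<Rightarrow> complex" and g :: "'a \<Rightarrow> complex" and \<psi> :: "'a \<Rightarrow> real"
  assumes \<kappa>: "(\<lambda>w. \<kappa> (fst w) (snd w)) \<in> borel_measurable (borel \<Otimes>\<^sub>M borel)"
    and [measurable]: "g \<in> borel_measurable borel"
    and \<psi>: "continuous_on UNIV \<psi>" "compact K" "\<And>x. x \<notin> K \<Longrightarrow> \<psi> x = 0"
    and tame: "tame (kop lborel (\<lambda>t x. ennreal (cmod (\<kappa> t x))) (\<lambda>x. ennreal (cmod (g x))))"
  shows "(LINT x|lborel. \<psi> x *\<^sub>R (LINT w|(lborel \<Otimes>\<^sub>M lborel). \<kappa> (fst w) (x - snd w) * g (R (fst w) (snd w))))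
    = (LINT w|(lborel \<Otimes>\<^sub>M lborel). (LINT x|lborel. \<psi> x *\<^sub>R \<kappa> (fst w) (x - snd w)) * g (R (fst w) (snd w)))"
proof -
  have [measurable (raw)]: "(\<lambda>w. \<kappa> (f w) (h w)) \<in> borel_measurable M"
    if [measurable]: "f \<in> borel_measurable M" "h \<in> borel_measurable M" for f h and M :: "'w measure"
    using measurable_compose[OF measurable_Pair[OF that] \<kappa>] by simp
  have [measurable]: "\<psi> \<in> borel_measurable borel" using \<psi>(1) by (rule borel_measurable_continuous_onI)
  have sf: "sigma_finite_measure (lborel \<Otimes>\<^sub>M lborel :: (real \<times> 'a) measure)"
    unfolding lborel_prod by (rule sigma_finite_lborel)
  interpret LL: pair_sigma_finite "lborel :: 'a measure" "lborel \<Otimes>\<^sub>M lborel :: (real \<times> 'a) measure" ..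
  obtain M where M: "\<And>x. \<bar>\<psi> x\<bar> \<le> M * indicator K x" "M \<ge> 0"
  proof -
    have "bounded (\<psi> ` K)" by (intro compact_imp_bounded compact_continuous_image \<psi>(2) continuous_on_subset[OF \<psi>(1)]) auto
    then obtain M where M: "\<And>x. x \<in> K \<Longrightarrow> norm (\<psi> x) \<le> M" by (auto simp: bounded_iff)
    have "\<bar>\<psi> x\<bar> \<le> max M 0 * indicator K x" for x
      using M[of x] \<psi>(3)[of x] by (cases "x \<in> K") auto
    then show thesis by (rule that) simp
  qed
  have [measurable]: "K \<in> sets borel" using \<psi>(2) by (simp add: borel_compact)
  let ?f = "\<lambda>x w. \<psi> x *\<^sub>R (\<kappa> (fst w) (x - snd w) * g (R (fst w) (snd w)))"
  let ?k = "kop lborel (\<lambda>t x. ennreal (cmod (\<kappa> t x))) (\<lambda>x. ennreal (cmod (g x)))"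
  have [measurable]: "?k \<in> borel_measurable borel" using tame by (simp add: tame_def)
  have int: "integrable (lborel \<Otimes>\<^sub>M (lborel \<Otimes>\<^sub>M lborel)) (\<lambda>(x, w). ?f x w)"
  proof (rule integrableI_bounded)
    have "(\<integral>\<^sup>+v. ennreal (norm (case v of (x, w) \<Rightarrow> ?f x w)) \<partial>(lborel \<Otimes>\<^sub>M (lborel \<Otimes>\<^sub>M lborel)))
        = (\<integral>\<^sup>+x. \<integral>\<^sup>+w. ennreal \<bar>\<psi> x\<bar> * (ennreal (cmod (\<kappa> (fst w) (x - snd w))) * ennreal (cmod (g (R (fst w) (snd w))))) \<partial>(lborel \<Otimes>\<^sub>M lborel) \<partial>lborel)"
      by (subst sigma_finite_measure.nn_integral_fst[OF sf, symmetric]) (simp_all add: norm_mult ennreal_mult)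
    also have "\<dots> = (\<integral>\<^sup>+x. ennreal \<bar>\<psi> x\<bar> * ?k x \<partial>lborel)"
      unfolding kop_def by (intro nn_integral_cong nn_integral_cmult) measurable
    also have "\<dots> \<le> (\<integral>\<^sup>+x. ennreal M * (?k x * indicator K x) \<partial>lborel)"
    proof (rule nn_integral_mono)
      fix x
      have "ennreal \<bar>\<psi> x\<bar> * ?k x \<le> ennreal (M * indicator K x) * ?k x"
        by (intro mult_right_mono ennreal_leI M) simp
      then show "ennreal \<bar>\<psi> x\<bar> * ?k x \<le> ennreal M * (?k x * indicator K x)"
        using M(2) by (simp add: ennreal_mult ennreal_indicator mult_ac)
    qed
    also have "\<dots> = ennreal M * (\<integral>\<^sup>+x. ?k x * indicator K x \<partial>lborel)" by (rule nn_integral_cmult) measurable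
    also have "\<dots> < \<infinity>" using tame_compact_finite[OF tame \<psi>(2)] by (simp add: ennreal_mult_less_top)
    finally show "(\<integral>\<^sup>+v. ennreal (norm (case v of (x, w) \<Rightarrow> ?f x w)) \<partial>(lborel \<Otimes>\<^sub>M (lborel \<Otimes>\<^sub>M lborel))) < \<infinity>" .
  qed measurable
  have "(LINT x|lborel. \<psi> x *\<^sub>R (LINT w|(lborel \<Otimes>\<^sub>M lborel). \<kappa> (fst w) (x - snd w) * g (R (fst w) (snd w))))
     = (LINT x|lborel. LINT w|(lborel \<Otimes>\<^sub>M lborel). ?f x w)"
    by simp
  also have "\<dots> = (LINT w|(lborel \<Otimes>\<^sub>M lborel). LINT x|lborel. ?f x w)"
    by (rule LL.Fubini_integral[symmetric]) (rule int)
  also have "\<dots> = (LINT w|(lborel \<Otimes>\<^sub>M lborel). (LINT x|lborel. \<psi> x *\<^sub>R \<kappa> (fst w) (x - snd w)) * g (R (fst w) (snd w)))"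
    by (simp flip: mult_scaleR_left)
  finally show ?thesis .
qed

lemma exp_mass_mono:
  assumes "\<And>t x. \<kappa> t x \<le> \<kappa>' t x"
  shows "exp_mass N \<kappa> e \<le> exp_mass N \<kappa>' e"
  unfolding exp_mass_def by (intro nn_integral_mono mult_right_mono assms) simp

lemma exp_mass_cmult:
  assumes N: "kernel_on N \<kappa>"
  shows "exp_mass N (\<lambda>t x. c * \<kappa> t x) e = c * exp_mass N \<kappa> e"
proof -
  interpret N: sigma_finite_measure N using N by (simp add: kernel_on_def)
  have [measurable_cong]: "sets N = sets borel" using N unfolding kernel_on_def by blast
  note [measurable (raw)] = kernel_measurable[OF N]
  have "exp_mass N (\<lambda>t x. c * \<kappa> t x) e = (\<integral>\<^sup>+t. c * (\<integral>\<^sup>+x. \<kappa> t x * ennreal (exp (e * norm x)) \<partial>lborel) \<partial>N)"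
    unfolding exp_mass_def by (simp add: mult.assoc nn_integral_cmult)
  also have "\<dots> = c * exp_mass N \<kappa> e" unfolding exp_mass_def by (rule nn_integral_cmult) measurable
  finally show ?thesis .
qed

text \<open>Hoelder's inequality for the measure with density \<kappa>: the p-th power of exp (e
  |x|) is exp (p e |x|). The p-th roots in the final constants originate here.\<close>

lemma exp_mass_interpolation:
  assumes N: "kernel_on N \<kappa>" and p: "p \<ge> 1" and M0: "M0 > 0" "exp_mass N \<kappa> 0 \<le> ennreal M0"
    and M1: "M1 \<ge> 0" "exp_mass N \<kappa> (p * e) \<le> ennreal M1"
  shows "exp_mass N \<kappa> e \<le> ennreal (M0 powr (1 - 1 / p) * M1 powr (1 / p))"
proof -
  have [measurable_cong]: "sets N = sets borel" using N unfolding kernel_on_def by blast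
  note [measurable (raw)] = kernel_measurable[OF N]
  have pair: "exp_mass N \<kappa> e = (\<integral>\<^sup>+z. \<kappa> (fst z) (0 - snd z) * ennreal (exp (e * norm (0 - snd z))) \<partial>(N \<Otimes>\<^sub>M lborel))" for e
    by (rule exp_mass_pair[OF N])
  let ?B = "M0 powr (1 - 1 / p) * M1 powr (1 / p)"
  have le: "F \<le> ?B" if F: "F \<ge> 0" "ennreal F \<le> exp_mass N \<kappa> e" for F
  proof -
    have "ennreal (F powr p) \<le> ennreal (M0 powr (p - 1)) *
        (\<integral>\<^sup>+z. \<kappa> (fst z) (0 - snd z) * ennreal (exp (e * norm (0 - snd z)) powr p) \<partial>(N \<Otimes>\<^sub>M lborel))"
      by (rule Jensen_powr_nn_integral) (use p M0 F pair[of 0] pair[of e] in auto)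
    also have "(\<integral>\<^sup>+z. \<kappa> (fst z) (0 - snd z) * ennreal (exp (e * norm (0 - snd z)) powr p) \<partial>(N \<Otimes>\<^sub>M lborel)) = exp_mass N \<kappa> (p * e)"
      unfolding pair by (simp add: powr_def mult_ac)
    also have "ennreal (M0 powr (p - 1)) * exp_mass N \<kappa> (p * e) \<le> ennreal (M0 powr (p - 1)) * ennreal M1"
      by (intro mult_left_mono M1) simp
    finally have "F powr p \<le> M0 powr (p - 1) * M1"
      using M1 by (simp add: ennreal_mult[symmetric])
    then have "(F powr p) powr (1 / p) \<le> (M0 powr (p - 1) * M1) powr (1 / p)"
      using p by (intro powr_mono2) auto
    also have "(F powr p) powr (1 / p) = F" using F p by (simp add: powr_powr)
    also have "(M0 powr (p - 1) * M1) powr (1 / p) = ?B"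
      using p M0 M1 by (simp add: powr_mult powr_powr diff_divide_distrib)
    finally show ?thesis .
  qed
  show ?thesis
  proof (cases "exp_mass N \<kappa> e")
    case (real r)
    then show ?thesis using le[of r] by (simp add: ennreal_leI)
  next
    case top
    \<comment> \<open>An infinite mass is impossible, since \<open>le\<close> would then apply to
      \<open>?B + 1\<close>.\<close>
    have "?B \<ge> 0" by simp
    then have "?B + 1 \<le> ?B" using top by (intro le) auto
    then show ?thesis by simp
  qed
qed

end

section \<open>Gaussian majorants of the kernel and of its gradient\<close>

text \<open>As |exp (- (d/2) Ln w)| = |w|^(- d/2), the prefactor is at most (4 pi t am)^(- d/2).
  Relative to the normalization (c/(pi t))^(d/2) of \<open>gauss\<close> this is (1/(4 c am))^(d/2),
  later \<open>a_1 A powr (d / 2)\<close>.\<close>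

lemma cmod_ou_kernel_le:
  fixes x :: "'a::euclidean_space"
  assumes t: "t > 0" and am: "am > 0" "am \<le> cmod \<alpha>" and c: "c > 0" "c \<le> Re (inverse \<alpha>) / 4" and b: "b \<le> Re \<beta>"
  shows "cmod (ou_kernel \<alpha> \<beta> t x) \<le> (1 / (4 * c * am)) powr (real DIM('a) / 2) * exp (- b * t) * gauss c t x"
proof -
  define d where "d = real DIM('a)"
  have \<alpha>: "\<alpha> \<noteq> 0" using am by auto
  have "cmod (exp (- (of_nat DIM('a) / 2) * Ln (of_real (4 * pi * t) * \<alpha>))) = (4 * pi * t * cmod \<alpha>) powr (- (d / 2))"
    using \<alpha> t by (simp add: norm_exp_eq_Re powr_def d_def norm_mult)
  also have "\<dots> \<le> (4 * pi * t * am) powr (- (d / 2))"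
    using t am by (intro powr_mono2') (auto simp: d_def)
  also have "(4 * pi * t * am) powr (- (d / 2)) = (1 / (4 * c * am)) powr (d / 2) * (c / (pi * t)) powr (d / 2)"
  proof -
    have "(1 / (4 * c * am)) * (c / (pi * t)) = 1 / (4 * pi * t * am)" using c by (simp add: field_simps)
    then have "(1 / (4 * c * am)) powr (d / 2) * (c / (pi * t)) powr (d / 2) = (1 / (4 * pi * t * am)) powr (d / 2)"
      using t am c by (subst powr_mult[symmetric]) (auto simp: mult_ac)
    also have "\<dots> = (4 * pi * t * am) powr (- (d / 2))"
      using t am by (simp add: powr_minus_divide powr_divide)
    finally show ?thesis by simp
  qed
  finally have 1: "cmod (exp (- (of_nat DIM('a) / 2) * Ln (of_real (4 * pi * t) * \<alpha>)))
     \<le> (1 / (4 * c * am)) powr (d / 2) * (c / (pi * t)) powr (d / 2)" .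
  have "cmod (exp (- (of_real t * \<beta>) - of_real ((norm x)\<^sup>2) / (of_real (4 * t) * \<alpha>)))
      = exp (- (t * Re \<beta>) - (norm x)\<^sup>2 / t * (Re (inverse \<alpha>) / 4))"
  proof -
    have "of_real ((norm x)\<^sup>2) / (of_real (4 * t) * \<alpha>) = of_real ((norm x)\<^sup>2 / t / 4) * inverse \<alpha>"
      using t \<alpha> by (simp add: field_simps)
    then show ?thesis by (simp add: norm_exp_eq_Re del: inverse_complex.simps)
  qed
  also have "\<dots> \<le> exp (- b * t - (c / t) * (norm x)\<^sup>2)"
  proof -
    have "t * b \<le> t * Re \<beta>" using t b by simp
    moreover have "(norm x)\<^sup>2 / t * c \<le> (norm x)\<^sup>2 / t * (Re (inverse \<alpha>) / 4)" using t c by (intro mult_left_mono) auto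
    ultimately show ?thesis by (simp add: mult.commute)
  qed
  also have "exp (- b * t - (c / t) * (norm x)\<^sup>2) = exp (- b * t) * exp (- (c / t) * (norm x)\<^sup>2)" by (simp add: exp_add[symmetric])
  finally have 2: "cmod (exp (- (of_real t * \<beta>) - of_real ((norm x)\<^sup>2) / (of_real (4 * t) * \<alpha>)))
     \<le> exp (- b * t) * exp (- (c / t) * (norm x)\<^sup>2)" .
  have "cmod (ou_kernel \<alpha> \<beta> t x) \<le> ((1 / (4 * c * am)) powr (d / 2) * (c / (pi * t)) powr (d / 2)) * (exp (- b * t) * exp (- (c / t) * (norm x)\<^sup>2))"
    unfolding ou_kernel_def norm_mult by (intro mult_mono 1 2) auto
  also have "\<dots> = (1 / (4 * c * am)) powr (d / 2) * exp (- b * t) * gauss c t x"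
    by (simp add: gauss_def d_def mult_ac)
  finally show ?thesis by (simp add: d_def)
qed

definition ou_gradient :: "'d \<Rightarrow> complex \<Rightarrow> complex \<Rightarrow> real \<Rightarrow> real^'d \<Rightarrow> complex" where
  "ou_gradient i \<alpha> \<beta> t x = - (of_real (x $ i) / (of_real (2 * t) * \<alpha>)) * ou_kernel \<alpha> \<beta> t x"

lemma ou_gradient_measurable [measurable (raw)]:
  fixes g :: "'w \<Rightarrow> real^'d" and i :: 'd
  assumes [measurable]: "f \<in> borel_measurable M" "g \<in> borel_measurable M"
  shows "(\<lambda>w. ou_gradient i \<alpha> \<beta> (f w) (g w)) \<in> borel_measurable M"
proof -
  have "(\<lambda>x::real^'d. x $ i) \<in> borel_measurable borel" by (intro borel_measurable_continuous_onI continuous_intros)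
  from measurable_compose[OF assms(2) this] have [measurable]: "(\<lambda>w. g w $ i) \<in> borel_measurable M" .
  show ?thesis unfolding ou_gradient_def by measurable
qed

lemma ou_kernel_continuous:
  fixes c :: "'a::euclidean_space"
  assumes "t > 0" "\<alpha> \<noteq> 0"
  shows "continuous_on UNIV (\<lambda>x. ou_kernel \<alpha> \<beta> t (x - c))"
  unfolding ou_kernel_def using assms by (intro continuous_intros) auto

lemma ou_gradient_continuous:
  assumes "t > 0" "\<alpha> \<noteq> 0"
  shows "continuous_on UNIV (\<lambda>x. ou_gradient i \<alpha> \<beta> t (x - c))"
  unfolding ou_gradient_def using assms by (intro continuous_intros ou_kernel_continuous) auto

lemma ou_kernel_derivative:
  fixes x :: "real^'d"
  assumes "t > 0" "\<alpha> \<noteq> 0"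
  shows "((\<lambda>s. ou_kernel \<alpha> \<beta> t (x + s *\<^sub>R axis i 1)) has_vector_derivative ou_gradient i \<alpha> \<beta> t (x + r *\<^sub>R axis i 1)) (at r)"
proof -
  let ?y = "\<lambda>s. x + s *\<^sub>R axis i 1"
  have n: "(norm (?y s))\<^sup>2 = (norm x)\<^sup>2 + 2 * s * x $ i + s\<^sup>2" for s
    unfolding power2_norm_eq_inner by (simp add: inner_add inner_axis inner_commute power2_eq_square algebra_simps)
  have "((\<lambda>s. (norm (?y s))\<^sup>2) has_real_derivative 2 * (?y r $ i)) (at r)"
    unfolding n by (auto intro!: derivative_eq_intros simp: axis_def)
  then have N: "((\<lambda>s. complex_of_real ((norm (?y s))\<^sup>2)) has_vector_derivative of_real (2 * (?y r $ i))) (at r)"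
    by (intro has_vector_derivative_of_real) (simp add: has_real_derivative_iff_has_vector_derivative)
  define D where "D = of_real (4 * t) * \<alpha>"
  define a where "a = exp (- (of_nat DIM(real^'d) / 2) * Ln (of_real (4 * pi * t) * \<alpha>))"
  have D: "D \<noteq> 0" using assms by (simp add: D_def)
  let ?g = "\<lambda>w. a * exp (- (of_real t * \<beta>) - w / D)"
  have "(?g has_field_derivative - (?g w / D)) (at w)" for w
    using D by (auto intro!: derivative_eq_intros)
  from field_vector_diff_chain_at[OF N this]
  have "((\<lambda>s. ou_kernel \<alpha> \<beta> t (?y s)) has_vector_derivative of_real (2 * (?y r $ i)) * - (ou_kernel \<alpha> \<beta> t (?y r) / D)) (at r)"
    unfolding comp_def ou_kernel_def D_def[symmetric] a_def[symmetric] .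
  moreover have "of_real (2 * u) * - (w / D) = - (of_real u / (of_real (2 * t) * \<alpha>)) * w" for u w
    using assms by (simp add: D_def field_simps)
  ultimately show ?thesis unfolding ou_gradient_def by (simp only:)
qed

text \<open>Half of the Gaussian decay absorbs the exponential: e r <= c r^2/(2t) + e^2
  t/(2c).\<close>

lemma gauss_exp_finite:
  assumes "c > 0" "t > 0"
  shows "(\<integral>\<^sup>+x. ennreal (gauss c t (x::'a::euclidean_space)) * ennreal (exp (e * norm x)) \<partial>lborel) < \<infinity>"
proof -
  define K where "K = (c / (pi * t)) powr (real DIM('a) / 2) * exp (e\<^sup>2 * t / (2 * c))"
  have ct: "c / (2 * t) > 0" using assms by simp
  have "(\<integral>\<^sup>+x. ennreal (gauss c t (x::'a)) * ennreal (exp (e * norm x)) \<partial>lborel)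
      \<le> (\<integral>\<^sup>+x. ennreal K * ennreal (norm (x::'a) ^ 0 * exp (- (c / (2 * t)) * (norm x)\<^sup>2)) \<partial>lborel)"
  proof (rule nn_integral_mono)
    fix x :: 'a
    define r where "r = norm x"
    have "0 \<le> (c / (2 * t)) * (r - e * t / c)\<^sup>2" using assms by simp
    also have "\<dots> = (c / (2 * t)) * r\<^sup>2 - e * r + e\<^sup>2 * t / (2 * c)"
      using assms by (simp add: power2_diff power_divide power2_eq_square field_simps)
    finally have "- (c / t) * r\<^sup>2 + e * r \<le> e\<^sup>2 * t / (2 * c) + - (c / (2 * t)) * r\<^sup>2"
      by (simp add: field_simps)
    then have "exp (- (c / t) * r\<^sup>2) * exp (e * r) \<le> exp (e\<^sup>2 * t / (2 * c)) * exp (- (c / (2 * t)) * r\<^sup>2)"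
      by (simp only: exp_add[symmetric] exp_le_cancel_iff)
    then have "(c / (pi * t)) powr (real DIM('a) / 2) * (exp (- (c / t) * r\<^sup>2) * exp (e * r))
       \<le> (c / (pi * t)) powr (real DIM('a) / 2) * (exp (e\<^sup>2 * t / (2 * c)) * exp (- (c / (2 * t)) * r\<^sup>2))"
      by (rule mult_left_mono) simp
    then have "gauss c t x * exp (e * norm x) \<le> K * (norm x ^ 0 * exp (- (c / (2 * t)) * (norm x)\<^sup>2))"
      unfolding gauss_def K_def r_def by (simp only: power_0 mult_1 mult.assoc)
    then show "ennreal (gauss c t x) * ennreal (exp (e * norm x)) \<le> ennreal K * ennreal (norm x ^ 0 * exp (- (c / (2 * t)) * (norm x)\<^sup>2))"
      by (simp add: ennreal_mult[symmetric] K_def ennreal_leI)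
  qed
  also have "\<dots> < \<infinity>"
    by (subst nn_integral_cmult, simp, subst nn_integral_norm_gaussian[OF ct]) (simp add: ennreal_mult_less_top)
  finally show ?thesis .
qed

lemma tgauss_1_0: "c > 0 \<Longrightarrow> tgauss \<delta> 1 c 0 t x = (if t > 0 then exp (- \<delta> * t) * gauss c t x else 0)"
  by (simp add: tgauss_def)

lemma tgauss_half_1:
  assumes "c > 0"
  shows "tgauss \<delta> (1 / 2) c 1 t x = (if t > 0 then sqrt c / t * (exp (- \<delta> * t) * gauss c t x) else 0)"
proof (cases "t > 0")
  case True
  have "t powr (1 / 2 - 1) * (c / t) powr (real 1 / 2) = sqrt c / t"
  proof -
    have "t powr (1 / 2 - 1) = sqrt t / t" using True powr_diff[of t "1 / 2" 1] by (simp only: powr_half_sqrt powr_one)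
    moreover have "(c / t) powr (real 1 / 2) = sqrt c / sqrt t" using True assms by (simp add: powr_half_sqrt real_sqrt_divide)
    ultimately show ?thesis using True by simp
  qed
  then have "exp (- \<delta> * t) * (t powr (1 / 2 - 1) * (c / t) powr (real 1 / 2)) * gauss c t x = exp (- \<delta> * t) * (sqrt c / t) * gauss c t x"
    by (simp only:)
  then show ?thesis using True unfolding tgauss_def by (simp only: if_True mult_ac)
qed (simp add: tgauss_def)

lemma cmod_resolvent_kernel_le:
  fixes x :: "'a::euclidean_space"
  assumes am: "am > 0" "am \<le> cmod \<alpha>" and c: "c > 0" "c \<le> Re (inverse \<alpha>) / 4" and b: "b \<le> Re \<beta>" and \<delta>: "\<delta> \<le> Re z + b"
  shows "cmod (if t > 0 then exp (- z * of_real t) * ou_kernel \<alpha> \<beta> t x else 0)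
    \<le> (1 / (4 * c * am)) powr (real DIM('a) / 2) * tgauss \<delta> 1 c 0 t x"
proof (cases "t > 0")
  case True
  have "cmod (exp (- z * of_real t) * ou_kernel \<alpha> \<beta> t x)
      \<le> exp (- Re z * t) * ((1 / (4 * c * am)) powr (real DIM('a) / 2) * exp (- b * t) * gauss c t x)"
    unfolding norm_mult using cmod_ou_kernel_le[OF True am c b, of x] by (intro mult_mono) (auto simp: norm_exp_eq_Re)
  also have "\<dots> = (1 / (4 * c * am)) powr (real DIM('a) / 2) * (exp (- (Re z + b) * t) * gauss c t x)"
    by (simp add: exp_add[symmetric] algebra_simps)
  also have "\<dots> \<le> (1 / (4 * c * am)) powr (real DIM('a) / 2) * (exp (- \<delta> * t) * gauss c t x)"
    using mult_right_mono[OF \<delta>, of t] True by (intro mult_left_mono mult_right_mono) (auto simp: algebra_simps)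
  finally show ?thesis using True c by (simp add: tgauss_1_0)
qed (simp add: tgauss_1_0 c)

text \<open>The factor |x_i| / (2t |\<alpha>|) of the gradient is bounded by 1/(2 am sqrt c) times
  (sqrt c / t) |x_i|, where sqrt c / t is the surplus of \<open>tgauss\<close> with s = 1/2, j = 1
  over s = 1, j = 0.\<close>

lemma cmod_resolvent_gradient_le:
  fixes x :: "real^'d"
  assumes am: "am > 0" "am \<le> cmod \<alpha>" and c: "c > 0" "c \<le> Re (inverse \<alpha>) / 4" and b: "b \<le> Re \<beta>" and \<delta>: "\<delta> \<le> Re z + b"
  shows "cmod (if t > 0 then exp (- z * of_real t) * ou_gradient i \<alpha> \<beta> t x else 0)
    \<le> (1 / (4 * c * am)) powr (real CARD('d) / 2) * (1 / (2 * am * sqrt c)) * (tgauss \<delta> (1 / 2) c 1 t x * \<bar>x \<bullet> axis i 1\<bar>)"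
proof (cases "t > 0")
  case True
  define A where "A = (1 / (4 * c * am)) powr (real CARD('d) / 2)"
  have "cmod (exp (- z * of_real t) * ou_gradient i \<alpha> \<beta> t x)
     = \<bar>x $ i\<bar> / (2 * t * cmod \<alpha>) * cmod (if t > 0 then exp (- z * of_real t) * ou_kernel \<alpha> \<beta> t x else 0)"
    using True by (simp add: ou_gradient_def norm_mult norm_divide)
  also have "\<dots> \<le> \<bar>x $ i\<bar> / (2 * t * am) * (A * tgauss \<delta> 1 c 0 t x)"
    using True am cmod_resolvent_kernel_le[OF am c b \<delta>, of t x]
    by (intro mult_mono divide_left_mono) (auto simp: A_def intro!: mult_pos_pos)
  also have "\<dots> = A * (1 / (2 * am * sqrt c)) * ((sqrt c / t * (exp (- \<delta> * t) * gauss c t x)) * \<bar>x \<bullet> axis i 1\<bar>)"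
    using True c am by (simp add: tgauss_1_0 inner_axis field_simps)
  finally show ?thesis using True unfolding A_def tgauss_half_1[OF c(1)] by (simp only: if_True)
qed (use am c in simp)

section \<open>Exponential masses of the resolvent kernels\<close>

context weighted_flow begin

lemma kernel_on_tgauss: "kernel_on lborel (\<lambda>t x. ennreal (tgauss \<delta> s c j t x * f x))" if "f \<in> borel_measurable borel"
proof (rule kernel_on_lborel)
  note [measurable] = that
  show "(\<lambda>z. ennreal (tgauss \<delta> s c j (fst z) (snd z) * f (snd z))) \<in> borel_measurable (borel \<Otimes>\<^sub>M borel)"
    by measurable
qed

text \<open>\<open>q\<close> is chosen such that 2 sqrt q = \<eta> / sqrt (c \<delta>). The
  hypothesis says q < 1, where the moment series converges.\<close>

lemma exp_mass_tgauss_finite: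
  assumes "c > 0" "\<eta>\<^sup>2 < 4 * c * \<delta>"
  shows "exp_mass lborel (\<lambda>t x. ennreal (K * tgauss \<delta> 1 c 0 t x)) \<eta> < \<infinity>"
proof (cases "K \<le> 0")
  case True
  then have "ennreal (K * tgauss \<delta> 1 c 0 t x) = 0" for t and x :: 'a
    by (simp add: ennreal_neg mult_nonpos_nonneg)
  then show ?thesis by (simp add: exp_mass_def)
next
  case False
  have "0 < 4 * c * \<delta>" using assms(2) zero_le_power2[of \<eta>] by linarith
  then have \<delta>: "\<delta> > 0" using assms(1) by (simp add: zero_less_mult_iff)
  define q where "q = \<eta>\<^sup>2 / (4 * (c * \<delta>))"
  have q: "0 \<le> q" "q < 1" using assms \<delta> by (auto simp: q_def)
  have "2 * sqrt q = \<eta> / sqrt (c * \<delta>)" using \<eta>_nonneg by (simp add: q_def real_sqrt_divide real_sqrt_mult)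
  then have "(\<integral>\<^sup>+t. \<integral>\<^sup>+x. ennreal (tgauss \<delta> 1 c 0 t (x::'a) * norm x ^ 0) * ennreal (exp (\<eta> * norm x)) \<partial>lborel \<partial>lborel)
      \<le> ennreal (\<delta> powr (- 1) * (\<Sum>k. moment_coeff (real DIM('a)) 1 (real 0) k * (2 * sqrt q) ^ k))"
    using assms \<delta> q \<eta>_nonneg moment_series_value[of "real DIM('a)" q]
    by (intro tgauss_exp_moment) (auto simp: sums_iff)
  also have "\<dots> < \<infinity>" by simp
  finally have "exp_mass lborel (\<lambda>t x. ennreal (tgauss \<delta> 1 c 0 t x * 1)) \<eta> < \<infinity>" by (simp add: exp_mass_def)
  then have "ennreal K * exp_mass lborel (\<lambda>t x. ennreal (tgauss \<delta> 1 c 0 t x * 1)) \<eta> < \<infinity>" by (simp add: ennreal_mult_less_top)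
  also have "ennreal K * exp_mass lborel (\<lambda>t x. ennreal (tgauss \<delta> 1 c 0 t x * 1)) \<eta> = exp_mass lborel (\<lambda>t x. ennreal K * ennreal (tgauss \<delta> 1 c 0 t x * 1)) \<eta>"
    by (rule exp_mass_cmult[symmetric, OF kernel_on_tgauss]) simp
  also have "(\<lambda>t x. ennreal K * ennreal (tgauss \<delta> 1 c 0 t (x::'a) * 1)) = (\<lambda>t x. ennreal (K * tgauss \<delta> 1 c 0 t x))"
    using False by (simp add: ennreal_mult[symmetric])
  finally show ?thesis .
qed

lemma kernel_semigroup_ou:
  assumes am: "am > 0" "am \<le> cmod \<alpha>" and c: "c > 0" "c \<le> Re (inverse \<alpha>) / 4" and b: "b \<le> Re \<beta>"
    and \<alpha>: "Re \<alpha> > 0" and z: "\<eta>\<^sup>2 < 4 * c * (Re z + b)"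
  shows "kernel_semigroup R \<theta> C \<eta> (ou_kernel \<alpha> \<beta>) z"
proof unfold_locales
  let ?A = "(1 / (4 * c * am)) powr (real DIM('a) / 2)"
  show "(\<lambda>w. ou_kernel \<alpha> \<beta> (fst w) (snd w :: 'a)) \<in> borel_measurable (borel \<Otimes>\<^sub>M borel)" by measurable
  show "ou_kernel \<alpha> \<beta> t (R s x) = ou_kernel \<alpha> \<beta> t x" for s t x by (simp add: ou_kernel_def)
  show "(LINT y|lborel. ou_kernel \<alpha> \<beta> s (x - y) * ou_kernel \<alpha> \<beta> t (y - w)) = ou_kernel \<alpha> \<beta> (s + t) (x - w)"
    if "s > 0" "t > 0" for s t and x w :: 'a by (rule ou_kernel_semigroup[OF \<alpha> that])
  show "(\<integral>\<^sup>+x. ennreal (cmod (ou_kernel \<alpha> \<beta> t (x::'a))) * ennreal (exp (\<eta> * norm x)) \<partial>lborel) < \<infinity>" if t: "t > 0" for t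
  proof -
    have "(\<integral>\<^sup>+x. ennreal (cmod (ou_kernel \<alpha> \<beta> t (x::'a))) * ennreal (exp (\<eta> * norm x)) \<partial>lborel)
       \<le> (\<integral>\<^sup>+x. ennreal (?A * exp (- b * t)) * (ennreal (gauss c t (x::'a)) * ennreal (exp (\<eta> * norm x))) \<partial>lborel)"
    proof (rule nn_integral_mono)
      fix x :: 'a
      have "ennreal (cmod (ou_kernel \<alpha> \<beta> t x)) \<le> ennreal (?A * exp (- b * t)) * ennreal (gauss c t x)"
        using cmod_ou_kernel_le[OF t am c b, of x] by (simp add: ennreal_mult[symmetric] ennreal_leI)
      then show "ennreal (cmod (ou_kernel \<alpha> \<beta> t x)) * ennreal (exp (\<eta> * norm x)) \<le> ennreal (?A * exp (- b * t)) * (ennreal (gauss c t x) * ennreal (exp (\<eta> * norm x)))"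
        unfolding mult.assoc[symmetric] by (rule mult_right_mono) simp
    qed
    also have "\<dots> = ennreal (?A * exp (- b * t)) * (\<integral>\<^sup>+x. ennreal (gauss c t (x::'a)) * ennreal (exp (\<eta> * norm x)) \<partial>lborel)"
      by (rule nn_integral_cmult) measurable
    also have "\<dots> < \<infinity>" using gauss_exp_finite[OF c(1) t, of \<eta>, where 'a = 'a] by (simp add: ennreal_mult_less_top)
    finally show ?thesis .
  qed
  show "(\<integral>\<^sup>+t. \<integral>\<^sup>+x. ennreal (cmod (if t > 0 then exp (- z * of_real t) * ou_kernel \<alpha> \<beta> t (x::'a) else 0)) *
       ennreal (exp (\<eta> * norm x)) \<partial>lborel \<partial>lborel) < \<infinity>"
  proof -
    have "exp_mass lborel (\<lambda>t x. ennreal (cmod (if t > 0 then exp (- z * of_real t) * ou_kernel \<alpha> \<beta> t (x::'a) else 0))) \<eta>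
        \<le> exp_mass lborel (\<lambda>t x. ennreal (?A * tgauss (Re z + b) 1 c 0 t x)) \<eta>"
      by (intro exp_mass_mono ennreal_leI cmod_resolvent_kernel_le[OF am c b]) simp
    also have "\<dots> < \<infinity>" by (rule exp_mass_tgauss_finite[OF c(1) z])
    finally show ?thesis by (simp add: exp_mass_def)
  qed
qed

text \<open>The masses at the endpoints 0 and p \<eta> are both proportional to 1/\<delta>, hence so
  is the interpolated one; only the moment series receives the power 1/p.\<close>

lemma exp_mass_resolvent_le:
  fixes vt p \<delta> c K :: real
  assumes "c > 0" "\<delta> > 0" "K > 0" "p \<ge> 1" "0 < vt" "vt < 1" and q: "(p * \<eta>)\<^sup>2 \<le> vt * (4 * c * \<delta>)"
  defines "\<Phi> \<equiv> \<Sum>k. moment_coeff (real DIM('a)) 1 0 k * (2 * sqrt vt) ^ k"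
  shows "exp_mass lborel (\<lambda>t x. ennreal (K * tgauss \<delta> 1 c 0 t x)) \<eta> \<le> ennreal (K / \<delta> * \<Phi> powr (1 / p))"
proof -
  note sums = moment_series_value[of "real DIM('a)" vt]
  have summ: "summable (\<lambda>k. moment_coeff (real DIM('a)) 1 0 k * (2 * sqrt vt) ^ k)"
    using sums assms by (auto simp: sums_iff)
  let ?\<kappa> = "\<lambda>t x. ennreal (tgauss \<delta> 1 c 0 t x * 1)"
  have N: "kernel_on lborel ?\<kappa>" by (rule kernel_on_tgauss) simp
  have "\<Phi> \<ge> 0" unfolding \<Phi>_def using assms by (intro suminf_nonneg summ mult_nonneg_nonneg) (auto simp: moment_coeff_nonneg)
  have pe: "p * \<eta> / sqrt (c * \<delta>) \<le> 2 * sqrt vt"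
  proof -
    have "(p * \<eta> / sqrt (c * \<delta>))\<^sup>2 \<le> (2 * sqrt vt)\<^sup>2"
      using assms by (simp add: power_divide power_mult_distrib field_simps)
    then show ?thesis by (rule power2_le_imp_le) (use assms in simp)
  qed
  have "exp_mass lborel ?\<kappa> \<eta> \<le> ennreal ((1 / \<delta>) powr (1 - 1 / p) * (\<delta> powr (- 1) * \<Phi>) powr (1 / p))"
  proof (rule exp_mass_interpolation[OF N \<open>p \<ge> 1\<close>])
    show "exp_mass lborel ?\<kappa> 0 \<le> ennreal (1 / \<delta>)"
      using tgauss_mass[OF \<open>\<delta> > 0\<close> \<open>c > 0\<close>, where 'a = 'a] by (simp add: exp_mass_def)
    show "exp_mass lborel ?\<kappa> (p * \<eta>) \<le> ennreal (\<delta> powr (- 1) * \<Phi>)"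
      using tgauss_exp_moment[of \<delta> 1 c "p * \<eta>" vt 0, where 'a = 'a] assms \<eta>_nonneg pe summ
      by (simp add: exp_mass_def \<Phi>_def)
  qed (use assms \<open>\<Phi> \<ge> 0\<close> in auto)
  also have "(1 / \<delta>) powr (1 - 1 / p) * (\<delta> powr (- 1) * \<Phi>) powr (1 / p) = 1 / \<delta> * \<Phi> powr (1 / p)"
  proof -
    have "\<delta> powr (- 1) = 1 / \<delta>" using assms by (simp add: powr_minus_divide)
    moreover have "(1 / \<delta> * \<Phi>) powr (1 / p) = (1 / \<delta>) powr (1 / p) * \<Phi> powr (1 / p)"
      using assms \<open>\<Phi> \<ge> 0\<close> by (intro powr_mult)
    moreover have "(1 / \<delta>) powr (1 - 1 / p) * (1 / \<delta>) powr (1 / p) = 1 / \<delta>"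
      using assms by (simp add: powr_add[symmetric])
    ultimately show ?thesis by (metis mult.assoc)
  qed
  finally have "ennreal K * exp_mass lborel ?\<kappa> \<eta> \<le> ennreal K * ennreal (1 / \<delta> * \<Phi> powr (1 / p))" by (rule mult_left_mono) simp
  also have "ennreal K * exp_mass lborel ?\<kappa> \<eta> = exp_mass lborel (\<lambda>t x. ennreal K * ?\<kappa> t x) \<eta>"
    by (rule exp_mass_cmult[OF N, symmetric])
  finally show ?thesis using assms by (simp add: ennreal_mult[symmetric])
qed

text \<open>As in \<open>exp_mass_resolvent_le\<close>, with both endpoint masses proportional to
  \<delta>^(- 1/2). The separate factor Gamma (1/2) belongs to the endpoint 0, whence its exponent 1
  - 1/p.\<close>

lemma exp_mass_gradient_le:
  fixes vt p \<delta> c K :: real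
  assumes "c > 0" "\<delta> > 0" "K > 0" "p \<ge> 1" "0 < vt" "vt < 1" and q: "(p * \<eta>)\<^sup>2 \<le> vt * (4 * c * \<delta>)" and b: "b \<in> Basis"
  defines "\<Psi> \<equiv> \<Sum>k. moment_coeff (real DIM('a)) (1 / 2) 1 k * (2 * sqrt vt) ^ k"
  shows "exp_mass lborel (\<lambda>t x. ennreal (K * (tgauss \<delta> (1 / 2) c 1 t x * \<bar>x \<bullet> b\<bar>))) \<eta>
    \<le> ennreal (K * \<delta> powr (- (1 / 2)) * (Gamma (1 / 2) powr (1 - 1 / p) * \<Psi> powr (1 / p)))"
proof -
  note sums = moment_series_value_gradient[of "real DIM('a)" vt]
  have summ: "summable (\<lambda>k. moment_coeff (real DIM('a)) (1 / 2) 1 k * (2 * sqrt vt) ^ k)"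
    using sums assms by (auto simp: sums_iff)
  let ?\<kappa> = "\<lambda>t x. ennreal (tgauss \<delta> (1 / 2) c 1 t x * \<bar>x \<bullet> b\<bar>)"
  have N: "kernel_on lborel ?\<kappa>" by (rule kernel_on_tgauss) simp
  have \<Psi>: "\<Psi> \<ge> 0" unfolding \<Psi>_def using assms by (intro suminf_nonneg summ mult_nonneg_nonneg) (auto simp: moment_coeff_nonneg)
  have G: "Gamma (1 / 2 :: real) > 0" by (simp add: Gamma_real_pos)
  have pe: "p * \<eta> / sqrt (c * \<delta>) \<le> 2 * sqrt vt"
  proof -
    have "(p * \<eta> / sqrt (c * \<delta>))\<^sup>2 \<le> (2 * sqrt vt)\<^sup>2"
      using assms by (simp add: power_divide power_mult_distrib field_simps)
    then show ?thesis by (rule power2_le_imp_le) (use assms in simp)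
  qed
  have "exp_mass lborel ?\<kappa> \<eta> \<le> ennreal ((Gamma (1 / 2) * \<delta> powr (- (1 / 2))) powr (1 - 1 / p) * (\<delta> powr (- (1 / 2)) * \<Psi>) powr (1 / p))"
  proof (rule exp_mass_interpolation[OF N \<open>p \<ge> 1\<close>])
    show "exp_mass lborel ?\<kappa> 0 \<le> ennreal (Gamma (1 / 2) * \<delta> powr (- (1 / 2)))"
      using tgauss_gradient_mass[OF \<open>\<delta> > 0\<close> \<open>c > 0\<close> b] by (simp add: exp_mass_def)
    \<comment> \<open>At this endpoint the component is replaced by |x| in order to reach the radial
      moments.\<close>
    have "exp_mass lborel ?\<kappa> (p * \<eta>) \<le> exp_mass lborel (\<lambda>t x. ennreal (tgauss \<delta> (1 / 2) c 1 t x * norm x ^ 1)) (p * \<eta>)"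
      using Basis_le_norm[OF b] by (intro exp_mass_mono ennreal_leI mult_left_mono) auto
    also have "\<dots> \<le> ennreal (\<delta> powr (- (1 / 2)) * \<Psi>)"
      using tgauss_exp_moment[of \<delta> "1 / 2" c "p * \<eta>" vt 1, where 'a = 'a] assms \<eta>_nonneg pe summ
      by (simp add: exp_mass_def \<Psi>_def)
    finally show "exp_mass lborel ?\<kappa> (p * \<eta>) \<le> ennreal (\<delta> powr (- (1 / 2)) * \<Psi>)" .
  qed (use assms \<Psi> G in auto)
  also have "(Gamma (1 / 2) * \<delta> powr (- (1 / 2))) powr (1 - 1 / p) * (\<delta> powr (- (1 / 2)) * \<Psi>) powr (1 / p)
    = \<delta> powr (- (1 / 2)) * (Gamma (1 / 2) powr (1 - 1 / p) * \<Psi> powr (1 / p))"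
  proof -
    define u where "u = \<delta> powr (- (1 / 2))"
    have u: "u > 0" using assms by (simp add: u_def)
    have "(Gamma (1 / 2) * u) powr (1 - 1 / p) = Gamma (1 / 2) powr (1 - 1 / p) * u powr (1 - 1 / p)"
      using G u by (intro powr_mult)
    moreover have "(u * \<Psi>) powr (1 / p) = u powr (1 / p) * \<Psi> powr (1 / p)" using u \<Psi> by (intro powr_mult)
    ultimately have "(Gamma (1 / 2) * u) powr (1 - 1 / p) * (u * \<Psi>) powr (1 / p)
       = (u powr (1 - 1 / p) * u powr (1 / p)) * (Gamma (1 / 2) powr (1 - 1 / p) * \<Psi> powr (1 / p))"
      by (simp only: mult.assoc mult.left_commute)
    moreover have "u powr (1 - 1 / p) * u powr (1 / p) = u" using u by (simp add: powr_add[symmetric])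
    ultimately show ?thesis by (simp only: u_def)
  qed
  finally have "ennreal K * exp_mass lborel ?\<kappa> \<eta> \<le> ennreal K * ennreal (\<delta> powr (- (1 / 2)) * (Gamma (1 / 2) powr (1 - 1 / p) * \<Psi> powr (1 / p)))" by (rule mult_left_mono) simp
  also have "ennreal K * exp_mass lborel ?\<kappa> \<eta> = exp_mass lborel (\<lambda>t x. ennreal K * ?\<kappa> t x) \<eta>"
    by (rule exp_mass_cmult[OF N, symmetric])
  finally show ?thesis using assms by (simp add: ennreal_mult[symmetric] mult.assoc)
qed

end

lemma moment_series_pos:
  assumes "d > 0" "s > 0" "j \<ge> 0" "q \<ge> 0" "summable (\<lambda>k. moment_coeff d s j k * (2 * sqrt q) ^ k)"
  shows "(\<Sum>k. moment_coeff d s j k * (2 * sqrt q) ^ k) > 0"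
proof -
  have "moment_coeff d s j 0 * (2 * sqrt q) ^ 0 \<le> (\<Sum>k. moment_coeff d s j k * (2 * sqrt q) ^ k)"
    using sum_le_suminf[OF assms(5), of "{0}"] assms by (auto simp: moment_coeff_nonneg)
  moreover have "moment_coeff d s j 0 > 0"
    using assms by (auto simp: moment_coeff_def intro!: divide_pos_pos mult_pos_pos Gamma_real_pos)
  ultimately show ?thesis by simp
qed

section \<open>Diagonalizable matrices and weighted Lebesgue spaces\<close>

lemma conj_diag_mult:
  fixes Y :: "complex^'n^'n"
  assumes "invertible Y"
  shows "(Y ** diag p ** matrix_inv Y) ** (Y ** diag q ** matrix_inv Y) = Y ** diag (\<lambda>i. p i * q i) ** matrix_inv Y"
proof -
  have "(diag p ** diag q :: complex^'n^'n) = diag (\<lambda>i. p i * q i)"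
    unfolding vec_eq_iff diag_mult by (simp add: diag_def)
  moreover have "(Y ** diag p ** matrix_inv Y) ** (Y ** diag q ** matrix_inv Y)
      = Y ** (diag p ** (matrix_inv Y ** Y) ** diag q) ** matrix_inv Y"
    by (simp add: matrix_mul_assoc)
  ultimately show ?thesis by (simp add: matrix_inv_mult[OF assms])
qed

lemma matrix_inv_unique:
  fixes M :: "complex^'n^'n"
  assumes "M ** N = mat 1" "N ** M = mat 1"
  shows "matrix_inv M = N"
proof -
  have "invertible M" using assms by (auto simp: invertible_def)
  then have "matrix_inv M ** (M ** N) = N" by (simp add: matrix_mul_assoc matrix_inv_mult)
  then show ?thesis by (simp add: assms)
qed

lemma matrix_inv_conj_diag:
  fixes Y :: "complex^'n^'n"
  assumes Y: "invertible Y" and "\<And>i. p i \<noteq> 0"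
  shows "matrix_inv (Y ** diag p ** matrix_inv Y) = Y ** diag (\<lambda>i. inverse (p i)) ** matrix_inv Y"
proof (rule matrix_inv_unique)
  have "diag (\<lambda>i. 1) = (mat 1 :: complex^'n^'n)" by (simp add: diag_def mat_def vec_eq_iff)
  then show "(Y ** diag p ** matrix_inv Y) ** (Y ** diag (\<lambda>i. inverse (p i)) ** matrix_inv Y) = mat 1"
    "(Y ** diag (\<lambda>i. inverse (p i)) ** matrix_inv Y) ** (Y ** diag p ** matrix_inv Y) = mat 1"
    by (simp_all add: conj_diag_mult[OF Y] assms matrix_inv_mult[OF Y])
qed

lemma diag_mult_vec: "diag p *v (x :: complex^'n) = (\<chi> i. p i * x $ i)"
  by (simp add: matrix_vector_mult_def diag_def vec_eq_iff if_distrib if_distribR cong: if_cong)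

lemma conj_diag_apply:
  fixes Y Z :: "complex^'n^'n"
  shows "(Y ** diag p ** Z) *v x = (\<Sum>k\<in>UNIV. (p k * (Z *v x) $ k) *s column k Y)"
proof -
  have "(Y ** diag p ** Z) *v x = Y *v (diag p *v (Z *v x))"
    by (simp add: matrix_vector_mul_assoc matrix_mul_assoc)
  then show ?thesis by (simp only: matrix_mult_sum[of Y] diag_mult_vec vec_lambda_beta)
qed

lemma eigenvalues_conj_diag:
  fixes Y :: "complex^'n^'n"
  assumes Y: "invertible Y"
  shows "eigenvalues (Y ** diag l ** matrix_inv Y) = range l"
proof safe
  fix \<mu> assume "\<mu> \<in> eigenvalues (Y ** diag l ** matrix_inv Y)"
  then obtain v where v: "v \<noteq> 0" "(Y ** diag l ** matrix_inv Y) *v v = \<mu> *s v" by (auto simp: eigenvalues_def)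
  define u where "u = matrix_inv Y *v v"
  have Yu: "Y *v u = v" by (simp add: u_def matrix_vector_mul_assoc matrix_inv_mult[OF Y])
  have "matrix_inv Y *v ((Y ** diag l ** matrix_inv Y) *v v) = diag l *v u"
    by (simp add: u_def matrix_vector_mul_assoc matrix_mul_assoc matrix_inv_mult[OF Y])
  then have "diag l *v u = \<mu> *s u" unfolding v u_def by (simp add: vector_scalar_commute)
  then have "l i * u $ i = \<mu> * u $ i" for i by (simp add: diag_mult_vec vec_eq_iff)
  moreover obtain i where "u $ i \<noteq> 0" using v(1) Yu by (metis matrix_vector_mult_0_right vec_eq_iff zero_index)
  ultimately show "\<mu> \<in> range l" by (metis mult_right_cancel rangeI)
next
  fix i
  have "matrix_inv Y *v (Y *v axis i 1) = axis i 1" by (simp add: matrix_vector_mul_assoc matrix_inv_mult[OF Y])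
  then have "Y *v axis i 1 \<noteq> 0" by (metis axis_eq_0_iff matrix_vector_mult_0_right zero_neq_one)
  moreover have "(Y ** diag l ** matrix_inv Y) *v (Y *v axis i 1) = l i *s (Y *v axis i 1)"
  proof -
    have "(Y ** diag l ** matrix_inv Y) *v (Y *v axis i 1) = Y *v (diag l *v axis i 1)"
      by (simp add: matrix_vector_mul_assoc matrix_mul_assoc[symmetric] matrix_inv_mult[OF Y])
    also have "diag l *v axis i 1 = l i *s axis i 1" by (auto simp: diag_mult_vec vec_eq_iff axis_def)
    finally show ?thesis by (simp add: vector_scalar_commute)
  qed
  ultimately show "l i \<in> eigenvalues (Y ** diag l ** matrix_inv Y)" unfolding eigenvalues_def by blast
qed

lemma bounded_linear_matrix_mult: "bounded_linear ((*v) (M :: complex^'n^'m))"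
  by (intro linear_conv_bounded_linear[THEN iffD1] linearI)
    (simp_all add: matrix_vector_mult_def vec_eq_iff scaleR_sum_right distrib_left sum.distrib)

lemma bounded_linear_scale_vec: "bounded_linear (\<lambda>c. c *s (v :: complex^'n))"
  by (intro linear_conv_bounded_linear[THEN iffD1] linearI) (simp_all add: vec_eq_iff algebra_simps)

lemma spectral_norm_le: "norm (M *v x) \<le> spectral_norm M * norm x"
  unfolding spectral_norm_def by (rule onorm[OF bounded_linear_matrix_mult])

lemma spectral_norm_nonneg: "spectral_norm M \<ge> 0"
  unfolding spectral_norm_def by (rule onorm_pos_le[OF bounded_linear_matrix_mult])

lemma condition_number_pos:
  fixes Y :: "complex^'n^'n"
  assumes "invertible Y"
  shows "condition_number Y > 0"
proof -
  obtain x :: "complex^'n" where x: "norm x = 1" using vector_choose_size[of 1] by auto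
  have "norm x = norm (Y *v (matrix_inv Y *v x))" by (simp add: matrix_vector_mul_assoc matrix_inv_mult[OF assms])
  also have "\<dots> \<le> spectral_norm Y * norm (matrix_inv Y *v x)" by (rule spectral_norm_le)
  also have "\<dots> \<le> spectral_norm Y * (spectral_norm (matrix_inv Y) * norm x)"
    by (intro mult_left_mono spectral_norm_le spectral_norm_nonneg)
  finally show ?thesis using x by (simp add: condition_number_def)
qed

lemma norm_conj_diag_le:
  fixes Y :: "complex^'n^'n"
  assumes "\<And>k. cmod (p k) \<le> K" "K \<ge> 0"
  shows "norm ((Y ** diag p ** matrix_inv Y) *v x) \<le> condition_number Y * K * norm x"
proof -
  have d: "norm (diag p *v y) \<le> K * norm y" for y
  proof -
    have "norm (diag p *v y) \<le> L2_set (\<lambda>i. K * norm (y $ i)) UNIV"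
      unfolding norm_vec_def diag_mult_vec
      using assms by (intro L2_set_mono) (auto simp: norm_mult intro: mult_right_mono)
    also have "\<dots> = K * norm y" using assms(2) by (simp add: L2_set_right_distrib norm_vec_def)
    finally show ?thesis .
  qed
  have "norm ((Y ** diag p ** matrix_inv Y) *v x) = norm (Y *v (diag p *v (matrix_inv Y *v x)))"
    by (simp add: matrix_vector_mul_assoc matrix_mul_assoc)
  also have "\<dots> \<le> spectral_norm Y * norm (diag p *v (matrix_inv Y *v x))" by (rule spectral_norm_le)
  also have "\<dots> \<le> spectral_norm Y * (K * norm (matrix_inv Y *v x))"
    by (intro mult_left_mono d spectral_norm_nonneg)
  also have "\<dots> \<le> spectral_norm Y * (K * (spectral_norm (matrix_inv Y) * norm x))"
    using assms(2) by (intro mult_left_mono spectral_norm_le spectral_norm_nonneg)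
  finally show ?thesis by (simp add: condition_number_def mult_ac)
qed

text \<open>Power, exponential and inverse are functions of \<open>A\<close> and \<open>B\<close>,
  so in the common eigenbasis every factor of the kernel is diagonal.\<close>

lemma heat_kernel_conj_diag:
  fixes Y :: "complex^'n^'n" and S :: "real^'d^'d"
  assumes Y: "invertible Y" and l: "\<And>k. l k \<noteq> 0" and t: "t > 0"
  shows "heat_kernel (Y ** diag l ** matrix_inv Y) (Y ** diag m ** matrix_inv Y) S x \<xi> t
    = Y ** diag (\<lambda>k. ou_kernel (l k) (m k) t (mat_exp (t *\<^sub>R S) *v x - \<xi>)) ** matrix_inv Y"
proof -
  define r where "r = (norm (mat_exp (t *\<^sub>R S) *v x - \<xi>))\<^sup>2"
  have sc: "a *\<^sub>R (Y ** diag p ** matrix_inv Y) = Y ** diag (\<lambda>k. of_real a * p k) ** matrix_inv Y" for a p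
    unfolding vec_eq_iff vector_scaleR_component conj_diag_component
    by (simp add: scaleR_conv_of_real sum_distrib_left mult_ac)
  have df: "- (Y ** diag p ** matrix_inv Y) - Y ** diag q ** matrix_inv Y = Y ** diag (\<lambda>k. - p k - q k) ** matrix_inv Y" for p q
    unfolding vec_eq_iff vector_minus_component vector_uminus_component conj_diag_component
    by (simp add: sum_subtractf sum_negf algebra_simps)
  have i: "matrix_inv ((4 * t) *\<^sub>R (Y ** diag l ** matrix_inv Y)) = Y ** diag (\<lambda>k. inverse (of_real (4 * t) * l k)) ** matrix_inv Y"
    unfolding sc by (rule matrix_inv_conj_diag[OF Y]) (use l t in simp)
  have e: "mat_exp (- (t *\<^sub>R (Y ** diag m ** matrix_inv Y)) - r *\<^sub>R matrix_inv ((4 * t) *\<^sub>R (Y ** diag l ** matrix_inv Y)))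
      = Y ** diag (\<lambda>k. exp (- (of_real t * m k) - of_real r * inverse (of_real (4 * t) * l k))) ** matrix_inv Y"
    unfolding i unfolding sc df by (rule mat_exp_conj_diag[OF Y])
  show ?thesis
    unfolding heat_kernel_def r_def[symmetric] e
    unfolding sc mat_fun_eq[OF Y] conj_diag_mult[OF Y] comp_def ou_kernel_def r_def divide_inverse
    by simp
qed

section \<open>Borel representatives and weighted norms\<close>

text \<open>The spaces consist of Lebesgue measurable functions, whereas substitution and Fubini are
  carried out for Borel functions; the replacement is made component by component.\<close>

lemma borel_representative:
  fixes f :: "'a::euclidean_space \<Rightarrow> 'b::euclidean_space"
  assumes [measurable]: "f \<in> borel_measurable lebesgue"
  obtains g where "g \<in> borel_measurable borel" "AE x in lborel. f x = g x"
proof -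
  have "\<forall>b. \<exists>g'\<in>borel_measurable lborel. AE x in lborel. f x \<bullet> b = g' x"
    by (intro allI completion_ex_borel_measurable_real) measurable
  then obtain g' where g': "\<And>b. g' b \<in> borel_measurable lborel" "\<And>b. AE x in lborel. f x \<bullet> b = g' b x"
    by metis
  have [measurable]: "g' b \<in> borel_measurable borel" for b using g'(1)[of b] by simp
  have "AE x in lborel. \<forall>b\<in>Basis. f x \<bullet> b = g' b x"
    by (rule AE_finite_allI[OF finite_Basis]) (rule g'(2))
  then have "AE x in lborel. f x = (\<Sum>b\<in>Basis. g' b x *\<^sub>R b)"
  proof eventually_elim
    fix x assume "\<forall>b\<in>Basis. f x \<bullet> b = g' b x"
    then have "(\<Sum>b\<in>Basis. g' b x *\<^sub>R b) = (\<Sum>b\<in>Basis. (f x \<bullet> b) *\<^sub>R b)" by (intro sum.cong) auto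
    then show "f x = (\<Sum>b\<in>Basis. g' b x *\<^sub>R b)" by (simp add: euclidean_representation)
  qed
  then show thesis by (rule that[rotated]) measurable
qed

lemma weighted_integral_borel:
  fixes f fb :: "'a::euclidean_space \<Rightarrow> 'b::euclidean_space" and \<theta> :: "'a \<Rightarrow> real"
  assumes [measurable]: "f \<in> borel_measurable lebesgue" "fb \<in> borel_measurable borel" "\<theta> \<in> borel_measurable borel"
    and eq: "AE x in lborel. f x = fb x" and \<theta>: "\<And>x. \<theta> x > 0"
  shows "integrable lebesgue (\<lambda>x. norm (\<theta> x *\<^sub>R f x) powr p)
      \<longleftrightarrow> (\<integral>\<^sup>+x. ennreal ((\<theta> x * norm (fb x)) powr p) \<partial>lborel) < \<infinity>" (is ?thesis1)
    and "(LINT x|lebesgue. norm (\<theta> x *\<^sub>R f x) powr p) = enn2real (\<integral>\<^sup>+x. ennreal ((\<theta> x * norm (fb x)) powr p) \<partial>lborel)" (is ?thesis2)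
proof -
  have n: "norm (\<theta> x *\<^sub>R y) = \<theta> x * norm y" for x and y :: 'b using \<theta>[of x] by simp
  have "\<theta> \<in> borel_measurable lebesgue" "fb \<in> borel_measurable lebesgue"
    by (auto intro: measurable_completion)
  note [measurable] = this
  have ae: "AE x in lebesgue. (\<theta> x * norm (f x)) powr p = (\<theta> x * norm (fb x)) powr p"
    using AE_completion[OF eq] by eventually_elim simp
  have "integrable lebesgue (\<lambda>x. norm (\<theta> x *\<^sub>R f x) powr p) \<longleftrightarrow> integrable lebesgue (\<lambda>x. (\<theta> x * norm (fb x)) powr p)"
    unfolding n by (rule integrable_cong_AE[OF _ _ ae]) measurable
  also have "\<dots> \<longleftrightarrow> integrable lborel (\<lambda>x. (\<theta> x * norm (fb x)) powr p)"
    by (rule integrable_completion) measurable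
  also have "\<dots> \<longleftrightarrow> (\<integral>\<^sup>+x. ennreal ((\<theta> x * norm (fb x)) powr p) \<partial>lborel) < \<infinity>"
    by (simp add: integrable_iff_bounded)
  finally show ?thesis1 .
  have "(LINT x|lebesgue. norm (\<theta> x *\<^sub>R f x) powr p) = (LINT x|lebesgue. (\<theta> x * norm (fb x)) powr p)"
    unfolding n by (rule integral_cong_AE[OF _ _ ae]) measurable
  also have "\<dots> = (LINT x|lborel. (\<theta> x * norm (fb x)) powr p)"
    by (rule integral_completion) measurable
  also have "\<dots> = enn2real (\<integral>\<^sup>+x. ennreal ((\<theta> x * norm (fb x)) powr p) \<partial>lborel)"
    by (rule integral_eq_nn_integral) auto
  finally show ?thesis2 .
qed

context weighted_flow begin

lemma Lp_imp_finite:
  fixes f fb :: "'a \<Rightarrow> 'b::euclidean_space"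
  assumes "f \<in> Lp p \<theta>" "fb \<in> borel_measurable borel" "AE x in lborel. f x = fb x"
  shows "(\<integral>\<^sup>+x. ennreal ((\<theta> x * norm (fb x)) powr p) \<partial>lborel) < \<infinity>"
  using weighted_integral_borel(1)[of f fb \<theta> p] assms \<theta>_pos by (auto simp: Lp_def loc_integrable_def)

lemma integrable_compact_of_finite:
  fixes f :: "'a \<Rightarrow> 'b::euclidean_space"
  assumes [measurable]: "f \<in> borel_measurable borel" and p: "p \<ge> 1"
    and fin: "(\<integral>\<^sup>+x. ennreal ((\<theta> x * norm (f x)) powr p) \<partial>lborel) < \<infinity>" and K: "compact K"
  shows "integrable lborel (\<lambda>x. indicator K x *\<^sub>R f x)"
proof (rule integrableI_bounded)
  have "(\<integral>\<^sup>+x. ennreal (norm (indicator K x *\<^sub>R f x)) \<partial>lborel) = (\<integral>\<^sup>+x. ennreal (norm (f x)) * indicator K x \<partial>lborel)"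
    by (intro nn_integral_cong) (auto simp: indicator_def)
  also have "\<dots> < \<infinity>" by (rule tame_compact_finite[OF tame_of_Lp[OF _ _ p] K]) (use fin in auto)
  finally show "(\<integral>\<^sup>+x. ennreal (norm (indicator K x *\<^sub>R f x)) \<partial>lborel) < \<infinity>" .
  show "(\<lambda>x. indicator K x *\<^sub>R f x) \<in> borel_measurable lborel"
    using borel_compact[OF K] by measurable
qed

lemma Lp_of_finite:
  fixes f :: "'a \<Rightarrow> 'b::euclidean_space"
  assumes [measurable]: "f \<in> borel_measurable borel" and p: "p \<ge> 1"
    and fin: "(\<integral>\<^sup>+x. ennreal ((\<theta> x * norm (f x)) powr p) \<partial>lborel) < \<infinity>"
  shows "f \<in> Lp p \<theta>"
proof -
  have fl: "f \<in> borel_measurable lebesgue" by (auto intro: measurable_completion)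
  have "set_integrable lebesgue K f" if K: "compact K" for K
  proof -
    have [measurable]: "K \<in> sets borel" using K by (simp add: borel_compact)
    show ?thesis unfolding set_integrable_def
      using integrable_compact_of_finite[OF assms(1) p fin K] by (subst integrable_completion) auto
  qed
  then show ?thesis
    using weighted_integral_borel(1)[of f f \<theta> p] fl fin \<theta>_pos by (auto simp: Lp_def loc_integrable_def)
qed

lemma Lp_norm_borel:
  fixes f fb :: "'a \<Rightarrow> 'b::euclidean_space"
  assumes "f \<in> borel_measurable lebesgue" "fb \<in> borel_measurable borel" "AE x in lborel. f x = fb x"
  shows "Lp_norm p \<theta> f = enn2real (\<integral>\<^sup>+x. ennreal ((\<theta> x * norm (fb x)) powr p) \<partial>lborel) powr (1 / p)"
  using weighted_integral_borel(2)[of f fb \<theta> p] assms \<theta>_pos by (simp add: Lp_norm_def)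

lemma Lp_norm_le:
  fixes f fb :: "'a \<Rightarrow> 'b::euclidean_space" and g gb :: "'a \<Rightarrow> 'c::euclidean_space"
  assumes f: "f \<in> borel_measurable lebesgue" "fb \<in> borel_measurable borel" "AE x in lborel. f x = fb x"
    and g: "g \<in> Lp p \<theta>" "gb \<in> borel_measurable borel" "AE x in lborel. g x = gb x"
    and p: "p \<ge> 1" and M: "M \<ge> 0"
    and le: "(\<integral>\<^sup>+x. ennreal ((\<theta> x * norm (fb x)) powr p) \<partial>lborel) \<le> ennreal (M powr p) * (\<integral>\<^sup>+x. ennreal ((\<theta> x * norm (gb x)) powr p) \<partial>lborel)"
  shows "Lp_norm p \<theta> f \<le> M * Lp_norm p \<theta> g"
proof -
  have gl: "g \<in> borel_measurable lebesgue" using g by (simp add: Lp_def loc_integrable_def)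
  let ?F = "\<integral>\<^sup>+x. ennreal ((\<theta> x * norm (fb x)) powr p) \<partial>lborel" and ?G = "\<integral>\<^sup>+x. ennreal ((\<theta> x * norm (gb x)) powr p) \<partial>lborel"
  have G: "?G < \<infinity>" by (rule Lp_imp_finite[OF g])
  have "enn2real ?F \<le> enn2real (ennreal (M powr p) * ?G)" using le G by (intro enn2real_mono) (auto simp: ennreal_mult_less_top)
  then have "enn2real ?F \<le> M powr p * enn2real ?G" by (simp add: enn2real_mult)
  then have "enn2real ?F powr (1 / p) \<le> (M powr p * enn2real ?G) powr (1 / p)" using p by (intro powr_mono2) auto
  also have "\<dots> = M * enn2real ?G powr (1 / p)" using p M by (simp add: powr_mult powr_powr)
  finally show ?thesis by (simp add: Lp_norm_borel[OF f] Lp_norm_borel[OF gl g(2,3)])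
qed

lemma integrable_test_mult:
  fixes f :: "'a \<Rightarrow> complex" and \<psi> :: "'a \<Rightarrow> real"
  assumes [measurable]: "f \<in> borel_measurable borel" and \<psi>: "continuous_on UNIV \<psi>" "compact K" "\<And>x. x \<notin> K \<Longrightarrow> \<psi> x = 0"
    and U: "tame U" "\<And>x. ennreal (cmod (f x)) \<le> U x"
  shows "integrable lborel (\<lambda>x. \<psi> x *\<^sub>R f x)"
proof (rule integrableI_bounded)
  have [measurable]: "\<psi> \<in> borel_measurable borel" using \<psi>(1) by (rule borel_measurable_continuous_onI)
  have [measurable]: "K \<in> sets borel" using \<psi>(2) by (simp add: borel_compact)
  have [measurable]: "U \<in> borel_measurable borel" using U by (simp add: tame_def)
  show "(\<lambda>x. \<psi> x *\<^sub>R f x) \<in> borel_measurable lborel" by measurable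
  have "bounded (\<psi> ` K)" by (intro compact_imp_bounded compact_continuous_image \<psi>(2) continuous_on_subset[OF \<psi>(1)]) auto
  then obtain M where M: "\<And>x. x \<in> K \<Longrightarrow> norm (\<psi> x) \<le> M" by (auto simp: bounded_iff)
  have "(\<integral>\<^sup>+x. ennreal (norm (\<psi> x *\<^sub>R f x)) \<partial>lborel) \<le> (\<integral>\<^sup>+x. ennreal M * (U x * indicator K x) \<partial>lborel)"
  proof (rule nn_integral_mono)
    fix x
    show "ennreal (norm (\<psi> x *\<^sub>R f x)) \<le> ennreal M * (U x * indicator K x)"
    proof (cases "x \<in> K")
      case True
      have "ennreal (norm (\<psi> x *\<^sub>R f x)) = ennreal \<bar>\<psi> x\<bar> * ennreal (cmod (f x))" by (simp add: ennreal_mult)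
      also have "\<dots> \<le> ennreal M * U x" using M[OF True] by (intro mult_mono ennreal_leI U) auto
      finally show ?thesis using True by simp
    qed (simp add: \<psi>(3))
  qed
  also have "\<dots> = ennreal M * (\<integral>\<^sup>+x. U x * indicator K x \<partial>lborel)" by (rule nn_integral_cmult) measurable
  also have "\<dots> < \<infinity>" using tame_compact_finite[OF U(1) \<psi>(2)] by (simp add: ennreal_mult_less_top)
  finally show "(\<integral>\<^sup>+x. ennreal (norm (\<psi> x *\<^sub>R f x)) \<partial>lborel) < \<infinity>" .
qed

end

text \<open>\<open>Lp_norm\<close> is 0 for a non-integrable function, so a small norm of a
  difference carries information only together with this integrability.\<close>

lemma integrable_weighted_diff:
  fixes f g :: "'a::euclidean_space \<Rightarrow> 'b::euclidean_space"
  assumes f: "f \<in> Lp p \<theta>" and g: "g \<in> Lp p \<theta>" and [measurable]: "\<theta> \<in> borel_measurable borel" and p: "p \<ge> 1"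
  shows "integrable lebesgue (\<lambda>x. norm (\<theta> x *\<^sub>R (f x - g x)) powr p)"
proof (rule Bochner_Integration.integrable_bound)
  have [measurable]: "f \<in> borel_measurable lebesgue" "g \<in> borel_measurable lebesgue" using f g by (auto simp: Lp_def loc_integrable_def)
  have [measurable]: "\<theta> \<in> borel_measurable lebesgue" by (auto intro: measurable_completion)
  show "integrable lebesgue (\<lambda>x. 2 powr p * (norm (\<theta> x *\<^sub>R f x) powr p + norm (\<theta> x *\<^sub>R g x) powr p))"
    using f g by (auto simp: Lp_def)
  show "(\<lambda>x. norm (\<theta> x *\<^sub>R (f x - g x)) powr p) \<in> borel_measurable lebesgue" by measurable
  show "AE x in lebesgue. norm (norm (\<theta> x *\<^sub>R (f x - g x)) powr p) \<le> norm (2 powr p * (norm (\<theta> x *\<^sub>R f x) powr p + norm (\<theta> x *\<^sub>R g x) powr p))"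
  proof (rule AE_I2)
    fix x
    have "norm (\<theta> x *\<^sub>R (f x - g x)) powr p \<le> (norm (\<theta> x *\<^sub>R f x) + norm (\<theta> x *\<^sub>R g x)) powr p"
      using p by (intro powr_mono2) (simp_all only: scaleR_diff_right norm_triangle_ineq4, simp_all)
    also have "\<dots> \<le> 2 powr p * (norm (\<theta> x *\<^sub>R f x) powr p + norm (\<theta> x *\<^sub>R g x) powr p)"
      using p by (intro powr_add_le) auto
    finally show "norm (norm (\<theta> x *\<^sub>R (f x - g x)) powr p) \<le> norm (2 powr p * (norm (\<theta> x *\<^sub>R f x) powr p + norm (\<theta> x *\<^sub>R g x) powr p))" by simp
  qed
qed

section \<open>The system\<close>

text \<open>The diagonalized problem: \<open>l\<close> and \<open>m\<close> are the eigenvalues of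
  \<open>A\<close> and \<open>B\<close> in the basis \<open>Y\<close>. The uniform bounds
  \<open>am\<close>, \<open>c\<close> and \<open>b\<close> give all components the same real
  Gaussian majorant.\<close>

locale ou_system = isometric_flow "\<lambda>t x. mat_exp (t *\<^sub>R S) *v x"
  for S :: "real^'d^'d" +
  fixes Y :: "complex^'n^'n" and l m :: "'n \<Rightarrow> complex" and am c b :: real
  assumes Y: "invertible Y" and am: "am > 0" "\<And>k. am \<le> cmod (l k)"
    and c: "c > 0" "\<And>k. c \<le> Re (inverse (l k)) / 4" and Re_l: "\<And>k. Re (l k) > 0" and b: "\<And>k. b \<le> Re (m k)"
begin

abbreviation R :: "real \<Rightarrow> real^'d \<Rightarrow> real^'d" where "R \<equiv> \<lambda>t x. mat_exp (t *\<^sub>R S) *v x"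

lemma l_nonzero: "l k \<noteq> 0" using Re_l[of k] by auto

definition coord :: "(real^'d \<Rightarrow> complex^'n) \<Rightarrow> 'n \<Rightarrow> real^'d \<Rightarrow> complex" where
  "coord f k x = (matrix_inv Y *v f x) $ k"

lemma coord_measurable':
  assumes [measurable]: "f \<in> borel_measurable M"
  shows "coord f k \<in> borel_measurable M"
proof -
  have "bounded_linear (\<lambda>v. (matrix_inv Y *v v) $ k)"
    by (rule bounded_linear_compose[OF bounded_linear_vec_nth bounded_linear_matrix_mult])
  then have "(\<lambda>v. (matrix_inv Y *v v) $ k) \<in> borel_measurable borel"
    by (intro borel_measurable_continuous_onI linear_continuous_on)
  note [measurable] = measurable_compose[OF _ this]
  show ?thesis unfolding coord_def[abs_def] by measurable
qed

lemma coord_measurable [measurable (raw)]: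
  assumes "f \<in> borel_measurable borel" "g \<in> borel_measurable M"
  shows "(\<lambda>x. coord f k (g x)) \<in> borel_measurable M"
  by (rule measurable_compose[OF assms(2) coord_measurable'[OF assms(1)]])

lemma coord_sum: "coord (\<lambda>x. \<Sum>k\<in>UNIV. a k x *s column k Y) k x = a k x"
proof -
  have "(\<Sum>k\<in>UNIV. a k x *s column k Y) = Y *v (\<chi> k. a k x)" by (simp add: matrix_mult_sum)
  then show ?thesis by (simp add: coord_def matrix_vector_mul_assoc matrix_inv_mult[OF Y])
qed

lemma sum_coord: "(\<Sum>k\<in>UNIV. coord f k x *s column k Y) = f x"
proof -
  have "(\<Sum>k\<in>UNIV. coord f k x *s column k Y) = Y *v (matrix_inv Y *v f x)" by (simp add: matrix_mult_sum[of Y] coord_def)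
  then show ?thesis by (simp add: matrix_vector_mul_assoc matrix_inv_mult[OF Y])
qed

lemma cmod_coord_le: "cmod (coord f k x) \<le> spectral_norm (matrix_inv Y) * norm (f x)"
  unfolding coord_def using Finite_Cartesian_Product.norm_nth_le[of "matrix_inv Y *v f x" k] spectral_norm_le[of "matrix_inv Y" "f x"] by linarith

text \<open>Defined before a weight is fixed, so that interpretations with two different weights
  speak of the same function.\<close>

definition kernel_op :: "('n \<Rightarrow> real \<Rightarrow> real^'d \<Rightarrow> complex) \<Rightarrow> (real^'d \<Rightarrow> complex^'n) \<Rightarrow> 'n \<Rightarrow> real^'d \<Rightarrow> complex" where
  "kernel_op \<kappa> g k x = (LINT w|(lborel \<Otimes>\<^sub>M lborel). \<kappa> k (fst w) (x - snd w) * coord g k (R (fst w) (snd w)))"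

definition vec_op :: "('n \<Rightarrow> real \<Rightarrow> real^'d \<Rightarrow> complex) \<Rightarrow> (real^'d \<Rightarrow> complex^'n) \<Rightarrow> real^'d \<Rightarrow> complex^'n" where
  "vec_op \<kappa> g x = (\<Sum>k\<in>UNIV. kernel_op \<kappa> g k x *s column k Y)"

definition res_kernel :: "complex \<Rightarrow> 'n \<Rightarrow> real \<Rightarrow> real^'d \<Rightarrow> complex" where
  "res_kernel z k t x = (if t > 0 then exp (- z * of_real t) * ou_kernel (l k) (m k) t x else 0)"

definition grad_kernel :: "complex \<Rightarrow> 'd \<Rightarrow> 'n \<Rightarrow> real \<Rightarrow> real^'d \<Rightarrow> complex" where
  "grad_kernel z i k t x = (if t > 0 then exp (- z * of_real t) * ou_gradient i (l k) (m k) t x else 0)"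

lemma res_kernel_measurable [measurable (raw)]:
  assumes [measurable]: "f \<in> borel_measurable M" "g \<in> borel_measurable M"
  shows "(\<lambda>w. res_kernel z k (f w) (g w)) \<in> borel_measurable M"
  unfolding res_kernel_def by measurable

lemma grad_kernel_measurable [measurable (raw)]:
  assumes [measurable]: "f \<in> borel_measurable M" "g \<in> borel_measurable M"
  shows "(\<lambda>w. grad_kernel z i k (f w) (g w)) \<in> borel_measurable M"
  unfolding grad_kernel_def by measurable

lemma scale_column_measurable [measurable (raw)]:
  "f \<in> borel_measurable M \<Longrightarrow> (\<lambda>x. f x *s (v :: complex^'n)) \<in> borel_measurable M"
  by (rule measurable_compose[where g = "\<lambda>a. a *s v"])
    (auto intro!: borel_measurable_continuous_onI linear_continuous_on bounded_linear_scale_vec)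

lemma vec_op_measurable:
  assumes \<kappa>: "\<And>k. (\<lambda>w. \<kappa> k (fst w) (snd w)) \<in> borel_measurable (borel \<Otimes>\<^sub>M borel)"
    and [measurable]: "g \<in> borel_measurable borel"
  shows "kernel_op \<kappa> g k \<in> borel_measurable borel" "vec_op \<kappa> g \<in> borel_measurable borel"
proof -
  have [measurable (raw)]: "(\<lambda>w. \<kappa> k (f w) (h w)) \<in> borel_measurable M"
    if [measurable]: "f \<in> borel_measurable M" "h \<in> borel_measurable M" for f h k and M :: "'w measure"
    using measurable_compose[OF measurable_Pair[OF that] \<kappa>] by simp
  show [measurable]: "kernel_op \<kappa> g k \<in> borel_measurable borel" for k unfolding kernel_op_def[abs_def] by measurable
  show "vec_op \<kappa> g \<in> borel_measurable borel" unfolding vec_op_def[abs_def] by measurable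
qed

end

locale weighted_ou_system = ou_system S Y l m am c b + weighted_flow "\<lambda>t x. mat_exp (t *\<^sub>R S) *v x" \<theta> C \<eta>
  for S :: "real^'d^'d" and Y :: "complex^'n^'n" and l m am c b \<theta> C \<eta>
begin

lemma cmod_kernel_op_le:
  assumes "\<And>k t x. cmod (\<kappa> k t x) \<le> K t x"
  shows "ennreal (cmod (kernel_op \<kappa> g k x)) \<le> kop lborel (\<lambda>t x. ennreal (K t x)) (\<lambda>x. ennreal (cmod (coord g k x))) x"
proof -
  have "ennreal (cmod (kernel_op \<kappa> g k x)) \<le> (\<integral>\<^sup>+w. ennreal (cmod (\<kappa> k (fst w) (x - snd w) * coord g k (R (fst w) (snd w)))) \<partial>(lborel \<Otimes>\<^sub>M lborel))"
    unfolding kernel_op_def by (rule cmod_integral_le_nn)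
  also have "\<dots> \<le> kop lborel (\<lambda>t x. ennreal (K t x)) (\<lambda>x. ennreal (cmod (coord g k x))) x"
    unfolding kop_def
  proof (intro nn_integral_mono)
    fix w :: "real \<times> (real^'d)"
    show "ennreal (cmod (\<kappa> k (fst w) (x - snd w) * coord g k (R (fst w) (snd w))))
      \<le> ennreal (K (fst w) (x - snd w)) * ennreal (cmod (coord g k (R (fst w) (snd w))))"
      using order_trans[OF norm_ge_zero assms[of k "fst w" "x - snd w"]]
      by (simp add: norm_mult ennreal_mult[symmetric] ennreal_leI mult_right_mono assms)
  qed
  finally show ?thesis .
qed

lemma Lpn_coord_le:
  assumes [measurable]: "g \<in> borel_measurable borel" and p: "p \<ge> 1"
  shows "Lpn p (coord g k) \<le> ennreal (spectral_norm (matrix_inv Y) powr p) * (\<integral>\<^sup>+x. ennreal ((\<theta> x * norm (g x)) powr p) \<partial>lborel)"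
proof -
  define s where "s = spectral_norm (matrix_inv Y)"
  have "Lpn p (coord g k) \<le> (\<integral>\<^sup>+x. ennreal (s powr p) * ennreal ((\<theta> x * norm (g x)) powr p) \<partial>lborel)"
    unfolding Lpn_def
  proof (rule nn_integral_mono)
    fix x
    have "\<theta> x * cmod (coord g k x) \<le> \<theta> x * (s * norm (g x))"
      using \<theta>_pos[of x] by (intro mult_left_mono) (auto simp: s_def cmod_coord_le less_imp_le)
    then have "(\<theta> x * cmod (coord g k x)) powr p \<le> (s * (\<theta> x * norm (g x))) powr p"
      using \<theta>_pos[of x] p by (intro powr_mono2) (auto simp: mult_ac less_imp_le)
    also have "\<dots> = s powr p * (\<theta> x * norm (g x)) powr p"
      by (rule powr_mult)
    finally show "ennreal ((\<theta> x * cmod (coord g k x)) powr p) \<le> ennreal (s powr p) * ennreal ((\<theta> x * norm (g x)) powr p)"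
      by (simp add: ennreal_mult[symmetric] ennreal_leI)
  qed
  also have "\<dots> = ennreal (s powr p) * (\<integral>\<^sup>+x. ennreal ((\<theta> x * norm (g x)) powr p) \<partial>lborel)"
    by (rule nn_integral_cmult) measurable
  finally show ?thesis by (simp add: s_def)
qed

lemma tame_coord:
  assumes [measurable]: "g \<in> borel_measurable borel" and p: "p \<ge> 1"
    and fin: "(\<integral>\<^sup>+x. ennreal ((\<theta> x * norm (g x)) powr p) \<partial>lborel) < \<infinity>"
  shows "tame (\<lambda>x. ennreal (cmod (coord g k x)))" and "Lpn p (coord g k) < \<infinity>"
proof -
  show L: "Lpn p (coord g k) < \<infinity>"
    by (rule order_le_less_trans[OF Lpn_coord_le[OF assms(1) p]]) (use fin in \<open>simp add: ennreal_mult_less_top\<close>)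
  show "tame (\<lambda>x. ennreal (cmod (coord g k x)))" by (rule tame_of_Lpn[OF _ p L]) measurable
qed

text \<open>The sum over the components is taken under the integral, where it is the matrix with
  eigenvalues \<open>\<kappa> k\<close> in the basis \<open>Y\<close> applied to \<open>g\<close>.
  The condition number therefore enters once and no factor depending on the number of components
  arises.\<close>

lemma norm_vec_op_le:
  assumes \<kappa>: "\<And>k. (\<lambda>w. \<kappa> k (fst w) (snd w)) \<in> borel_measurable (borel \<Otimes>\<^sub>M borel)"
    and K: "\<And>k t x. cmod (\<kappa> k t x) \<le> K t x" and g[measurable]: "g \<in> borel_measurable borel"
    and fin: "\<And>k. kop lborel (\<lambda>t x. ennreal (K t x)) (\<lambda>x. ennreal (cmod (coord g k x))) x < \<infinity>"
  shows "ennreal (norm (vec_op \<kappa> g x)) \<le> kop lborel (\<lambda>t x. ennreal (condition_number Y * K t x)) (\<lambda>x. ennreal (norm (g x))) x"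
proof -
  have [measurable (raw)]: "(\<lambda>w. \<kappa> k (f w) (h w)) \<in> borel_measurable M"
    if [measurable]: "f \<in> borel_measurable M" "h \<in> borel_measurable M" for f h k and M :: "'w measure"
    using measurable_compose[OF measurable_Pair[OF that] \<kappa>] by simp
  let ?f = "\<lambda>k w. \<kappa> k (fst w) (x - snd w) * coord g k (R (fst w) (snd w))"
  have i: "integrable (lborel \<Otimes>\<^sub>M lborel) (?f k)" for k
  proof (rule integrableI_bounded)
    have "(\<integral>\<^sup>+w. ennreal (cmod (?f k w)) \<partial>(lborel \<Otimes>\<^sub>M lborel)) \<le> kop lborel (\<lambda>t x. ennreal (K t x)) (\<lambda>x. ennreal (cmod (coord g k x))) x"
      unfolding kop_def
    proof (intro nn_integral_mono)
      fix w :: "real \<times> (real^'d)"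
      show "ennreal (cmod (?f k w)) \<le> ennreal (K (fst w) (x - snd w)) * ennreal (cmod (coord g k (R (fst w) (snd w))))"
        using order_trans[OF norm_ge_zero K[of k "fst w" "x - snd w"]]
        by (simp add: norm_mult ennreal_mult[symmetric] ennreal_leI mult_right_mono K)
    qed
    then show "(\<integral>\<^sup>+w. ennreal (cmod (?f k w)) \<partial>(lborel \<Otimes>\<^sub>M lborel)) < \<infinity>" using fin[of k] by (rule order_le_less_trans)
  qed measurable
  let ?F = "\<lambda>w. \<Sum>k\<in>UNIV. ?f k w *s column k Y"
  have ik: "integrable (lborel \<Otimes>\<^sub>M lborel) (\<lambda>w. ?f k w *s column k Y)" for k
    by (rule integrable_bounded_linear[OF bounded_linear_scale_vec i])
  have "vec_op \<kappa> g x = (\<Sum>k\<in>UNIV. LINT w|(lborel \<Otimes>\<^sub>M lborel). ?f k w *s column k Y)"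
    unfolding vec_op_def kernel_op_def
    by (intro sum.cong refl integral_bounded_linear[OF bounded_linear_scale_vec i, symmetric])
  also have "\<dots> = (LINT w|(lborel \<Otimes>\<^sub>M lborel). ?F w)"
    by (rule Bochner_Integration.integral_sum[symmetric]) (rule ik)
  finally have eq: "vec_op \<kappa> g x = (LINT w|(lborel \<Otimes>\<^sub>M lborel). ?F w)" .
  have "integrable (lborel \<Otimes>\<^sub>M lborel) ?F" by (intro Bochner_Integration.integrable_sum ik)
  then have "ennreal (norm (vec_op \<kappa> g x)) \<le> (\<integral>\<^sup>+w. ennreal (norm (?F w)) \<partial>(lborel \<Otimes>\<^sub>M lborel))"
    unfolding eq by (rule integral_norm_bound_ennreal)
  also have "\<dots> \<le> kop lborel (\<lambda>t x. ennreal (condition_number Y * K t x)) (\<lambda>x. ennreal (norm (g x))) x"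
    unfolding kop_def
  proof (intro nn_integral_mono)
    fix w :: "real \<times> (real^'d)"
    have K0: "K (fst w) (x - snd w) \<ge> 0" by (rule order_trans[OF norm_ge_zero K])
    have "?F w = (Y ** diag (\<lambda>k. \<kappa> k (fst w) (x - snd w)) ** matrix_inv Y) *v g (R (fst w) (snd w))"
      by (simp add: conj_diag_apply coord_def)
    then have "norm (?F w) \<le> condition_number Y * K (fst w) (x - snd w) * norm (g (R (fst w) (snd w)))"
      using norm_conj_diag_le[OF K K0] by simp
    then show "ennreal (norm (?F w)) \<le> ennreal (condition_number Y * K (fst w) (x - snd w)) * ennreal (norm (g (R (fst w) (snd w))))"
      using condition_number_pos[OF Y] K0 by (simp add: ennreal_mult[symmetric] ennreal_leI)
  qed
  finally show ?thesis .
qed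

lemma kernel_semigroup_component:
  assumes "\<eta>\<^sup>2 < 4 * c * (Re z + b)"
  shows "kernel_semigroup R \<theta> C \<eta> (ou_kernel (l k) (m k)) z"
  by (rule kernel_semigroup_ou[OF am c b[of k] Re_l assms])

text \<open>The matrix kernel is diagonal in the basis \<open>Y\<close>, and \<xi> = R h y produces
  the scalar operators. The identity is claimed almost everywhere because splitting the integral
  relies on the absolute convergence of every component.\<close>

lemma ou_semigroup_AE:
  assumes v: "v \<in> borel_measurable lebesgue" and vb[measurable]: "vb \<in> borel_measurable borel" and eq: "AE x in lborel. v x = vb x"
    and p: "p \<ge> 1" and fin: "(\<integral>\<^sup>+x. ennreal ((\<theta> x * norm (vb x)) powr p) \<partial>lborel) < \<infinity>"
    and z: "\<eta>\<^sup>2 < 4 * c * (Re z + b)" and h: "h > 0"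
  shows "AE x in lborel. ou_semigroup (Y ** diag l ** matrix_inv Y) (Y ** diag m ** matrix_inv Y) S h v x
    = (\<Sum>k\<in>UNIV. kernel_semigroup.T R (ou_kernel (l k) (m k)) h (coord vb k) x *s column k Y)"
proof -
  let ?A = "Y ** diag l ** matrix_inv Y" and ?B = "Y ** diag m ** matrix_inv Y"
  have "AE x in lborel. \<forall>k\<in>(UNIV :: 'n set). kop (dirac h) (\<lambda>t x. ennreal (cmod (ou_kernel (l k) (m k) t x))) (\<lambda>x. ennreal (cmod (coord vb k x))) x < \<infinity>"
  proof (rule AE_finite_allI)
    fix k
    interpret KS: kernel_semigroup R \<theta> C \<eta> "ou_kernel (l k) (m k)" z by (rule kernel_semigroup_component[OF z])
    show "AE x in lborel. kop (dirac h) (\<lambda>t x. ennreal (cmod (ou_kernel (l k) (m k) t x))) (\<lambda>x. ennreal (cmod (coord vb k x))) x < \<infinity>"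
      by (rule tame_AE_finite[OF tame_kop[OF tame_coord(1)[OF vb p fin] KS.kernel_k KS.exp_mass_k[OF h]]])
  qed simp
  then show ?thesis
  proof eventually_elim
    fix x assume fk: "\<forall>k\<in>UNIV. kop (dirac h) (\<lambda>t x. ennreal (cmod (ou_kernel (l k) (m k) t x))) (\<lambda>x. ennreal (cmod (coord vb k x))) x < \<infinity>"
    have i: "integrable lborel (\<lambda>y. ou_kernel (l k) (m k) h (x - y) * coord vb k (R h y))" for k
    proof -
      interpret KS: kernel_semigroup R \<theta> C \<eta> "ou_kernel (l k) (m k)" z by (rule kernel_semigroup_component[OF z])
      show ?thesis by (rule KS.T_integrable) (use fk in auto)
    qed
    let ?G = "\<lambda>\<xi>. \<Sum>k\<in>UNIV. (ou_kernel (l k) (m k) h (R h x - \<xi>) * coord vb k \<xi>) *s column k Y"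
    have [measurable]: "?G \<in> borel_measurable borel" by measurable
    have hk: "heat_kernel ?A ?B S x \<xi> h *v f \<xi> = (\<Sum>k\<in>UNIV. (ou_kernel (l k) (m k) h (R h x - \<xi>) * coord f k \<xi>) *s column k Y)" for f \<xi>
      by (simp add: heat_kernel_conj_diag[OF Y l_nonzero h] conj_diag_apply coord_def)
    have "AE \<xi> in lebesgue. heat_kernel ?A ?B S x \<xi> h *v v \<xi> = ?G \<xi>"
      using AE_completion[OF eq] by eventually_elim (simp add: hk coord_def)
    moreover have "(\<lambda>\<xi>. heat_kernel ?A ?B S x \<xi> h *v v \<xi>) \<in> borel_measurable lebesgue"
    proof -
      have [measurable]: "coord v k \<in> borel_measurable lebesgue" for k by (rule coord_measurable'[OF v])
      have [measurable]: "(\<lambda>\<xi>. ou_kernel (l k) (m k) h (R h x - \<xi>)) \<in> borel_measurable lebesgue" for k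
        by (rule measurable_completion) simp
      show ?thesis unfolding hk by measurable
    qed
    ultimately have "ou_semigroup ?A ?B S h v x = (LINT \<xi>|lebesgue. ?G \<xi>)"
      unfolding ou_semigroup_def using h by (simp, intro integral_cong_AE) (auto intro: measurable_completion)
    also have "\<dots> = (LINT \<xi>|lborel. ?G \<xi>)" by (rule integral_completion) measurable
    also have "\<dots> = (LINT y|lborel. ?G (R h y))" by (rule integral_R[symmetric]) measurable
    also have "\<dots> = (LINT y|lborel. (\<Sum>k\<in>UNIV. (ou_kernel (l k) (m k) h (x - y) * coord vb k (R h y)) *s column k Y))"
    proof -
      have "ou_kernel (l k) (m k) h (R h x - R h y) = ou_kernel (l k) (m k) h (x - y)" for k y
        unfolding R_diff[symmetric] by (simp add: ou_kernel_def)
      then show ?thesis by simp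
    qed
    also have "\<dots> = (\<Sum>k\<in>UNIV. LINT y|lborel. (ou_kernel (l k) (m k) h (x - y) * coord vb k (R h y)) *s column k Y)"
      by (intro Bochner_Integration.integral_sum integrable_bounded_linear[OF bounded_linear_scale_vec i])
    also have "\<dots> = (\<Sum>k\<in>UNIV. (LINT y|lborel. ou_kernel (l k) (m k) h (x - y) * coord vb k (R h y)) *s column k Y)"
      by (intro sum.cong refl integral_bounded_linear[OF bounded_linear_scale_vec i])
    also have "\<dots> = (\<Sum>k\<in>UNIV. kernel_semigroup.T R (ou_kernel (l k) (m k)) h (coord vb k) x *s column k Y)"
    proof (intro sum.cong refl arg_cong2[of _ _ _ _ "(*s)"])
      fix k
      interpret KS: kernel_semigroup R \<theta> C \<eta> "ou_kernel (l k) (m k)" z by (rule kernel_semigroup_component[OF z])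
      show "(LINT y|lborel. ou_kernel (l k) (m k) h (x - y) * coord vb k (R h y)) = KS.T h (coord vb k) x"
        by (rule KS.T_def[symmetric])
    qed
    finally show "ou_semigroup ?A ?B S h v x = (\<Sum>k\<in>UNIV. kernel_semigroup.T R (ou_kernel (l k) (m k)) h (coord vb k) x *s column k Y)" .
  qed
qed

end

section \<open>Representation of the solution and its weak derivatives\<close>

context weighted_ou_system begin

text \<open>Reduces to \<open>generator_imp_res\<close> in each coordinate: convergence in the
  vector-valued norm passes to the coordinates with a factor given by
  \<open>spectral_norm (matrix_inv Y)\<close>.\<close>

lemma resolvent_representation:
  assumes p: "p \<ge> 1" and z: "\<eta>\<^sup>2 < 4 * c * (Re z + b)"
    and g: "g \<in> Lp p \<theta>" and gb[measurable]: "gb \<in> borel_measurable borel" and geq: "AE x in lborel. g x = gb x"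
    and rs: "resolvent_solution p \<theta> (Y ** diag l ** matrix_inv Y) (Y ** diag m ** matrix_inv Y) S z g v"
  shows "AE x in lborel. v x = vec_op (res_kernel z) gb x"
proof -
  let ?T = "ou_semigroup (Y ** diag l ** matrix_inv Y) (Y ** diag m ** matrix_inv Y) S"
  obtain w where gen: "(v, w) \<in> ou_generator p \<theta> (Y ** diag l ** matrix_inv Y) (Y ** diag m ** matrix_inv Y) S"
    and weq: "AE x in lebesgue. z *s v x - w x = g x"
    using rs by (auto simp: resolvent_solution_def)
  define f where "f t x = (1 / t) *\<^sub>R (?T t v x - v x)" for t x
  have v: "v \<in> Lp p \<theta>" and w: "w \<in> Lp p \<theta>" and fL: "eventually (\<lambda>t. f t \<in> Lp p \<theta>) (at_right 0)"
    and flim: "((\<lambda>t. Lp_norm p \<theta> (\<lambda>x. f t x - w x)) \<longlongrightarrow> 0) (at_right 0)"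
    using gen by (auto simp: ou_generator_def Lp_tendsto_def f_def[abs_def])
  have vl: "v \<in> borel_measurable lebesgue" and wl: "w \<in> borel_measurable lebesgue"
    using v w by (auto simp: Lp_def loc_integrable_def)
  obtain vb where vb[measurable]: "vb \<in> borel_measurable borel" and veq: "AE x in lborel. v x = vb x"
    using borel_representative[OF vl] by blast
  \<comment> \<open>Defined by the equation instead of being chosen as a representative of
    \<open>w\<close>, so that z vb - wb = gb holds at every point.\<close>
  define wb where "wb x = z *s vb x - gb x" for x
  have zs: "(\<lambda>x :: complex^'n. z *s x) \<in> borel_measurable borel"
    by (intro borel_measurable_continuous_onI linear_continuous_on linear_conv_bounded_linear[THEN iffD1] linearI)
      (simp_all add: vec_eq_iff algebra_simps)
  have [measurable]: "wb \<in> borel_measurable borel"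
    unfolding wb_def[abs_def] by (intro borel_measurable_diff gb measurable_compose[OF vb zs])
  have weq': "AE x in lborel. w x = wb x"
    using weq[unfolded AE_completion_iff] veq geq by eventually_elim (auto simp: wb_def algebra_simps)
  have vfin: "(\<integral>\<^sup>+x. ennreal ((\<theta> x * norm (vb x)) powr p) \<partial>lborel) < \<infinity>" by (rule Lp_imp_finite[OF v vb veq])
  have wfin: "(\<integral>\<^sup>+x. ennreal ((\<theta> x * norm (wb x)) powr p) \<partial>lborel) < \<infinity>" by (rule Lp_imp_finite[OF w _ weq']) measurable
  define Tv where "Tv h x = (\<Sum>k\<in>UNIV. kernel_semigroup.T R (ou_kernel (l k) (m k)) h (coord vb k) x *s column k Y)" for h x
  define G where "G h x = (1 / h) *\<^sub>R (Tv h x - vb x) - wb x" for h x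
  have Tm: "(\<lambda>x. kernel_semigroup.T R (ou_kernel (l k) (m k)) h (coord vb k) x) \<in> borel_measurable borel" for h k
  proof -
    interpret KS: kernel_semigroup R \<theta> C \<eta> "ou_kernel (l k) (m k)" z by (rule kernel_semigroup_component[OF z])
    show ?thesis by measurable
  qed
  note [measurable] = Tm
  have [measurable]: "G h \<in> borel_measurable borel" for h unfolding G_def[abs_def] Tv_def by measurable
  have lin: "coord (\<lambda>x. r *\<^sub>R (a x - a' x) - a'' x) k x = r *\<^sub>R (coord a k x - coord a' k x) - coord a'' k x" for r a a' a'' k x
    unfolding coord_def
    by (simp add: linear_diff[OF bounded_linear.linear[OF bounded_linear_matrix_mult]] linear_scale[OF bounded_linear.linear[OF bounded_linear_matrix_mult]])
  have Gk: "coord (G h) k x = (kernel_semigroup.T R (ou_kernel (l k) (m k)) h (coord vb k) x - coord vb k x) / of_real h - coord wb k x" for h k x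
  proof -
    have "coord (Tv h) k x = kernel_semigroup.T R (ou_kernel (l k) (m k)) h (coord vb k) x"
      unfolding Tv_def[abs_def] by (rule coord_sum)
    then show ?thesis unfolding G_def[abs_def] lin by (simp add: scaleR_conv_of_real)
  qed
  have Glim: "((\<lambda>h. \<integral>\<^sup>+x. ennreal ((\<theta> x * norm (G h x)) powr p) \<partial>lborel) \<longlongrightarrow> 0) (at_right 0)"
  proof -
    \<comment> \<open>\<open>enn2real\<close> sends infinity to 0, so the real norm determines the
      extended integral only once the latter is known to be finite; this uses that the difference
      quotients belong to the space for small times.\<close>
    have "eventually (\<lambda>h. (\<integral>\<^sup>+x. ennreal ((\<theta> x * norm (G h x)) powr p) \<partial>lborel) = ennreal (Lp_norm p \<theta> (\<lambda>x. f h x - w x) powr p)) (at_right 0)"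
      using fL eventually_at_right_less[of "0::real"]
    proof eventually_elim
      fix h :: real assume fh: "f h \<in> Lp p \<theta>" and h: "0 < h"
      have eq: "AE x in lborel. f h x - w x = G h x"
        using ou_semigroup_AE[OF vl vb veq p vfin z h] veq weq'
        by eventually_elim (simp add: f_def G_def Tv_def)
      have ml: "(\<lambda>x. f h x - w x) \<in> borel_measurable lebesgue"
        using fh wl by (auto simp: Lp_def loc_integrable_def)
      have "integrable lebesgue (\<lambda>x. norm (\<theta> x *\<^sub>R (f h x - w x)) powr p)"
        by (rule integrable_weighted_diff[OF fh w _ p]) measurable
      then have fin: "(\<integral>\<^sup>+x. ennreal ((\<theta> x * norm (G h x)) powr p) \<partial>lborel) < \<infinity>"
        using weighted_integral_borel(1)[OF ml _ _ eq] \<theta>_pos by simp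
      have "Lp_norm p \<theta> (\<lambda>x. f h x - w x) = enn2real (\<integral>\<^sup>+x. ennreal ((\<theta> x * norm (G h x)) powr p) \<partial>lborel) powr (1 / p)"
        by (rule Lp_norm_borel[OF ml _ eq]) measurable
      then have "Lp_norm p \<theta> (\<lambda>x. f h x - w x) powr p = enn2real (\<integral>\<^sup>+x. ennreal ((\<theta> x * norm (G h x)) powr p) \<partial>lborel)"
        using p by (simp add: powr_powr)
      then show "(\<integral>\<^sup>+x. ennreal ((\<theta> x * norm (G h x)) powr p) \<partial>lborel) = ennreal (Lp_norm p \<theta> (\<lambda>x. f h x - w x) powr p)"
        using fin by simp
    qed
    moreover have "((\<lambda>h. ennreal (Lp_norm p \<theta> (\<lambda>x. f h x - w x) powr p)) \<longlongrightarrow> ennreal (0 powr p)) (at_right 0)"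
      using p by (intro tendsto_ennrealI tendsto_powr'[OF flim]) (auto simp: Lp_norm_def)
    ultimately show ?thesis using p by (simp add: tendsto_cong)
  qed
  have "AE x in lborel. \<forall>k\<in>(UNIV :: 'n set). coord vb k x = kernel_op (res_kernel z) gb k x"
  proof (rule AE_finite_allI)
    fix k
    interpret KS: kernel_semigroup R \<theta> C \<eta> "ou_kernel (l k) (m k)" z by (rule kernel_semigroup_component[OF z])
    have "((\<lambda>h. Lpn p (\<lambda>x. (KS.T h (coord vb k) x - coord vb k x) / of_real h - coord wb k x)) \<longlongrightarrow> 0) (at_right 0)"
    proof (rule tendsto_sandwich[OF _ _ tendsto_const tendsto_ennreal_const_mult[OF Glim, of "spectral_norm (matrix_inv Y) powr p"]])
      have "Lpn p (\<lambda>x. (KS.T h (coord vb k) x - coord vb k x) / of_real h - coord wb k x)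
         \<le> ennreal (spectral_norm (matrix_inv Y) powr p) * (\<integral>\<^sup>+x. ennreal ((\<theta> x * norm (G h x)) powr p) \<partial>lborel)" for h
        using Lpn_coord_le[of "G h" p k] p by (simp add: Gk[abs_def])
      then show "eventually (\<lambda>h. Lpn p (\<lambda>x. (KS.T h (coord vb k) x - coord vb k x) / of_real h - coord wb k x)
         \<le> ennreal (spectral_norm (matrix_inv Y) powr p) * (\<integral>\<^sup>+x. ennreal ((\<theta> x * norm (G h x)) powr p) \<partial>lborel)) (at_right 0)"
        by (intro always_eventually allI)
    qed simp
    then have "AE x in lborel. coord vb k x = KS.res (\<lambda>x. z * coord vb k x - coord wb k x) x"
      by (intro KS.generator_imp_res[OF _ _ p] tame_coord(2)[OF _ p] vfin wfin) measurable
    moreover have "(\<lambda>x. z * coord vb k x - coord wb k x) = coord gb k"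
    proof
      fix x
      have "matrix_inv Y *v wb x = z *s (matrix_inv Y *v vb x) - matrix_inv Y *v gb x"
        unfolding wb_def by (simp add: linear_diff[OF bounded_linear.linear[OF bounded_linear_matrix_mult]] vector_scalar_commute)
      then show "z * coord vb k x - coord wb k x = coord gb k x" by (simp add: coord_def)
    qed
    moreover have "KS.res (coord gb k) x = kernel_op (res_kernel z) gb k x" for x
      unfolding KS.res_def kernel_op_def KS.rk_def res_kernel_def ..
    ultimately show "AE x in lborel. coord vb k x = kernel_op (res_kernel z) gb k x" by simp
  qed simp
  then show ?thesis using veq
  proof eventually_elim
    fix x assume k: "\<forall>k\<in>UNIV. coord vb k x = kernel_op (res_kernel z) gb k x" and v: "v x = vb x"
    have "vb x = (\<Sum>k\<in>UNIV. coord vb k x *s column k Y)" by (rule sum_coord[symmetric])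
    also have "\<dots> = vec_op (res_kernel z) gb x" unfolding vec_op_def using k by simp
    finally show "v x = vec_op (res_kernel z) gb x" using v by simp
  qed
qed

lemma vec_op_estimate:
  assumes \<kappa>: "\<And>k. (\<lambda>w. \<kappa> k (fst w) (snd w)) \<in> borel_measurable (borel \<Otimes>\<^sub>M borel)"
    and K: "\<And>k t x. cmod (\<kappa> k t x) \<le> K t x" "(\<lambda>w. K (fst w) (snd w)) \<in> borel_measurable (borel \<Otimes>\<^sub>M borel)"
    and g[measurable]: "g \<in> borel_measurable borel" and p: "p \<ge> 1"
    and fin: "(\<integral>\<^sup>+x. ennreal ((\<theta> x * norm (g x)) powr p) \<partial>lborel) < \<infinity>"
    and M: "M > 0" "exp_mass lborel (\<lambda>t x. ennreal (condition_number Y * K t x)) \<eta> \<le> ennreal M"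
  shows "tame (kop lborel (\<lambda>t x. ennreal (K t x)) (\<lambda>x. ennreal (cmod (coord g k x))))"
    and "(\<integral>\<^sup>+x. ennreal ((\<theta> x * norm (vec_op \<kappa> g x)) powr p) \<partial>lborel)
      \<le> ennreal ((C * M) powr p) * (\<integral>\<^sup>+x. ennreal ((\<theta> x * norm (g x)) powr p) \<partial>lborel)"
proof -
  note [measurable] = K(2)
  have N: "kernel_on lborel (\<lambda>t x. ennreal (K t x))" by (rule kernel_on_lborel) measurable
  have N': "kernel_on lborel (\<lambda>t x. ennreal (condition_number Y * K t x))" by (rule kernel_on_lborel) measurable
  have K0: "K t x \<ge> 0" for t x by (rule order_trans[OF norm_ge_zero K(1)])
  note Y0 = condition_number_pos[OF Y]
  have "ennreal (condition_number Y) * exp_mass lborel (\<lambda>t x. ennreal (K t x)) \<eta> = exp_mass lborel (\<lambda>t x. ennreal (condition_number Y * K t x)) \<eta>"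
    using Y0 K0 by (simp add: exp_mass_cmult[OF N, symmetric] ennreal_mult)
  also have "\<dots> < \<infinity>" using M(2) by (rule order_le_less_trans) simp
  finally have "exp_mass lborel (\<lambda>t x. ennreal (K t x)) \<eta> < \<infinity>" using Y0 by (auto simp: ennreal_mult_less_top)
  then show t: "tame (kop lborel (\<lambda>t x. ennreal (K t x)) (\<lambda>x. ennreal (cmod (coord g k x))))" for k
    by (rule tame_kop[OF tame_coord(1)[OF g p fin] N])
  have "AE x in lborel. \<forall>k\<in>(UNIV :: 'n set). kop lborel (\<lambda>t x. ennreal (K t x)) (\<lambda>x. ennreal (cmod (coord g k x))) x < \<infinity>"
    by (rule AE_finite_allI) (simp_all add: tame_AE_finite[OF t, simplified])
  then have "AE x in lborel. ennreal (norm (vec_op \<kappa> g x)) \<le> kop lborel (\<lambda>t x. ennreal (condition_number Y * K t x)) (\<lambda>x. ennreal (norm (g x))) x"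
    by eventually_elim (rule norm_vec_op_le[OF \<kappa> K(1) g], simp)
  then show "(\<integral>\<^sup>+x. ennreal ((\<theta> x * norm (vec_op \<kappa> g x)) powr p) \<partial>lborel)
      \<le> ennreal ((C * M) powr p) * (\<integral>\<^sup>+x. ennreal ((\<theta> x * norm (g x)) powr p) \<partial>lborel)"
    by (intro kop_Lp_bound[OF N' _ _ p M]) auto
qed

lemma res_kernel_by_parts:
  assumes \<phi>: "test_function \<phi>"
  shows "(LINT x|lborel. partial i \<phi> x *\<^sub>R res_kernel z k t (x - y)) = - (LINT x|lborel. \<phi> x *\<^sub>R grad_kernel z i k t (x - y))"
proof (cases "t > 0")
  case True
  show ?thesis
  proof (rule test_function_by_parts[OF \<phi>])
    show "continuous_on UNIV (\<lambda>x. res_kernel z k t (x - y))" "continuous_on UNIV (\<lambda>x. grad_kernel z i k t (x - y))"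
      unfolding res_kernel_def grad_kernel_def using True
      by (auto intro!: continuous_intros ou_kernel_continuous ou_gradient_continuous l_nonzero)
    show "((\<lambda>s. res_kernel z k t (x + s *\<^sub>R axis i 1 - y)) has_vector_derivative grad_kernel z i k t (x + r *\<^sub>R axis i 1 - y)) (at r)" for x r
      using has_vector_derivative_mult_right[OF ou_kernel_derivative[OF True l_nonzero], of "exp (- z * of_real t)" k "m k" "x - y" i r] True
      by (simp add: res_kernel_def grad_kernel_def algebra_simps)
  qed
qed (simp add: res_kernel_def grad_kernel_def)

text \<open>The integral against the test function is moved inside, so the integration by parts
  takes place in x for fixed time and y, where the kernel is continuously differentiable. The
  singularity of the gradient at t = 0 is controlled by the tame majorant built from
  \<open>K'\<close>.\<close>

lemma weak_partial_vec_op: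
  fixes i :: 'd and v :: "real^'d \<Rightarrow> complex^'n" and K K' :: "real \<Rightarrow> real^'d \<Rightarrow> real"
  assumes v: "loc_integrable v" and veq: "AE x in lborel. v x = vec_op (res_kernel z) g x" and [measurable]: "g \<in> borel_measurable borel"
    and K: "\<And>k t x. cmod (res_kernel z k t x) \<le> K t x" and K': "\<And>k t x. cmod (grad_kernel z i k t x) \<le> K' t x"
    and t: "\<And>k. tame (kop lborel (\<lambda>t x. ennreal (K t x)) (\<lambda>x. ennreal (cmod (coord g k x))))"
    and t': "\<And>k. tame (kop lborel (\<lambda>t x. ennreal (K' t x)) (\<lambda>x. ennreal (cmod (coord g k x))))"
    and w: "loc_integrable (vec_op (grad_kernel z i) g)"
  shows "weak_partial i v (vec_op (grad_kernel z i) g)"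
  unfolding weak_partial_def
proof (intro conjI allI impI v w)
  fix \<phi> :: "real^'d \<Rightarrow> real" assume \<phi>: "test_function \<phi>"
  have rm: "(\<lambda>w. res_kernel z k (fst w) (snd w)) \<in> borel_measurable (borel \<Otimes>\<^sub>M borel)"
    and gm: "(\<lambda>w. grad_kernel z i k (fst w) (snd w)) \<in> borel_measurable (borel \<Otimes>\<^sub>M borel)" for k by measurable
  note [measurable] = vec_op_measurable[OF rm assms(3)] vec_op_measurable[OF gm assms(3)]
  note c\<phi> = test_continuous[OF \<phi>] and c\<phi>' = test_partial_continuous[OF \<phi>, of i] and K\<phi> = test_compact[OF \<phi>]
  have [measurable]: "\<phi> \<in> borel_measurable borel" "partial i \<phi> \<in> borel_measurable borel"
    using c\<phi> c\<phi>' by (auto intro: borel_measurable_continuous_onI)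
  have tame_sub: "tame (kop lborel (\<lambda>t x. ennreal (cmod (\<kappa> t x))) (\<lambda>x. ennreal (cmod (coord g k x))))"
    if \<kappa>: "(\<lambda>w. \<kappa> (fst w) (snd w)) \<in> borel_measurable (borel \<Otimes>\<^sub>M borel)" and le: "\<And>t x. cmod (\<kappa> t x) \<le> L t x"
      and tL: "tame (kop lborel (\<lambda>t x. ennreal (L t x)) (\<lambda>x. ennreal (cmod (coord g k x))))" for \<kappa> :: "real \<Rightarrow> real^'d \<Rightarrow> complex" and L k
  proof -
    note [measurable] = \<kappa>
    have N: "kernel_on lborel (\<lambda>t x. ennreal (cmod (\<kappa> t x)))" by (rule kernel_on_lborel) measurable
    have m: "kop lborel (\<lambda>t x. ennreal (cmod (\<kappa> t x))) (\<lambda>x. ennreal (cmod (coord g k x))) \<in> borel_measurable borel"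
      by (rule kop_measurable[OF N]) measurable
    have "kop lborel (\<lambda>t x. ennreal (cmod (\<kappa> t x))) (\<lambda>x. ennreal (cmod (coord g k x))) x
        \<le> kop lborel (\<lambda>t x. ennreal (L t x)) (\<lambda>x. ennreal (cmod (coord g k x))) x" for x
      unfolding kop_def by (intro nn_integral_mono mult_right_mono ennreal_leI le) simp
    then have "ennreal (\<theta> x) * kop lborel (\<lambda>t x. ennreal (cmod (\<kappa> t x))) (\<lambda>x. ennreal (cmod (coord g k x))) x
        \<le> ennreal (\<theta> x) * kop lborel (\<lambda>t x. ennreal (L t x)) (\<lambda>x. ennreal (cmod (coord g k x))) x" for x
      by (rule mult_left_mono) simp
    then show ?thesis using tL m unfolding tame_def by (meson order_trans)
  qed
  note tr = tame_sub[OF rm K t] and tg = tame_sub[OF gm K' t']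
  have comp: "(LINT x|lborel. partial i \<phi> x *\<^sub>R kernel_op (res_kernel z) g k x) = - (LINT x|lborel. \<phi> x *\<^sub>R kernel_op (grad_kernel z i) g k x)" for k
  proof -
    have "(LINT x|lborel. partial i \<phi> x *\<^sub>R kernel_op (res_kernel z) g k x)
       = (LINT w|(lborel \<Otimes>\<^sub>M lborel). (LINT x|lborel. partial i \<phi> x *\<^sub>R res_kernel z k (fst w) (x - snd w)) * coord g k (R (fst w) (snd w)))"
      unfolding kernel_op_def by (rule integral_test_swap[OF rm _ c\<phi>' K\<phi> test_support(2)[OF \<phi>] tr]) measurable
    also have "\<dots> = - (LINT w|(lborel \<Otimes>\<^sub>M lborel). (LINT x|lborel. \<phi> x *\<^sub>R grad_kernel z i k (fst w) (x - snd w)) * coord g k (R (fst w) (snd w)))"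
      unfolding res_kernel_by_parts[OF \<phi>] by simp
    also have "(LINT w|(lborel \<Otimes>\<^sub>M lborel). (LINT x|lborel. \<phi> x *\<^sub>R grad_kernel z i k (fst w) (x - snd w)) * coord g k (R (fst w) (snd w)))
       = (LINT x|lborel. \<phi> x *\<^sub>R kernel_op (grad_kernel z i) g k x)"
      unfolding kernel_op_def by (rule integral_test_swap[OF gm _ c\<phi> K\<phi> test_support(1)[OF \<phi>] tg, symmetric]) measurable
    finally show ?thesis .
  qed
  have int: "integrable lborel (\<lambda>x. partial i \<phi> x *\<^sub>R kernel_op (res_kernel z) g k x)" for k
    by (rule integrable_test_mult[OF _ c\<phi>' K\<phi> test_support(2)[OF \<phi>] t[of k]]) (simp_all add: cmod_kernel_op_le[OF K])
  have int': "integrable lborel (\<lambda>x. \<phi> x *\<^sub>R kernel_op (grad_kernel z i) g k x)" for k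
    by (rule integrable_test_mult[OF _ c\<phi> K\<phi> test_support(1)[OF \<phi>] t'[of k]]) (simp_all add: cmod_kernel_op_le[OF K'])
  have sum: "(LINT x|lborel. \<psi> x *\<^sub>R vec_op \<kappa> g x) = (\<Sum>k\<in>UNIV. (LINT x|lborel. \<psi> x *\<^sub>R kernel_op \<kappa> g k x) *s column k Y)"
    if i: "\<And>k. integrable lborel (\<lambda>x. \<psi> x *\<^sub>R kernel_op \<kappa> g k x)" for \<psi> \<kappa>
  proof -
    have "\<psi> x *\<^sub>R vec_op \<kappa> g x = (\<Sum>k\<in>UNIV. (\<psi> x *\<^sub>R kernel_op \<kappa> g k x) *s column k Y)" for x
      unfolding vec_op_def scaleR_sum_right by (intro sum.cong refl) (simp add: vec_eq_iff)
    then show ?thesis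
      by (simp add: Bochner_Integration.integral_sum integrable_bounded_linear[OF bounded_linear_scale_vec i] integral_bounded_linear[OF bounded_linear_scale_vec i])
  qed
  have "(LINT x|lebesgue. partial i \<phi> x *\<^sub>R v x) = (LINT x|lebesgue. partial i \<phi> x *\<^sub>R vec_op (res_kernel z) g x)"
  proof (rule integral_cong_AE)
    have [measurable]: "v \<in> borel_measurable lebesgue" using v by (simp add: loc_integrable_def)
    have [measurable]: "partial i \<phi> \<in> borel_measurable lebesgue" "vec_op (res_kernel z) g \<in> borel_measurable lebesgue"
      by (auto intro: measurable_completion)
    show "(\<lambda>x. partial i \<phi> x *\<^sub>R v x) \<in> borel_measurable lebesgue" "(\<lambda>x. partial i \<phi> x *\<^sub>R vec_op (res_kernel z) g x) \<in> borel_measurable lebesgue"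
      by measurable
    show "AE x in lebesgue. partial i \<phi> x *\<^sub>R v x = partial i \<phi> x *\<^sub>R vec_op (res_kernel z) g x"
      using AE_completion[OF veq] by eventually_elim simp
  qed
  also have "\<dots> = (LINT x|lborel. partial i \<phi> x *\<^sub>R vec_op (res_kernel z) g x)" by (rule integral_completion) measurable
  also have "\<dots> = - (LINT x|lborel. \<phi> x *\<^sub>R vec_op (grad_kernel z i) g x)"
    unfolding sum[OF int] sum[OF int'] comp sum_negf[symmetric] by (intro sum.cong refl) (simp add: vec_eq_iff)
  also have "(LINT x|lborel. \<phi> x *\<^sub>R vec_op (grad_kernel z i) g x) = (LINT x|lebesgue. \<phi> x *\<^sub>R vec_op (grad_kernel z i) g x)"
    by (rule integral_completion[symmetric]) measurable
  finally show "(LINT x|lebesgue. partial i \<phi> x *\<^sub>R v x) = - (LINT x|lebesgue. \<phi> x *\<^sub>R vec_op (grad_kernel z i) g x)" .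
qed

end

text \<open>The theorem bounds every weak derivative \<open>w\<close>, while the estimate concerns
  the one with the differentiated kernel; uniqueness links the two.\<close>

lemma weak_partial_unique:
  fixes v w w' :: "real^'d \<Rightarrow> 'b::euclidean_space"
  assumes "weak_partial i v w" "weak_partial i v w'"
  shows "AE x in lborel. w x = w' x"
proof -
  have w: "loc_integrable w" "loc_integrable w'" using assms by (auto simp: weak_partial_def)
  have eq: "(LINT x|lebesgue. \<phi> x *\<^sub>R w x) = (LINT x|lebesgue. \<phi> x *\<^sub>R w' x)" if "test_function \<phi>" for \<phi>
    using assms that unfolding weak_partial_def by (metis neg_equal_iff_equal)
  have wl: "w \<in> borel_measurable lebesgue" "w' \<in> borel_measurable lebesgue" using w by (auto simp: loc_integrable_def)
  obtain wb where wb[measurable]: "wb \<in> borel_measurable borel" and weq: "AE x in lborel. w x = wb x"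
    using borel_representative[OF wl(1)] by blast
  obtain wb' where wb'[measurable]: "wb' \<in> borel_measurable borel" and weq': "AE x in lborel. w' x = wb' x"
    using borel_representative[OF wl(2)] by blast
  have loc: "integrable lborel (\<lambda>x. indicator K x *\<^sub>R ub x)"
    if u: "loc_integrable u" "AE x in lborel. u x = ub x" "compact K" and [measurable]: "ub \<in> borel_measurable borel"
    for u ub :: "real^'d \<Rightarrow> 'b" and K
  proof -
    have [measurable]: "K \<in> sets borel" using u(3) by (rule borel_compact)
    have [measurable]: "u \<in> borel_measurable lebesgue" using u(1) by (simp add: loc_integrable_def)
    have [measurable]: "ub \<in> borel_measurable lebesgue" "indicator K \<in> borel_measurable lebesgue" by (auto intro: measurable_completion)
    have ae: "AE x in lebesgue. indicator K x *\<^sub>R u x = indicator K x *\<^sub>R ub x"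
      using AE_completion[OF u(2)] by eventually_elim simp
    have "integrable lebesgue (\<lambda>x. indicator K x *\<^sub>R u x)" using u by (simp add: loc_integrable_def set_integrable_def)
    then have "integrable lebesgue (\<lambda>x. indicator K x *\<^sub>R ub x)"
      by (subst integrable_cong_AE[OF _ _ ae, symmetric]) simp_all
    then show ?thesis by (subst (asm) integrable_completion) simp_all
  qed
  have test: "integrable lborel (\<lambda>x. \<phi> x *\<^sub>R ub x)" "(LINT x|lebesgue. \<phi> x *\<^sub>R u x) = (LINT x|lborel. \<phi> x *\<^sub>R ub x)"
    if u: "loc_integrable u" "AE x in lborel. u x = ub x" and [measurable]: "ub \<in> borel_measurable borel" and \<phi>: "test_function \<phi>"
    for u ub :: "real^'d \<Rightarrow> 'b" and \<phi>
  proof -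
    let ?K = "closure {x. \<phi> x \<noteq> 0}"
    have [measurable]: "\<phi> \<in> borel_measurable borel" using test_continuous[OF \<phi>] by (rule borel_measurable_continuous_onI)
    have [measurable]: "u \<in> borel_measurable lebesgue" using u(1) by (simp add: loc_integrable_def)
    have "bounded (\<phi> ` ?K)"
      by (intro compact_imp_bounded compact_continuous_image test_compact[OF \<phi>] continuous_on_subset[OF test_continuous[OF \<phi>]]) auto
    then obtain M where M: "\<And>x. x \<in> ?K \<Longrightarrow> norm (\<phi> x) \<le> M" unfolding bounded_iff by blast
    show "integrable lborel (\<lambda>x. \<phi> x *\<^sub>R ub x)"
    proof (rule Bochner_Integration.integrable_bound[OF integrable_scaleR_right[OF loc[OF u test_compact[OF \<phi>] that(3)], of M]])
      show "AE x in lborel. norm (\<phi> x *\<^sub>R ub x) \<le> norm (M *\<^sub>R indicator ?K x *\<^sub>R ub x)"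
      proof (rule AE_I2)
        fix x
        show "norm (\<phi> x *\<^sub>R ub x) \<le> norm (M *\<^sub>R indicator ?K x *\<^sub>R ub x)"
        proof (cases "x \<in> ?K")
          case True
          then have "norm (\<phi> x) * norm (ub x) \<le> \<bar>M\<bar> * norm (ub x)" using M[OF True] by (intro mult_right_mono) auto
          then show ?thesis using True by simp
        next
          case False
          from test_support(1)[OF \<phi> False] show ?thesis by (simp only: scaleR_zero_left norm_zero norm_ge_zero)
        qed
      qed
    qed measurable
    have [measurable]: "\<phi> \<in> borel_measurable lebesgue" "ub \<in> borel_measurable lebesgue" by (auto intro: measurable_completion)
    have ae: "AE x in lebesgue. \<phi> x *\<^sub>R u x = \<phi> x *\<^sub>R ub x" using AE_completion[OF u(2)] by eventually_elim simp
    have "(LINT x|lebesgue. \<phi> x *\<^sub>R u x) = (LINT x|lebesgue. \<phi> x *\<^sub>R ub x)" by (rule integral_cong_AE[OF _ _ ae]) measurable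
    also have "\<dots> = (LINT x|lborel. \<phi> x *\<^sub>R ub x)" by (rule integral_completion) measurable
    finally show "(LINT x|lebesgue. \<phi> x *\<^sub>R u x) = (LINT x|lborel. \<phi> x *\<^sub>R ub x)" .
  qed
  have "AE x in lborel. \<forall>e\<in>Basis. (wb x - wb' x) \<bullet> e = 0"
  proof (rule AE_finite_allI[OF finite_Basis])
    fix e :: 'b assume "e \<in> Basis"
    show "AE x in lborel. (wb x - wb' x) \<bullet> e = 0"
    proof (rule AE_zero_of_test_functions)
      fix K :: "(real^'d) set" assume K: "compact K"
      have "integrable lborel (\<lambda>x. (indicator K x *\<^sub>R wb x - indicator K x *\<^sub>R wb' x) \<bullet> e)"
        by (intro integrable_inner_left Bochner_Integration.integrable_diff loc[OF w(1) weq K wb] loc[OF w(2) weq' K wb'])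
      then show "integrable lborel (\<lambda>x. indicator K x * ((wb x - wb' x) \<bullet> e))"
        by (simp add: inner_diff_left right_diff_distrib)
    next
      fix \<phi> :: "real^'d \<Rightarrow> real" assume \<phi>: "test_function \<phi>"
      note t = test[OF w(1) weq wb \<phi>] and t' = test[OF w(2) weq' wb' \<phi>]
      have "(LINT x|lborel. \<phi> x *\<^sub>R wb x - \<phi> x *\<^sub>R wb' x) = 0"
        using eq[OF \<phi>] t t' by simp
      moreover have "(LINT x|lborel. (\<phi> x *\<^sub>R wb x - \<phi> x *\<^sub>R wb' x) \<bullet> e) = (LINT x|lborel. \<phi> x *\<^sub>R wb x - \<phi> x *\<^sub>R wb' x) \<bullet> e"
        using t(1) t'(1) by (intro integral_inner_left) auto
      ultimately show "(LINT x|lborel. \<phi> x * ((wb x - wb' x) \<bullet> e)) = 0"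
        by (simp add: inner_diff_left right_diff_distrib)
    qed measurable
  qed
  then show ?thesis using weq weq'
  proof eventually_elim
    fix x assume "\<forall>e\<in>Basis. (wb x - wb' x) \<bullet> e = 0" "w x = wb x" "w' x = wb' x"
    then show "w x = w' x" using euclidean_all_zero_iff[of "wb x - wb' x"] by auto
  qed
qed

section \<open>Identification of the constants\<close>

text \<open>With r = vt/(1 - vt), the first hypergeometric value is (1 - vt) times the even series,
  and r^(1/2) (1 - vt)^(- (d - 2)/2) is (1 - vt) times sqrt vt (1 - vt)^(- (d + 1)/2). The factor
  1/(1 - vt) of the constant removes both.\<close>

lemma C7_eq:
  fixes d :: nat
  assumes d: "d \<ge> 1" and vt: "0 \<le> vt" "vt < 1"
  shows "C\<^sub>7 d A Y p C vt = C * condition_number Y * a_1 A powr (real d / 2)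
    * (\<Sum>k. moment_coeff (real d) 1 0 k * (2 * sqrt vt) ^ k) powr (1 / p)"
proof -
  define D where "D = real d"
  have D: "D > 0" using d by (simp add: D_def)
  define r where "r = vt / (1 - vt)"
  define X where "X = hyp2f1_real (- (D - 1) / 2) 1 (1 / 2) (- r)
       + pi powr (1 / 2) * (Gamma ((D + 1) / 2) / Gamma (D / 2)) * r powr (1 / 2) * hyp2f1_real (- (D - 2) / 2) (3 / 2) (3 / 2) (- r)"
  define \<Sigma> where "\<Sigma> = (\<Sum>m. pochhammer (D / 2) m / pochhammer (1 / 2) m * vt ^ m)"
  have 1: "hyp2f1_real (- (D - 1) / 2) 1 (1 / 2) (- r) = (1 - vt) * \<Sigma>"
    using hyp2f1_Pfaff[of "1 / 2" "- (D - 1) / 2" vt] D vt by (simp add: r_def \<Sigma>_def field_simps)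
  have 2: "hyp2f1_real (- (D - 2) / 2) (3 / 2) (3 / 2) (- r) = (1 - vt) powr (- (D - 2) / 2)"
    using hyp2f1_binomial[of "3 / 2" vt "- (D - 2) / 2"] vt by (simp add: r_def)
  have 3: "(1 - vt) powr (- (D - 2) / 2) = (1 - vt) * sqrt (1 - vt) * (1 - vt) powr (- ((D + 1) / 2))"
  proof -
    have "(1 - vt) powr (- (D - 2) / 2) = (1 - vt) powr (1 + 1 / 2 + - ((D + 1) / 2))"
      by (rule arg_cong[of _ _ "\<lambda>x. (1 - vt) powr x"]) (simp add: field_simps)
    also have "\<dots> = (1 - vt) powr 1 * (1 - vt) powr (1 / 2) * (1 - vt) powr (- ((D + 1) / 2))" by (simp only: powr_add)
    finally show ?thesis using vt by (simp add: powr_half_sqrt)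
  qed
  have 4: "r powr (1 / 2) * sqrt (1 - vt) = sqrt vt"
    using vt by (simp add: powr_half_sqrt r_def real_sqrt_divide)
  have "X = (1 - vt) * \<Sigma> + sqrt pi * (Gamma ((D + 1) / 2) / Gamma (D / 2)) * r powr (1 / 2) * ((1 - vt) * sqrt (1 - vt) * (1 - vt) powr (- ((D + 1) / 2)))"
    unfolding X_def 1 2 3 by (simp add: powr_half_sqrt)
  also have "\<dots> = (1 - vt) * (\<Sigma> + sqrt pi * (Gamma ((D + 1) / 2) / Gamma (D / 2)) * (r powr (1 / 2) * sqrt (1 - vt)) * (1 - vt) powr (- ((D + 1) / 2)))"
    by (simp only: algebra_simps)
  finally have X: "1 / (1 - vt) * X = (\<Sum>k. moment_coeff D 1 0 k * (2 * sqrt vt) ^ k)"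
    using moment_series_value[OF D vt] vt by (simp add: sums_iff 4 \<Sigma>_def)
  show ?thesis
    unfolding C\<^sub>7_def Let_def D_def[symmetric] r_def[symmetric] X_def[symmetric] X[symmetric] powr_mult by (simp only: mult.assoc)
qed

text \<open>Here both summands contain the factor sqrt (1 - vt), which accounts for the exponent
  1/(2p). The leading Gamma (1/2) is split into its power 1 - 1/p from the unweighted mass and its
  power 1/p, which completes the series. Finally (a_1/a_min)^(1/2) = 1/(2 a_min sqrt c) is the
  prefactor of the gradient bound.\<close>

lemma C8_eq:
  fixes d :: nat
  assumes d: "d \<ge> 1" and vt: "0 \<le> vt" "vt < 1" and p: "p \<ge> 1"
    and A: "a_min A > 0" "a_max A > 0" "min_Re_eigenvalue A > 0"
  defines "c \<equiv> min_Re_eigenvalue A / (4 * (a_max A)\<^sup>2)"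
  shows "C\<^sub>8 d A Y p C vt = C * condition_number Y * (a_1 A powr (real d / 2) * (1 / (2 * a_min A * sqrt c)))
    * (Gamma (1 / 2) powr (1 - 1 / p) * (\<Sum>k. moment_coeff (real d) (1 / 2) 1 k * (2 * sqrt vt) ^ k) powr (1 / p))"
proof -
  define D where "D = real d"
  have D: "D > 0" using d by (simp add: D_def)
  define r where "r = vt / (1 - vt)"
  define X where "X = Gamma ((D + 1) / 2) / Gamma (D / 2) * hyp2f1_real (- D / 2) (1 / 2) (1 / 2) (- r)
       + 2 * (Gamma ((D + 2) / 2) / (Gamma (1 / 2) * Gamma (D / 2))) * r powr (1 / 2) * hyp2f1_real (- (D - 1) / 2) 1 (3 / 2) (- r)"
  define \<Sigma> where "\<Sigma> = (\<Sum>m. pochhammer ((D + 2) / 2) m / pochhammer (3 / 2) m * vt ^ m)"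
  define s where "s = sqrt (1 - vt)"
  have s: "s > 0" "s * s = 1 - vt" using vt by (auto simp: s_def)
  have G: "Gamma (1 / 2 :: real) > 0" by (simp add: Gamma_real_pos)
  have 1: "hyp2f1_real (- (D - 1) / 2) 1 (3 / 2) (- r) = s * s * \<Sigma>"
    using hyp2f1_Pfaff[of "3 / 2" "- (D - 1) / 2" vt] D vt by (simp add: r_def \<Sigma>_def s(2) field_simps)
  have 2: "hyp2f1_real (- D / 2) (1 / 2) (1 / 2) (- r) = (1 - vt) powr (- D / 2)"
    using hyp2f1_binomial[of "1 / 2" vt "- D / 2"] vt by (simp add: r_def)
  have 3: "(1 - vt) powr (- D / 2) = s * (1 - vt) powr (- ((D + 1) / 2))"
  proof -
    have "(1 - vt) powr (- D / 2) = (1 - vt) powr (1 / 2 + - ((D + 1) / 2))"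
      by (rule arg_cong[of _ _ "\<lambda>x. (1 - vt) powr x"]) (simp add: field_simps)
    also have "\<dots> = (1 - vt) powr (1 / 2) * (1 - vt) powr (- ((D + 1) / 2))" by (simp only: powr_add)
    finally show ?thesis using vt by (simp add: powr_half_sqrt s_def)
  qed
  have 4: "r powr (1 / 2) = sqrt vt / s"
    using vt by (simp add: powr_half_sqrt r_def real_sqrt_divide s_def)
  have "Gamma (1 / 2) * (1 / s) * X = Gamma (1 / 2) * (Gamma ((D + 1) / 2) / Gamma (D / 2)) * (1 - vt) powr (- ((D + 1) / 2))
       + 2 * (Gamma ((D + 2) / 2) / Gamma (D / 2)) * sqrt vt * \<Sigma>"
    unfolding X_def 1 2 3 4 using s(1) by (simp add: distrib_left Gamma_one_half_real)
  then have X: "Gamma (1 / 2) * (1 / s) * X = (\<Sum>k. moment_coeff D (1 / 2) 1 k * (2 * sqrt vt) ^ k)"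
    using moment_series_value_gradient[OF D vt] by (simp add: sums_iff \<Sigma>_def)
  have 5: "Gamma (1 / 2) powr (1 - 1 / p) * (Gamma (1 / 2) * (1 / s) * X) powr (1 / p)
      = Gamma (1 / 2) * ((1 / (1 - vt)) powr (1 / (2 * p)) * X powr (1 / p))"
  proof -
    have "(1 / (1 - vt)) powr (1 / (2 * p)) = ((1 / (1 - vt)) powr (1 / 2)) powr (1 / p)" by (simp add: powr_powr)
    also have "(1 / (1 - vt)) powr (1 / 2) = 1 / s" using vt by (simp add: powr_half_sqrt real_sqrt_divide s_def)
    finally have 6: "(1 / (1 - vt)) powr (1 / (2 * p)) = (1 / s) powr (1 / p)" .
    have "Gamma (1 / 2 :: real) powr (1 - 1 / p) * Gamma (1 / 2) powr (1 / p) = Gamma (1 / 2) powr (1 - 1 / p + 1 / p)"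
      by (simp only: powr_add)
    also have "\<dots> = Gamma (1 / 2)" using G by simp
    finally show ?thesis unfolding 6 powr_mult by (simp only: mult.assoc[symmetric])
  qed
  have 7: "a_1 A powr ((D + 1) / 2) * (1 / a_min A powr (1 / 2)) = a_1 A powr (D / 2) * (1 / (2 * a_min A * sqrt c))"
  proof -
    have "a_1 A powr (1 / 2) * (1 / a_min A powr (1 / 2)) = a_max A / (sqrt (min_Re_eigenvalue A) * (sqrt (a_min A) * sqrt (a_min A)))"
      using A by (simp add: powr_half_sqrt a_1_def real_sqrt_divide real_sqrt_mult)
    also have "\<dots> = 1 / (2 * a_min A * sqrt c)"
      using A by (simp add: c_def real_sqrt_divide real_sqrt_mult)
    finally have 8: "a_1 A powr (1 / 2) * (1 / a_min A powr (1 / 2)) = 1 / (2 * a_min A * sqrt c)" .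
    show ?thesis by (simp only: add_divide_distrib powr_add mult.assoc 8)
  qed
  have "C\<^sub>8 d A Y p C vt = C * condition_number Y * (a_1 A powr ((D + 1) / 2) * (1 / a_min A powr (1 / 2)))
      * (Gamma (1 / 2) * ((1 / (1 - vt)) powr (1 / (2 * p)) * X powr (1 / p)))"
    unfolding C\<^sub>8_def Let_def D_def[symmetric] r_def[symmetric] X_def[symmetric] by simp
  then show ?thesis unfolding 7 5[symmetric] X unfolding D_def .
qed

context weighted_ou_system begin

text \<open>The function \<open>v\<close> enters through its formula alone, so the weight here may
  differ from the one in which the equation is solved.\<close>

lemma resolvent_estimates:
  fixes v g gb :: "real^'d \<Rightarrow> complex^'n"
  assumes v: "loc_integrable v" and veq: "AE x in lborel. v x = vec_op (res_kernel z) gb x"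
    and gb[measurable]: "gb \<in> borel_measurable borel" and geq: "AE x in lborel. g x = gb x" and g: "g \<in> Lp p \<theta>"
    and p: "p \<ge> 1" and vt: "0 < vt" "vt < 1" and \<delta>: "\<delta> > 0" "\<delta> \<le> Re z + b" and q: "(p * \<eta>)\<^sup>2 \<le> vt * (4 * c * \<delta>)"
  defines "a \<equiv> (1 / (4 * c * am)) powr (real CARD('d) / 2)"
  shows "v \<in> W1p p \<theta>"
    and "Lp_norm p \<theta> v \<le> C * condition_number Y * a * (\<Sum>k. moment_coeff (real CARD('d)) 1 0 k * (2 * sqrt vt) ^ k) powr (1 / p)
      / \<delta> * Lp_norm p \<theta> g"
    and "weak_partial i v w \<Longrightarrow> Lp_norm p \<theta> w \<le> C * condition_number Y * (a * (1 / (2 * am * sqrt c)))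
      * (Gamma (1 / 2) powr (1 - 1 / p) * (\<Sum>k. moment_coeff (real CARD('d)) (1 / 2) 1 k * (2 * sqrt vt) ^ k) powr (1 / p))
      / \<delta> powr (1 / 2) * Lp_norm p \<theta> g"
proof -
  note Y0 = condition_number_pos[OF Y]
  have a: "a > 0" unfolding a_def using c am by (intro powr_gt_zero[THEN iffD2]) (simp add: less_imp_neq[symmetric])
  define a' where "a' = a * (1 / (2 * am * sqrt c))"
  have a': "a' > 0" using a c am by (simp add: a'_def)
  define \<Phi> where "\<Phi> = (\<Sum>k. moment_coeff (real CARD('d)) 1 0 k * (2 * sqrt vt) ^ k)"
  define \<Psi> where "\<Psi> = (\<Sum>k. moment_coeff (real CARD('d)) (1 / 2) 1 k * (2 * sqrt vt) ^ k)"
  have \<Phi>: "\<Phi> > 0" unfolding \<Phi>_def using vt moment_series_value[of "real CARD('d)" vt]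
    by (intro moment_series_pos) (auto simp: sums_iff)
  have \<Psi>: "\<Psi> > 0" unfolding \<Psi>_def using vt moment_series_value_gradient[of "real CARD('d)" vt]
    by (intro moment_series_pos) (auto simp: sums_iff)
  define M where "M = condition_number Y * a / \<delta> * \<Phi> powr (1 / p)"
  define M' where "M' = condition_number Y * a' * \<delta> powr (- (1 / 2)) * (Gamma (1 / 2) powr (1 - 1 / p) * \<Psi> powr (1 / p))"
  have M: "M > 0" "M' > 0" using Y0 a a' \<delta> \<Phi> \<Psi> by (simp_all add: M_def M'_def Gamma_one_half_real)
  define K :: "real \<Rightarrow> real^'d \<Rightarrow> real" where "K t x = a * tgauss \<delta> 1 c 0 t x" for t x
  define K' :: "'d \<Rightarrow> real \<Rightarrow> real^'d \<Rightarrow> real" where "K' i t x = a' * (tgauss \<delta> (1 / 2) c 1 t x * \<bar>x \<bullet> axis i 1\<bar>)" for i t x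
  have K: "cmod (res_kernel z k t x) \<le> K t x" for k t x
    unfolding res_kernel_def K_def a_def using cmod_resolvent_kernel_le[OF am(1) am(2)[of k] c(1) c(2)[of k] b[of k] \<delta>(2), of t x] by simp
  have K': "cmod (grad_kernel z i k t x) \<le> K' i t x" for i k t x
    unfolding grad_kernel_def K'_def a'_def a_def by (rule cmod_resolvent_gradient_le[OF am(1) am(2) c(1) c(2) b \<delta>(2)])
  have Km: "(\<lambda>w. K (fst w) (snd w)) \<in> borel_measurable (borel \<Otimes>\<^sub>M borel)"
    "(\<lambda>w. K' i (fst w) (snd w)) \<in> borel_measurable (borel \<Otimes>\<^sub>M borel)" for i
    unfolding K_def K'_def by measurable
  have mass: "exp_mass lborel (\<lambda>t x. ennreal (condition_number Y * K t x)) \<eta> \<le> ennreal M"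
    using exp_mass_resolvent_le[OF c(1) \<delta>(1) _ p vt q, of "condition_number Y * a"] Y0 a
    by (simp add: K_def M_def \<Phi>_def mult.assoc)
  have mass': "exp_mass lborel (\<lambda>t x. ennreal (condition_number Y * K' i t x)) \<eta> \<le> ennreal M'" for i
    using exp_mass_gradient_le[OF c(1) \<delta>(1) _ p vt q, of "condition_number Y * a'" "axis i 1"] Y0 a'
    by (simp add: K'_def M'_def \<Psi>_def mult.assoc axis_in_Basis_iff)
  have rm: "(\<lambda>w. res_kernel z k (fst w) (snd w)) \<in> borel_measurable (borel \<Otimes>\<^sub>M borel)"
    and gm: "(\<lambda>w. grad_kernel z i k (fst w) (snd w)) \<in> borel_measurable (borel \<Otimes>\<^sub>M borel)" for k i by measurable
  note vm = vec_op_measurable(2)[OF rm gb] vec_op_measurable(2)[OF gm gb]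
  have gfin: "(\<integral>\<^sup>+x. ennreal ((\<theta> x * norm (gb x)) powr p) \<partial>lborel) < \<infinity>" by (rule Lp_imp_finite[OF g gb geq])
  note est = vec_op_estimate[OF rm K Km(1) gb p gfin M(1) mass]
    and est' = vec_op_estimate[OF gm K' Km(2) gb p gfin M(2) mass']
  have vfin: "(\<integral>\<^sup>+x. ennreal ((\<theta> x * norm (vec_op (res_kernel z) gb x)) powr p) \<partial>lborel) < \<infinity>"
    using est(2) by (rule order_le_less_trans) (use gfin in \<open>simp add: ennreal_mult_less_top\<close>)
  have wfin: "(\<integral>\<^sup>+x. ennreal ((\<theta> x * norm (vec_op (grad_kernel z i) gb x)) powr p) \<partial>lborel) < \<infinity>" for i
    using est'(2) by (rule order_le_less_trans) (use gfin in \<open>simp add: ennreal_mult_less_top\<close>)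
  have wLp: "vec_op (grad_kernel z i) gb \<in> Lp p \<theta>" for i by (rule Lp_of_finite[OF vm(2) p wfin])
  have wp: "weak_partial i v (vec_op (grad_kernel z i) gb)" for i
    by (rule weak_partial_vec_op[OF v veq gb K K' est(1) est'(1)]) (use wLp in \<open>simp add: Lp_def\<close>)
  have vl: "v \<in> borel_measurable lebesgue" using v by (simp add: loc_integrable_def)
  have \<theta>m: "\<theta> \<in> borel_measurable borel" using \<theta>_cont by (rule borel_measurable_continuous_onI)
  have "v \<in> Lp p \<theta>"
    using v weighted_integral_borel(1)[OF vl vm(1) \<theta>m veq \<theta>_pos] vfin by (simp add: Lp_def)
  then show "v \<in> W1p p \<theta>" using wp wLp by (auto simp: W1p_def)
  have "Lp_norm p \<theta> v \<le> C * M * Lp_norm p \<theta> g"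
    by (rule Lp_norm_le[OF vl vm(1) veq g gb geq p _ est(2)]) (use C_pos M in simp)
  then show "Lp_norm p \<theta> v \<le> C * condition_number Y * a * (\<Sum>k. moment_coeff (real CARD('d)) 1 0 k * (2 * sqrt vt) ^ k) powr (1 / p)
      / \<delta> * Lp_norm p \<theta> g"
    by (simp add: M_def \<Phi>_def mult.assoc)
  assume w: "weak_partial i v w"
  have "Lp_norm p \<theta> w \<le> C * M' * Lp_norm p \<theta> g"
  proof (rule Lp_norm_le[OF _ vm(2) weak_partial_unique[OF w wp] g gb geq p _ est'(2)])
    show "w \<in> borel_measurable lebesgue" using w by (simp add: weak_partial_def loc_integrable_def)
  qed (use C_pos M in simp)
  then show "Lp_norm p \<theta> w \<le> C * condition_number Y * (a * (1 / (2 * am * sqrt c)))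
      * (Gamma (1 / 2) powr (1 - 1 / p) * (\<Sum>k. moment_coeff (real CARD('d)) (1 / 2) 1 k * (2 * sqrt vt) ^ k) powr (1 / p))
      / \<delta> powr (1 / 2) * Lp_norm p \<theta> g"
    using \<delta> by (simp add: M'_def \<Psi>_def a'_def powr_minus_divide mult.assoc)
qed

end

section \<open>Spectral bounds and assembly of the theorem\<close>

lemma weighted_flow_mat_exp:
  fixes S :: "real^'d^'d" and \<theta> :: "real^'d \<Rightarrow> real"
  assumes S: "transpose S = - S" and \<theta>: "weight_function \<eta> C \<theta>" and rad: "radial \<theta>"
  shows "weighted_flow (\<lambda>t x. mat_exp (t *\<^sub>R S) *v x) \<theta> C \<eta>"
proof -
  interpret isometric_flow "\<lambda>t x. mat_exp (t *\<^sub>R S) *v x" by (rule isometric_flow_mat_exp[OF S])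
  show ?thesis
    by unfold_locales (use \<theta> rad in \<open>auto simp: weight_function_def radial_def\<close>)
qed

lemma eigenvalue_bounds:
  fixes M :: "complex^'n^'n"
  assumes fin: "finite (eigenvalues M)" and \<mu>: "\<mu> \<in> eigenvalues M"
  shows "a_min M \<le> cmod \<mu>" "cmod \<mu> \<le> a_max M" "min_Re_eigenvalue M \<le> Re \<mu>"
  using assms by (auto simp: a_min_def a_max_def min_Re_eigenvalue_def)

lemma min_Re_eigenvalue_pos:
  fixes A :: "complex^'n^'n"
  assumes "finite (eigenvalues A)" "eigenvalues A \<noteq> {}" "\<forall>\<mu>\<in>eigenvalues A. Re \<mu> > 0"
  shows "min_Re_eigenvalue A > 0" "a_min A > 0" "a_max A > 0"
proof -
  obtain \<mu> where \<mu>: "\<mu> \<in> eigenvalues A" using assms by auto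
  show "min_Re_eigenvalue A > 0" using assms by (simp add: min_Re_eigenvalue_def)
  show 0: "a_min A > 0" using assms by (auto simp: a_min_def)
  show "a_max A > 0" using eigenvalue_bounds(1,2)[OF assms(1) \<mu>] 0 by linarith
qed

lemma is_diag_conj:
  fixes A Y :: "complex^'n^'n"
  assumes Y: "invertible Y" and D: "is_diag (matrix_inv Y ** A ** Y)"
  shows "A = Y ** diag (\<lambda>k. (matrix_inv Y ** A ** Y) $ k $ k) ** matrix_inv Y"
proof -
  have "diag (\<lambda>k. (matrix_inv Y ** A ** Y) $ k $ k) = matrix_inv Y ** A ** Y"
    using D by (auto simp: is_diag_def diag_def vec_eq_iff)
  then have "Y ** diag (\<lambda>k. (matrix_inv Y ** A ** Y) $ k $ k) ** matrix_inv Y = (Y ** matrix_inv Y) ** A ** (Y ** matrix_inv Y)"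
    by (simp add: matrix_mul_assoc)
  then show ?thesis by (simp add: matrix_inv_mult[OF Y])
qed

theorem theorem5p7:
  fixes A B Y :: "complex^'n^'n" and S :: "real^'d^'d"
    and \<theta>\<^sub>1 \<theta>\<^sub>2 :: "real^'d \<Rightarrow> real" and g v :: "real^'d \<Rightarrow> complex^'n"
    and p \<eta>\<^sub>1 \<eta>\<^sub>2 C\<^sub>\<theta>\<^sub>1 C\<^sub>\<theta>\<^sub>2 vt \<epsilon> :: real and z :: complex
  assumes "CARD('d) \<ge> 2"
    and "invertible Y" and "is_diag (matrix_inv Y ** A ** Y)" and "is_diag (matrix_inv Y ** B ** Y)"
    and "\<forall>\<mu>\<in>eigenvalues A. Re \<mu> > 0"
    and "transpose S = - S"
    and "1 \<le> p"
    and "weight_function \<eta>\<^sub>1 C\<^sub>\<theta>\<^sub>1 \<theta>\<^sub>1" and "radial \<theta>\<^sub>1"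
    and "((\<lambda>\<psi>. SUP x. \<bar>(\<theta>\<^sub>1 (x + \<psi>) - \<theta>\<^sub>1 x) / \<theta>\<^sub>1 x\<bar>) \<longlongrightarrow> 0) (at 0)"
    and "0 < vt" and "vt < 1" and "\<epsilon> > 0"
    and "Re z > growth_rate A B p \<eta>\<^sub>1 \<epsilon>"
    and "weight_function \<eta>\<^sub>2 C\<^sub>\<theta>\<^sub>2 \<theta>\<^sub>2" and "radial \<theta>\<^sub>2"
    and "0 \<le> \<eta>\<^sub>2\<^sup>2"
    and "\<eta>\<^sub>2\<^sup>2 \<le> vt * (min_Re_eigenvalue A * (Re z - growth_rate A B p \<eta>\<^sub>1 \<epsilon>) / ((a_max A)\<^sup>2 * p\<^sup>2))"
    and "\<exists>C>0. \<forall>x. \<theta>\<^sub>1 x \<le> C * \<theta>\<^sub>2 x"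
    and "g \<in> Lp p \<theta>\<^sub>1"
    and "resolvent_solution p \<theta>\<^sub>1 A B S z g v"
    and "g \<in> Lp p \<theta>\<^sub>2"
  shows "v \<in> W1p p \<theta>\<^sub>2 \<and>
    Lp_norm p \<theta>\<^sub>2 v
           \<le> C\<^sub>7 CARD('d) A Y p C\<^sub>\<theta>\<^sub>2 vt / (Re z - growth_rate A B p \<eta>\<^sub>1 \<epsilon>) * Lp_norm p \<theta>\<^sub>2 g \<and>
    (\<forall>i w. weak_partial i v w \<longrightarrow> Lp_norm p \<theta>\<^sub>2 w
           \<le> C\<^sub>8 CARD('d) A Y p C\<^sub>\<theta>\<^sub>2 vt / (Re z - growth_rate A B p \<eta>\<^sub>1 \<epsilon>) powr (1 / 2) * Lp_norm p \<theta>\<^sub>2 g)"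
proof -
  define l where "l k = (matrix_inv Y ** A ** Y) $ k $ k" for k
  define m where "m k = (matrix_inv Y ** B ** Y) $ k $ k" for k
  have A: "A = Y ** diag l ** matrix_inv Y" unfolding l_def[abs_def] by (rule is_diag_conj[OF assms(2,3)])
  have B: "B = Y ** diag m ** matrix_inv Y" unfolding m_def[abs_def] by (rule is_diag_conj[OF assms(2,4)])
  have eA: "eigenvalues A = range l" and eB: "eigenvalues B = range m"
    unfolding A B by (rule eigenvalues_conj_diag[OF assms(2)])+
  have fin: "finite (eigenvalues A)" "finite (eigenvalues B)" "eigenvalues A \<noteq> {}" by (simp_all add: eA eB)
  define a0 where "a0 = min_Re_eigenvalue A"
  define c where "c = a0 / (4 * (a_max A)\<^sup>2)"
  define b where "b = min_Re_eigenvalue B"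
  define \<delta> where "\<delta> = Re z - growth_rate A B p \<eta>\<^sub>1 \<epsilon>"
  have pos: "a0 > 0" "a_min A > 0" "a_max A > 0"
    unfolding a0_def using min_Re_eigenvalue_pos[OF fin(1,3) assms(5)] by auto
  have c: "c > 0" and \<delta>: "\<delta> > 0" using pos assms(14) by (auto simp: c_def \<delta>_def)
  have lk: "a_min A \<le> cmod (l k)" "cmod (l k) \<le> a_max A" "a0 \<le> Re (l k)" for k
    unfolding a0_def by (rule eigenvalue_bounds[OF fin(1)], simp add: eA)+
  have inv: "c \<le> Re (inverse (l k)) / 4" for k
  proof -
    have "0 < cmod (l k)" using lk(1)[of k] pos by linarith
    then have "a0 / (a_max A)\<^sup>2 \<le> Re (l k) / (cmod (l k))\<^sup>2"
      using lk[of k] pos by (intro frac_le power_mono) auto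
    moreover have "Re (inverse (l k)) = Re (l k) / (cmod (l k))\<^sup>2" by (simp add: cmod_power2)
    moreover have "c = a0 / (a_max A)\<^sup>2 / 4" by (simp add: c_def)
    ultimately show ?thesis by (metis divide_right_mono zero_le_numeral)
  qed
  have sys: "ou_system S Y l m (a_min A) c b"
  proof -
    interpret isometric_flow "\<lambda>t x. mat_exp (t *\<^sub>R S) *v x" by (rule isometric_flow_mat_exp[OF assms(6)])
    show ?thesis
    proof
      show "0 < Re (l k)" for k using lk(3)[of k] pos by linarith
      show "b \<le> Re (m k)" for k unfolding b_def by (rule eigenvalue_bounds(3)[OF fin(2)]) (simp add: eB)
    qed (use assms(2) pos c lk inv in auto)
  qed
  \<comment> \<open>\<open>W1\<close> supplies the formula for the solution and \<open>W2\<close>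
    its estimate; \<open>vec_op\<close> denotes the same function in both.\<close>
  interpret W1: weighted_ou_system S Y l m "a_min A" c b \<theta>\<^sub>1 C\<^sub>\<theta>\<^sub>1 \<eta>\<^sub>1
    by (intro weighted_ou_system.intro sys weighted_flow_mat_exp assms)
  interpret W2: weighted_ou_system S Y l m "a_min A" c b \<theta>\<^sub>2 C\<^sub>\<theta>\<^sub>2 \<eta>\<^sub>2
    by (intro weighted_ou_system.intro sys weighted_flow_mat_exp assms)
  \<comment> \<open>The quotient a_max^2 / a_0 in the growth rate is 1/(4 c).\<close>
  have gr: "\<delta> = Re z + b - (1 + \<epsilon>) * (\<eta>\<^sub>1\<^sup>2 * p / (4 * c))"
    using pos by (simp add: \<delta>_def growth_rate_def b_def c_def a0_def)
  \<comment> \<open>The growth rate contains the term that \<open>kernel_semigroup_component\<close>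
    demands for the first weight, enlarged by the factor (1 + \<epsilon>) p >= 1.\<close>
  have ge: "\<eta>\<^sub>1\<^sup>2 / (4 * c) \<le> (1 + \<epsilon>) * (\<eta>\<^sub>1\<^sup>2 * p / (4 * c))"
  proof -
    have "\<eta>\<^sub>1\<^sup>2 / (4 * c) * 1 \<le> \<eta>\<^sub>1\<^sup>2 / (4 * c) * ((1 + \<epsilon>) * p)"
      using c assms(7,13) mult_mono[of 1 "1 + \<epsilon>" 1 p] by (intro mult_left_mono) auto
    then show ?thesis by (simp add: ac_simps)
  qed
  have "\<eta>\<^sub>1\<^sup>2 / (4 * c) < Re z + b" using gr ge \<delta> by linarith
  then have dec: "\<eta>\<^sub>1\<^sup>2 < 4 * c * (Re z + b)" using c by (simp add: divide_less_eq ac_simps)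
  have "0 \<le> \<eta>\<^sub>1\<^sup>2 / (4 * c)" using c by simp
  then have \<delta>_le: "\<delta> \<le> Re z + b" using gr ge by linarith
  \<comment> \<open>After multiplication by p^2 the bound on the second growth rate becomes the
    ratio condition of the moment series.\<close>
  have "(p * \<eta>\<^sub>2)\<^sup>2 \<le> p\<^sup>2 * (vt * (min_Re_eigenvalue A * \<delta> / ((a_max A)\<^sup>2 * p\<^sup>2)))"
    unfolding power_mult_distrib \<delta>_def by (intro mult_left_mono assms) simp
  also have "\<dots> = vt * (4 * c * \<delta>)" using pos assms(7) by (simp add: c_def a0_def field_simps)
  finally have q: "(p * \<eta>\<^sub>2)\<^sup>2 \<le> vt * (4 * c * \<delta>)" .
  obtain gb where gb: "gb \<in> borel_measurable borel" "AE x in lborel. g x = gb x"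
    using borel_representative[of g] assms(22) by (auto simp: Lp_def loc_integrable_def)
  have veq: "AE x in lborel. v x = W1.vec_op (W1.res_kernel z) gb x"
    using W1.resolvent_representation[OF assms(7) dec assms(20) gb] assms(21) unfolding A[symmetric] B[symmetric] .
  have v: "loc_integrable v"
    using assms(21) by (auto simp: resolvent_solution_def ou_generator_def Lp_def)
  note est = W2.resolvent_estimates[OF v veq gb assms(22,7,11,12) \<delta> \<delta>_le q]
  have a1: "1 / (4 * c * a_min A) = a_1 A" using pos by (simp add: c_def a0_def a_1_def)
  have d: "CARD('d) \<ge> 1" using assms(1) by simp
  note C7 = C7_eq[OF d less_imp_le[OF assms(11)] assms(12)]
    and C8 = C8_eq[OF d less_imp_le[OF assms(11)] assms(12,7) pos(2,3) pos(1)[unfolded a0_def]]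
  show ?thesis
    unfolding C7 C8 a0_def[symmetric] c_def[symmetric] \<delta>_def[symmetric]
    by (intro conjI allI impI est[unfolded a1])
qed

end
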